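(* Let $M_1$ and $M_2$ be even lattices of signature $(1,1)$ with discriminant forms $(A_{M_1},q_{M_1})$ and $(A_{M_2},q_{M_2})$. Then the following statements are equivalent: (1) There exists an even lattice $N$ with primitive embeddings $\iota_i\colon N\hookrightarrow U^{\oplus2}$, $i=1,2$, such that $M_i\cong\iota_i(N)^\perp$. (2) There exists an isomorphism $f\colon A_{M_1}\to A_{M_2}$ such that $q_{M_1}=q_{M_2}\circ f$. (3) There exists an isomorphism $M_1\oplus U\cong M_2\oplus U$. (4) The lattices $M_1$ and $M_2$ are stably equivalent, that is, $M_1\oplus M_1'\cong M_2\oplus M_2'$ for some unimodular lattices $M_1'$ and $M_2'$. In particular, two abelian surfaces $X_1$ and $X_2$ of Picard number $2$ share the same mirror partner if and only if $\mathrm{NS}(X_1)$ and $\mathrm{NS}(X_2)$ are stably equivalent.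
   Context: $U$ is the lattice with Gram matrix $\begin{pmatrix}0&1\\1&0\end{pmatrix}$. The discriminant form of an even lattice $M$ is $A_M=M^*/M$ with the induced quadratic form $q_M\colon A_M\to\mathbb{Q}/2\mathbb{Z}$. Abelian surfaces are over $\mathbb{C}$. For an abelian surface $X$, $\mathrm{NS}(X)$ is the N\'eron--Severi lattice, $T(X)=\mathrm{NS}(X)^\perp\subseteq H^2(X,\mathbb{Z})$, and $N(X)=H^0(X,\mathbb{Z})\oplus\mathrm{NS}(X)\oplus H^4(X,\mathbb{Z})$ with the Mukai pairing $(r,D,s)\cdot(r',D',s')=DD'-rs'-sr'$. Two abelian surfaces $X$ and $Y$ are mirror partners if there exist lattice isometries $T(X)\cong N(Y)$ and $N(X)\cong T(Y)$. "$X_1$ and $X_2$ share the same mirror partner" means that some abelian surface $Y$ is a mirror partner of both. *)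

theory Defs
  imports "HOL-Analysis.Analysis" "HOL-Analysis.Finite_Function_Topology" "HOL-Algebra.Coset"
begin

section \<open>Integral lattices\<close>

text \<open>
  A lattice is a full subgroup of a finite-dimensional rational or real quadratic space: its
  points are the integral span of a finite linearly independent subset of a real vector space,
  and its form is a real bilinear form of which only the restriction to the span of the points
  matters. This makes \<open>M \<otimes> \<real>\<close>, the dual \<open>M\<^sup>*\<close> and the signature directly accessible.
\<close>

record 'a quad_lattice =
  points :: "'a set"
  form :: "'a \<Rightarrow> 'a \<Rightarrow> real"

definition int_span :: "'a::real_vector set \<Rightarrow> 'a set" where
  "int_span B = range (\<lambda>c :: 'a \<Rightarrow> int. \<Sum>v\<in>B. of_int (c v) *\<^sub>R v)"

definition is_lattice :: "'a::real_vector quad_lattice \<Rightarrow> bool" where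
  "is_lattice M \<longleftrightarrow>
     (\<exists>B. finite B \<and> independent B \<and> points M = int_span B) \<and>
     bilinear (form M) \<and>
     (\<forall>x\<in>points M. \<forall>y\<in>points M. form M x y \<in> \<int>) \<and>
     (\<forall>x\<in>points M. \<forall>y\<in>points M. form M x y = form M y x) \<and>
     (\<forall>x\<in>points M. (\<forall>y\<in>points M. form M x y = 0) \<longrightarrow> x = 0)"

definition even_lattice :: "'a::real_vector quad_lattice \<Rightarrow> bool" where
  "even_lattice M \<longleftrightarrow> is_lattice M \<and> (\<forall>x\<in>points M. \<exists>k::int. form M x x = 2 * of_int k)"

definition lattice_rank :: "'a::real_vector quad_lattice \<Rightarrow> nat" where
  "lattice_rank M = dim (points M)"

definition has_signature :: "'a::real_vector quad_lattice \<Rightarrow> nat \<Rightarrow> nat \<Rightarrow> bool" where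
  "has_signature M p q \<longleftrightarrow>
     (\<exists>P Q. subspace P \<and> subspace Q \<and> {x + y |x y. x \<in> P \<and> y \<in> Q} = span (points M) \<and>
        dim P = p \<and> dim Q = q \<and>
        (\<forall>x\<in>P. \<forall>y\<in>Q. form M x y = 0) \<and>
        (\<forall>x\<in>P. x \<noteq> 0 \<longrightarrow> form M x x > 0) \<and>
        (\<forall>y\<in>Q. y \<noteq> 0 \<longrightarrow> form M y y < 0))"

definition dual_points :: "'a::real_vector quad_lattice \<Rightarrow> 'a set" where
  "dual_points M = {x \<in> span (points M). \<forall>y\<in>points M. form M x y \<in> \<int>}"

definition unimodular :: "'a::real_vector quad_lattice \<Rightarrow> bool" where
  "unimodular M \<longleftrightarrow> is_lattice M \<and> dual_points M = points M"

definition disc_group :: "'a::real_vector quad_lattice \<Rightarrow> 'a set monoid" where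
  "disc_group M = \<lparr>carrier = dual_points M, mult = (+), one = 0\<rparr> Mod points M"

text \<open>
  Values in \<open>\<rat>/2\<int>\<close> are represented by cosets of \<open>2\<int>\<close> in the reals; for an even lattice
  the union over all representatives of a class in \<open>M\<^sup>*/M\<close> is a single coset.
\<close>

definition disc_form :: "'a::real_vector quad_lattice \<Rightarrow> 'a set \<Rightarrow> real set" where
  "disc_form M a = {t. \<exists>x\<in>a. \<exists>k::int. t = form M x x + 2 * of_int k}"

definition disc_forms_isomorphic ::
  "'a::real_vector quad_lattice \<Rightarrow> 'b::real_vector quad_lattice \<Rightarrow> bool" where
  "disc_forms_isomorphic M1 M2 \<longleftrightarrow>
     (\<exists>f\<in>iso (disc_group M1) (disc_group M2).
        \<forall>a\<in>carrier (disc_group M1). disc_form M1 a = disc_form M2 (f a))"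

definition lattice_embedding ::
  "('a::real_vector \<Rightarrow> 'b::real_vector) \<Rightarrow> 'a quad_lattice \<Rightarrow> 'b quad_lattice \<Rightarrow> bool" where
  "lattice_embedding f M L \<longleftrightarrow>
     f ` points M \<subseteq> points L \<and> inj_on f (points M) \<and>
     (\<forall>x\<in>points M. \<forall>y\<in>points M. f (x + y) = f x + f y) \<and>
     (\<forall>x\<in>points M. \<forall>y\<in>points M. form L (f x) (f y) = form M x y)"

text \<open>Primitivity: the quotient of the target by the image is torsion-free.\<close>

definition primitive_embedding ::
  "('a::real_vector \<Rightarrow> 'b::real_vector) \<Rightarrow> 'a quad_lattice \<Rightarrow> 'b quad_lattice \<Rightarrow> bool" where
  "primitive_embedding f M L \<longleftrightarrow> lattice_embedding f M L \<and>
     (\<forall>x\<in>points L. \<forall>n::nat. n > 0 \<and> of_nat n *\<^sub>R x \<in> f ` points M \<longrightarrow> x \<in> f ` points M)"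

definition isometric ::
  "'a::real_vector quad_lattice \<Rightarrow> 'b::real_vector quad_lattice \<Rightarrow> bool"  (infix "\<cong>\<^sub>L" 50) where
  "M \<cong>\<^sub>L L \<longleftrightarrow> (\<exists>f. lattice_embedding f M L \<and> f ` points M = points L)"

definition ortho_compl ::
  "'a set \<Rightarrow> 'a::real_vector quad_lattice \<Rightarrow> 'a quad_lattice" where
  "ortho_compl S L = \<lparr>points = {x \<in> points L. \<forall>y\<in>S. form L x y = 0}, form = form L\<rparr>"

definition lattice_sum ::
  "'a::real_vector quad_lattice \<Rightarrow> 'b::real_vector quad_lattice \<Rightarrow> ('a \<times> 'b) quad_lattice"
  (infixr "\<oplus>\<^sub>L" 65) where
  "M \<oplus>\<^sub>L L = \<lparr>points = points M \<times> points L,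
     form = (\<lambda>(x, y) (x', y'). form M x x' + form L y y')\<rparr>"

definition hyp_plane :: "(real \<times> real) quad_lattice" where
  "hyp_plane = \<lparr>points = \<int> \<times> \<int>, form = (\<lambda>(a, b) (c, d). a * d + b * c)\<rparr>"

text \<open>
  HOL cannot quantify over types inside a formula, so lattices under an existential quantifier
  live in the space \<open>\<real>\<^bsup>(\<nat>)\<^esup>\<close> of finitely supported real sequences. The lemma
  \<open>lattice_standard_copy\<close> below shows that this is no restriction.
\<close>

type_synonym std_lattice = "(nat \<Rightarrow>\<^sub>0 real) quad_lattice"

definition stably_equivalent ::
  "'a::real_vector quad_lattice \<Rightarrow> 'b::real_vector quad_lattice \<Rightarrow> bool" where
  "stably_equivalent M1 M2 \<longleftrightarrow>
     (\<exists>(K1::std_lattice) (K2::std_lattice).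
        unimodular K1 \<and> unimodular K2 \<and> M1 \<oplus>\<^sub>L K1 \<cong>\<^sub>L M2 \<oplus>\<^sub>L K2)"


lemma poly_lookup_scaleR: "Poly_Mapping.lookup (r *\<^sub>R p) i = r * Poly_Mapping.lookup p i"
  for p :: "nat \<Rightarrow>\<^sub>0 real"
proof -
  have "finite {i. r * Poly_Mapping.lookup p i \<noteq> 0}"
    by (rule finite_subset[OF _ finite_lookup[of p]]) auto
  then show ?thesis
    by (simp add: scaleR_poly_mapping_def)
qed

lemma independent_poly_singles:
  "independent (range (\<lambda>n::nat. Poly_Mapping.single n (1::real)))"
  unfolding independent_explicit_module
proof (intro allI impI)
  fix t u and v :: "nat \<Rightarrow>\<^sub>0 real"
  assume t: "finite t" "t \<subseteq> range (\<lambda>n::nat. Poly_Mapping.single n (1::real))"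
    and s: "(\<Sum>v\<in>t. u v *\<^sub>R v) = 0" and v: "v \<in> t"
  obtain m where m: "v = Poly_Mapping.single m 1" using t v by auto
  have "0 = Poly_Mapping.lookup (\<Sum>v\<in>t. u v *\<^sub>R v) m" by (simp add: s)
  also have "\<dots> = (\<Sum>w\<in>t. u w * Poly_Mapping.lookup w m)"
    by (simp add: lookup_sum poly_lookup_scaleR)
  also have "\<dots> = (\<Sum>w\<in>t. if w = v then u v else 0)"
  proof (intro sum.cong refl)
    fix w assume "w \<in> t"
    then obtain n where n: "w = Poly_Mapping.single n 1" using t by blast
    show "u w * Poly_Mapping.lookup w m = (if w = v then u v else 0)"
      by (cases "n = m") (auto simp: n m lookup_single dest: arg_cong[where f = "\<lambda>p. Poly_Mapping.lookup p m"])
  qed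
  also have "\<dots> = u v" using t v by simp
  finally show "u v = 0" by simp
qed

lemma lattice_standard_copy:
  fixes M :: "'a::real_vector quad_lattice"
  assumes "is_lattice M"
  shows "\<exists>K::std_lattice. is_lattice K \<and> M \<cong>\<^sub>L K"
proof -
  obtain B where B: "finite B" "independent B" "points M = int_span B"
    using assms by (auto simp: is_lattice_def)
  obtain h :: "'a \<Rightarrow> nat" where h: "inj_on h B"
    using finite_imp_inj_to_nat_seg[OF B(1)] by blast
  define s where "s = (\<lambda>n::nat. Poly_Mapping.single n (1::real))"
  have inj_s: "inj s"
  proof (rule injI)
    fix m n assume "s m = s n"
    then have "Poly_Mapping.lookup (s m) m = Poly_Mapping.lookup (s n) m" by simp
    then show "m = n" by (cases "n = m") (auto simp: s_def lookup_single)
  qed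
  obtain g where g: "linear g" "\<And>x. x \<in> B \<Longrightarrow> g x = s (h x)"
    using linear_independent_extend[OF B(2), of "s \<circ> h"] by auto
  have gB: "g ` B \<subseteq> range s" using g(2) by auto
  have indep: "independent (g ` B)"
    using independent_mono[OF independent_poly_singles] gB unfolding s_def by blast
  have inj_gB: "inj_on g B"
    using h inj_s by (auto simp: inj_on_def g(2))
  have inj_g: "inj_on g (span B)"
    using linear_inj_on_span_independent_image[OF g(1) indep inj_gB] .
  obtain g' where g': "linear g'" "\<And>v. v \<in> span B \<Longrightarrow> g' (g v) = v"
    using linear_exists_left_inverse_on[OF g(1) subspace_span inj_g] by blast
  have sub: "points M \<subseteq> span B"
    unfolding B(3) int_span_def by clarify (intro span_sum span_scale span_base)
  have int: "\<forall>x\<in>points M. \<forall>y\<in>points M. form M x y \<in> \<int>"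
    and sym: "\<forall>x\<in>points M. \<forall>y\<in>points M. form M x y = form M y x"
    and nondeg: "\<forall>x\<in>points M. (\<forall>y\<in>points M. form M x y = 0) \<longrightarrow> x = 0"
    using assms[unfolded is_lattice_def] by - (elim conjE, assumption)+
  define K where "K = \<lparr>points = g ` points M, form = (\<lambda>x y. form M (g' x) (g' y))\<rparr>"
  have gg: "g' (g x) = x" if "x \<in> points M" for x using g'(2)[OF subsetD[OF sub that]] .
  have "g ` points M = int_span (g ` B)"
  proof (intro equalityI subsetI)
    fix y assume "y \<in> g ` points M"
    then obtain c :: "'a \<Rightarrow> int" where "y = g (\<Sum>v\<in>B. of_int (c v) *\<^sub>R v)"
      unfolding B(3) int_span_def by (elim imageE) simp
    also have "\<dots> = (\<Sum>v\<in>B. of_int (c (the_inv_into B g (g v))) *\<^sub>R g v)"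
      by (simp add: linear_sum[OF g(1)] linear_scale[OF g(1)] the_inv_into_f_f[OF inj_gB])
    also have "\<dots> = (\<Sum>w\<in>g ` B. of_int ((c \<circ> the_inv_into B g) w) *\<^sub>R w)"
      by (simp add: sum.reindex[OF inj_gB])
    finally show "y \<in> int_span (g ` B)" unfolding int_span_def
      by (intro range_eqI[where x = "c \<circ> the_inv_into B g"])
  next
    fix y assume "y \<in> int_span (g ` B)"
    then obtain c :: "_ \<Rightarrow> int" where "y = (\<Sum>w\<in>g ` B. of_int (c w) *\<^sub>R w)"
      unfolding int_span_def by (elim rangeE)
    also have "\<dots> = g (\<Sum>v\<in>B. of_int ((c \<circ> g) v) *\<^sub>R v)"
      by (simp add: sum.reindex[OF inj_gB] linear_sum[OF g(1)] linear_scale[OF g(1)])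
    finally have y: "y = g (\<Sum>v\<in>B. of_int ((c \<circ> g) v) *\<^sub>R v)" .
    have "(\<Sum>v\<in>B. of_int ((c \<circ> g) v) *\<^sub>R v) \<in> points M"
      unfolding B(3) int_span_def by (intro range_eqI[where x = "c \<circ> g"] refl)
    then show "y \<in> g ` points M" unfolding y by (rule imageI)
  qed
  then have "\<exists>C. finite C \<and> independent C \<and> points K = int_span C"
    using B(1) indep by (intro exI[of _ "g ` B"]) (simp add: K_def)
  moreover have "bilinear (form K)"
  proof -
    have "linear (form M x)" "linear (\<lambda>x. form M x y)" for x y
      using assms by (simp_all add: is_lattice_def bilinear_def)
    then show ?thesis
      using linear_compose[OF g'(1)] by (auto simp: K_def bilinear_def o_def)
  qed
  moreover have "form K x y \<in> \<int>" "form K x y = form K y x"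
    if xy: "x \<in> points K" "y \<in> points K" for x y
  proof -
    obtain u v where uv: "u \<in> points M" "v \<in> points M" "x = g u" "y = g v"
      using xy by (auto simp: K_def)
    show "form K x y \<in> \<int>" "form K x y = form K y x"
      using int[rule_format, OF uv(1,2)] sym[rule_format, OF uv(1,2)] uv(1,2)
      unfolding uv(3,4) K_def by (simp_all only: quad_lattice.simps gg)
  qed
  moreover have "x = 0" if x: "x \<in> points K" "\<forall>y\<in>points K. form K x y = 0" for x
  proof -
    obtain u where u: "u \<in> points M" "x = g u"
      using x by (auto simp: K_def)
    have "\<forall>v\<in>points M. form M u v = 0"
      using x(2) by (simp add: K_def u gg)
    then have "u = 0"
      using nondeg u(1) by blast
    then show "x = 0" using u(2) linear_0[OF g(1)] by simp
  qed
  ultimately have "is_lattice K"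
    unfolding is_lattice_def by blast
  moreover have "lattice_embedding g M K"
    using inj_on_subset[OF inj_g sub]
    by (simp add: lattice_embedding_def K_def gg linear_add[OF g(1)])
  then have "M \<cong>\<^sub>L K"
    unfolding isometric_def by (intro exI[of _ g]) (simp add: K_def)
  ultimately show ?thesis by blast
qed

section \<open>Complex tori and abelian surfaces\<close>

text \<open>
  A two-dimensional complex torus \<open>X = \<complex>\<^sup>2/\<Lambda>\<close> is given by \<open>\<Lambda> \<subseteq> \<complex>\<^sup>2\<close>. The bases of \<open>\<Lambda>\<close> used
  are positively oriented for the orientation of \<open>\<complex>\<^sup>2\<close> as a complex vector space.
\<close>

definition real_coords :: "complex^2 \<Rightarrow> real^4" where
  "real_coords v = vector [Re (v $ 1), Im (v $ 1), Re (v $ 2), Im (v $ 2)]"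

definition oriented_period_basis :: "(complex^2)^4 \<Rightarrow> (complex^2) set \<Rightarrow> bool" where
  "oriented_period_basis \<omega> \<Lambda> \<longleftrightarrow>
     det (\<chi> i. real_coords (\<omega> $ i)) > 0 \<and>
     \<Lambda> = range (\<lambda>c :: 4 \<Rightarrow> int. \<Sum>i\<in>UNIV. of_int (c i) *\<^sub>R (\<omega> $ i))"

definition complex_torus :: "(complex^2) set \<Rightarrow> bool" where
  "complex_torus \<Lambda> \<longleftrightarrow> (\<exists>\<omega>. oriented_period_basis \<omega> \<Lambda>)"

type_synonym real_form = "(complex^2) \<Rightarrow>\<^sub>L (complex^2) \<Rightarrow>\<^sub>L real"

abbreviation form_apply :: "real_form \<Rightarrow> complex^2 \<Rightarrow> complex^2 \<Rightarrow> real" where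
  "form_apply E v w \<equiv> blinfun_apply (blinfun_apply E v) w"

text \<open>
  \<open>H\<^sup>2(X, \<int>) = \<Lambda>\<^sup>2 Hom(\<Lambda>, \<int>)\<close>: the alternating integral forms on \<open>\<Lambda> = H\<^sub>1(X, \<int>)\<close>, each
  identified with its \<open>\<real>\<close>-bilinear extension to \<open>\<complex>\<^sup>2 = \<Lambda> \<otimes> \<real>\<close>.
\<close>

definition H2_points :: "(complex^2) set \<Rightarrow> real_form set" where
  "H2_points \<Lambda> = {E. (\<forall>v. form_apply E v v = 0) \<and> (\<forall>v\<in>\<Lambda>. \<forall>w\<in>\<Lambda>. form_apply E v w \<in> \<int>)}"

text \<open>
  The cup product \<open>H\<^sup>2 \<times> H\<^sup>2 \<rightarrow> H\<^sup>4 \<cong> \<int>\<close> is the wedge product evaluated on a positively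
  oriented basis of \<open>\<Lambda>\<close>; the value does not depend on the basis.
\<close>

definition wedge_eval :: "(complex^2)^4 \<Rightarrow> real_form \<Rightarrow> real_form \<Rightarrow> real" where
  "wedge_eval \<omega> E F =
    (let e = (\<lambda>i j. form_apply E (\<omega> $ i) (\<omega> $ j)); f = (\<lambda>i j. form_apply F (\<omega> $ i) (\<omega> $ j)) in
       e 1 2 * f 3 4 - e 1 3 * f 2 4 + e 1 4 * f 2 3 +
       e 2 3 * f 1 4 - e 2 4 * f 1 3 + e 3 4 * f 1 2)"

definition H2 :: "(complex^2) set \<Rightarrow> real_form quad_lattice" where
  "H2 \<Lambda> = \<lparr>points = H2_points \<Lambda>, form = wedge_eval (SOME \<omega>. oriented_period_basis \<omega> \<Lambda>)\<rparr>"

text \<open>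
  \<open>NS(X) = H\<^sup>2(X, \<int>) \<inter> H\<^sup>1\<^sup>,\<^sup>1(X)\<close> (Lefschetz); a real alternating form is of type \<open>(1,1)\<close> iff
  it is invariant under multiplication by \<open>\<i>\<close>, that is, iff it is the imaginary part of a
  Hermitian form.
\<close>

definition NS :: "(complex^2) set \<Rightarrow> real_form quad_lattice" where
  "NS \<Lambda> = \<lparr>points = {E \<in> H2_points \<Lambda>. \<forall>v w. form_apply E (\<i> *s v) (\<i> *s w) = form_apply E v w},
     form = form (H2 \<Lambda>)\<rparr>"

text \<open>
  A polarization is a positive definite Hermitian form \<open>H\<close> whose imaginary part \<open>E\<close> is integral
  on \<open>\<Lambda>\<close>; with \<open>H\<close> linear in its first argument, \<open>H(v,v) = E(\<i>v,v)\<close>. A complex torus is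
  projective, i.e. an abelian variety, iff it admits a polarization.
\<close>

definition abelian_surface :: "(complex^2) set \<Rightarrow> bool" where
  "abelian_surface \<Lambda> \<longleftrightarrow> complex_torus \<Lambda> \<and>
     (\<exists>E\<in>points (NS \<Lambda>). \<forall>v. v \<noteq> 0 \<longrightarrow> form_apply E (\<i> *s v) v > 0)"

definition picard_number :: "(complex^2) set \<Rightarrow> nat" where
  "picard_number \<Lambda> = lattice_rank (NS \<Lambda>)"

definition transcendental_lattice :: "(complex^2) set \<Rightarrow> real_form quad_lattice" where
  "transcendental_lattice \<Lambda> = ortho_compl (points (NS \<Lambda>)) (H2 \<Lambda>)"

definition mukai_N :: "(complex^2) set \<Rightarrow> (real \<times> real_form \<times> real) quad_lattice" where
  "mukai_N \<Lambda> = \<lparr>points = \<int> \<times> points (NS \<Lambda>) \<times> \<int>,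
     form = (\<lambda>(r, D, s) (r', D', s'). form (NS \<Lambda>) D D' - r * s' - s * r')\<rparr>"

definition mirror_partners :: "(complex^2) set \<Rightarrow> (complex^2) set \<Rightarrow> bool" where
  "mirror_partners X Y \<longleftrightarrow> abelian_surface X \<and> abelian_surface Y \<and>
     transcendental_lattice X \<cong>\<^sub>L mukai_N Y \<and> mukai_N X \<cong>\<^sub>L transcendental_lattice Y"

definition share_mirror_partner :: "(complex^2) set \<Rightarrow> (complex^2) set \<Rightarrow> bool" where
  "share_mirror_partner X1 X2 \<longleftrightarrow> (\<exists>Y. mirror_partners X1 Y \<and> mirror_partners X2 Y)"

end

theory Submission
  imports Defs
begin

text \<open>
  (1) implies (3): any two vectors spanning a primitive binary sublattice \<open>N\<close> of \<open>U\<^sup>3\<close> can be moved by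
  explicit isometries to a normal form, from which one reads off that the complement of \<open>N\<close> in \<open>U\<^sup>3\<close>
  is \<open>N(-1) \<oplus> U\<close>. Applied to \<open>N\<close> in \<open>U\<^sup>2 \<oplus> U\<close> this gives \<open>M\<^sub>i \<oplus> U \<cong> N(-1) \<oplus> U\<close>. The same lemma gives
  \<open>T(X) \<cong> NS(X)(-1) \<oplus> U\<close> for abelian surfaces of Picard number 2.

  (4) implies (2): a stable equivalence identifies the discriminant groups compatibly with their
  bilinear forms; its graph defines a unimodular overlattice \<open>R\<close> of \<open>M\<^sub>1 \<oplus> M\<^sub>2(-1)\<close>. The stabilizing
  lattices may be odd, so \<open>R\<close> need not be even. Reduction theory shows that \<open>R\<close> is a sum of two
  planes with an isotropic vector, so its characteristic vectors have norm divisible by 8, and a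
  transvection of the discriminant group makes \<open>R\<close> even, i.e. corrects the quadratic form.

  (2) implies (1): the graph of an isometry of discriminant forms is an even unimodular
  lattice of signature (2,2), hence \<open>U\<^sup>2\<close>, containing \<open>M\<^sub>2(-1)\<close> primitively with complement \<open>M\<^sub>1\<close>; the
  diagonal of \<open>M\<^sub>2\<close> gives the complement \<open>M\<^sub>2\<close> for the same \<open>N = M\<^sub>2(-1)\<close>.

  Since \<open>N(X) \<cong> NS(X) \<oplus> U\<close>, a common mirror partner gives (3) for the Neron-Severi lattices.
  Conversely an abelian surface with Neron-Severi lattice \<open>NS(X\<^sub>1)(-1)\<close> is a common mirror partner, and
  it is constructed from an explicit period matrix.
\<close>

section \<open>Primitive binary sublattices of \<open>U\<^sup>3\<close>\<close>

text \<open>The third hyperbolic plane is what separates (3) from (1): a binary lattice may have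
  inequivalent primitive embeddings in U^2, with different complements, whereas in U^3 there is
  enough room to bring all of them to one shape, so that the complement depends on the lattice
  alone. The delicate implication is from (4) to (2), since an odd stabilizing lattice loses the
  discriminant quadratic form modulo 2 and keeps only the bilinear form modulo 1. On
  \<open>R\<close> the parity of the norm is additive, hence equal to the pairing with a
  characteristic vector \<open>w\<close>. If \<open>w\<close> is isotropic, then
  \<open>w - 2 h\<close> has norm 4 (\<open>Q h h - Q w h\<close>), and the bracket is even because
  \<open>w\<close> is characteristic; this is the divisibility by 8. With
  \<open>w - 2 h = (2 c, 0)\<close> it says that the norm of \<open>c\<close> is even. Put
  \<open>k = 2 c.x\<close>, an integer. The transvection changes the norm of \<open>x\<close> by
  \<open>k^2 (1 + c.c)\<close>, which has the parity of \<open>k\<close> exactly when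
  \<open>c.c\<close> is even, and the parity of \<open>k\<close> is the defect to be removed. An
  isotropic \<open>w\<close> is visible in a hyperbolic basis, which is why an isotropic vector of
  \<open>R\<close> has to be found first.\<close>

type_synonym int4 = "int \<times> int \<times> int \<times> int"
type_synonym int6 = "int \<times> int \<times> int4"

text \<open>U^2 and U^3 on integer tuples: in coordinates every isometry used below amounts to a
  polynomial identity.\<close>

definition hyp4 :: "int4 \<Rightarrow> int4 \<Rightarrow> int" where
  "hyp4 = (\<lambda>(a, b, c, d) (a', b', c', d'). a * b' + b * a' + (c * d' + d * c'))"

definition hyp6 :: "int6 \<Rightarrow> int6 \<Rightarrow> int" where
  "hyp6 = (\<lambda>(a, b, y) (a', b', y'). a * b' + b * a' + hyp4 y y')"

definition smul6 :: "int \<Rightarrow> int6 \<Rightarrow> int6" where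
  "smul6 k = (\<lambda>(a, b, c, d, e, f). (k * a, k * b, k * c, k * d, k * e, k * f))"

definition isometry :: "('v::ab_group_add \<Rightarrow> 'v \<Rightarrow> int) \<Rightarrow> ('v \<Rightarrow> 'v) \<Rightarrow> bool" where
  "isometry B \<phi> \<longleftrightarrow> bij \<phi> \<and> (\<forall>x y. \<phi> (x + y) = \<phi> x + \<phi> y) \<and> (\<forall>x y. B (\<phi> x) (\<phi> y) = B x y)"

lemma isometry_comp: "isometry B \<phi> \<Longrightarrow> isometry B \<psi> \<Longrightarrow> isometry B (\<phi> \<circ> \<psi>)"
  by (auto simp: isometry_def intro: bij_comp)

lemma isometryI:
  assumes "\<And>x. \<psi> (\<phi> x) = x" "\<And>x. \<phi> (\<psi> x) = x" "\<And>x y. \<phi> (x + y) = \<phi> x + \<phi> y"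
    "\<And>x y. B (\<phi> x) (\<phi> y) = B x y"
  shows "isometry B \<phi>"
  using assms by (auto simp: isometry_def intro!: o_bij[of \<psi>])

lemma isometry_inv:
  assumes "isometry B \<phi>" shows "isometry B (inv_into UNIV \<phi>)"
proof -
  have b: "bij \<phi>" and a: "\<And>x y. \<phi> (x + y) = \<phi> x + \<phi> y" and f: "\<And>x y. B (\<phi> x) (\<phi> y) = B x y"
    using assms by (auto simp: isometry_def)
  note i = bij_is_surj[OF b, THEN surj_f_inv_f] bij_is_inj[OF b, THEN inv_f_f]
  have "inv_into UNIV \<phi> (x + y) = inv_into UNIV \<phi> x + inv_into UNIV \<phi> y" for x y
    by (metis a i)
  moreover have "B (inv_into UNIV \<phi> x) (inv_into UNIV \<phi> y) = B x y" for x y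
    by (metis f i(1))
  ultimately show ?thesis using bij_imp_bij_inv[OF b] by (auto simp: isometry_def)
qed

lemmas int_tuple_simps = hyp4_def hyp6_def smul6_def zero_prod_def uminus_prod_def

lemma smul6_Suc: "smul6 (int (Suc n)) x = x + smul6 (int n) x"
  by (cases x) (simp add: smul6_def algebra_simps)

lemma smul6_neg: "smul6 (- k) x = - smul6 k x"
  by (cases x) (simp add: smul6_def)

lemma isometry_smul6:
  assumes "isometry B \<phi>"
  shows "\<phi> (smul6 k x) = smul6 k (\<phi> x)"
proof -
  have a: "\<And>x y. \<phi> (x + y) = \<phi> x + \<phi> y" using assms by (auto simp: isometry_def)
  have z: "\<phi> 0 = 0" using a[of 0 0] by simp
  have m: "\<phi> (- x) = - \<phi> x" for x using a[of x "- x"] z by (simp add: eq_neg_iff_add_eq_0 add.commute)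
  have z6: "smul6 0 y = 0" for y by (cases y) (simp add: smul6_def zero_prod_def)
  have n: "\<phi> (smul6 (int n) x) = smul6 (int n) (\<phi> x)" for n
    by (induction n) (simp_all only: smul6_Suc a z z6 of_nat_0)
  show ?thesis
    by (cases k) (simp_all only: n smul6_neg m)
qed

text \<open>Euclid's algorithm is replaced by choosing the image with the least positive first coordinate.\<close>

lemma hyp4_normal_form:
  fixes y :: int4
  shows "\<exists>\<phi> g n. isometry hyp4 \<phi> \<and> g \<ge> 0 \<and> \<phi> y = (g, g * n, 0, 0)"
proof (cases "y = 0")
  case True
  show ?thesis
    by (rule exI[of _ id], rule exI[of _ 0]) (auto simp: True isometry_def zero_prod_def)
next
  case False
  define T where "T = (\<lambda>z. \<exists>\<phi>. isometry hyp4 \<phi> \<and> \<phi> y = z)"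
  have move: "T (\<psi> z)" if "T z" "isometry hyp4 \<psi>" for z \<psi>
    using that isometry_comp unfolding T_def by (metis comp_apply)
  have swap: "T (b, a, c, d)" if "T (a, b, c, d)" for a b c d
  proof -
    have "isometry hyp4 (\<lambda>(a, b, c, d). (b, a, c, d))"
      by (rule isometryI[where \<psi> = "\<lambda>(a, b, c, d). (b, a, c, d)"])
         (simp_all add: hyp4_def prod_eq_iff split_beta algebra_simps)
    from move[OF that this] show ?thesis by simp
  qed
  have block: "T (c, d, a, b)" if "T (a, b, c, d)" for a b c d
  proof -
    have "isometry hyp4 (\<lambda>(a, b, c, d). (c, d, a, b))"
      by (rule isometryI[where \<psi> = "\<lambda>(a, b, c, d). (c, d, a, b)"])
         (simp_all add: hyp4_def prod_eq_iff split_beta algebra_simps)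
    from move[OF that this] show ?thesis by simp
  qed
  have neg: "T (- a, - b, c, d)" if "T (a, b, c, d)" for a b c d
  proof -
    have "isometry hyp4 (\<lambda>(a, b, c, d). (- a, - b, c, d))"
      by (rule isometryI[where \<psi> = "\<lambda>(a, b, c, d). (- a, - b, c, d)"])
         (simp_all add: hyp4_def prod_eq_iff split_beta algebra_simps)
    from move[OF that this] show ?thesis by simp
  qed
  \<comment> \<open>Read \<open>(a, b, c, d)\<close> as the integer matrix with rows (a, -c) and (d,
    b), whose determinant is half the norm. A shear adds a multiple of the first row to the second,
    and the normal form is the Smith form diag(g, g n).\<close>
  have shear: "T (a, b - k * c, c, d + k * a)" if "T (a, b, c, d)" for a b c d k
  proof -
    have "isometry hyp4 (\<lambda>(a, b, c, d). (a, b - k * c, c, d + k * a))"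
      by (rule isometryI[where \<psi> = "\<lambda>(a, b, c, d). (a, b + k * c, c, d - k * a)"])
         (simp_all add: hyp4_def prod_eq_iff split_beta algebra_simps)
    from move[OF that this] show ?thesis by simp
  qed
  have T_y: "T y" unfolding T_def by (intro exI[of _ id]) (simp add: isometry_def)
  have "\<exists>a b c d. T (a, b, c, d) \<and> a \<noteq> 0"
  proof -
    obtain a b c d where y: "y = (a, b, c, d)" by (cases y)
    with False consider "a \<noteq> 0" | "b \<noteq> 0" | "c \<noteq> 0" | "d \<noteq> 0" by (auto simp: zero_prod_def)
    then show ?thesis using T_y swap block unfolding y by metis
  qed
  then obtain a b c d where abcd: "T (a, b, c, d)" "a \<noteq> 0" by blast
  have ex: "\<exists>p. (\<exists>b c d. T (int p, b, c, d)) \<and> p > 0"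
  proof (cases "a > 0")
    case True
    with abcd show ?thesis by (intro exI[of _ "nat a"]) auto
  next
    case False
    with abcd neg[OF abcd(1)] show ?thesis by (intro exI[of _ "nat (- a)"]) auto
  qed
  define p where "p = (LEAST p. (\<exists>b c d. T (int p, b, c, d)) \<and> p > 0)"
  have p: "\<exists>b c d. T (int p, b, c, d)" "p > 0"
    using LeastI_ex[OF ex] unfolding p_def[symmetric] by auto
  have least: "\<not> ((\<exists>b c d. T (int m, b, c, d)) \<and> m > 0)" if "m < p" for m
    using not_less_Least that unfolding p_def by blast
  \<comment> \<open>Otherwise a shear puts the remainder of \<open>d\<close> modulo \<open>p\<close>
    in the last place, and \<open>block\<close> and \<open>swap\<close> carry it to the front,
    against the minimality of \<open>p\<close>.\<close>
  have dvd_d: "int p dvd d" if "T (int p, b, c, d)" for b c d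
  proof (rule ccontr)
    assume "\<not> int p dvd d"
    then have m: "0 < d mod int p" "d mod int p < int p"
      using p(2) pos_mod_sign[of "int p" d] pos_mod_bound[of "int p" d] by (simp_all add: dvd_eq_mod_eq_0 order.not_eq_order_implies_strict)
    have e: "d + - (d div int p) * int p = d mod int p" by (simp add: minus_div_mult_eq_mod)
    have "T (d mod int p, c, int p, b - - (d div int p) * c)"
      using swap[OF block[OF shear[OF that, of "- (d div int p)"]]] unfolding e .
    with m least[of "nat (d mod int p)"] show False by fastforce
  qed
  have swap2: "T (a, b, d, c)" if "T (a, b, c, d)" for a b c d
    using block[OF swap[OF block[OF that]]] .
  obtain b c d where 1: "T (int p, b, c, d)" using p by blast
  obtain k where d: "d = int p * k" using dvd_d[OF 1] by blast
  have "T (int p, b + k * c, c, 0)" using shear[OF 1, of "- k"] by (simp add: d mult.commute)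
  then have 2: "T (int p, b + k * c, 0, c)" by (rule swap2)
  obtain l where c: "c = int p * l" using dvd_d[OF 2] by blast
  have 3: "T (int p, b + k * c, 0, 0)" using shear[OF 2, of "- l"] by (simp add: c mult.commute)
  \<comment> \<open>A shear between two swaps copies the second entry to the last place, where
    \<open>dvd_d\<close> applies to it.\<close>
  have "T (int p, b + k * c, 0, b + k * c)"
    using swap[OF shear[OF swap[OF 3], of 1]] by simp
  then obtain n where "b + k * c = int p * n" using dvd_d by blast
  with 3 show ?thesis unfolding T_def by (metis of_nat_0_le_iff)
qed

lemma isometry_hyp4_lift:
  assumes "isometry hyp4 \<phi>"
  shows "isometry hyp6 (\<lambda>(a, b, y). (a, b, \<phi> y))"
proof -
  note i = assms[unfolded isometry_def]
  show ?thesis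
    by (rule isometryI[where \<psi> = "\<lambda>(a, b, y). (a, b, inv_into UNIV \<phi> y)"])
       (use i in \<open>auto simp: hyp6_def bij_is_surj bij_is_inj surj_f_inv_f split_beta\<close>)
qed

lemma isometry_hyp4_lift':
  assumes "isometry hyp4 \<phi>"
  shows "isometry hyp6 (\<lambda>(a, b, c, d, z). case \<phi> (a, b, c, d) of (a', b', c', d') \<Rightarrow> (a', b', c', d', z))"
proof -
  have \<phi>: "bij \<phi>" "\<And>x y. \<phi> (x + y) = \<phi> x + \<phi> y" "\<And>x y. hyp4 (\<phi> x) (\<phi> y) = hyp4 x y"
    using assms by (auto simp: isometry_def)
  have fst4: "fst (\<phi> (x + y)) = fst (\<phi> x) + fst (\<phi> y)" for x y by (simp add: \<phi>)
  have h: "hyp6 (a, b, c, d, z) (a', b', c', d', z') =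
     hyp4 (a, b, c, d) (a', b', c', d') + (fst z * snd z' + snd z * fst z')" for a b c d z a' b' c' d' z'
    by (simp add: hyp6_def hyp4_def split_beta)
  have ad: "\<phi> (a + a', b + b', c + c', d + d') = \<phi> (a, b, c, d) + \<phi> (a', b', c', d')" for a a' b b' c c' d d'
    using \<phi>(2)[of "(a, b, c, d)" "(a', b', c', d')"] by simp
  show ?thesis
  proof (rule isometryI[where \<psi> = "\<lambda>(a, b, c, d, z). case inv_into UNIV \<phi> (a, b, c, d) of (a', b', c', d') \<Rightarrow> (a', b', c', d', z)"])
    fix x y :: int6
    obtain a b c d z where x: "x = (a, b, c, d, z)" by (cases x)
    obtain a' b' c' d' z' where y: "y = (a', b', c', d', z')" by (cases y)
    obtain s t u v where p: "\<phi> (a, b, c, d) = (s, t, u, v)" by (cases "\<phi> (a, b, c, d)")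
    obtain s' t' u' v' where p': "\<phi> (a', b', c', d') = (s', t', u', v')" by (cases "\<phi> (a', b', c', d')")
    obtain s1 t1 u1 v1 where q: "inv_into UNIV \<phi> (a, b, c, d) = (s1, t1, u1, v1)" by (cases "inv_into UNIV \<phi> (a, b, c, d)")
    have ip: "inv_into UNIV \<phi> (s, t, u, v) = (a, b, c, d)" using \<phi>(1) p by (metis bij_inv_eq_iff)
    have iq: "\<phi> (s1, t1, u1, v1) = (a, b, c, d)" using \<phi>(1) q by (metis bij_inv_eq_iff)
    show "(case case x of (a, b, c, d, z) \<Rightarrow> case \<phi> (a, b, c, d) of (a', b', c', d') \<Rightarrow> (a', b', c', d', z) of
          (a, b, c, d, z) \<Rightarrow> case inv_into UNIV \<phi> (a, b, c, d) of (a', b', c', d') \<Rightarrow> (a', b', c', d', z)) = x"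
      by (simp add: x p ip)
    show "(case case x of (a, b, c, d, z) \<Rightarrow> case inv_into UNIV \<phi> (a, b, c, d) of (a', b', c', d') \<Rightarrow> (a', b', c', d', z) of
          (a, b, c, d, z) \<Rightarrow> case \<phi> (a, b, c, d) of (a', b', c', d') \<Rightarrow> (a', b', c', d', z)) = x"
      by (simp add: x q iq)
    show "(case x + y of (a, b, c, d, z) \<Rightarrow> case \<phi> (a, b, c, d) of (a', b', c', d') \<Rightarrow> (a', b', c', d', z)) =
       (case x of (a, b, c, d, z) \<Rightarrow> case \<phi> (a, b, c, d) of (a', b', c', d') \<Rightarrow> (a', b', c', d', z)) +
       (case y of (a, b, c, d, z) \<Rightarrow> case \<phi> (a, b, c, d) of (a', b', c', d') \<Rightarrow> (a', b', c', d', z))"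
      by (simp add: x y p p' ad)
    have "hyp4 (s, t, u, v) (s', t', u', v') = hyp4 (a, b, c, d) (a', b', c', d')"
      using \<phi>(3) p p' by metis
    then show "hyp6 (case x of (a, b, c, d, z) \<Rightarrow> case \<phi> (a, b, c, d) of (a', b', c', d') \<Rightarrow> (a', b', c', d', z))
       (case y of (a, b, c, d, z) \<Rightarrow> case \<phi> (a, b, c, d) of (a', b', c', d') \<Rightarrow> (a', b', c', d', z)) = hyp6 x y"
      by (simp add: x y p p' h)
  qed
qed

text \<open>The rank four normal form is applied twice: to the last two planes, which empties the
  third, and then to the first two, the second of which now holds \<open>(g, g * n)\<close>.\<close>

lemma hyp6_normal_form:
  "\<exists>\<phi> g n. isometry hyp6 \<phi> \<and> g \<ge> 0 \<and> \<phi> v = (g, g * n, 0, 0, 0, 0)"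
proof -
  obtain a b y where v: "v = (a, b, y)" by (cases v)
  obtain \<phi> g n where 1: "isometry hyp4 \<phi>" "\<phi> y = (g, g * n, 0, 0)" using hyp4_normal_form by blast
  obtain \<psi> h m where 2: "isometry hyp4 \<psi>" "\<psi> (a, b, g, g * n) = (h, h * m, 0, 0)" "h \<ge> 0" using hyp4_normal_form by blast
  note i = isometry_comp[OF isometry_hyp4_lift'[OF 2(1)] isometry_hyp4_lift[OF 1(1)]]
  show ?thesis
    by (rule exI, rule exI[of _ h], rule exI[of _ m], intro conjI, rule i, rule 2(3)) (simp add: v 1(2) 2(2))
qed

text \<open>The case \<open>d = 0\<close> is linear independence; the other values of
  \<open>d\<close> say that the sublattice is saturated.\<close>

definition independent_primitive :: "int6 \<Rightarrow> int6 \<Rightarrow> bool" where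
  "independent_primitive v1 v2 \<longleftrightarrow>
     (\<forall>i j d x. smul6 d x = smul6 i v1 + smul6 j v2 \<longrightarrow> d dvd i \<and> d dvd j)"

text \<open>The complement is N(-1) + U, written in vectors: \<open>w1\<close>, \<open>w2\<close>
  carry the negated Gram matrix of \<open>v1\<close>, \<open>v2\<close>, and \<open>p\<close>,
  \<open>q\<close> are a hyperbolic pair. That the generators are free comes from nondegeneracy,
  once the statement is carried over to lattices.\<close>

definition split_complement :: "int6 \<Rightarrow> int6 \<Rightarrow> bool" where
  "split_complement v1 v2 \<longleftrightarrow> (\<exists>w1 w2 p q.
     hyp6 w1 w1 = - hyp6 v1 v1 \<and> hyp6 w1 w2 = - hyp6 v1 v2 \<and> hyp6 w2 w2 = - hyp6 v2 v2 \<and>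
     hyp6 p p = 0 \<and> hyp6 q q = 0 \<and> hyp6 p q = 1 \<and>
     (\<forall>w\<in>{w1, w2}. hyp6 w p = 0 \<and> hyp6 w q = 0) \<and>
     (\<forall>w\<in>{w1, w2, p, q}. hyp6 w v1 = 0 \<and> hyp6 w v2 = 0) \<and>
     (\<forall>x. hyp6 x v1 = 0 \<and> hyp6 x v2 = 0 \<longrightarrow>
        (\<exists>i j k l. x = smul6 i w1 + smul6 j w2 + smul6 k p + smul6 l q)))"

lemma hyp6_add:
  "hyp6 (x + y) z = hyp6 x z + hyp6 y z" "hyp6 z (x + y) = hyp6 z x + hyp6 z y"
  "hyp6 (smul6 k x) z = k * hyp6 x z" "hyp6 z (smul6 k x) = k * hyp6 z x"
  by (cases x; cases y; cases z; simp add: int_tuple_simps algebra_simps)+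

lemma hyp6_commute: "hyp6 x y = hyp6 y x"
  by (cases x; cases y; simp add: int_tuple_simps algebra_simps)

lemma smul6_add: "smul6 k (x + y) = smul6 k x + smul6 k y" "smul6 (k + l) x = smul6 k x + smul6 l x"
  "smul6 (k * l) x = smul6 k (smul6 l x)"
  by (cases x; cases y; simp add: int_tuple_simps algebra_simps)+

lemma split_complement_isometry:
  assumes "isometry hyp6 \<phi>" "split_complement v1 v2"
  shows "split_complement (\<phi> v1) (\<phi> v2)"
proof -
  have \<phi>: "\<And>x y. \<phi> (x + y) = \<phi> x + \<phi> y" "\<And>x y. hyp6 (\<phi> x) (\<phi> y) = hyp6 x y" "surj \<phi>"
    using assms(1) by (auto simp: isometry_def bij_is_surj)
  note s = isometry_smul6[OF assms(1)]
  obtain w1 w2 p q where w: "hyp6 w1 w1 = - hyp6 v1 v1" "hyp6 w1 w2 = - hyp6 v1 v2" "hyp6 w2 w2 = - hyp6 v2 v2"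
     "hyp6 p p = 0" "hyp6 q q = 0" "hyp6 p q = 1"
     "\<forall>w\<in>{w1, w2}. hyp6 w p = 0 \<and> hyp6 w q = 0"
     "\<forall>w\<in>{w1, w2, p, q}. hyp6 w v1 = 0 \<and> hyp6 w v2 = 0"
     and c: "\<And>x. hyp6 x v1 = 0 \<and> hyp6 x v2 = 0 \<Longrightarrow>
        \<exists>i j k l. x = smul6 i w1 + smul6 j w2 + smul6 k p + smul6 l q"
    using assms(2) unfolding split_complement_def by blast
  have "\<exists>i j k l. x = smul6 i (\<phi> w1) + smul6 j (\<phi> w2) + smul6 k (\<phi> p) + smul6 l (\<phi> q)"
    if "hyp6 x (\<phi> v1) = 0 \<and> hyp6 x (\<phi> v2) = 0" for x
  proof -
    obtain x' where x: "x = \<phi> x'" using \<phi>(3) by blast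
    with that obtain i j k l where "x' = smul6 i w1 + smul6 j w2 + smul6 k p + smul6 l q" using c \<phi>(2) by metis
    then show ?thesis unfolding x by (intro exI) (simp only: \<phi>(1) s)
  qed
  with w show ?thesis unfolding split_complement_def
    by - (rule exI[of _ "\<phi> w1"], rule exI[of _ "\<phi> w2"], rule exI[of _ "\<phi> p"], rule exI[of _ "\<phi> q"],
      (simp add: \<phi>(2) del: split_paired_All))
qed

text \<open>The same base change is made on the negated copy, with \<open>w2 + t w1\<close> in place
  of \<open>w2\<close>; \<open>p\<close> and \<open>q\<close> stay.\<close>

lemma split_complement_shift:
  assumes "split_complement v1 v2"
  shows "split_complement v1 (v2 + smul6 t v1)"
proof -
  obtain w1 w2 p q where w: "hyp6 w1 w1 = - hyp6 v1 v1" "hyp6 w1 w2 = - hyp6 v1 v2" "hyp6 w2 w2 = - hyp6 v2 v2"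
     "hyp6 p p = 0" "hyp6 q q = 0" "hyp6 p q = 1"
     "\<forall>w\<in>{w1, w2}. hyp6 w p = 0 \<and> hyp6 w q = 0"
     "\<forall>w\<in>{w1, w2, p, q}. hyp6 w v1 = 0 \<and> hyp6 w v2 = 0"
     and c: "\<And>x. hyp6 x v1 = 0 \<and> hyp6 x v2 = 0 \<Longrightarrow>
        \<exists>i j k l. x = smul6 i w1 + smul6 j w2 + smul6 k p + smul6 l q"
    using assms unfolding split_complement_def by blast
  have "\<exists>i j k l. x = smul6 i w1 + smul6 j (w2 + smul6 t w1) + smul6 k p + smul6 l q"
    if "hyp6 x v1 = 0 \<and> hyp6 x (v2 + smul6 t v1) = 0" for x
  proof -
    have "hyp6 x v1 = 0 \<and> hyp6 x v2 = 0" using that by (auto simp: hyp6_add)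
    from c[OF this] obtain i j k l where "x = smul6 i w1 + smul6 j w2 + smul6 k p + smul6 l q" by blast
    then have "x = smul6 (i + - (j * t)) w1 + smul6 j (w2 + smul6 t w1) + smul6 k p + smul6 l q"
      by (simp only: smul6_add smul6_neg) simp
    then show ?thesis by blast
  qed
  with w show ?thesis unfolding split_complement_def
    by - (rule exI[of _ w1], rule exI[of _ "w2 + smul6 t w1"], rule exI[of _ p], rule exI[of _ q],
      (simp add: hyp6_add algebra_simps hyp6_commute[of w2 w1] hyp6_commute[of v2 v1] del: split_paired_All, blast))
qed

lemma independent_primitive_isometry:
  assumes "isometry hyp6 \<phi>" "independent_primitive v1 v2"
  shows "independent_primitive (\<phi> v1) (\<phi> v2)"
proof -
  have \<phi>: "\<And>x y. \<phi> (x + y) = \<phi> x + \<phi> y" "bij \<phi>"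
    using assms(1) by (auto simp: isometry_def)
  note s = isometry_smul6[OF assms(1)]
  show ?thesis unfolding independent_primitive_def
  proof (intro allI impI)
    fix i j d x assume *: "smul6 d x = smul6 i (\<phi> v1) + smul6 j (\<phi> v2)"
    obtain x' where x: "x = \<phi> x'" using \<phi>(2) by (metis bij_pointE)
    have "\<phi> (smul6 d x') = \<phi> (smul6 i v1 + smul6 j v2)" using * by (simp only: x s \<phi>(1))
    then have "smul6 d x' = smul6 i v1 + smul6 j v2" using \<phi>(2) by (metis bij_is_inj injD)
    then show "d dvd i \<and> d dvd j" using assms(2) unfolding independent_primitive_def by blast
  qed
qed

lemma independent_primitive_shift:
  assumes "independent_primitive v1 v2"
  shows "independent_primitive v1 (v2 + smul6 t v1)"
  unfolding independent_primitive_def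
proof (intro allI impI)
  fix i j d x assume "smul6 d x = smul6 i v1 + smul6 j (v2 + smul6 t v1)"
  then have "smul6 d x = smul6 (i + j * t) v1 + smul6 j v2" by (simp add: smul6_add add_ac)
  then have "d dvd i + j * t" "d dvd j" using assms unfolding independent_primitive_def by blast+
  then show "d dvd i \<and> d dvd j" by (simp add: dvd_add_left_iff)
qed

text \<open>
  The complement of the normal form. With \<open>b r + g s = 1\<close> the vectors
  \<open>f = (0,1,0,0,0,-1)\<close> and \<open>f' = (r, -ar, 0, s, r, ar)\<close> span a totally isotropic plane dual to
  \<open>v1, v2\<close>; then \<open>w1, w2\<close> are obtained from \<open>v1, v2\<close> by subtracting combinations of \<open>f, f'\<close>, and
  \<open>p, q\<close> span the complement of \<open>v1, v2, f, f'\<close>.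
\<close>

lemma split_complement_normal:
  assumes rs: "b * r + g * s = 1"
  shows "split_complement (1, a, 0, 0, 0, 0) (0, b, g, g * n, 0, 0)"
proof -
  define v1 v2 where "v1 = (1::int, a, 0::int, 0::int, 0::int, 0::int)" and "v2 = (0::int, b, g, g * n, 0::int, 0::int)"
  define f f' where "f = (0::int, 1::int, 0::int, 0::int, 0::int, -1::int)" and "f' = (r, - a * r, 0::int, s, r, a * r)"
  define w1 w2 where "w1 = v1 + smul6 (- 2 * a) f + smul6 (- b) f'"
    and "w2 = v2 + smul6 (- b) f + smul6 (- 2 * g * g * n) f'"
  define q where "q = (- g, a * g, 0::int, b, - g, - a * g)"
  define p0 where "p0 = (0::int, 0::int, r, - n * r, 0::int, - s)"
  \<comment> \<open>\<open>p0\<close> has norm \<open>- 2 n r^2\<close> and pairs to 1 with the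
    isotropic \<open>q\<close>, so adding \<open>n r^2\<close> times \<open>q\<close> makes it
    isotropic.\<close>
  define p where "p = p0 + smul6 (n * r * r) q"
  have ff: "hyp6 f f = 0" "hyp6 f f' = 0" "hyp6 f' f' = 0" "hyp6 f' f = 0"
    by (simp_all add: f_def f'_def int_tuple_simps algebra_simps)
  have fv: "hyp6 f v1 = 1" "hyp6 f v2 = 0" "hyp6 f' v1 = 0" "hyp6 f' v2 = 1" 
    using rs by (simp_all add: f_def f'_def v1_def v2_def int_tuple_simps algebra_simps)
  have vf: "hyp6 v1 f = 1" "hyp6 v2 f = 0" "hyp6 v1 f' = 0" "hyp6 v2 f' = 1" 
    using fv hyp6_commute by metis+
  have vv: "hyp6 v1 v1 = 2 * a" "hyp6 v1 v2 = b" "hyp6 v2 v1 = b" "hyp6 v2 v2 = 2 * g * g * n"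
    by (simp_all add: v1_def v2_def int_tuple_simps algebra_simps)
  have q: "hyp6 q q = 0" "hyp6 q v1 = 0" "hyp6 q v2 = 0" "hyp6 q f = 0" "hyp6 q f' = 0"
    using rs by (simp_all add: q_def f_def f'_def v1_def v2_def int_tuple_simps algebra_simps)
  have p0: "hyp6 p0 q = 1"
    "hyp6 p0 v1 = 0" "hyp6 p0 v2 = 0"
    "hyp6 p0 f = 0" "hyp6 p0 f' = 0"
    "hyp6 p0 p0 = - 2 * n * r * r"
    using rs by (simp_all add: p0_def q_def f_def f'_def v1_def v2_def int_tuple_simps algebra_simps)
  have p: "hyp6 p p = 0" "hyp6 p q = 1" "hyp6 p v1 = 0" "hyp6 p v2 = 0" "hyp6 p f = 0" "hyp6 p f' = 0"
    unfolding p_def using hyp6_commute[of q "p0"] by (simp_all add: hyp6_add q p0)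
  have wv: "hyp6 w p = 0 \<and> hyp6 w q = 0" if "w \<in> {w1, w2}" for w
    using that unfolding w1_def w2_def by (auto simp: hyp6_add hyp6_commute[of _ p] hyp6_commute[of _ q] p q)
  have ww: "hyp6 w1 v1 = 0" "hyp6 w1 v2 = 0" "hyp6 w2 v1 = 0" "hyp6 w2 v2 = 0"
     "hyp6 w1 f = 1" "hyp6 w1 f' = 0" "hyp6 w2 f = 0" "hyp6 w2 f' = 1"
    unfolding w1_def w2_def by (simp_all add: hyp6_add ff fv vf vv)
  have g: "hyp6 w1 w1 = - 2 * a" "hyp6 w1 w2 = - b" "hyp6 w2 w2 = - 2 * g * g * n"
    by (simp_all add: w1_def[of] w2_def[of] hyp6_add ff fv vf vv)
  have plane: "\<exists>k l. x = smul6 k p + smul6 l q"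
    if "hyp6 x v1 = 0" "hyp6 x v2 = 0" "hyp6 x f = 0" "hyp6 x f' = 0" for x
  proof -
    obtain x1 x2 x3 x4 x5 x6 where x: "x = (x1, x2, x3, x4, x5, x6)" by (cases x)
    have 1: "x2 = - a * x1" "x5 = x1" "b * x1 + g * (x4 + n * x3) = 0"
      using that unfolding x by (simp_all add: v1_def v2_def f_def int_tuple_simps algebra_simps)
    have 2: "r * (x6 - a * x1) + s * x3 = 0"
      using that(4) unfolding x by (simp add: f'_def int_tuple_simps algebra_simps 1(1,2))
    \<comment> \<open>Of the equations, one says that \<open>(x1, x4 + n x3)\<close> is orthogonal
      to \<open>(b, g)\<close>, another that \<open>(x3, x6 - a x1)\<close> is orthogonal to
      \<open>(s, r)\<close>. Both pairs are coprime by \<open>rs\<close>, so the solutions are the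
      multiples \<open>m\<close> of \<open>(g, - b)\<close> and \<open>k\<close> of
      \<open>(r, - s)\<close>; the definitions of \<open>k\<close> and \<open>m\<close> recover
      these factors by the Bezout relation.\<close>
    define k where "k = b * x3 - g * (x6 - a * x1)"
    define m where "m = r * (- x4 - n * x3) + s * x1"
    have "x3 = (b * r + g * s) * x3" by (simp add: rs)
    also have "\<dots> = r * k + g * (r * (x6 - a * x1) + s * x3)" by (simp add: k_def algebra_simps)
    finally have e3: "x3 = r * k" by (simp add: 2)
    have "x6 - a * x1 = (b * r + g * s) * (x6 - a * x1)" by (simp add: rs)
    also have "\<dots> = b * (r * (x6 - a * x1) + s * x3) - s * k" by (simp add: k_def algebra_simps)
    finally have e6: "x6 = a * x1 - s * k" by (simp add: 2)
    have "x1 = (b * r + g * s) * x1" by (simp add: rs)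
    also have "\<dots> = g * m + r * (b * x1 + g * (x4 + n * x3))" by (simp add: m_def algebra_simps)
    finally have e1: "x1 = g * m" by (simp add: 1)
    have "x4 + n * x3 = (b * r + g * s) * (x4 + n * x3)" by (simp add: rs)
    also have "\<dots> = - b * m + s * (b * x1 + g * (x4 + n * x3))" by (simp add: m_def algebra_simps)
    finally have "x4 + n * x3 = - b * m" by (simp only: 1(3))
    then have e4: "x4 = - b * m - n * r * k" by (simp add: e3 algebra_simps)
    have "x = smul6 k p + smul6 (- m - k * n * r * r) q"
      unfolding x 1(1,2) e3 e4 e6 e1 by (simp add: p_def p0_def q_def int_tuple_simps algebra_simps)
    then show ?thesis by blast
  qed
  have "\<exists>i j k l. x = smul6 i w1 + smul6 j w2 + smul6 k p + smul6 l q"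
    if x: "hyp6 x v1 = 0 \<and> hyp6 x v2 = 0" for x
  proof -
    \<comment> \<open>\<open>f\<close>, \<open>f'\<close> are dual to \<open>w1\<close>,
      \<open>w2\<close> as well (see \<open>ww\<close>), so this subtraction makes the vector
      orthogonal to \<open>f\<close> and \<open>f'\<close>.\<close>
    define x' where "x' = x + smul6 (- hyp6 x f) w1 + smul6 (- hyp6 x f') w2"
    have "\<exists>k l. x' = smul6 k p + smul6 l q"
      by (rule plane) (simp_all add: x'_def hyp6_add ww x)
    then obtain k l where "x' = smul6 k p + smul6 l q" by blast
    then have "x = smul6 (hyp6 x f) w1 + smul6 (hyp6 x f') w2 + smul6 k p + smul6 l q"
      unfolding x'_def smul6_neg by (simp add: algebra_simps)
    then show ?thesis by blast
  qed
  then show ?thesis unfolding v1_def[symmetric] v2_def[symmetric] split_complement_def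
    by - (rule exI[of _ w1], rule exI[of _ w2], rule exI[of _ p], rule exI[of _ q],
      (use wv in \<open>simp add: g vv p q ww del: split_paired_All\<close>))
qed

text \<open>Primitivity enters twice. It forces \<open>g = 1\<close> in the normal form of
  \<open>v1\<close>. Isometries of the last two planes fix that form, and with a shift by
  \<open>v1\<close> they bring \<open>v2\<close> to \<open>(0, c, h, h * n, 0, 0)\<close>;
  primitivity of the pair then makes \<open>c\<close> and \<open>h\<close> coprime, which is the
  Bezout relation required by the explicit case.\<close>

theorem split_complement:
  assumes "independent_primitive v1 v2"
  shows "split_complement v1 v2"
proof -
  obtain \<phi> g a where 1: "isometry hyp6 \<phi>" "g \<ge> 0" "\<phi> v1 = (g, g * a, 0, 0, 0, 0)" using hyp6_normal_form by blast
  note P1 = independent_primitive_isometry[OF 1(1) assms]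
  have "smul6 g (1, a, 0, 0, 0, 0) = smul6 1 (\<phi> v1) + smul6 0 (\<phi> v2)"
    by (cases "\<phi> v2") (simp add: 1 smul6_def)
  then have "g dvd 1" using P1 unfolding independent_primitive_def by blast
  then have g: "g = 1" using 1(2) by simp
  obtain t b y where v2: "\<phi> v2 = (t, b, y)" by (cases "\<phi> v2")
  obtain \<psi> h n where 2: "isometry hyp4 \<psi>" "\<psi> y = (h, h * n, 0, 0)" using hyp4_normal_form by blast
  let ?\<psi> = "\<lambda>(a, b, y). (a, b, \<psi> y)"
  have L: "isometry hyp6 ?\<psi>" by (rule isometry_hyp4_lift[OF 2(1)])
  have "\<psi> 0 = 0" using 2(1) unfolding isometry_def by (metis add_cancel_right_right add.right_neutral)
  then have \<psi>1: "?\<psi> (\<phi> v1) = (1, a, 0, 0, 0, 0)" by (simp add: 1 g zero_prod_def)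
  define c where "c = b - t * a"
  have \<psi>2: "?\<psi> (\<phi> v2) + smul6 (- t) (?\<psi> (\<phi> v1)) = (0, c, h, h * n, 0, 0)"
    unfolding \<psi>1 by (simp add: v2 2 smul6_def c_def)
  note P2 = independent_primitive_shift[OF independent_primitive_isometry[OF L P1], of "- t"]
  define d where "d = gcd c h"
  obtain c' h' where ch: "c = d * c'" "h = d * h'" unfolding d_def by (meson dvdE gcd_dvd1 gcd_dvd2)
  have "smul6 d (0, c', h', h' * n, 0, 0) = smul6 0 (1, a, 0, 0, 0, 0) + smul6 1 (0, c, h, h * n, 0, 0)"
    by (simp add: ch smul6_def)
  then have "d dvd 1" using P2 unfolding \<psi>2 unfolding \<psi>1 independent_primitive_def by blast
  then have "gcd c h = 1" unfolding d_def by simp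
  then obtain r s where "c * r + h * s = 1" using bezout_int[of c h] by (metis mult.commute)
  then have "split_complement (1, a, 0, 0, 0, 0) (0, c, h, h * n, 0, 0)" by (rule split_complement_normal)
  then have "split_complement (?\<psi> (\<phi> v1)) (?\<psi> (\<phi> v2) + smul6 (- t) (?\<psi> (\<phi> v1)))" unfolding \<psi>2 unfolding \<psi>1 .
  from split_complement_shift[OF this, of t]
  have "split_complement (?\<psi> (\<phi> v1)) (?\<psi> (\<phi> v2))" by (simp add: smul6_neg)
  then have *: "split_complement ((?\<psi> \<circ> \<phi>) v1) ((?\<psi> \<circ> \<phi>) v2)" by (simp only: comp_apply)
  note i = isometry_comp[OF L 1(1)]
  have "inj (?\<psi> \<circ> \<phi>)" using i by (auto simp only: isometry_def dest: bij_is_inj)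
  note j = inv_f_f[OF this]
  from split_complement_isometry[OF isometry_inv[OF i] *] show ?thesis unfolding j .
qed

section \<open>Lattices\<close>

definition additive_subgroup :: "'a::real_vector set \<Rightarrow> bool" where
  "additive_subgroup S \<longleftrightarrow> 0 \<in> S \<and> (\<forall>x\<in>S. \<forall>y\<in>S. x - y \<in> S)"

lemma additive_subgroupD:
  assumes "additive_subgroup S"
  shows "0 \<in> S" "x \<in> S \<Longrightarrow> y \<in> S \<Longrightarrow> x - y \<in> S" "x \<in> S \<Longrightarrow> - x \<in> S"
    "x \<in> S \<Longrightarrow> y \<in> S \<Longrightarrow> x + y \<in> S" "x \<in> S \<Longrightarrow> of_int k *\<^sub>R x \<in> S"
proof -
  show 0: "0 \<in> S" using assms by (auto simp: additive_subgroup_def)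
  show d: "x - y \<in> S" if "x \<in> S" "y \<in> S" for x y
    using assms that by (auto simp: additive_subgroup_def)
  show n: "- x \<in> S" if "x \<in> S" for x using d[OF 0 that] by simp
  show a: "x + y \<in> S" if "x \<in> S" "y \<in> S" for x y using d[OF that(1) n[OF that(2)]] by simp
  have "of_nat m *\<^sub>R x \<in> S" if "x \<in> S" for x m
    by (induction m) (auto simp: 0 algebra_simps intro: a that)
  then show "of_int k *\<^sub>R x \<in> S" if "x \<in> S" for x
    using that n[of "of_nat _ *\<^sub>R x"] by (cases k) (auto simp del: of_nat_Suc)
qed

lemma additive_subgroup_sum:
  assumes "additive_subgroup S" "\<And>i. i \<in> I \<Longrightarrow> f i \<in> S"
  shows "sum f I \<in> S"
  using assms(2) by (induction I rule: infinite_finite_induct) (auto intro: additive_subgroupD[OF assms(1)])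

lemma additive_subgroup_Int: "additive_subgroup S \<Longrightarrow> additive_subgroup T \<Longrightarrow> additive_subgroup (S \<inter> T)"
  by (auto simp: additive_subgroup_def)

lemma additive_subgroup_int_span [simp]: "additive_subgroup (int_span B)"
  unfolding additive_subgroup_def
proof (intro conjI ballI)
  show "0 \<in> int_span B" unfolding int_span_def by (rule range_eqI[of _ _ "\<lambda>_. 0"]) simp
  fix x y assume "x \<in> int_span B" "y \<in> int_span B"
  then obtain c d :: "_ \<Rightarrow> int" where "x = (\<Sum>v\<in>B. of_int (c v) *\<^sub>R v)" "y = (\<Sum>v\<in>B. of_int (d v) *\<^sub>R v)"
    unfolding int_span_def by blast
  then show "x - y \<in> int_span B" unfolding int_span_def
    by (intro range_eqI[of _ _ "\<lambda>v. c v - d v"]) (simp add: sum_subtractf scaleR_left_diff_distrib)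
qed

lemma int_span_base:
  assumes "finite B" "b \<in> B" shows "b \<in> int_span B"
proof -
  have "b = (\<Sum>v\<in>B. if v = b then b else 0)" using assms by simp
  also have "\<dots> = (\<Sum>v\<in>B. of_int (if v = b then 1 else 0) *\<^sub>R v)" by (intro sum.cong) auto
  finally show ?thesis unfolding int_span_def by (rule range_eqI[where x = "\<lambda>v. if v = b then 1 else 0"])
qed

lemma int_span_minimal:
  assumes "additive_subgroup S" "B \<subseteq> S" shows "int_span B \<subseteq> S"
  using assms unfolding int_span_def
  by (auto intro!: additive_subgroup_sum additive_subgroupD(5)[OF assms(1)])

lemma int_span_subset_span: "int_span B \<subseteq> span B"
  unfolding int_span_def by (auto intro: span_sum span_scale span_base)

lemma span_int_span: "finite B \<Longrightarrow> span (int_span B) = span B"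
  by (intro equalityI span_minimal int_span_subset_span subspace_span)
     (auto intro: span_base int_span_base)

lemma int_span_insert:
  assumes "finite B" "b \<notin> B"
  shows "int_span (insert b B) = {of_int n *\<^sub>R b + y |n y. y \<in> int_span B}"
proof (intro equalityI subsetI)
  fix x assume "x \<in> int_span (insert b B)"
  then obtain c :: "_ \<Rightarrow> int" where "x = (\<Sum>v\<in>insert b B. of_int (c v) *\<^sub>R v)" unfolding int_span_def by blast
  then have "x = of_int (c b) *\<^sub>R b + (\<Sum>v\<in>B. of_int (c v) *\<^sub>R v)" using assms by simp
  then show "x \<in> {of_int n *\<^sub>R b + y |n y. y \<in> int_span B}" unfolding int_span_def by blast
next
  fix x assume "x \<in> {of_int n *\<^sub>R b + y |n y. y \<in> int_span B}"
  then obtain n y where x: "x = of_int n *\<^sub>R b + y" "y \<in> int_span B" by blast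
  have "int_span B \<subseteq> int_span (insert b B)"
    using assms by (intro int_span_minimal) (auto intro: int_span_base)
  moreover have "b \<in> int_span (insert b B)" using assms by (intro int_span_base) auto
  ultimately show "x \<in> int_span (insert b B)" unfolding x(1) using x(2)
    by (blast intro: additive_subgroupD(4,5)[OF additive_subgroup_int_span])
qed

lemma int_span_empty [simp]: "int_span {} = {0}"
  by (auto simp: int_span_def)

lemma int_subgroup_principal:
  fixes I :: "int set"
  assumes "0 \<in> I" "\<And>m n. m \<in> I \<Longrightarrow> n \<in> I \<Longrightarrow> m - n \<in> I"
  shows "\<exists>d\<in>I. \<forall>n\<in>I. d dvd n"
proof (cases "I = {0}")
  case False
  have neg: "- n \<in> I" if "n \<in> I" for n using assms(2)[OF assms(1) that] by simp
  have add: "m + n \<in> I" if "m \<in> I" "n \<in> I" for m n using assms(2)[OF that(1) neg[OF that(2)]] by simp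
  have mul: "int k * n \<in> I" if "n \<in> I" for n k
    by (induction k) (auto simp: assms(1) algebra_simps intro: add that)
  have mul: "k * n \<in> I" if "n \<in> I" for n k
    using mul[OF that] neg[OF mul[OF that]] by (cases k rule: int_cases2) auto
  obtain n where "n \<in> I" "n \<noteq> 0" using False assms(1) by blast
  then have ex: "\<exists>k::nat. k > 0 \<and> int k \<in> I" using neg[of n] by (intro exI[of _ "nat \<bar>n\<bar>"]) (auto simp: abs_if)
  define k where "k = (LEAST k::nat. k > 0 \<and> int k \<in> I)"
  have k: "k > 0" "int k \<in> I" using LeastI_ex[OF ex] unfolding k_def by auto
  have "int k dvd n" if n: "n \<in> I" for n
  proof (rule ccontr)
    assume "\<not> int k dvd n"
    then have m: "0 < n mod int k" "n mod int k < int k"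
      using k(1) pos_mod_sign[of "int k" n] pos_mod_bound[of "int k" n]
      by (simp_all add: dvd_eq_mod_eq_0 order.not_eq_order_implies_strict)
    have "n - (n div int k) * int k \<in> I" by (intro assms(2) n mul k)
    then have "n mod int k \<in> I" by (simp add: minus_div_mult_eq_mod)
    then have "nat (n mod int k) > 0 \<and> int (nat (n mod int k)) \<in> I" using m by simp
    then have "k \<le> nat (n mod int k)" unfolding k_def by (rule Least_le)
    then show False using m by linarith
  qed
  then show ?thesis using k by blast
qed auto

text \<open>As for subgroups of free abelian groups: the coefficients of \<open>b\<close> that occur
  in \<open>S\<close> are the multiples of some \<open>d\<close>. A lift \<open>s\<close> of
  \<open>d\<close> together with a basis of \<open>S \<inter> int_span B\<close> generates
  \<open>S\<close>; if \<open>d = 0\<close>, that basis suffices. Real independence persists because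
  \<open>b\<close> is outside \<open>span B\<close>.\<close>

theorem subgroup_int_span_basis:
  assumes "finite B" "independent B" "additive_subgroup S" "S \<subseteq> int_span B"
  shows "\<exists>C. finite C \<and> independent C \<and> S = int_span C"
  using assms
proof (induction B arbitrary: S rule: finite_induct)
  case empty
  then show ?case using additive_subgroupD(1)[of S] by (intro exI[of _ "{}"]) auto
next
  case (insert b B)
  have ind: "independent B" and b: "b \<notin> span B" using insert.prems(1) insert.hyps(2) by (auto simp: independent_insert)
  have "\<exists>C. finite C \<and> independent C \<and> S \<inter> int_span B = int_span C"
    by (rule insert.IH[OF ind]) (auto intro: additive_subgroup_Int insert.prems)
  then obtain C where C: "finite C" "independent C" "S \<inter> int_span B = int_span C" by blast
  note S = additive_subgroupD[OF insert.prems(2)]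
  note iB = additive_subgroupD[OF additive_subgroup_int_span[of B]]
  define I where "I = {n :: int. \<exists>y\<in>int_span B. of_int n *\<^sub>R b + y \<in> S}"
  have "0 \<in> I" unfolding I_def using S(1) iB(1) by (auto intro: bexI[of _ 0])
  moreover have "m - n \<in> I" if mn: "m \<in> I" "n \<in> I" for m n
  proof -
    obtain y z where yz: "y \<in> int_span B" "of_int m *\<^sub>R b + y \<in> S" "z \<in> int_span B" "of_int n *\<^sub>R b + z \<in> S"
      using mn unfolding I_def by blast
    have e: "of_int (m - n) *\<^sub>R b + (y - z) = (of_int m *\<^sub>R b + y) - (of_int n *\<^sub>R b + z)"
      by (simp add: algebra_simps)
    have "of_int (m - n) *\<^sub>R b + (y - z) \<in> S" unfolding e by (rule S(2)[OF yz(2,4)])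
    then show ?thesis unfolding I_def using iB(2)[OF yz(1,3)] by blast
  qed
  ultimately obtain d where d: "d \<in> I" "\<And>n. n \<in> I \<Longrightarrow> d dvd n" using int_subgroup_principal[of I] by blast
  obtain y where y: "y \<in> int_span B" "of_int d *\<^sub>R b + y \<in> S" using d(1) unfolding I_def by blast
  define s where "s = of_int d *\<^sub>R b + y"
  have C_span: "span C \<subseteq> span B"
    using C(3) int_span_base[OF C(1)] int_span_subset_span[of B] by (intro span_minimal subspace_span) blast
  have dec: "\<exists>k. \<exists>z\<in>int_span C. x = of_int k *\<^sub>R s + z" if x: "x \<in> S" for x
  proof -
    obtain n z where nz: "x = of_int n *\<^sub>R b + z" "z \<in> int_span B"
      using x insert.prems(3) int_span_insert[OF insert.hyps(1,2)] by blast
    then have "n \<in> I" unfolding I_def using x by blast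
    then obtain k where k: "n = d * k" using d(2) by blast
    have "x - of_int k *\<^sub>R s = z - of_int k *\<^sub>R y" by (simp add: nz s_def k algebra_simps)
    moreover have "x - of_int k *\<^sub>R s \<in> S" unfolding s_def by (intro S x y)
    moreover have "z - of_int k *\<^sub>R y \<in> int_span B" by (intro iB nz y)
    ultimately have "x - of_int k *\<^sub>R s \<in> int_span C" using C(3) by auto
    then show ?thesis by (intro exI[of _ k] bexI[of _ "x - of_int k *\<^sub>R s"]) auto
  qed
  show ?case
  proof (cases "d = 0")
    case True
    then have "s \<in> int_span C" using y C(3) by (auto simp: s_def)
    then have "S \<subseteq> int_span C" using dec by (blast intro: additive_subgroupD(4,5)[OF additive_subgroup_int_span])
    then show ?thesis using C by blast
  next
    case False
    have s: "s \<notin> span C"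
    proof
      assume "s \<in> span C"
      then have "s - y \<in> span B" using C_span y int_span_subset_span[of B] by (blast intro: span_diff)
      then have "of_int d *\<^sub>R b \<in> span B" by (simp add: s_def)
      from span_scale[OF this, of "1 / of_int d"] show False using False b by simp
    qed
    then have sC: "s \<notin> C" using span_base by blast
    have "S = int_span (insert s C)"
    proof
      show "S \<subseteq> int_span (insert s C)" unfolding int_span_insert[OF C(1) sC] using dec by blast
      show "int_span (insert s C) \<subseteq> S"
        using C int_span_base[OF C(1)] y by (intro int_span_minimal insert.prems) (auto simp: s_def)
    qed
    with C s show ?thesis by (intro exI[of _ "insert s C"]) (auto simp: independent_insert)
  qed
qed

text \<open>Embeddings of lattices are only additive, and only on points. The linear extension lets
  them act on dual vectors, which lie in the real span.\<close>

lemma additive_extends_linear: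
  fixes f :: "'a::real_vector \<Rightarrow> 'b::real_vector"
  assumes "finite B" "independent B"
    and add: "\<And>x y. x \<in> int_span B \<Longrightarrow> y \<in> int_span B \<Longrightarrow> f (x + y) = f x + f y"
  shows "\<exists>F. linear F \<and> (\<forall>x\<in>int_span B. F x = f x)"
proof -
  obtain F where F: "linear F" "\<And>b. b \<in> B \<Longrightarrow> F b = f b"
    using linear_independent_extend[OF assms(2), of f] by blast
  let ?E = "{x \<in> int_span B. F x = f x}"
  note S = additive_subgroupD[OF additive_subgroup_int_span[of B]]
  have f0: "f 0 = 0" using add[OF S(1) S(1)] by simp
  have diff: "f (x - y) = f x - f y" if "x \<in> int_span B" "y \<in> int_span B" for x y
    using add[OF S(2)[OF that] that(2)] by simp
  have "additive_subgroup ?E"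
    using S(1,2) by (auto simp: additive_subgroup_def f0 linear_0[OF F(1)] linear_diff[OF F(1)] diff)
  then have "int_span B \<subseteq> ?E"
    using F(2) int_span_base[OF assms(1)] by (intro int_span_minimal) auto
  then show ?thesis using F(1) by blast
qed

section \<open>Lattices, isometries and direct sums\<close>

lemma is_latticeD:
  assumes "is_lattice M"
  shows "bilinear (form M)"
    and "x \<in> points M \<Longrightarrow> y \<in> points M \<Longrightarrow> form M x y \<in> \<int>"
    and "x \<in> points M \<Longrightarrow> y \<in> points M \<Longrightarrow> form M x y = form M y x"
    and "x \<in> points M \<Longrightarrow> (\<And>y. y \<in> points M \<Longrightarrow> form M x y = 0) \<Longrightarrow> x = 0"
    and "additive_subgroup (points M)"
proof -
  from assms obtain B where B: "points M = int_span B" unfolding is_lattice_def by (elim conjE exE)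
  show "additive_subgroup (points M)" unfolding B by simp
  show "bilinear (form M)" using assms unfolding is_lattice_def by (elim conjE)
  have "\<forall>x\<in>points M. \<forall>y\<in>points M. form M x y \<in> \<int>"
    "\<forall>x\<in>points M. \<forall>y\<in>points M. form M x y = form M y x"
    "\<forall>x\<in>points M. (\<forall>y\<in>points M. form M x y = 0) \<longrightarrow> x = 0"
    using assms unfolding is_lattice_def by - (elim conjE, assumption)+
  then show "x \<in> points M \<Longrightarrow> y \<in> points M \<Longrightarrow> form M x y \<in> \<int>"
    "x \<in> points M \<Longrightarrow> y \<in> points M \<Longrightarrow> form M x y = form M y x"
    "x \<in> points M \<Longrightarrow> (\<And>y. y \<in> points M \<Longrightarrow> form M x y = 0) \<Longrightarrow> x = 0"
    by simp_all
qed

lemma lattice_basis: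
  assumes "is_lattice M"
  obtains B where "finite B" "independent B" "points M = int_span B"
  using assms unfolding is_lattice_def by (elim conjE exE)

lemma bilinear_eq_on_span:
  assumes "bilinear f" "bilinear g" "\<And>x y. x \<in> S \<Longrightarrow> y \<in> T \<Longrightarrow> f x y = g x y" "x \<in> span S" "y \<in> span T"
  shows "f x y = g x y"
proof -
  have l: "linear (f x)" "linear (\<lambda>x. f x y)" "linear (g x)" "linear (\<lambda>x. g x y)" for x y
    using assms(1,2) by (auto simp: bilinear_def)
  have "f x y = g x y" if "x \<in> S" for x
    by (rule linear_eq_on_span[OF l(1) l(3) assms(3)[OF that] assms(5)])
  then show ?thesis by (rule linear_eq_on_span[OF l(2) l(4) _ assms(4)])
qed

lemma bilinear_swap: "bilinear f \<Longrightarrow> bilinear (\<lambda>x y. f y x)"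
  by (auto simp: bilinear_def)

text \<open>The definition of a lattice gives symmetry on points; dual vectors need it on the whole
  span.\<close>

lemma lattice_form_commute:
  assumes "is_lattice M" "x \<in> span (points M)" "y \<in> span (points M)"
  shows "form M x y = form M y x"
  using bilinear_eq_on_span[OF is_latticeD(1)[OF assms(1)] bilinear_swap[OF is_latticeD(1)[OF assms(1)]] is_latticeD(3)[OF assms(1)] assms(2,3)] .

lemma lattice_embedding_refl: "lattice_embedding id M M"
  by (auto simp: lattice_embedding_def)

lemma isometric_refl: "M \<cong>\<^sub>L M"
  unfolding isometric_def using lattice_embedding_refl by (intro exI[of _ id]) auto

lemma isometric_trans: "M \<cong>\<^sub>L L \<Longrightarrow> L \<cong>\<^sub>L K \<Longrightarrow> M \<cong>\<^sub>L K"
  unfolding isometric_def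
proof (elim exE conjE)
  fix f g assume *: "lattice_embedding f M L" "f ` points M = points L" "lattice_embedding g L K" "g ` points L = points K"
  have [simp]: "f x \<in> points L" if "x \<in> points M" for x using *(2) that by blast
  have "(g \<circ> f) ` points M = points K" using *(2,4) by (metis image_comp)
  moreover have "inj_on (g \<circ> f) (points M)"
    using *(1,3) by (intro comp_inj_on) (simp_all add: lattice_embedding_def *(2))
  moreover have "lattice_embedding (g \<circ> f) M K" unfolding lattice_embedding_def
    using *(1,3) calculation by (simp add: lattice_embedding_def)
  ultimately show "\<exists>f. lattice_embedding f M K \<and> f ` points M = points K" by blast
qed

text \<open>An embedding is additive just on points, so the inverse is additive because the points
  of \<open>M\<close> are closed under sums; hence the hypothesis on \<open>M\<close>.\<close>

lemma isometric_sym: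
  assumes "additive_subgroup (points M)" "M \<cong>\<^sub>L L" shows "L \<cong>\<^sub>L M"
proof -
  obtain f where f: "lattice_embedding f M L" "f ` points M = points L" using assms(2) unfolding isometric_def by blast
  define g where "g = the_inv_into (points M) f"
  have inj: "inj_on f (points M)" using f(1) by (simp add: lattice_embedding_def)
  have gf: "g (f x) = x" if "x \<in> points M" for x unfolding g_def by (rule the_inv_into_f_f[OF inj that])
  have "g (f x + f y) = x + y" if "x \<in> points M" "y \<in> points M" for x y
    using gf[of "x + y"] f(1) additive_subgroupD(4)[OF assms(1) that] that by (simp add: lattice_embedding_def)
  then have "lattice_embedding g L M" unfolding lattice_embedding_def f(2)[symmetric]
    using f(1) by (auto simp: gf lattice_embedding_def inj_on_def)
  moreover have "g ` points L = points M" unfolding f(2)[symmetric] by (auto simp: gf image_image)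
  ultimately show ?thesis unfolding isometric_def by blast
qed

lemma isometric_sum: "M \<cong>\<^sub>L M' \<Longrightarrow> L \<cong>\<^sub>L L' \<Longrightarrow> M \<oplus>\<^sub>L L \<cong>\<^sub>L M' \<oplus>\<^sub>L L'"
  unfolding isometric_def
proof (elim exE conjE)
  fix f g assume *: "lattice_embedding f M M'" "f ` points M = points M'" "lattice_embedding g L L'" "g ` points L = points L'"
  then have "map_prod f g ` points (M \<oplus>\<^sub>L L) = points (M' \<oplus>\<^sub>L L')"
    by (simp add: lattice_sum_def map_prod_surj_on)
  with * show "\<exists>f. lattice_embedding f (M \<oplus>\<^sub>L L) (M' \<oplus>\<^sub>L L') \<and> f ` points (M \<oplus>\<^sub>L L) = points (M' \<oplus>\<^sub>L L')"
    by (intro exI[of _ "map_prod f g"]) (auto simp: lattice_embedding_def inj_on_def lattice_sum_def)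
qed

definition neg_lattice :: "'a quad_lattice \<Rightarrow> 'a quad_lattice" where
  "neg_lattice M = \<lparr>points = points M, form = (\<lambda>x y. - form M x y)\<rparr>"

lemma neg_lattice_simps [simp]: "points (neg_lattice M) = points M" "form (neg_lattice M) x y = - form M x y"
  by (simp_all add: neg_lattice_def)

lemma isometric_neg: "M \<cong>\<^sub>L L \<Longrightarrow> neg_lattice M \<cong>\<^sub>L neg_lattice L"
  unfolding isometric_def by (auto simp: lattice_embedding_def)

lemma neg_lattice_sum: "neg_lattice (M \<oplus>\<^sub>L L) = neg_lattice M \<oplus>\<^sub>L neg_lattice L"
  by (auto simp: neg_lattice_def lattice_sum_def fun_eq_iff)

lemma neg_neg_lattice: "neg_lattice (neg_lattice M) = (M :: 'a quad_lattice)"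
  by (simp add: neg_lattice_def)

lemma neg_hyp_plane: "neg_lattice hyp_plane \<cong>\<^sub>L hyp_plane"
  unfolding isometric_def
proof (intro exI conjI)
  show "lattice_embedding (\<lambda>(a, b). (a, - b)) (neg_lattice hyp_plane) hyp_plane"
    by (auto simp: lattice_embedding_def hyp_plane_def inj_on_def)
  show "(\<lambda>(a, b). (a, - b)) ` points (neg_lattice hyp_plane) = points hyp_plane"
    by (auto simp: hyp_plane_def image_iff) (metis Ints_minus minus_minus)
qed

lemma additive_subgroup_Times: "additive_subgroup S \<Longrightarrow> additive_subgroup T \<Longrightarrow> additive_subgroup (S \<times> T)"
  by (auto simp: additive_subgroup_def zero_prod_def)

lemma additive_subgroup_Ints: "additive_subgroup (\<int> :: real set)"
  by (auto simp: additive_subgroup_def)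

lemma points_sum [simp]: "points (M \<oplus>\<^sub>L L) = points M \<times> points L"
  by (simp add: lattice_sum_def)

lemma form_sum [simp]: "form (M \<oplus>\<^sub>L L) (x, y) (x', y') = form M x x' + form L y y'"
  by (simp add: lattice_sum_def)

lemma points_hyp_plane [simp]: "points hyp_plane = \<int> \<times> \<int>"
  and form_hyp_plane [simp]: "form hyp_plane (a, b) (c, d) = a * d + b * c"
  by (simp_all add: hyp_plane_def)

lemma bilinear_hyp_plane: "bilinear (form hyp_plane)"
  unfolding bilinear_def by (auto intro!: linearI simp: algebra_simps)

lemma bilinear_form_sum:
  assumes "bilinear (form M)" "bilinear (form L)" shows "bilinear (form (M \<oplus>\<^sub>L L))"
  unfolding bilinear_def
  by (auto intro!: linearI simp: bilinear_ladd[OF assms(1)] bilinear_ladd[OF assms(2)] bilinear_radd[OF assms(1)]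
      bilinear_radd[OF assms(2)] bilinear_lmul[OF assms(1)] bilinear_lmul[OF assms(2)] bilinear_rmul[OF assms(1)]
      bilinear_rmul[OF assms(2)] algebra_simps)

lemma independent_Times:
  fixes B :: "'a::real_vector set" and C :: "'b::real_vector set"
  assumes "independent B" "independent C" "finite B" "finite C"
  shows "independent ((\<lambda>x. (x, 0)) ` B \<union> Pair 0 ` C)"
proof
  let ?i = "\<lambda>x. (x, 0) :: 'a \<times> 'b" and ?j = "Pair 0 :: 'b \<Rightarrow> 'a \<times> 'b"
  have z: "0 \<notin> B" using assms(1) dependent_zero by blast
  assume "dependent (?i ` B \<union> ?j ` C)"
  then obtain u where u: "\<exists>v\<in>?i ` B \<union> ?j ` C. u v \<noteq> 0" "(\<Sum>v\<in>?i ` B \<union> ?j ` C. u v *\<^sub>R v) = 0"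
    using assms(3,4) by (subst (asm) dependent_finite) auto
  have "(\<Sum>v\<in>?i ` B \<union> ?j ` C. u v *\<^sub>R v) = (\<Sum>v\<in>?i ` B. u v *\<^sub>R v) + (\<Sum>v\<in>?j ` C. u v *\<^sub>R v)"
    using assms z by (intro sum.union_disjoint) auto
  also have "\<dots> = (\<Sum>b\<in>B. u (?i b) *\<^sub>R ?i b) + (\<Sum>c\<in>C. u (?j c) *\<^sub>R ?j c)"
    by (simp add: sum.reindex inj_on_def)
  also have "\<dots> = ((\<Sum>b\<in>B. u (?i b) *\<^sub>R b), (\<Sum>c\<in>C. u (?j c) *\<^sub>R c))"
    by (simp add: prod_eq_iff fst_sum snd_sum)
  finally have "(\<Sum>b\<in>B. u (?i b) *\<^sub>R b) = 0" "(\<Sum>c\<in>C. u (?j c) *\<^sub>R c) = 0"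
    using u(2) by (simp_all add: zero_prod_def)
  then have "u (?i b) = 0" if "b \<in> B" for b using independentD[OF assms(1,3) order_refl, of "\<lambda>b. u (?i b)" b] that by blast
  moreover have "u (?j c) = 0" if "c \<in> C" for c
    using independentD[OF assms(2,4) order_refl, of "\<lambda>c. u (?j c)" c] that \<open>(\<Sum>c\<in>C. u (?j c) *\<^sub>R c) = 0\<close> by blast
  ultimately show False using u(1) by auto
qed

lemma int_span_Un:
  assumes "finite B" "finite C" "B \<inter> C = {}"
  shows "int_span (B \<union> C) = {x + y |x y. x \<in> int_span B \<and> y \<in> int_span C}"
proof (intro equalityI subsetI)
  fix x assume "x \<in> int_span (B \<union> C)"
  then obtain c :: "_ \<Rightarrow> int" where "x = (\<Sum>v\<in>B \<union> C. of_int (c v) *\<^sub>R v)" unfolding int_span_def by blast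
  then have "x = (\<Sum>v\<in>B. of_int (c v) *\<^sub>R v) + (\<Sum>v\<in>C. of_int (c v) *\<^sub>R v)" using assms by (simp add: sum.union_disjoint)
  then show "x \<in> {x + y |x y. x \<in> int_span B \<and> y \<in> int_span C}" unfolding int_span_def by blast
next
  fix x assume "x \<in> {x + y |x y. x \<in> int_span B \<and> y \<in> int_span C}"
  moreover have "int_span B \<subseteq> int_span (B \<union> C)" "int_span C \<subseteq> int_span (B \<union> C)"
    using int_span_base[of "B \<union> C"] assms(1,2)
    by (intro int_span_minimal[OF additive_subgroup_int_span]; blast)+
  ultimately show "x \<in> int_span (B \<union> C)" by (auto intro: additive_subgroupD(4)[OF additive_subgroup_int_span])
qed

lemma int_span_linear_image:
  assumes "linear F" "inj_on F B"
  shows "int_span (F ` B) = F ` int_span B"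
proof (intro equalityI subsetI)
  fix y assume "y \<in> int_span (F ` B)"
  then obtain c :: "_ \<Rightarrow> int" where "y = (\<Sum>w\<in>F ` B. of_int (c w) *\<^sub>R w)" unfolding int_span_def by blast
  also have "\<dots> = F (\<Sum>v\<in>B. of_int (c (F v)) *\<^sub>R v)"
    by (simp add: sum.reindex[OF assms(2)] linear_sum[OF assms(1)] linear_scale[OF assms(1)])
  finally show "y \<in> F ` int_span B" unfolding int_span_def
    by (rule image_eqI) (rule range_eqI[of _ _ "c \<circ> F"], simp)
next
  fix y assume "y \<in> F ` int_span B"
  then obtain c :: "_ \<Rightarrow> int" where "y = F (\<Sum>v\<in>B. of_int (c v) *\<^sub>R v)" unfolding int_span_def by blast
  also have "\<dots> = (\<Sum>w\<in>F ` B. of_int (c (the_inv_into B F w)) *\<^sub>R w)"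
    by (simp add: sum.reindex[OF assms(2)] linear_sum[OF assms(1)] linear_scale[OF assms(1)] the_inv_into_f_f[OF assms(2)])
  finally show "y \<in> int_span (F ` B)" unfolding int_span_def by (rule range_eqI[where x = "\<lambda>w. c (the_inv_into B F w)"])
qed

lemma int_span_Times:
  assumes "finite B" "independent B" "finite C"
  shows "int_span ((\<lambda>x. (x, 0)) ` B \<union> Pair 0 ` C) = int_span B \<times> int_span C"
proof -
  have z: "0 \<notin> B" using assms(2) dependent_zero by blast
  have 1: "int_span ((\<lambda>x. (x, 0) :: 'a \<times> 'b) ` B) = (\<lambda>x. (x, 0)) ` int_span B"
    by (rule int_span_linear_image) (auto intro!: linearI inj_onI)
  have 2: "int_span ((Pair 0 :: 'b \<Rightarrow> 'a \<times> 'b) ` C) = Pair 0 ` int_span C"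
    by (rule int_span_linear_image) (auto intro!: linearI inj_onI)
  have "int_span ((\<lambda>x. (x, 0) :: 'a \<times> 'b) ` B \<union> Pair 0 ` C) =
      {x + y |x y. x \<in> int_span ((\<lambda>x. (x, 0) :: 'a \<times> 'b) ` B) \<and> y \<in> int_span ((Pair 0 :: 'b \<Rightarrow> 'a \<times> 'b) ` C)}"
    using assms z by (intro int_span_Un) auto
  then show ?thesis unfolding 1 2 by (auto; force)
qed

lemma is_lattice_sum:
  assumes "is_lattice M" "is_lattice L" shows "is_lattice (M \<oplus>\<^sub>L L)"
proof -
  obtain B where B: "finite B" "independent B" "points M = int_span B" using assms(1) by (rule lattice_basis)
  obtain C where C: "finite C" "independent C" "points L = int_span C" using assms(2) by (rule lattice_basis)
  note M = is_latticeD[OF assms(1)] and L = is_latticeD[OF assms(2)]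
  note 0 = additive_subgroupD(1)[OF M(5)] additive_subgroupD(1)[OF L(5)]
  have z: "form M x 0 = 0" "form L y 0 = 0" for x y using M(1) L(1) bilinear_rzero by blast+
  have "\<exists>D. finite D \<and> independent D \<and> points (M \<oplus>\<^sub>L L) = int_span D"
    using B C independent_Times[OF B(2) C(2) B(1) C(1)]
    by (intro exI[of _ "(\<lambda>x. (x, 0)) ` B \<union> Pair 0 ` C"]) (simp add: int_span_Times)
  moreover have "p = 0" if p: "p \<in> points (M \<oplus>\<^sub>L L)" "\<forall>q\<in>points (M \<oplus>\<^sub>L L). form (M \<oplus>\<^sub>L L) p q = 0" for p
  proof -
    obtain x y where xy: "p = (x, y)" "x \<in> points M" "y \<in> points L" using p(1) by auto
    have "form M x x' = 0" if "x' \<in> points M" for x' using bspec[OF p(2), of "(x', 0)"] that 0 by (simp add: xy z)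
    moreover have "form L y y' = 0" if "y' \<in> points L" for y' using bspec[OF p(2), of "(0, y')"] that 0 by (simp add: xy z)
    ultimately show ?thesis using M(4)[OF xy(2)] L(4)[OF xy(3)] by (simp add: xy zero_prod_def)
  qed
  ultimately show ?thesis
    unfolding is_lattice_def using bilinear_form_sum[OF M(1) L(1)] M(2,3) L(2,3) by auto
qed

lemma is_lattice_hyp_plane: "is_lattice hyp_plane"
proof -
  have s: "finite {1::real}" "independent {1::real}" by simp_all
  have i: "int_span {1::real} = \<int>" by (auto simp: int_span_def Ints_def)
  have "\<exists>B. finite B \<and> independent B \<and> points hyp_plane = int_span B"
    using independent_Times[OF s(2) s(2) s(1) s(1)] int_span_Times[OF s s(1)]
    by (intro exI[of _ "(\<lambda>x. (x, 0)) ` {1} \<union> Pair 0 ` {1}"]) (simp add: i)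
  moreover have "p = 0" if "p \<in> points hyp_plane" "\<forall>q\<in>points hyp_plane. form hyp_plane p q = 0" for p
    using that(2)[THEN bspec, of "(1, 0)"] that(2)[THEN bspec, of "(0, 1)"] by (cases p) (auto simp: zero_prod_def)
  ultimately show ?thesis unfolding is_lattice_def using bilinear_hyp_plane by auto
qed

lemma unimodular_hyp_plane: "unimodular hyp_plane"
proof -
  have "dual_points hyp_plane \<subseteq> points hyp_plane"
  proof
    fix p assume p: "p \<in> dual_points hyp_plane"
    obtain a b where ab: "p = (a, b)" by (cases p)
    have "form hyp_plane p q \<in> \<int>" if "q \<in> \<int> \<times> \<int>" for q using p that by (auto simp: dual_points_def)
    from this[of "(1, 0)"] this[of "(0, 1)"] show "p \<in> points hyp_plane" by (simp add: ab)
  qed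
  moreover have "points hyp_plane \<subseteq> dual_points hyp_plane"
    unfolding dual_points_def using is_latticeD(2)[OF is_lattice_hyp_plane] by (auto intro: span_base)
  ultimately show ?thesis using is_lattice_hyp_plane unfolding unimodular_def by blast
qed

text \<open>Extending the isometry and its inverse separately gives linear maps that are inverse to
  each other on the spans, which is the form needed to transport duals.\<close>

lemma isometric_linear:
  assumes "is_lattice M" "is_lattice L" "M \<cong>\<^sub>L L"
  obtains F G where "linear F" "linear G" "F ` points M = points L" "G ` points L = points M"
    "\<And>x. x \<in> span (points M) \<Longrightarrow> G (F x) = x" "\<And>y. y \<in> span (points L) \<Longrightarrow> F (G y) = y"
    "\<And>x y. x \<in> span (points M) \<Longrightarrow> y \<in> span (points M) \<Longrightarrow> form L (F x) (F y) = form M x y"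
proof -
  obtain B where B: "finite B" "independent B" "points M = int_span B" using assms(1) by (rule lattice_basis)
  obtain C where C: "finite C" "independent C" "points L = int_span C" using assms(2) by (rule lattice_basis)
  obtain f where f: "lattice_embedding f M L" "f ` points M = points L" using assms(3) unfolding isometric_def by blast
  have fa: "f (x + y) = f x + f y" if "x \<in> points M" "y \<in> points M" for x y using f(1) that by (simp add: lattice_embedding_def)
  obtain F where F: "linear F" "\<And>x. x \<in> points M \<Longrightarrow> F x = f x"
    using additive_extends_linear[OF B(1,2), of f] fa unfolding B(3) by blast
  define g where "g = the_inv_into (points M) f"
  have inj: "inj_on f (points M)" using f(1) by (simp add: lattice_embedding_def)
  have gf: "g (f x) = x" if "x \<in> points M" for x unfolding g_def by (rule the_inv_into_f_f[OF inj that])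
  have ga: "g (x + y) = g x + g y" if "x \<in> points L" "y \<in> points L" for x y
    using that gf fa additive_subgroupD(4)[OF is_latticeD(5)[OF assms(1)]] unfolding f(2)[symmetric] by (auto simp: fa[symmetric])
  obtain G where G: "linear G" "\<And>x. x \<in> points L \<Longrightarrow> G x = g x"
    using additive_extends_linear[OF C(1,2), of g] ga unfolding C(3) by blast
  have FP: "F ` points M = points L" using F(2) f(2) by (auto simp: image_iff)
  have GF: "G (F x) = x" if "x \<in> points M" for x using that FP by (metis F(2) G(2) gf imageI)
  have GP: "G ` points L = points M" unfolding FP[symmetric] by (auto simp: GF image_image)
  have FG: "F (G y) = y" if "y \<in> points L" for y using that GF unfolding FP[symmetric] by auto
  have FM: "form L (F x) (F y) = form M x y" if "x \<in> points M" "y \<in> points M" for x y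
    using f(1) that by (simp add: F(2) lattice_embedding_def)
  have bF: "bilinear (\<lambda>x y. form L (F x) (F y))"
    using is_latticeD(1)[OF assms(2)] linear_compose[OF F(1)] unfolding bilinear_def by (auto simp: o_def)
  show ?thesis
  proof (rule that[OF F(1) G(1) FP GP])
    show "G (F x) = x" if "x \<in> span (points M)" for x
      using linear_eq_on_span[OF linear_compose[OF F(1) G(1)] linear_id, of "points M" x] GF that by simp
    show "F (G y) = y" if "y \<in> span (points L)" for y
      using linear_eq_on_span[OF linear_compose[OF G(1) F(1)] linear_id, of "points L" y] FG that by simp
    show "form L (F x) (F y) = form M x y" if "x \<in> span (points M)" "y \<in> span (points M)" for x y
      by (rule bilinear_eq_on_span[OF bF is_latticeD(1)[OF assms(1)] FM that])
  qed
qed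

lemma isometric_dual_image:
  assumes "linear F" "F ` points M = points L"
    "\<And>x y. x \<in> span (points M) \<Longrightarrow> y \<in> span (points M) \<Longrightarrow> form L (F x) (F y) = form M x y"
  shows "F ` dual_points M = dual_points L"
proof -
  have s: "span (points L) = F ` span (points M)" using linear_span_image[OF assms(1)] assms(2) by metis
  have eq: "F x \<in> dual_points L \<longleftrightarrow> x \<in> dual_points M" if "x \<in> span (points M)" for x
    using that unfolding dual_points_def mem_Collect_eq s unfolding assms(2)[symmetric]
    by (auto simp: assms(3) span_base)
  show ?thesis
  proof (intro equalityI subsetI)
    fix y assume "y \<in> dual_points L"
    moreover from this obtain x where "x \<in> span (points M)" "y = F x" using s by (auto simp: dual_points_def)
    ultimately show "y \<in> F ` dual_points M" using eq by blast
  qed (use eq in \<open>auto simp: dual_points_def\<close>)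
qed

lemma unimodular_isometric:
  assumes "unimodular M" "is_lattice L" "M \<cong>\<^sub>L L" shows "unimodular L"
proof -
  obtain F G where F: "linear F" "F ` points M = points L"
    "\<And>x y. x \<in> span (points M) \<Longrightarrow> y \<in> span (points M) \<Longrightarrow> form L (F x) (F y) = form M x y"
    using isometric_linear[OF _ assms(2,3)] assms(1) unfolding unimodular_def by metis
  show ?thesis using isometric_dual_image[OF F] assms(1,2) F(2) unfolding unimodular_def by simp
qed

text \<open>The stabilizing lattice is U, replaced by a copy in the sequence space over which
  \<open>stably_equivalent\<close> quantifies.\<close>

lemma isometric_sum_hyp_imp_stably_equivalent:
  assumes "M1 \<oplus>\<^sub>L hyp_plane \<cong>\<^sub>L M2 \<oplus>\<^sub>L hyp_plane"
  shows "stably_equivalent M1 M2"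
proof -
  obtain K :: std_lattice where K: "is_lattice K" "hyp_plane \<cong>\<^sub>L K"
    using lattice_standard_copy[OF is_lattice_hyp_plane] by blast
  have "K \<cong>\<^sub>L hyp_plane" by (rule isometric_sym[OF is_latticeD(5)[OF is_lattice_hyp_plane] K(2)])
  then have "M1 \<oplus>\<^sub>L K \<cong>\<^sub>L M2 \<oplus>\<^sub>L K"
    using isometric_trans[OF isometric_trans[OF isometric_sum[OF isometric_refl] assms] isometric_sum[OF isometric_refl K(2)]] by blast
  then show ?thesis unfolding stably_equivalent_def using unimodular_isometric[OF unimodular_hyp_plane K] by blast
qed

section \<open>Unimodular lattices of signature (2,2)\<close>

lemma det_4:
  "det (A::'a::comm_ring_1^4^4) =
    A$1$1 * (A$2$2 * (A$3$3 * A$4$4 - A$3$4 * A$4$3) - A$2$3 * (A$3$2 * A$4$4 - A$3$4 * A$4$2) + A$2$4 * (A$3$2 * A$4$3 - A$3$3 * A$4$2))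
  - A$1$2 * (A$2$1 * (A$3$3 * A$4$4 - A$3$4 * A$4$3) - A$2$3 * (A$3$1 * A$4$4 - A$3$4 * A$4$1) + A$2$4 * (A$3$1 * A$4$3 - A$3$3 * A$4$1))
  + A$1$3 * (A$2$1 * (A$3$2 * A$4$4 - A$3$4 * A$4$2) - A$2$2 * (A$3$1 * A$4$4 - A$3$4 * A$4$1) + A$2$4 * (A$3$1 * A$4$2 - A$3$2 * A$4$1))
  - A$1$4 * (A$2$1 * (A$3$2 * A$4$3 - A$3$3 * A$4$2) - A$2$2 * (A$3$1 * A$4$3 - A$3$3 * A$4$1) + A$2$3 * (A$3$1 * A$4$2 - A$3$2 * A$4$1))"
proof -
  have f1234: "finite {2::4, 3, 4}" "1 \<notin> {2::4, 3, 4}"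
    by auto
  have f234: "finite {3::4, 4}" "2 \<notin> {3::4, 4}"
    by auto
  have f34: "finite {4::4}" "3 \<notin> {4::4}"
    by auto
  show ?thesis
    unfolding det_def UNIV_4
    unfolding sum_over_permutations_insert[OF f1234]
    unfolding sum_over_permutations_insert[OF f234]
    unfolding sum_over_permutations_insert[OF f34]
    unfolding permutes_sing
    by (simp add: sign_swap_id permutation_swap_id sign_compose sign_id permutation_compose transpose_def algebra_simps)
qed

text \<open>Determinants of symmetric matrices given by their upper triangles, here and in
  \<open>gram4\<close>: base changes of a lattice turn into polynomial identities between the
  entries.\<close>

definition gram3 :: "real \<Rightarrow> real \<Rightarrow> real \<Rightarrow> real \<Rightarrow> real \<Rightarrow> real \<Rightarrow> real" where
  "gram3 a11 a12 a13 a22 a23 a33 =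
     a11 * (a22 * a33 - a23 * a23) - a12 * (a12 * a33 - a23 * a13) + a13 * (a12 * a23 - a22 * a13)"

definition gram4 :: "real \<Rightarrow> real \<Rightarrow> real \<Rightarrow> real \<Rightarrow> real \<Rightarrow> real \<Rightarrow> real \<Rightarrow> real \<Rightarrow> real \<Rightarrow> real \<Rightarrow> real" where
  "gram4 a11 a12 a13 a14 a22 a23 a24 a33 a34 a44 =
     a11 * (a22 * (a33 * a44 - a34 * a34) - a23 * (a23 * a44 - a34 * a24) + a24 * (a23 * a34 - a33 * a24))
   - a12 * (a12 * (a33 * a44 - a34 * a34) - a23 * (a13 * a44 - a34 * a14) + a24 * (a13 * a34 - a33 * a14))
   + a13 * (a12 * (a23 * a44 - a34 * a24) - a22 * (a13 * a44 - a34 * a14) + a24 * (a13 * a24 - a23 * a14))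
   - a14 * (a12 * (a23 * a34 - a33 * a24) - a22 * (a13 * a34 - a33 * a14) + a23 * (a13 * a24 - a23 * a14))"

text \<open>The base change from \<open>(x, y)\<close> to \<open>(y - t x, x)\<close> has
  determinant -1, so Gram determinants do not change; the lemmas that follow do the same at the
  other neighbouring positions. These are the swaps of lattice reduction.\<close>

lemma gram4_shift12:
  "gram4 (a22 - t * a12 - t * (a12 - t * a11)) (a12 - t * a11) (a23 - t * a13) (a24 - t * a14) a11 a13 a14 a33 a34 a44
   = gram4 a11 a12 a13 a14 a22 a23 a24 a33 a34 a44"
  unfolding gram4_def by algebra

lemma gram4_shift23:
  "gram4 a11 (a13 - t * a12) a12 a14 (a33 - t * a23 - t * (a23 - t * a22)) (a23 - t * a22) (a34 - t * a24) a22 a24 a44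
   = gram4 a11 a12 a13 a14 a22 a23 a24 a33 a34 a44"
  unfolding gram4_def by algebra

lemma gram4_shift34:
  "gram4 a11 a12 (a14 - t * a13) a13 a22 (a24 - t * a23) a23 (a44 - t * a34 - t * (a34 - t * a33)) (a34 - t * a33) a33
   = gram4 a11 a12 a13 a14 a22 a23 a24 a33 a34 a44"
  unfolding gram4_def by algebra

lemma gram3_shift12:
  "gram3 (a22 - t * a12 - t * (a12 - t * a11)) (a12 - t * a11) (a23 - t * a13) a11 a13 a33
   = gram3 a11 a12 a13 a22 a23 a33"
  unfolding gram3_def by algebra

lemma gram3_shift23:
  "gram3 a11 (a13 - t * a12) a12 (a33 - t * a23 - t * (a23 - t * a22)) (a23 - t * a22) a22
   = gram3 a11 a12 a13 a22 a23 a33"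
  unfolding gram3_def by algebra

text \<open>The Desnanot-Jacobi identity: the minors of two families sharing all but their last
  vector multiply to the product of the neighbouring minors plus the square of the mixed minor.
  \<open>gram_sylvester3\<close> is the next size.\<close>

lemma gram_sylvester2:
  "(a11 * a22 - a12 * a12) * (a11 * a33 - a13 * a13)
   = a11 * gram3 a11 a12 a13 a22 a23 a33 + (a11 * a23 - a12 * a13)^2"
  unfolding gram3_def by algebra

lemma gram_sylvester3:
  "gram3 a11 a12 a13 a22 a23 a33 * gram3 a11 a12 a14 a22 a24 a44
   = (a11 * a22 - a12 * a12) * gram4 a11 a12 a13 a14 a22 a23 a24 a33 a34 a44
     + (a11 * (a22 * a34 - a24 * a23) - a12 * (a12 * a34 - a24 * a13) + a14 * (a12 * a23 - a22 * a13))^2"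
  unfolding gram3_def gram4_def by algebra

text \<open>The second vector \<open>y\<close> is replaced by its projection
  \<open>a11 y - a12 x\<close> orthogonal to \<open>x\<close>, which scales the determinant by
  \<open>a11^2\<close>. \<open>gram4_degenerate3\<close> projects the third vector in the same way,
  with the factor squared being the second minor.\<close>

lemma gram4_degenerate2:
  "a11^2 * gram4 a11 a12 a13 a14 a22 a23 a24 a33 a34 a44
   = gram4 a11 0 a13 a14 (a11 * (a11 * a22 - a12 * a12)) (a11 * a23 - a12 * a13) (a11 * a24 - a12 * a14) a33 a34 a44"
  unfolding gram4_def by algebra

lemma gram4_degenerate3:
  "(a11 * a22 - a12 * a12)^2 * gram4 a11 a12 a13 a14 a22 a23 a24 a33 a34 a44
   = gram4 a11 a12 0 a14 a22 0 a24 ((a11 * a22 - a12 * a12) * gram3 a11 a12 a13 a22 a23 a33)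
      ((a12 * a23 - a13 * a22) * a14 + (a12 * a13 - a11 * a23) * a24 + (a11 * a22 - a12 * a12) * a34) a44"
  unfolding gram3_def gram4_def by algebra

text \<open>Here \<open>d\<close> is a minor of a minimal basis, \<open>d'\<close> the minor that
  replaces it when two neighbouring vectors are swapped, \<open>e\<close> the product of the
  adjacent minors and \<open>s\<close> the mixed minor after rounding. Minimality and the
  Desnanot-Jacobi identity give \<open>d^2 \<le> |e| + d^2 / 4\<close>.\<close>

lemma shift_inequality:
  fixes d :: real
  assumes "\<bar>d\<bar> \<le> \<bar>d'\<bar>" "d * d' = e + s^2" "\<bar>s\<bar> \<le> \<bar>d\<bar> / 2"
  shows "3 * d^2 \<le> 4 * \<bar>e\<bar>"
proof -
  have "d^2 = \<bar>d\<bar> * \<bar>d\<bar>" by (simp add: power2_eq_square)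
  also have "\<dots> \<le> \<bar>d\<bar> * \<bar>d'\<bar>" by (intro mult_left_mono assms) simp
  also have "\<dots> = \<bar>e + s^2\<bar>" by (simp add: abs_mult[symmetric] assms)
  also have "\<dots> \<le> \<bar>e\<bar> + s^2" by (simp add: abs_triangle_ineq[THEN order_trans])
  finally have "d^2 \<le> \<bar>e\<bar> + s^2" .
  moreover have "s^2 \<le> (\<bar>d\<bar> / 2)^2" using assms(3) by (simp add: abs_le_square_iff[symmetric])
  ultimately show ?thesis by (simp add: power_divide)
qed

lemma round_remainder:
  fixes e d :: real assumes "d \<noteq> 0"
  shows "\<bar>e - of_int (round (e / d)) * d\<bar> \<le> \<bar>d\<bar> / 2"
proof -
  have "e - of_int (round (e / d)) * d = (e / d - of_int (round (e / d))) * d" using assms by (simp add: field_simps)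
  then have "\<bar>e - of_int (round (e / d)) * d\<bar> = \<bar>of_int (round (e / d)) - e / d\<bar> * \<bar>d\<bar>"
    by (simp add: abs_mult abs_minus_commute)
  also have "\<dots> \<le> 1 / 2 * \<bar>d\<bar>" by (intro mult_right_mono of_int_round_abs_le) simp
  finally show ?thesis by simp
qed

text \<open>The hypotheses say that the Gram-Schmidt norms \<open>d1, d2/d1, d3/d2, 1/d3\<close> satisfy the Lovasz condition.\<close>

lemma reduced_minors:
  fixes d1 d2 d3 :: real
  assumes "d1 \<in> \<int>" "d2 \<in> \<int>" "d3 \<in> \<int>" "d1 > 0" "d2 > 0" "d3 > 0"
    and 1: "3 * d1^2 \<le> 4 * d2" and 2: "3 * d2^2 \<le> 4 * (d1 * d3)" and 3: "3 * d3^2 \<le> 4 * d2"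
  shows "d1 = 1 \<and> d2 = 1 \<and> d3 = 1"
proof -
  have small: "x = 1" if x: "x \<in> \<int>" "x > 0" "x^2 < 4" for x :: real
  proof -
    obtain k where k: "x = of_int k" using x(1) by (auto elim!: Ints_cases)
    have "x < 2" using power2_less_imp_less[of x 2] x(3) by simp
    then show ?thesis using x(2) by (simp add: k)
  qed
  \<comment> \<open>Bounding \<open>d1^2\<close> and \<open>d3^2\<close> by \<open>4/3 d2\<close>
    leads to \<open>81 d2^2 \<le> 256\<close>, so the positive integer \<open>d2\<close> is below 2;
    then \<open>1\<close> and \<open>3\<close> bound the other two.\<close>
  have "(3 * d2^2)^2 \<le> (4 * (d1 * d3))^2" using 2 by (intro power_mono) simp_all
  also have "\<dots> = 16 * (d1^2 * d3^2)" by (simp add: power_mult_distrib)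
  also have "\<dots> \<le> 16 * ((4 / 3 * d2) * (4 / 3 * d2))"
    using 1 3 assms by (intro mult_left_mono mult_mono) simp_all
  finally have "d2^2 * (81 * d2^2) \<le> d2^2 * 256" by (simp add: power2_eq_square algebra_simps)
  then have "81 * d2^2 \<le> 256" using assms(5) by (simp add: mult_le_cancel_left)
  then have d2: "d2 = 1" using small assms by simp
  show ?thesis using small[of d1] small[of d3] assms 1 3 by (simp add: d2)
qed

text \<open>The discriminant is the square 1, so the form has a rational zero, which is made
  primitive and completed to a basis by Bezout. The determinant -1 is preserved, so the mixed value
  squares to 1, and the sign of the second vector adjusts it. The norm of the second vector stays
  free because the form may be odd.\<close>

lemma binary_isotropic_basis:
  fixes \<alpha> \<beta> \<gamma> :: int
  assumes "\<beta>^2 - \<alpha> * \<gamma> = 1"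
  shows "\<exists>p q r s. \<bar>p * s - q * r\<bar> = 1 \<and> \<alpha> * p * p + 2 * \<beta> * p * q + \<gamma> * q * q = 0 \<and>
     \<alpha> * p * r + \<beta> * (p * s + q * r) + \<gamma> * q * s = 1"
proof -
  define f where "f = (\<lambda>p q. \<alpha> * p * p + 2 * \<beta> * p * q + \<gamma> * q * q)"
  have "\<exists>p q. (p \<noteq> 0 \<or> q \<noteq> 0) \<and> f p q = 0"
  proof (cases "\<alpha> = 0")
    case True then show ?thesis by (intro exI[of _ 1] exI[of _ 0]) (simp add: f_def)
  next
    case False
    \<comment> \<open>The zero comes from the quadratic formula with square root 1.\<close>
    have "f (1 - \<beta>) \<alpha> = \<alpha> * (1 - (\<beta>^2 - \<alpha> * \<gamma>))" by (simp add: f_def power2_eq_square algebra_simps)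
    then show ?thesis using assms False by (intro exI[of _ "1 - \<beta>"] exI[of _ \<alpha>]) simp
  qed
  then obtain p0 q0 where pq0: "p0 \<noteq> 0 \<or> q0 \<noteq> 0" "f p0 q0 = 0" by blast
  define d where "d = gcd p0 q0"
  obtain p q where pq: "p0 = d * p" "q0 = d * q" unfolding d_def by (meson dvdE gcd_dvd1 gcd_dvd2)
  have d: "d \<noteq> 0" using pq0(1) by (simp add: d_def)
  have "f p0 q0 = d * d * f p q" by (simp add: f_def pq algebra_simps)
  then have f: "f p q = 0" using pq0(2) d by simp
  have "d * gcd p q = d" using gcd_mult_left[of d p q] unfolding pq[symmetric] by (simp add: d_def)
  then have "gcd p q = 1" using d by simp
  then obtain s r' where "p * s + q * r' = 1" using bezout_int[of p q] by (metis mult.commute)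
  then obtain r where r: "p * s - q * r = 1" by (metis diff_minus_eq_add mult_minus_right)
  define b where "b = \<alpha> * p * r + \<beta> * (p * s + q * r) + \<gamma> * q * s"
  have "b^2 - f p q * f r s = (\<beta>^2 - \<alpha> * \<gamma>) * (p * s - q * r)^2"
    unfolding b_def f_def by algebra
  then have "b^2 = 1" using f assms r by simp
  then consider "b = 1" | "b = - 1" by (auto simp: power2_eq_1_iff)
  then show ?thesis
  proof cases
    case 1
    then show ?thesis using r f by (intro exI[of _ p] exI[of _ q] exI[of _ r] exI[of _ s]) (simp add: b_def f_def)
  next
    case 2
    have "\<bar>p * (- s) - q * (- r)\<bar> = 1" using r by linarith
    moreover have "\<alpha> * p * (- r) + \<beta> * (p * (- s) + q * (- r)) + \<gamma> * q * (- s) = - b"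
      by (simp add: b_def algebra_simps)
    ultimately show ?thesis using 2 f by (intro exI[of _ p] exI[of _ q] exI[of _ "- r"] exI[of _ "- s"]) (simp add: f_def)
  qed
qed

section \<open>Unimodular forms of rank four: isotropic vectors and hyperbolic bases\<close>

definition quad :: "'a \<Rightarrow> 'a \<Rightarrow> 'a \<Rightarrow> 'a \<Rightarrow> 4 \<Rightarrow> 'a" where
  "quad x y z w = (\<lambda>i. if i = 1 then x else if i = 2 then y else if i = 3 then z else w)"

lemma quad_simps [simp]: "quad x y z w 1 = x" "quad x y z w 2 = y" "quad x y z w 3 = z" "quad x y z w 4 = w"
  by (simp_all add: quad_def)

lemma span_range_4:
  assumes "x \<in> span (range (c :: 4 \<Rightarrow> 'v::real_vector))"
  obtains n :: "real^4" where "x = (\<Sum>j\<in>UNIV. n $ j *\<^sub>R c j)"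
proof -
  have "\<exists>n :: real^4. x = (\<Sum>j\<in>UNIV. n $ j *\<^sub>R c j)"
    using assms
  proof (induction rule: span_induct_alt)
    case base show ?case by (rule exI[of _ 0]) simp
  next
    case (step a x y)
    then obtain n :: "real^4" and i where n: "y = (\<Sum>j\<in>UNIV. n $ j *\<^sub>R c j)" "x = c i" by blast
    have "a *\<^sub>R c i = (\<Sum>j\<in>UNIV. if j = i then a *\<^sub>R c i else 0)" by simp
    also have "\<dots> = (\<Sum>j\<in>UNIV. (a *\<^sub>R axis i 1 :: real^4) $ j *\<^sub>R c j)"
      by (intro sum.cong) (auto simp: axis_def)
    finally show ?case unfolding n
      by (intro exI[of _ "a *\<^sub>R axis i 1 + n"]) (simp add: scaleR_left_distrib sum.distrib)
  qed
  then show ?thesis using that by blast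
qed

text \<open>\<open>q\<close> is a real basis inside \<open>R\<close> with a known Gram matrix; it
  need not generate \<open>R\<close>. Rank four, a positive determinant and values of both signs
  amount to signature (2,2), and \<open>self_dual\<close> is unimodularity.\<close>

locale unimodular_22 =
  fixes R :: "'v::real_vector set" and B :: "'v \<Rightarrow> 'v \<Rightarrow> real" and q :: "4 \<Rightarrow> 'v"
  assumes bilinear: "bilinear B"
    and commute: "\<And>x y. x \<in> R \<Longrightarrow> y \<in> R \<Longrightarrow> B x y = B y x"
    and integral: "\<And>x y. x \<in> R \<Longrightarrow> y \<in> R \<Longrightarrow> B x y \<in> \<int>"
    and inj_q: "inj q" and independent_q: "independent (range q)"
    and q_mem: "\<And>i. q i \<in> R" and R_span: "R \<subseteq> span (range q)"
    and basis: "\<exists>C. finite C \<and> independent C \<and> R = int_span C"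
    and det_q: "det (\<chi> i j. B (q i) (q j)) > 0"
    and self_dual: "\<And>x. x \<in> span (range q) \<Longrightarrow> (\<And>y. y \<in> R \<Longrightarrow> B x y \<in> \<int>) \<Longrightarrow> x \<in> R"
    and positive: "\<exists>x\<in>R. B x x > 0" and negative: "\<exists>x\<in>R. B x x < 0"
begin

lemma subgroup: "additive_subgroup R" using basis by auto

lemmas R_closed = additive_subgroupD[OF subgroup]

lemma R_scale: "a \<in> \<int> \<Longrightarrow> x \<in> R \<Longrightarrow> a *\<^sub>R x \<in> R"
  by (auto elim!: Ints_cases intro: R_closed)

lemmas B_simps = bilinear_ladd[OF bilinear] bilinear_radd[OF bilinear] bilinear_lmul[OF bilinear] bilinear_rmul[OF bilinear]
  bilinear_lsub[OF bilinear] bilinear_rsub[OF bilinear] bilinear_lneg[OF bilinear] bilinear_rneg[OF bilinear]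
  bilinear_lzero[OF bilinear] bilinear_rzero[OF bilinear]

definition gram :: "(4 \<Rightarrow> 'v) \<Rightarrow> real" where "gram c = det (\<chi> i j. B (c i) (c j))"

lemma gram_quad:
  assumes "x \<in> R" "y \<in> R" "z \<in> R" "w \<in> R"
  shows "gram (quad x y z w) = gram4 (B x x) (B x y) (B x z) (B x w) (B y y) (B y z) (B y w) (B z z) (B z w) (B w w)"
  unfolding gram_def det_4 gram4_def
  using commute[OF assms(2,1)] commute[OF assms(3,1)] commute[OF assms(4,1)] commute[OF assms(3,2)] commute[OF assms(4,2)] commute[OF assms(4,3)]
  by simp

lemma gram_change:
  assumes "\<And>i. c i = (\<Sum>j\<in>UNIV. A $ i $ j *\<^sub>R d j)"
  shows "gram c = det A * det A * gram d"
proof -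
  have l: "B (\<Sum>k\<in>UNIV. f k *\<^sub>R d k) y = (\<Sum>k\<in>UNIV. f k * B (d k) y)" for f :: "4 \<Rightarrow> real" and y
    using bilinear unfolding bilinear_def by (simp add: linear_sum[of "\<lambda>x. B x y"] B_simps)
  have r: "B y (\<Sum>k\<in>UNIV. f k *\<^sub>R d k) = (\<Sum>k\<in>UNIV. f k * B y (d k))" for f :: "4 \<Rightarrow> real" and y
    using bilinear unfolding bilinear_def by (simp add: linear_sum[of "B y"] B_simps)
  have "(\<chi> i j. B (c i) (c j)) = A ** (\<chi> i j. B (d i) (d j)) ** transpose A"
    unfolding vec_eq_iff matrix_matrix_mult_def transpose_def assms l r
    by (simp add: sum_4 algebra_simps)
  then show ?thesis unfolding gram_def by (simp add: det_mul det_transpose)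
qed

text \<open>Expanding in \<open>q\<close> turns the determinant into a square times the positive
  \<open>det_q\<close>. This excludes an orthogonal frame with exactly three norms of one
  sign.\<close>

lemma gram_nonneg:
  assumes "\<And>i. c i \<in> R" shows "gram c \<ge> 0"
proof -
  have "\<exists>n :: real^4. c i = (\<Sum>j\<in>UNIV. n $ j *\<^sub>R q j)" for i
    using span_range_4[of "c i" q] R_span assms by blast
  then obtain A where "\<And>i. c i = (\<Sum>j\<in>UNIV. A i $ j *\<^sub>R q j)" by metis
  then have "gram c = det (\<chi> i. A i) * det (\<chi> i. A i) * gram q" by (intro gram_change) simp
  then show ?thesis using det_q by (simp add: gram_def)
qed

lemma nondegenerate:
  assumes "x \<in> span (range q)" "\<And>y. y \<in> R \<Longrightarrow> B x y = 0" shows "x = 0"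
proof -
  obtain n :: "real^4" where n: "x = (\<Sum>j\<in>UNIV. n $ j *\<^sub>R q j)" using span_range_4[OF assms(1)] .
  have "(\<chi> i j. B (q i) (q j)) *v n = 0"
    unfolding vec_eq_iff matrix_vector_mult_def
  proof
    fix i
    have "(\<Sum>j\<in>UNIV. B (q i) (q j) * n $ j) = (\<Sum>j\<in>UNIV. n $ j * B (q j) (q i))"
      by (intro sum.cong) (simp_all add: commute[OF q_mem q_mem, of i])
    also have "\<dots> = B x (q i)" unfolding n sum_4 by (simp add: B_simps)
    finally show "(\<chi> i. \<Sum>j\<in>UNIV. (\<chi> i j. B (q i) (q j)) $ i $ j * n $ j) $ i = 0 $ i" using assms(2)[OF q_mem] by simp
  qed
  moreover have "invertible (\<chi> i j. B (q i) (q j))" using det_q by (simp add: invertible_det_nz)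
  ultimately have "n = 0" by (metis invertible_left_inverse matrix_left_invertible_ker)
  then show ?thesis by (simp add: n)
qed

definition generates :: "(4 \<Rightarrow> 'v) \<Rightarrow> bool" where
  "generates c \<longleftrightarrow> (\<forall>i. c i \<in> R) \<and> (\<forall>x\<in>R. \<exists>n :: 4 \<Rightarrow> int. x = (\<Sum>j\<in>UNIV. of_int (n j) *\<^sub>R c j))"

lemma independent_q_coeffs:
  assumes "(\<Sum>j\<in>UNIV. n j *\<^sub>R q j) = (\<Sum>j\<in>UNIV. m j *\<^sub>R q j)" shows "n i = m i"
proof -
  define u where "u = (\<lambda>v. n (the_inv q v) - m (the_inv q v))"
  have "(\<Sum>v\<in>range q. u v *\<^sub>R v) = (\<Sum>j\<in>UNIV. (n j - m j) *\<^sub>R q j)"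
    by (simp add: sum.reindex[OF inj_q] u_def the_inv_f_f[OF inj_q])
  also have "\<dots> = 0" using assms by (simp add: scaleR_left_diff_distrib sum_subtractf)
  finally have "u (q i) = 0" by (intro independentD[OF independent_q, of "range q"]) auto
  then show ?thesis by (simp add: u_def the_inv_f_f[OF inj_q])
qed

text \<open>The basis dual to \<open>c\<close> lies in \<open>R\<close> by \<open>self_dual\<close>,
  so the Gram matrix has an integral inverse and determinant 1 or -1; as a nonzero square times
  \<open>det_q\<close> it is positive.\<close>

lemma gram_generates:
  assumes "generates c" shows "gram c = 1"
proof -
  have c: "c i \<in> R" for i using assms by (simp add: generates_def)
  have "\<exists>n :: real^4. c i = (\<Sum>j\<in>UNIV. n $ j *\<^sub>R q j)" for i
    using span_range_4[of "c i" q] R_span c by blast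
  then obtain A0 :: "4 \<Rightarrow> real^4" where A0: "\<And>i. c i = (\<Sum>j\<in>UNIV. A0 i $ j *\<^sub>R q j)" by metis
  define A where "A = (\<chi> i. A0 i)"
  have A: "c i = (\<Sum>j\<in>UNIV. A $ i $ j *\<^sub>R q j)" for i using A0 by (simp add: A_def)
  have "\<exists>n :: 4 \<Rightarrow> int. q i = (\<Sum>j\<in>UNIV. of_int (n j) *\<^sub>R c j)" for i
    using assms q_mem by (simp add: generates_def)
  then obtain D0 :: "4 \<Rightarrow> 4 \<Rightarrow> int" where D0: "\<And>i. q i = (\<Sum>j\<in>UNIV. of_int (D0 i j) *\<^sub>R c j)" by metis
  define D :: "real^4^4" where "D = (\<chi> i j. of_int (D0 i j))"
  have D: "q i = (\<Sum>j\<in>UNIV. D $ i $ j *\<^sub>R c j)" for i using D0 by (simp add: D_def)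
  have "(D ** A) $ i $ j = mat 1 $ i $ j" for i j
  proof -
    have "(\<Sum>k\<in>UNIV. (D ** A) $ i $ k *\<^sub>R q k) = q i"
      unfolding D[of i] A matrix_matrix_mult_def by (simp add: sum_4 algebra_simps)
    also have "\<dots> = (\<Sum>k\<in>UNIV. if k = i then q i else 0)" by simp
    also have "\<dots> = (\<Sum>k\<in>UNIV. mat 1 $ i $ k *\<^sub>R q k)" by (intro sum.cong) (auto simp: mat_def)
    finally show ?thesis by (rule independent_q_coeffs)
  qed
  then have "D ** A = mat 1" by (simp add: vec_eq_iff)
  then have "det D * det A = 1" by (metis det_I det_mul)
  then have "det A \<noteq> 0" by auto
  moreover have "gram c = det A * det A * gram q" by (rule gram_change[OF A])
  ultimately have pos: "gram c > 0" using det_q by (auto simp: gram_def zero_less_mult_iff)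
  define G where "G = (\<chi> i j. B (c i) (c j))"
  have "invertible G" using pos by (simp add: invertible_det_nz G_def gram_def)
  then obtain H where H: "H ** G = mat 1" unfolding invertible_def by blast
  define d where "d i = (\<Sum>k\<in>UNIV. H $ i $ k *\<^sub>R c k)" for i
  have Bd: "B (d i) (c j) = mat 1 $ i $ j" for i j
  proof -
    have "B (d i) (c j) = (H ** G) $ i $ j"
      unfolding d_def G_def matrix_matrix_mult_def sum_4 by (simp add: B_simps)
    then show ?thesis by (simp add: H)
  qed
  have dR: "d i \<in> R" for i
  proof (rule self_dual)
    show "d i \<in> span (range q)" unfolding d_def using c R_span by (blast intro: span_sum span_scale)
    fix y assume "y \<in> R"
    then obtain n :: "4 \<Rightarrow> int" where n: "y = (\<Sum>j\<in>UNIV. of_int (n j) *\<^sub>R c j)" using assms unfolding generates_def by blast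
    have "B (d i) y = (\<Sum>j\<in>UNIV. of_int (n j) * mat 1 $ i $ j)"
      unfolding n sum_4 by (simp add: B_simps Bd)
    also have "\<dots> \<in> \<int>" by (intro Ints_sum Ints_mult) (simp_all add: mat_def)
    finally show "B (d i) y \<in> \<int>" .
  qed
  then have "\<exists>n :: 4 \<Rightarrow> int. d i = (\<Sum>j\<in>UNIV. of_int (n j) *\<^sub>R c j)" for i
    using assms by (simp add: generates_def)
  then obtain N0 :: "4 \<Rightarrow> 4 \<Rightarrow> int" where N0: "\<And>i. d i = (\<Sum>j\<in>UNIV. of_int (N0 i j) *\<^sub>R c j)" by metis
  define N :: "real^4^4" where "N = (\<chi> i j. of_int (N0 i j))"
  have "N ** G = mat 1" unfolding vec_eq_iff
  proof (intro allI)
    fix i j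
    have "(N ** G) $ i $ j = B (d i) (c j)"
      unfolding N0 N_def G_def matrix_matrix_mult_def sum_4 by (simp add: B_simps)
    then show "(N ** G) $ i $ j = mat 1 $ i $ j" by (simp add: Bd)
  qed
  then have NG: "det N * det G = 1" by (metis det_I det_mul)
  have "det N \<in> \<int>" unfolding det_4 N_def by simp
  moreover have "det G \<in> \<int>" unfolding det_4 G_def by (simp add: integral[OF c c])
  ultimately obtain n g where ng: "det N = of_int n" "det G = of_int g" by (auto elim!: Ints_cases)
  have "real_of_int (n * g) = 1" using NG by (simp add: ng)
  then have "n * g = 1" by linarith
  moreover have "g > 0" using pos ng(2) by (simp add: gram_def G_def)
  ultimately have "g = 1" by (auto simp: zmult_eq_1_iff)
  then show ?thesis using ng(2) by (simp add: gram_def G_def)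
qed

lemma generates_int_span:
  assumes "R = int_span (range c)" "inj c" shows "generates c"
  unfolding generates_def
proof (intro conjI allI ballI)
  show "c i \<in> R" for i unfolding assms(1) by (intro int_span_base) auto
  fix x assume "x \<in> R"
  then obtain n :: "_ \<Rightarrow> int" where "x = (\<Sum>v\<in>range c. of_int (n v) *\<^sub>R v)" unfolding assms(1) int_span_def by blast
  then have "x = (\<Sum>j\<in>UNIV. of_int (n (c j)) *\<^sub>R c j)" by (simp add: sum.reindex[OF assms(2)])
  then show "\<exists>n :: 4 \<Rightarrow> int. x = (\<Sum>j\<in>UNIV. of_int (n j) *\<^sub>R c j)" by (intro exI[of _ "n \<circ> c"]) simp
qed

lemma card_independent:
  assumes "finite C" "independent C" "C \<subseteq> R" "R \<subseteq> span C" shows "card C = 4"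
proof -
  have "card (range q) = 4" using card_image[OF inj_q] by simp
  moreover have "card C \<le> card (range q)"
    using independent_span_bound[of "range q" C] assms R_span by auto
  moreover have "card (range q) \<le> card C"
    using independent_span_bound[of C "range q"] assms independent_q q_mem by auto
  ultimately show ?thesis by simp
qed

lemma generates_exists: "\<exists>c. generates c"
proof -
  obtain C where C: "finite C" "independent C" "R = int_span C" using basis by blast
  have "card C = 4"
    by (rule card_independent) (use C in \<open>auto intro: int_span_base int_span_subset_span[THEN subsetD]\<close>)
  then obtain c where "bij_betw c (UNIV :: 4 set) C" using C(1) finite_same_card_bij[of "UNIV :: 4 set" C] by auto
  then show ?thesis using generates_int_span[of c] C(3) unfolding bij_betw_def by auto
qed

text \<open>
  If \<open>B\<close> is anisotropic, a basis for which the product of the leading Gram minors is least in absolute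
  value satisfies the hypotheses of \<open>reduced_minors\<close>. Its first three vectors can then be made
  orthogonal of norm \<open>\<plusminus>1\<close>, all of the same sign by anisotropy, so an indefinite \<open>B\<close> would have negative
  determinant.
\<close>

theorem isotropic: "\<exists>x\<in>R. x \<noteq> 0 \<and> B x x = 0"
proof (rule ccontr)
  assume "\<not> ?thesis"
  then have aniso: "x = 0" if "x \<in> R" "B x x = 0" for x using that by blast
  define D2 where "D2 x y = B x x * B y y - B x y * B x y" for x y
  define D3 where "D3 x y z = gram3 (B x x) (B x y) (B x z) (B y y) (B y z) (B z z)" for x y z
  define D4 where "D4 x y z w = gram4 (B x x) (B x y) (B x z) (B x w) (B y y) (B y z) (B y w) (B z z) (B z w) (B w w)" for x y z w
  have D_int: "B x x \<in> \<int>" "D2 x y \<in> \<int>" "D3 x y z \<in> \<int>" if "x \<in> R" "y \<in> R" "z \<in> R" for x y z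
    unfolding D2_def D3_def gram3_def by (intro Ints_diff Ints_mult Ints_add integral that)+
  \<comment> \<open>Gram determinant 1 stands in for being a basis: the swaps preserve it by the
    identities \<open>gram4_shift12\<close>, \<open>gram4_shift23\<close> and
    \<open>gram4_shift34\<close>.\<close>
  define F where "F = (\<lambda>(x, y, z, w). x \<in> R \<and> y \<in> R \<and> z \<in> R \<and> w \<in> R \<and> D4 x y z w = 1)"
  \<comment> \<open>A swap of neighbours changes exactly one of the three factors, so minimality of
    the product compares that factor alone. The product is integral on \<open>F\<close>, so
    \<open>nat\<close> and the floor lose only its sign.\<close>
  define \<mu> where "\<mu> = (\<lambda>(x, y, z, w :: 'v). nat \<lfloor>\<bar>B x x * D2 x y * D3 x y z\<bar>\<rfloor>)"
  have \<mu>: "real (\<mu> (x, y, z, w)) = \<bar>B x x * D2 x y * D3 x y z\<bar>" if "F (x, y, z, w)" for x y z w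
  proof -
    have "\<bar>B x x * D2 x y * D3 x y z\<bar> \<in> \<int>" using that by (intro Ints_abs Ints_mult D_int) (auto simp: F_def)
    then show ?thesis by (auto simp: \<mu>_def elim!: Ints_cases)
  qed
  obtain c where c: "generates c" using generates_exists by blast
  have cR: "c i \<in> R" for i using c by (simp add: generates_def)
  have "quad (c 1) (c 2) (c 3) (c 4) = c" using forall_4 by (auto simp: fun_eq_iff)
  then have "F (c 1, c 2, c 3, c 4)"
    using gram_quad[OF cR[of 1] cR[of 2] cR[of 3] cR[of 4]] gram_generates[OF c] cR by (simp add: F_def D4_def)
  then obtain p where p: "F p" "\<And>p'. F p' \<Longrightarrow> \<mu> p \<le> \<mu> p'"
    using ex_has_least_nat[of F _ \<mu>] by blast
  obtain x y z w where xyzw: "p = (x, y, z, w)" by (cases p)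
  have R: "x \<in> R" "y \<in> R" "z \<in> R" "w \<in> R" and D4: "D4 x y z w = 1" using p(1) by (auto simp: F_def xyzw)
  have least: "\<bar>B x x * D2 x y * D3 x y z\<bar> \<le> \<bar>B x' x' * D2 x' y' * D3 x' y' z'\<bar>" if "F (x', y', z', w')" for x' y' z' w'
    using p(2)[OF that] \<mu>[OF that] \<mu>[of x y z w] p(1) unfolding xyzw by linarith
  note comm = commute[OF R(2,1)] commute[OF R(3,1)] commute[OF R(4,1)] commute[OF R(3,2)] commute[OF R(4,2)] commute[OF R(4,3)]
  \<comment> \<open>\<open>u\<close> and \<open>v\<close> are the second and third Gram-Schmidt
    vectors with denominators cleared, hence in \<open>R\<close>. Their norms are products of
    consecutive minors.\<close>
  define u where "u = B x x *\<^sub>R y - B x y *\<^sub>R x"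
  define v where "v = (B x y * B y z - B x z * B y y) *\<^sub>R x + (B x y * B x z - B x x * B y z) *\<^sub>R y + D2 x y *\<^sub>R z"
  have uR: "u \<in> R" unfolding u_def by (intro R_closed R_scale integral R)
  have vR: "v \<in> R" unfolding v_def D2_def by (intro R_closed R_scale Ints_diff Ints_mult integral R)
  have Bu: "B x u = 0" "B u u = B x x * D2 x y" "B u z = B x x * B y z - B x y * B x z" "B u w = B x x * B y w - B x y * B x w" "B y u = D2 x y"
    unfolding u_def D2_def by (simp_all add: B_simps comm algebra_simps)
  have Bv: "B x v = 0" "B y v = 0" "B z v = D3 x y z"
      "B v w = (B x y * B y z - B x z * B y y) * B x w + (B x y * B x z - B x x * B y z) * B y w + D2 x y * B z w"
    unfolding v_def D2_def D3_def gram3_def by (simp_all add: B_simps comm algebra_simps)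
  have "B v v = (B x y * B y z - B x z * B y y) * B x v + (B x y * B x z - B x x * B y z) * B y v + D2 x y * B z v"
    by (subst (2) v_def) (simp add: B_simps commute[OF vR R(1)] commute[OF vR R(2)] commute[OF vR R(3)])
  then have Bvv: "B v v = D2 x y * D3 x y z" by (simp add: Bv)
  have nz1: "B x x \<noteq> 0"
  proof
    assume "B x x = 0"
    then have "x = 0" using aniso R by blast
    then show False using D4 by (simp add: D4_def gram4_def B_simps)
  qed
  have nz2: "D2 x y \<noteq> 0"
  proof
    assume 0: "D2 x y = 0"
    \<comment> \<open>The projected vector is isotropic, so it vanishes; a zero row in the projected
      Gram matrix then contradicts determinant 1.\<close>
    then have "u = 0" using aniso[OF uR] by (simp add: Bu)
    then have "B u z = 0" "B u w = 0" by (simp_all add: B_simps)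
    then have "(B x x)^2 * D4 x y z w = 0"
      using 0 unfolding D4_def gram4_degenerate2 by (simp add: Bu D2_def gram4_def)
    then show False using nz1 D4 by simp
  qed
  have nz3: "D3 x y z \<noteq> 0"
  proof
    assume 0: "D3 x y z = 0"
    then have "v = 0" using aniso[OF vR] by (simp add: Bvv)
    then have "B v w = 0" by (simp add: B_simps)
    then have "(D2 x y)^2 * D4 x y z w = 0"
      using 0 unfolding D4_def D2_def gram4_degenerate3 by (simp add: Bv D2_def D3_def gram4_def)
    then show False using nz2 D4 by simp
  qed
  have I1: "3 * (B x x)^2 \<le> 4 * \<bar>D2 x y\<bar>"
  proof -
    \<comment> \<open>The integer nearest to the Gram-Schmidt coefficient makes the mixed minor at
      most half of the leading one, before the swap of \<open>x\<close> and \<open>y - t x\<close>.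
      The next two inequalities follow the same pattern one position further.\<close>
    define t where "t = real_of_int (round (B x y / B x x))"
    define y' where "y' = y - t *\<^sub>R x"
    have y'R: "y' \<in> R" unfolding y'_def t_def by (intro R_closed R)
    have e: "B y' y' = B y y - t * B x y - t * (B x y - t * B x x)" "B y' x = B x y - t * B x x"
        "B y' z = B y z - t * B x z" "B y' w = B y w - t * B x w"
      unfolding y'_def by (simp_all add: B_simps comm algebra_simps)
    have "D4 y' x z w = 1" using D4 unfolding D4_def e gram4_shift12 by simp
    then have "F (y', x, z, w)" using R y'R by (simp add: F_def)
    from least[OF this] have "\<bar>B x x\<bar> * \<bar>D2 x y * D3 x y z\<bar> \<le> \<bar>B y' y'\<bar> * \<bar>D2 y' x * D3 y' x z\<bar>"
      by (simp add: abs_mult mult.assoc)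
    moreover have "D2 y' x = D2 x y" unfolding D2_def e by (simp add: algebra_simps)
    moreover have "D3 y' x z = D3 x y z" unfolding D3_def e gram3_shift12 by simp
    ultimately have "\<bar>B x x\<bar> \<le> \<bar>B y' y'\<bar>" using nz2 nz3 by simp
    moreover have "B x x * B y' y' = D2 x y + (B x y - t * B x x)^2"
      unfolding e D2_def by (simp add: power2_eq_square algebra_simps)
    ultimately show ?thesis using round_remainder[OF nz1, of "B x y"] unfolding t_def[symmetric] by (rule shift_inequality)
  qed
  have I2: "3 * (D2 x y)^2 \<le> 4 * \<bar>B x x * D3 x y z\<bar>"
  proof -
    define E where "E = B x x * B y z - B x y * B x z"
    define t where "t = real_of_int (round (E / D2 x y))"
    define z' where "z' = z - t *\<^sub>R y"
    have z'R: "z' \<in> R" unfolding z'_def t_def by (intro R_closed R)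
    have e: "B z' z' = B z z - t * B y z - t * (B y z - t * B y y)" "B z' y = B y z - t * B y y"
        "B x z' = B x z - t * B x y" "B z' w = B z w - t * B y w"
      unfolding z'_def by (simp_all add: B_simps comm algebra_simps)
    have "D4 x z' y w = 1" using D4 unfolding D4_def e gram4_shift23 by simp
    then have "F (x, z', y, w)" using R z'R by (simp add: F_def)
    from least[OF this] have "\<bar>D2 x y\<bar> * \<bar>B x x * D3 x y z\<bar> \<le> \<bar>D2 x z'\<bar> * \<bar>B x x * D3 x z' y\<bar>"
      by (simp add: abs_mult mult_ac)
    moreover have "D3 x z' y = D3 x y z" unfolding D3_def e gram3_shift23 by simp
    ultimately have "\<bar>D2 x y\<bar> \<le> \<bar>D2 x z'\<bar>" using nz1 nz3 by simp
    moreover have "D2 x y * D2 x z' = B x x * D3 x y z + (E - t * D2 x y)^2"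
    proof -
      have "D2 x y * D2 x z' = B x x * gram3 (B x x) (B x y) (B x z') (B y y) (B y z') (B z' z') + (B x x * B y z' - B x y * B x z')^2"
        unfolding D2_def by (rule gram_sylvester2)
      moreover have "B x x * B y z' - B x y * B x z' = E - t * D2 x y"
        unfolding E_def D2_def e commute[OF R(2) z'R] by (simp add: algebra_simps)
      moreover have "gram3 (B x x) (B x y) (B x z') (B y y) (B y z') (B z' z') = D3 x y z"
        unfolding D3_def e commute[OF R(2) z'R] gram3_def by algebra
      ultimately show ?thesis by simp
    qed
    ultimately show ?thesis using round_remainder[OF nz2, of E] unfolding t_def[symmetric] by (rule shift_inequality)
  qed
  \<comment> \<open>The minor after \<open>D3\<close> is the full determinant 1, so only
    \<open>D2\<close> remains on the right.\<close>
  have I3: "3 * (D3 x y z)^2 \<le> 4 * \<bar>D2 x y\<bar>"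
  proof -
    define E where "E = B x x * (B y y * B z w - B y w * B y z) - B x y * (B x y * B z w - B y w * B x z) + B x w * (B x y * B y z - B y y * B x z)"
    define t where "t = real_of_int (round (E / D3 x y z))"
    define w' where "w' = w - t *\<^sub>R z"
    have w'R: "w' \<in> R" unfolding w'_def t_def by (intro R_closed R)
    have e: "B w' w' = B w w - t * B z w - t * (B z w - t * B z z)" "B w' z = B z w - t * B z z"
        "B x w' = B x w - t * B x z" "B y w' = B y w - t * B y z"
      unfolding w'_def by (simp_all add: B_simps comm algebra_simps)
    have "D4 x y w' z = 1" using D4 unfolding D4_def e gram4_shift34 by simp
    then have "F (x, y, w', z)" using R w'R by (simp add: F_def)
    from least[OF this] have "\<bar>D3 x y z\<bar> * \<bar>B x x * D2 x y\<bar> \<le> \<bar>D3 x y w'\<bar> * \<bar>B x x * D2 x y\<bar>"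
      by (simp add: abs_mult mult_ac)
    then have "\<bar>D3 x y z\<bar> \<le> \<bar>D3 x y w'\<bar>" using nz1 nz2 by simp
    moreover have "D3 x y z * D3 x y w' = D2 x y + (E - t * D3 x y z)^2"
    proof -
      have "D3 x y z * D3 x y w' = D2 x y * gram4 (B x x) (B x y) (B x z) (B x w') (B y y) (B y z) (B y w') (B z z) (B z w') (B w' w')
         + (B x x * (B y y * B z w' - B y w' * B y z) - B x y * (B x y * B z w' - B y w' * B x z) + B x w' * (B x y * B y z - B y y * B x z))^2"
        unfolding D3_def D2_def by (rule gram_sylvester3)
      moreover have "B x x * (B y y * B z w' - B y w' * B y z) - B x y * (B x y * B z w' - B y w' * B x z) + B x w' * (B x y * B y z - B y y * B x z) = E - t * D3 x y z"
        unfolding E_def D3_def gram3_def e commute[OF R(3) w'R] by algebra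
      moreover have "gram4 (B x x) (B x y) (B x z) (B x w') (B y y) (B y z) (B y w') (B z z) (B z w') (B w' w') = D4 x y z w"
        unfolding D4_def e commute[OF R(3) w'R] gram4_def by algebra
      ultimately show ?thesis by (simp add: D4)
    qed
    ultimately show ?thesis using round_remainder[OF nz3, of E] unfolding t_def[symmetric] by (rule shift_inequality)
  qed
  have abs1: "\<bar>B x x\<bar> = 1 \<and> \<bar>D2 x y\<bar> = 1 \<and> \<bar>D3 x y z\<bar> = 1"
    using I1 I2 I3 nz1 nz2 nz3 D_int[OF R(1,2,3)] by (intro reduced_minors Ints_abs) (simp_all add: abs_mult)
  have uv: "B u v = 0" unfolding u_def by (simp add: B_simps Bv)
  \<comment> \<open>With the opposite sign the orthogonal vectors \<open>x\<close> and
    \<open>u\<close> would have opposite norms and an isotropic sum; \<open>D3\<close> is handled by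
    \<open>x + v\<close>.\<close>
  have D2: "D2 x y = 1"
  proof (rule ccontr)
    assume "D2 x y \<noteq> 1"
    then have "D2 x y = - 1" using abs1 by linarith
    then have "B (x + u) (x + u) = 0" by (simp add: B_simps Bu commute[OF uR R(1)])
    then have "x + u = 0" using aniso R_closed(4)[OF R(1) uR] by blast
    then have "B x (x + u) = 0" by (simp add: B_simps)
    then show False using nz1 by (simp add: B_simps Bu)
  qed
  have D3: "D3 x y z = B x x"
  proof (rule ccontr)
    assume "D3 x y z \<noteq> B x x"
    then have "D3 x y z = - B x x" using abs1 by linarith
    then have "B (x + v) (x + v) = 0" by (simp add: B_simps Bv Bvv D2 commute[OF vR R(1)])
    then have "x + v = 0" using aniso R_closed(4)[OF R(1) vR] by blast
    then have "B x (x + v) = 0" by (simp add: B_simps)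
    then show False using nz1 by (simp add: B_simps Bv)
  qed
  define \<epsilon> where "\<epsilon> = B x x"
  have \<epsilon>2: "\<epsilon> * \<epsilon> = 1" using abs1 by (simp add: \<epsilon>_def abs_if split: if_splits)
  have sq: "B x x = \<epsilon>" "B u u = \<epsilon>" "B v v = \<epsilon>" by (simp_all add: \<epsilon>_def Bu Bvv D2 D3)
  have "\<exists>r\<in>R. \<epsilon> * B r r < 0"
  proof -
    consider "\<epsilon> = 1" | "\<epsilon> = - 1" using \<epsilon>2 by (metis square_eq_1_iff)
    then show ?thesis using positive negative by cases auto
  qed
  then obtain r where r: "r \<in> R" "\<epsilon> * B r r < 0" by blast
  \<comment> \<open>All three frame vectors have norm \<epsilon>. Projecting a vector of the
    opposite sign off the frame keeps its sign, so together with the frame it has negative Gram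
    determinant.\<close>
  define \<rho> where "\<rho> = r - (\<epsilon> * B r x) *\<^sub>R x - (\<epsilon> * B r u) *\<^sub>R u - (\<epsilon> * B r v) *\<^sub>R v"
  have \<rho>R: "\<rho> \<in> R" unfolding \<rho>_def \<epsilon>_def by (intro R_closed R_scale Ints_mult integral R uR vR r)
  have \<rho>0: "B x \<rho> = 0" "B u \<rho> = 0" "B v \<rho> = 0"
    unfolding \<rho>_def using \<epsilon>2
    by (simp_all add: B_simps sq Bu Bv uv commute[OF uR R(1)] commute[OF vR R(1)] commute[OF vR uR]
        commute[OF r(1) R(1)] commute[OF r(1) uR] commute[OF r(1) vR] algebra_simps)
  have "B \<rho> \<rho> = B r \<rho>"
    by (subst (1) \<rho>_def) (simp add: B_simps \<rho>0)
  also have "\<dots> = B r r - \<epsilon> * ((B r x)^2 + (B r u)^2 + (B r v)^2)"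
    unfolding \<rho>_def by (simp add: B_simps power2_eq_square algebra_simps)
  finally have h: "B \<rho> \<rho> = B r r - \<epsilon> * ((B r x)^2 + (B r u)^2 + (B r v)^2)" .
  have "\<epsilon> * B \<rho> \<rho> = \<epsilon> * B r r - (\<epsilon> * \<epsilon>) * ((B r x)^2 + (B r u)^2 + (B r v)^2)"
    unfolding h by (simp add: algebra_simps)
  then have "\<epsilon> * B \<rho> \<rho> = \<epsilon> * B r r - ((B r x)^2 + (B r u)^2 + (B r v)^2)" by (simp add: \<epsilon>2)
  then have neg: "\<epsilon> * B \<rho> \<rho> < 0" using r(2) by (smt (verit) zero_le_power2)
  have "gram (quad x u v \<rho>) = (\<epsilon> * \<epsilon>) * (\<epsilon> * B \<rho> \<rho>)"
    unfolding gram_quad[OF R(1) uR vR \<rho>R] by (simp add: gram4_def sq Bu Bv uv \<rho>0)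
  then have "gram (quad x u v \<rho>) < 0" using neg by (simp add: \<epsilon>2)
  moreover have "gram (quad x u v \<rho>) \<ge> 0" by (rule gram_nonneg) (simp add: quad_def R uR vR \<rho>R)
  ultimately show False by simp
qed

text \<open>The values of \<open>B x\<close> on \<open>R\<close> are the multiples of some
  \<open>d\<close>, and \<open>x / d\<close> still pairs integrally with \<open>R\<close>, hence
  lies in \<open>R\<close> by \<open>self_dual\<close> and takes the value 1.\<close>

lemma isotropic_dual_pair: "\<exists>z\<in>R. \<exists>f\<in>R. B z z = 0 \<and> B z f = 1"
proof -
  obtain x where x: "x \<in> R" "x \<noteq> 0" "B x x = 0" using isotropic by blast
  define I where "I = {n :: int. \<exists>y\<in>R. B x y = of_int n}"
  have "0 \<in> I" unfolding I_def using R_closed(1) by (auto simp: B_simps intro!: bexI[of _ 0])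
  moreover have "m - n \<in> I" if mn: "m \<in> I" "n \<in> I" for m n
  proof -
    obtain y y' where "y \<in> R" "B x y = of_int m" "y' \<in> R" "B x y' = of_int n" using mn by (auto simp: I_def)
    then show ?thesis unfolding I_def by (intro CollectI bexI[of _ "y - y'"]) (auto simp: B_simps intro: R_closed)
  qed
  ultimately obtain d where d: "d \<in> I" "\<And>n. n \<in> I \<Longrightarrow> d dvd n" using int_subgroup_principal[of I] by blast
  have I: "\<exists>k. B x y = of_int (d * k)" if y: "y \<in> R" for y
  proof -
    obtain n where n: "B x y = of_int n" using integral[OF x(1) y] by (auto elim!: Ints_cases)
    then have "n \<in> I" using y by (auto simp: I_def)
    then show ?thesis using d(2) n by (metis dvdE)
  qed
  have "d \<noteq> 0"
  proof
    assume "d = 0"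
    then have "B x y = 0" if "y \<in> R" for y using I[OF that] by simp
    then show False using nondegenerate[of x] x R_span by blast
  qed
  define z where "z = (1 / of_int d) *\<^sub>R x"
  have "z \<in> R"
  proof (rule self_dual)
    show "z \<in> span (range q)" unfolding z_def using x R_span by (auto intro: span_scale)
    show "B z y \<in> \<int>" if "y \<in> R" for y
      using I[OF that] \<open>d \<noteq> 0\<close> by (auto simp: z_def B_simps)
  qed
  moreover obtain f where "f \<in> R" "B x f = of_int d" using d(1) by (auto simp: I_def)
  ultimately show ?thesis using x(3) \<open>d \<noteq> 0\<close>
    by (intro bexI[of _ z] bexI[of _ f]) (auto simp: z_def B_simps)
qed

text \<open>\<open>z\<close> and \<open>f\<close> span a unimodular plane, so its complement
  \<open>L\<close> splits off, and the binary isotropic basis takes care of \<open>L\<close>. The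
  norms of \<open>f\<close> and \<open>g\<close> remain arbitrary, since \<open>R\<close> may be
  odd.\<close>

theorem hyperbolic_basis:
  obtains z f e g where "z \<in> R" "f \<in> R" "e \<in> R" "g \<in> R"
    "B z z = 0" "B z f = 1" "B e e = 0" "B e g = 1" "B z e = 0" "B z g = 0" "B f e = 0" "B f g = 0"
    "\<And>x. x \<in> R \<Longrightarrow> \<exists>i j k l :: int. x = of_int i *\<^sub>R z + of_int j *\<^sub>R f + of_int k *\<^sub>R e + of_int l *\<^sub>R g"
proof -
  obtain z f where zf: "z \<in> R" "f \<in> R" "B z z = 0" "B z f = 1" using isotropic_dual_pair by blast
  have fz: "B f z = 1" using zf commute by metis
  define L where "L = {x \<in> R. B x z = 0 \<and> B x f = 0}"
  have L: "additive_subgroup L"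
    unfolding L_def additive_subgroup_def by (auto simp: B_simps intro: R_closed)
  obtain C where C: "finite C" "independent C" "R = int_span C" using basis by blast
  have "\<exists>C'. finite C' \<and> independent C' \<and> L = int_span C'"
    by (rule subgroup_int_span_basis[OF C(1,2) L]) (auto simp: L_def C(3))
  then obtain C' where C': "finite C'" "independent C'" "L = int_span C'" by blast
  have C'L: "C' \<subseteq> L" unfolding C'(3) using int_span_base[OF C'(1)] by blast
  have dec: "\<exists>i j :: int. \<exists>y\<in>L. x = of_int i *\<^sub>R z + of_int j *\<^sub>R f + y" if x: "x \<in> R" for x
  proof -
    obtain j where j: "B x z = of_int j" using integral[OF x zf(1)] by (auto elim!: Ints_cases)
    obtain m where m: "B x f = of_int m" using integral[OF x zf(2)] by (auto elim!: Ints_cases)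
    obtain n where n: "B f f = of_int n" using integral[OF zf(2,2)] by (auto elim!: Ints_cases)
    \<comment> \<open>The coefficients are those of the projection: the Gram matrix with rows (0,
      1), (1, n) has the integral inverse with rows (-n, 1), (1, 0).\<close>
    define y where "y = x - of_int (m - j * n) *\<^sub>R z - of_int j *\<^sub>R f"
    have "y \<in> R" unfolding y_def by (intro R_closed(2) R_closed(5) x zf)
    then have "y \<in> L" unfolding L_def using j m n zf fz by (auto simp: B_simps y_def)
    then show ?thesis by (intro exI[of _ "m - j * n"] exI[of _ j] bexI[of _ y]) (auto simp: y_def)
  qed
  have C'0: "B x z = 0 \<and> B x f = 0" if "x \<in> span C'" for x
  proof -
    have l: "linear (\<lambda>x. B x z)" "linear (\<lambda>x. B x f)" using bilinear by (auto simp: bilinear_def)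
    show ?thesis using that C'L linear_eq_0_on_span[OF l(1), of C' x] linear_eq_0_on_span[OF l(2), of C' x]
      by (auto simp: L_def subset_iff)
  qed
  have f: "f \<notin> span C'" using C'0[of f] fz by auto
  have z: "z \<notin> span (insert f C')"
  proof
    assume "z \<in> span (insert f C')"
    then obtain s where s: "z - s *\<^sub>R f \<in> span C'" by (auto simp: span_insert)
    have "B (z - s *\<^sub>R f) z = - s" by (simp add: B_simps zf fz)
    then have "s = 0" using C'0[OF s] by simp
    then show False using s C'0[of z] zf by simp
  qed
  have nin: "f \<notin> C'" "z \<notin> C'" "z \<noteq> f" using f z by (auto simp: span_base)
  have "card (insert z (insert f C')) = 4"
  proof (rule card_independent)
    show "independent (insert z (insert f C'))" using C'(2) f z by (simp add: independent_insert span_base)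
    show "R \<subseteq> span (insert z (insert f C'))"
    proof
      fix x assume "x \<in> R"
      then obtain i j :: int and y where "y \<in> L" "x = of_int i *\<^sub>R z + of_int j *\<^sub>R f + y" using dec by blast
      moreover have "y \<in> span (insert z (insert f C'))"
        using \<open>y \<in> L\<close> C'(3) int_span_subset_span span_mono[of C' "insert z (insert f C')"] by blast
      moreover have "z \<in> span (insert z (insert f C'))" "f \<in> span (insert z (insert f C'))" by (auto intro: span_base)
      ultimately show "x \<in> span (insert z (insert f C'))" by (auto intro: span_add span_scale)
    qed
  qed (use C' C'L zf in \<open>auto simp: L_def\<close>)
  then have "card C' = 2" using C'(1) nin by simp
  then obtain c1 c2 where c12: "C' = {c1, c2}" "c1 \<noteq> c2" by (meson card_2_iff)
  have c: "c1 \<in> R" "c2 \<in> R" "B c1 z = 0" "B c1 f = 0" "B c2 z = 0" "B c2 f = 0"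
    using C'L c12 by (auto simp: L_def)
  have Lc: "\<exists>k l :: int. y = of_int k *\<^sub>R c1 + of_int l *\<^sub>R c2" if "y \<in> L" for y
    using that c12 unfolding C'(3) int_span_def by auto
  note cc = commute[OF zf(1) c(1)] commute[OF zf(1) c(2)] commute[OF zf(2) c(1)] commute[OF zf(2) c(2)]
  have "generates (quad z f c1 c2)" unfolding generates_def
  proof (intro conjI allI ballI)
    fix i show "quad z f c1 c2 i \<in> R" using zf c by (simp add: quad_def)
  next
    fix x assume "x \<in> R"
    then obtain i j :: int and y where y: "y \<in> L" "x = of_int i *\<^sub>R z + of_int j *\<^sub>R f + y" using dec by blast
    obtain k l :: int where "y = of_int k *\<^sub>R c1 + of_int l *\<^sub>R c2" using Lc[OF y(1)] by blast
    then show "\<exists>n :: 4 \<Rightarrow> int. x = (\<Sum>j\<in>UNIV. of_int (n j) *\<^sub>R quad z f c1 c2 j)"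
      unfolding sum_4 by (intro exI[of _ "quad i j k l"]) (simp add: y)
  qed
  \<comment> \<open>The whole Gram determinant is 1 and that of the plane of \<open>z\<close>,
    \<open>f\<close> is -1, so \<open>L\<close> has determinant -1.\<close>
  from gram_generates[OF this] have "B c1 c2 * B c1 c2 - B c1 c1 * B c2 c2 = 1"
    unfolding gram_quad[OF zf(1,2) c(1,2)] by (simp add: gram4_def zf cc c algebra_simps)
  moreover obtain \<alpha> \<beta> \<gamma> where abc: "B c1 c1 = of_int \<alpha>" "B c1 c2 = of_int \<beta>" "B c2 c2 = of_int \<gamma>"
    using integral[OF c(1,1)] integral[OF c(1,2)] integral[OF c(2,2)] by (auto elim!: Ints_cases)
  ultimately have "real_of_int (\<beta>^2 - \<alpha> * \<gamma>) = 1" by (simp add: power2_eq_square)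
  then have "\<beta>^2 - \<alpha> * \<gamma> = 1" by linarith
  from binary_isotropic_basis[OF this] obtain p q' r s where pq: "\<bar>p * s - q' * r\<bar> = 1"
    "\<alpha> * p * p + 2 * \<beta> * p * q' + \<gamma> * q' * q' = 0" "\<alpha> * p * r + \<beta> * (p * s + q' * r) + \<gamma> * q' * s = 1" by blast
  define e where "e = of_int p *\<^sub>R c1 + of_int q' *\<^sub>R c2"
  define g where "g = of_int r *\<^sub>R c1 + of_int s *\<^sub>R c2"
  have "B e e = of_int (\<alpha> * p * p + 2 * \<beta> * p * q' + \<gamma> * q' * q')"
    by (simp add: e_def B_simps abc commute[OF c(2,1)] algebra_simps)
  then have ee: "B e e = 0" by (simp only: pq of_int_0)
  have "B e g = of_int (\<alpha> * p * r + \<beta> * (p * s + q' * r) + \<gamma> * q' * s)"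
    by (simp add: e_def g_def B_simps abc commute[OF c(2,1)] algebra_simps)
  then have eg: "B e g = 1" by (simp only: pq of_int_1)
  define \<delta> where "\<delta> = p * s - q' * r"
  have \<delta>: "\<delta> * \<delta> = 1" using pq(1) unfolding \<delta>_def[symmetric] by (auto simp: abs_if split: if_splits)
  have sub: "of_int (\<delta> * s) *\<^sub>R e - of_int (\<delta> * q') *\<^sub>R g = of_int (\<delta> * \<delta>) *\<^sub>R c1"
    "of_int (\<delta> * p) *\<^sub>R g - of_int (\<delta> * r) *\<^sub>R e = of_int (\<delta> * \<delta>) *\<^sub>R c2"
  proof -
    have "s' *\<^sub>R (p' *\<^sub>R c1 + t *\<^sub>R c2) - t *\<^sub>R (r' *\<^sub>R c1 + s' *\<^sub>R c2) = (p' * s' - t * r') *\<^sub>R c1"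
      "p' *\<^sub>R (r' *\<^sub>R c1 + s' *\<^sub>R c2) - r' *\<^sub>R (p' *\<^sub>R c1 + t *\<^sub>R c2) = (p' * s' - t * r') *\<^sub>R c2" for p' s' t r' :: real
      by (simp_all add: algebra_simps)
    note * = this[where s' = "of_int s" and p' = "of_int p" and t = "of_int q'" and r' = "of_int r", folded e_def g_def]
    have "of_int (\<delta> * s) *\<^sub>R e - of_int (\<delta> * q') *\<^sub>R g = of_int \<delta> *\<^sub>R (of_int s *\<^sub>R e - of_int q' *\<^sub>R g)"
      "of_int (\<delta> * p) *\<^sub>R g - of_int (\<delta> * r) *\<^sub>R e = of_int \<delta> *\<^sub>R (of_int p *\<^sub>R g - of_int r *\<^sub>R e)"
      by (simp_all add: scaleR_diff_right)
    then show "of_int (\<delta> * s) *\<^sub>R e - of_int (\<delta> * q') *\<^sub>R g = of_int (\<delta> * \<delta>) *\<^sub>R c1"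
      "of_int (\<delta> * p) *\<^sub>R g - of_int (\<delta> * r) *\<^sub>R e = of_int (\<delta> * \<delta>) *\<^sub>R c2"
      unfolding * by (simp_all add: \<delta>_def)
  qed
  show ?thesis
  proof (rule that[OF zf(1,2) _ _ zf(3,4) ee eg])
    show "e \<in> R" "g \<in> R" unfolding e_def g_def by (intro R_closed c)+
    show "B z e = 0" "B z g = 0" "B f e = 0" "B f g = 0" by (simp_all add: e_def g_def B_simps cc c)
    fix x assume "x \<in> R"
    then obtain i j :: int and y where y: "y \<in> L" "x = of_int i *\<^sub>R z + of_int j *\<^sub>R f + y" using dec by blast
    obtain k l :: int where "y = of_int k *\<^sub>R c1 + of_int l *\<^sub>R c2" using Lc[OF y(1)] by blast
    also have "\<dots> = of_int k *\<^sub>R (of_int (\<delta> * s) *\<^sub>R e - of_int (\<delta> * q') *\<^sub>R g) + of_int l *\<^sub>R (of_int (\<delta> * p) *\<^sub>R g - of_int (\<delta> * r) *\<^sub>R e)"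
      unfolding sub \<delta> by simp
    also have "\<dots> = of_int (k * (\<delta> * s) - l * (\<delta> * r)) *\<^sub>R e + of_int (l * (\<delta> * p) - k * (\<delta> * q')) *\<^sub>R g"
      by (simp add: algebra_simps)
    finally show "\<exists>i j k l :: int. x = of_int i *\<^sub>R z + of_int j *\<^sub>R f + of_int k *\<^sub>R e + of_int l *\<^sub>R g"
      unfolding y(2) by (metis add.assoc)
  qed
qed

end

section \<open>Even binary lattices and gluing\<close>

definition even_real :: "real \<Rightarrow> bool" where "even_real r \<longleftrightarrow> (\<exists>k::int. r = 2 * of_int k)"

lemma even_real_add: "even_real r \<Longrightarrow> even_real s \<Longrightarrow> even_real (r + s)"
  unfolding even_real_def by (metis distrib_left of_int_add)

lemma even_real_diff: "even_real r \<Longrightarrow> even_real s \<Longrightarrow> even_real (r - s)"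
  unfolding even_real_def by (metis right_diff_distrib of_int_diff)

lemma even_real_2: "r \<in> \<int> \<Longrightarrow> even_real (2 * r)" by (auto simp: even_real_def elim!: Ints_cases)

lemma even_real_mult: "even_real r \<Longrightarrow> s \<in> \<int> \<Longrightarrow> even_real (r * s)"
  unfolding even_real_def by (metis Ints_cases mult.assoc of_int_mult)

lemma even_real_half: "even_real r \<Longrightarrow> r / 2 \<in> \<int>" by (auto simp: even_real_def)

lemma even_real_of_int: "even_real (of_int n) \<longleftrightarrow> even n"
proof
  assume "even_real (of_int n)"
  then obtain k where "real_of_int n = 2 * of_int k" by (auto simp: even_real_def)
  then have "n = 2 * k" by linarith
  then show "even n" by simp
qed (auto simp: even_real_def elim!: evenE)

lemma even_latticeD:
  assumes "even_lattice M" shows "is_lattice M" "x \<in> points M \<Longrightarrow> even_real (form M x x)"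
  using assms by (auto simp: even_lattice_def even_real_def)

lemma dual_subgroup:
  assumes "is_lattice M" shows "additive_subgroup (dual_points M)"
proof -
  note b = is_latticeD(1)[OF assms]
  show ?thesis unfolding additive_subgroup_def dual_points_def
    by (auto simp: bilinear_lzero[OF b] bilinear_lsub[OF b] span_zero intro: span_diff)
qed

lemma points_subset_dual: "is_lattice M \<Longrightarrow> points M \<subseteq> dual_points M"
  unfolding dual_points_def using is_latticeD(2) by (auto intro: span_base)

lemma dual_span: "x \<in> dual_points M \<Longrightarrow> x \<in> span (points M)"
  by (simp add: dual_points_def)

lemma dual_form: "x \<in> dual_points M \<Longrightarrow> y \<in> points M \<Longrightarrow> form M x y \<in> \<int>"
  by (simp add: dual_points_def)

lemma dual_form': "is_lattice M \<Longrightarrow> x \<in> dual_points M \<Longrightarrow> y \<in> points M \<Longrightarrow> form M y x \<in> \<int>"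
  using lattice_form_commute[of M y x] by (simp add: dual_points_def span_base)

lemmas form_simps = bilinear_ladd bilinear_radd bilinear_lmul bilinear_rmul
  bilinear_lsub bilinear_rsub bilinear_lneg bilinear_rneg bilinear_lzero bilinear_rzero

text \<open>\<open>4 a c - b b\<close> is the determinant of the Gram matrix; below, signature (1,1)
  enters through its negative sign.\<close>

definition binary :: "'a::real_vector quad_lattice \<Rightarrow> 'a \<Rightarrow> 'a \<Rightarrow> int \<Rightarrow> int \<Rightarrow> int \<Rightarrow> bool" where
  "binary M p1 p2 a b c \<longleftrightarrow> even_lattice M \<and> p1 \<noteq> p2 \<and> independent {p1, p2} \<and> points M = int_span {p1, p2} \<and>
     form M p1 p1 = 2 * of_int a \<and> form M p1 p2 = of_int b \<and> form M p2 p2 = 2 * of_int c"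

lemma even_rank2_binary:
  assumes "even_lattice M" "dim (points M) = 2"
  shows "\<exists>p1 p2 a b c. binary M p1 p2 a b c"
proof -
  note M = even_latticeD[OF assms(1)]
  obtain C where C: "finite C" "independent C" "points M = int_span C" using M(1) by (rule lattice_basis)
  have "card C = dim (span (points M))" using C by (simp add: span_int_span dim_eq_card_independent)
  then have "card C = 2" using assms(2) by simp
  then obtain p1 p2 where p: "C = {p1, p2}" "p1 \<noteq> p2" by (meson card_2_iff)
  have m: "p1 \<in> points M" "p2 \<in> points M" using C int_span_base[OF C(1)] p by auto
  obtain a b c where "form M p1 p1 = 2 * of_int a" "form M p1 p2 = of_int b" "form M p2 p2 = 2 * of_int c"
    using M(2)[OF m(1)] M(2)[OF m(2)] is_latticeD(2)[OF M(1) m] by (auto simp: even_real_def elim!: Ints_cases)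
  then show ?thesis using C p assms(1) unfolding binary_def by blast
qed

lemma int_span_pair: "p1 \<noteq> p2 \<Longrightarrow> int_span {p1, p2} = {of_int i *\<^sub>R p1 + of_int j *\<^sub>R p2 |i j. True}"
proof -
  assume "p1 \<noteq> p2"
  then have "int_span {p1, p2} = {of_int n *\<^sub>R p1 + y |n y. y \<in> int_span {p2}}" by (intro int_span_insert) auto
  moreover have "int_span {p2} = {of_int n *\<^sub>R p2 + y |n y. y \<in> int_span {}}" by (intro int_span_insert) auto
  ultimately show ?thesis by auto
qed

lemma independent_pair:
  assumes "independent {p1, p2}" "p1 \<noteq> p2" "s *\<^sub>R p1 + t *\<^sub>R p2 = 0" shows "s = 0" "t = 0"
proof -
  define u where "u = (\<lambda>x. if x = p1 then s else t)"
  have *: "(\<Sum>v\<in>{p1, p2}. u v *\<^sub>R v) = 0" using assms by (simp add: u_def)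
  show "s = 0" using independentD[OF assms(1) _ _ *, of p1] by (simp add: u_def)
  show "t = 0" using independentD[OF assms(1) _ _ *, of p2] assms(2) by (simp add: u_def)
qed

lemma binary_form_expand:
  assumes "binary M p1 p2 a b c"
  shows "form M (s *\<^sub>R p1 + t *\<^sub>R p2) (s' *\<^sub>R p1 + t' *\<^sub>R p2) = 2 * of_int a * s * s' + of_int b * (s * t' + t * s') + 2 * of_int c * t * t'"
proof -
  have M: "is_lattice M" and f: "form M p1 p1 = 2 * of_int a" "form M p1 p2 = of_int b" "form M p2 p2 = 2 * of_int c"
    and p: "p1 \<in> points M" "p2 \<in> points M"
    using assms int_span_base[of "{p1, p2}"] unfolding binary_def even_lattice_def by auto
  have "form M p2 p1 = of_int b" using f is_latticeD(3)[OF M p] by simp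
  with f show ?thesis by (simp add: form_simps[OF is_latticeD(1)[OF M]] algebra_simps)
qed

lemma dim_1_line:
  assumes "dim V = 1" obtains v where "v \<in> V" "v \<noteq> 0" "V \<subseteq> span {v}"
proof -
  obtain C where C: "C \<subseteq> V" "independent C" "V \<subseteq> span C" "card C = dim V" using basis_exists by blast
  then obtain v where "C = {v}" using assms by (metis card_1_singletonE)
  then show ?thesis using C dependent_zero[of "{v}"] that[of v] by auto
qed

lemma signature_11_orthogonal_pair:
  assumes "has_signature M 1 1"
  obtains v w where "span (points M) = span {v, w}" "independent {v, w}" "v \<noteq> w"
    "form M v v > 0" "form M w w < 0" "form M v w = 0"
proof -
  obtain P Q where P: "subspace P" and Q: "subspace Q" and PQ: "{x + y |x y. x \<in> P \<and> y \<in> Q} = span (points M)"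
    and dim: "dim P = 1" "dim Q = 1" and orth: "\<forall>x\<in>P. \<forall>y\<in>Q. form M x y = 0"
    and pos: "\<forall>x\<in>P. x \<noteq> 0 \<longrightarrow> form M x x > 0" and neg: "\<forall>x\<in>Q. x \<noteq> 0 \<longrightarrow> form M x x < 0"
    using assms unfolding has_signature_def by (elim exE conjE)
  obtain v where v: "v \<in> P" "v \<noteq> 0" "P \<subseteq> span {v}" using dim_1_line[OF dim(1)] .
  obtain w where w: "w \<in> Q" "w \<noteq> 0" "Q \<subseteq> span {w}" using dim_1_line[OF dim(2)] .
  have f: "form M v v > 0" "form M w w < 0" "form M v w = 0" using pos neg orth v w by blast+
  have nin: "v \<notin> span {w}"
  proof
    assume "v \<in> span {w}"
    then have "v \<in> Q" using w(1) subspace_scale[OF Q] by (auto simp: span_singleton)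
    then show False using neg v(2) f(1) by force
  qed
  have ind: "independent {v, w}" using nin w(2) by (auto simp: independent_insert span_base)
  have sp: "span (points M) = span {v, w}"
  proof (intro equalityI subsetI)
    fix x assume "x \<in> span (points M)"
    then obtain x1 x2 where x: "x1 \<in> P" "x2 \<in> Q" "x = x1 + x2" unfolding PQ[symmetric] by blast
    then have "x1 \<in> span {v, w}" "x2 \<in> span {v, w}"
      using span_mono[of "{v}" "{v, w}"] span_mono[of "{w}" "{v, w}"] v(3) w(3) by blast+
    then show "x \<in> span {v, w}" unfolding x(3) by (rule span_add)
  next
    fix x assume "x \<in> span {v, w}"
    then obtain s t where x: "x = s *\<^sub>R v + t *\<^sub>R w" by (auto simp: span_insert span_singleton algebra_simps)
    show "x \<in> span (points M)" unfolding PQ[symmetric] x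
      using subspace_scale[OF P v(1)] subspace_scale[OF Q w(1)] by blast
  qed
  have "v \<noteq> w" using nin by (auto intro: span_base)
  then show ?thesis by (rule that[OF sp ind _ f])
qed

lemma signature_11_rank:
  assumes "has_signature M 1 1" shows "dim (points M) = 2"
proof -
  obtain v w where "span (points M) = span {v, w}" "independent {v, w}" "v \<noteq> w"
    using signature_11_orthogonal_pair[OF assms] .
  then have "dim (span (points M)) = card {v, w}" by (simp add: dim_eq_card_independent)
  with \<open>v \<noteq> w\<close> show ?thesis by simp
qed

text \<open>Passing from an orthogonal pair with norms of opposite sign to the lattice basis
  multiplies the determinant by a nonzero square.\<close>

lemma signature_11_disc:
  assumes "binary M p1 p2 a b c" "has_signature M 1 1"
  shows "4 * a * c - b * b < 0"
proof -
  have M: "even_lattice M" and p12: "p1 \<noteq> p2" "independent {p1, p2}" and pts: "points M = int_span {p1, p2}"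
    using assms(1) unfolding binary_def by auto
  note bil = is_latticeD(1)[OF even_latticeD(1)[OF M]]
  obtain v w where sp: "span (points M) = span {v, w}" and vw: "form M v v > 0" "form M w w < 0" "form M v w = 0"
    using signature_11_orthogonal_pair[OF assms(2)] .
  have vs: "v \<in> span (points M)" "w \<in> span (points M)" unfolding sp by (auto intro: span_base)
  have wv: "form M w v = 0" using lattice_form_commute[OF even_latticeD(1)[OF M] vs] vw by simp
  have ex: "\<exists>s t. x = s *\<^sub>R v + t *\<^sub>R w" if "x \<in> span (points M)" for x
    using that unfolding sp by (auto simp: span_insert span_singleton algebra_simps)
  have "p1 \<in> span (points M)" "p2 \<in> span (points M)" unfolding pts by (auto intro!: span_base int_span_base)
  then obtain s t s' t' where p: "p1 = s *\<^sub>R v + t *\<^sub>R w" "p2 = s' *\<^sub>R v + t' *\<^sub>R w" using ex by meson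
  have f: "form M p1 p1 = s * s * form M v v + t * t * form M w w"
    "form M p1 p2 = s * s' * form M v v + t * t' * form M w w"
    "form M p2 p2 = s' * s' * form M v v + t' * t' * form M w w"
    unfolding p by (simp_all add: form_simps[OF bil] vw wv algebra_simps)
  have "real_of_int (4 * a * c - b * b) = form M p1 p1 * form M p2 p2 - form M p1 p2 * form M p1 p2"
    using assms(1) unfolding binary_def by simp
  also have "\<dots> = (s * t' - t * s')^2 * (form M v v * form M w w)"
    unfolding f by algebra
  also have "\<dots> < 0"
  proof -
    have "s * t' - t * s' \<noteq> 0"
    proof
      assume 0: "s * t' - t * s' = 0"
      have "t' *\<^sub>R p1 + (- t) *\<^sub>R p2 = (s * t' - t * s') *\<^sub>R v" "s' *\<^sub>R p1 + (- s) *\<^sub>R p2 = - (s * t' - t * s') *\<^sub>R w"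
        unfolding p by (simp_all add: algebra_simps)
      then have "t = 0" "s = 0"
        using independent_pair[OF p12(2,1), of t' "- t"] independent_pair[OF p12(2,1), of s' "- s"] 0 by auto
      then have "p1 = 0" by (simp add: p)
      then show False using p12(2) dependent_zero by blast
    qed
    then show ?thesis using vw by (simp add: mult_pos_neg)
  qed
  finally show ?thesis by linarith
qed

section \<open>Gluing along discriminant groups\<close>

text \<open>
  \<open>R\<close> is the overlattice of \<open>M1 \<oplus> M2(-1)\<close> belonging to the graph of an isomorphism of the
  discriminant groups that respects the bilinear forms.
\<close>

definition glue :: "'a::real_vector quad_lattice \<Rightarrow> 'b::real_vector quad_lattice \<Rightarrow> ('a \<times> 'b) set \<Rightarrow> bool" where
  "glue M1 M2 R \<longleftrightarrow> additive_subgroup R \<and> R \<subseteq> dual_points M1 \<times> dual_points M2 \<and>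
     (\<forall>x\<in>dual_points M1. \<exists>y. (x, y) \<in> R) \<and> (\<forall>y\<in>dual_points M2. \<exists>x. (x, y) \<in> R) \<and>
     (\<forall>x y. (x, y) \<in> R \<longrightarrow> (x \<in> points M1 \<longleftrightarrow> y \<in> points M2)) \<and> points M1 \<times> points M2 \<subseteq> R \<and>
     (\<forall>x y x' y'. (x, y) \<in> R \<longrightarrow> (x', y') \<in> R \<longrightarrow> form M1 x x' - form M2 y y' \<in> \<int>)"

definition even_glue :: "'a::real_vector quad_lattice \<Rightarrow> 'b::real_vector quad_lattice \<Rightarrow> ('a \<times> 'b) set \<Rightarrow> bool" where
  "even_glue M1 M2 R \<longleftrightarrow> glue M1 M2 R \<and> (\<forall>x y. (x, y) \<in> R \<longrightarrow> even_real (form M1 x x - form M2 y y))"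

lemma glueD:
  assumes "glue M1 M2 R"
  shows "additive_subgroup R" "(x, y) \<in> R \<Longrightarrow> x \<in> dual_points M1" "(x, y) \<in> R \<Longrightarrow> y \<in> dual_points M2"
    "x \<in> dual_points M1 \<Longrightarrow> \<exists>y. (x, y) \<in> R" "y \<in> dual_points M2 \<Longrightarrow> \<exists>x. (x, y) \<in> R"
    "(x, y) \<in> R \<Longrightarrow> x \<in> points M1 \<longleftrightarrow> y \<in> points M2" "x \<in> points M1 \<Longrightarrow> y \<in> points M2 \<Longrightarrow> (x, y) \<in> R"
    "(x, y) \<in> R \<Longrightarrow> (x', y') \<in> R \<Longrightarrow> form M1 x x' - form M2 y y' \<in> \<int>"
proof -
  note * = assms[unfolded glue_def]
  show "additive_subgroup R" using * by (elim conjE)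
  have "R \<subseteq> dual_points M1 \<times> dual_points M2" "points M1 \<times> points M2 \<subseteq> R" using * by - (elim conjE, assumption)+
  then show "(x, y) \<in> R \<Longrightarrow> x \<in> dual_points M1" "(x, y) \<in> R \<Longrightarrow> y \<in> dual_points M2"
    "x \<in> points M1 \<Longrightarrow> y \<in> points M2 \<Longrightarrow> (x, y) \<in> R" by auto
  have "\<forall>x\<in>dual_points M1. \<exists>y. (x, y) \<in> R" "\<forall>y\<in>dual_points M2. \<exists>x. (x, y) \<in> R"
    "\<forall>x y. (x, y) \<in> R \<longrightarrow> (x \<in> points M1 \<longleftrightarrow> y \<in> points M2)"
    "\<forall>x y x' y'. (x, y) \<in> R \<longrightarrow> (x', y') \<in> R \<longrightarrow> form M1 x x' - form M2 y y' \<in> \<int>"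
    using * by - (elim conjE, assumption)+
  then show "x \<in> dual_points M1 \<Longrightarrow> \<exists>y. (x, y) \<in> R" "y \<in> dual_points M2 \<Longrightarrow> \<exists>x. (x, y) \<in> R"
    "(x, y) \<in> R \<Longrightarrow> x \<in> points M1 \<longleftrightarrow> y \<in> points M2"
    "(x, y) \<in> R \<Longrightarrow> (x', y') \<in> R \<Longrightarrow> form M1 x x' - form M2 y y' \<in> \<int>" by blast+
qed

lemma glue_swap_points:
  assumes "glue M1 M2 R" "is_lattice M1" "is_lattice M2"
  shows "(x, 0) \<in> R \<longleftrightarrow> x \<in> points M1" "(0, y) \<in> R \<longleftrightarrow> y \<in> points M2"
  using glueD(6,7)[OF assms(1)] additive_subgroupD(1)[OF is_latticeD(5)[OF assms(2)]]
    additive_subgroupD(1)[OF is_latticeD(5)[OF assms(3)]] by blast+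

text \<open>\<open>K1\<close> and \<open>K2\<close> are their own duals, so the isometry
  \<open>F\<close> maps the dual of \<open>M1\<close> times \<open>K1\<close> onto the dual of
  \<open>M2\<close> times \<open>K2\<close>. The vectors \<open>x\<close> and \<open>y\<close> are
  glued when \<open>F (x, 0)\<close> and \<open>(y, 0)\<close> differ by a lattice point. The norm
  of the \<open>K2\<close> part is an integer of unknown parity, which is why only the bilinear
  forms are compared.\<close>

lemma stably_equivalent_imp_glue:
  assumes M: "is_lattice M1" "is_lattice M2" and "stably_equivalent M1 M2"
  shows "\<exists>R. glue M1 M2 R"
proof -
  obtain K1 K2 :: std_lattice where K: "unimodular K1" "unimodular K2" "M1 \<oplus>\<^sub>L K1 \<cong>\<^sub>L M2 \<oplus>\<^sub>L K2"
    using assms(3) unfolding stably_equivalent_def by blast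
  have KL: "is_lattice K1" "is_lattice K2" and Kd: "dual_points K1 = points K1" "dual_points K2 = points K2"
    using K unfolding unimodular_def by auto
  obtain F G where F: "linear F" "linear G" "F ` points (M1 \<oplus>\<^sub>L K1) = points (M2 \<oplus>\<^sub>L K2)"
    "G ` points (M2 \<oplus>\<^sub>L K2) = points (M1 \<oplus>\<^sub>L K1)"
    "\<And>x. x \<in> span (points (M1 \<oplus>\<^sub>L K1)) \<Longrightarrow> G (F x) = x" "\<And>y. y \<in> span (points (M2 \<oplus>\<^sub>L K2)) \<Longrightarrow> F (G y) = y"
    "\<And>x y. x \<in> span (points (M1 \<oplus>\<^sub>L K1)) \<Longrightarrow> y \<in> span (points (M1 \<oplus>\<^sub>L K1)) \<Longrightarrow> form (M2 \<oplus>\<^sub>L K2) (F x) (F y) = form (M1 \<oplus>\<^sub>L K1) x y"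
    using isometric_linear[OF is_lattice_sum[OF M(1) KL(1)] is_lattice_sum[OF M(2) KL(2)] K(3)] by metis
  have span_sum: "span (points (M \<oplus>\<^sub>L K)) = span (points M) \<times> span (points K)"
    if "is_lattice M" "is_lattice K" for M :: "'c::real_vector quad_lattice" and K :: "'d::real_vector quad_lattice"
  proof
    show "span (points (M \<oplus>\<^sub>L K)) \<subseteq> span (points M) \<times> span (points K)"
      by (rule span_minimal) (auto intro: span_base subspace_Times)
    show "span (points M) \<times> span (points K) \<subseteq> span (points (M \<oplus>\<^sub>L K))"
    proof clarify
      fix x y assume xy: "x \<in> span (points M)" "y \<in> span (points K)"
      have l: "linear (\<lambda>x. (x, 0) :: 'c \<times> 'd)" "linear (Pair 0 :: 'd \<Rightarrow> 'c \<times> 'd)" by (auto intro!: linearI)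
      note z = additive_subgroupD(1)[OF is_latticeD(5)]
      have "(x, 0) \<in> span (points (M \<oplus>\<^sub>L K))"
        using linear_span_image[OF l(1), of "points M"] xy z[OF that(2)] span_mono[of "(\<lambda>x. (x, 0)) ` points M" "points (M \<oplus>\<^sub>L K)"] by auto
      moreover have "(0, y) \<in> span (points (M \<oplus>\<^sub>L K))"
        using linear_span_image[OF l(2), of "points K"] xy z[OF that(1)] span_mono[of "Pair 0 ` points K" "points (M \<oplus>\<^sub>L K)"] by auto
      ultimately have "(x, 0) + (0, y) \<in> span (points (M \<oplus>\<^sub>L K))" by (rule span_add)
      then show "(x, y) \<in> span (points (M \<oplus>\<^sub>L K))" by simp
    qed
  qed
  have dual_sum: "dual_points (M \<oplus>\<^sub>L K) = dual_points M \<times> dual_points K"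
    if "is_lattice M" "is_lattice K" for M :: "'c::real_vector quad_lattice" and K :: "'d::real_vector quad_lattice"
  proof -
    note z = additive_subgroupD(1)[OF is_latticeD(5)]
    have 1: "form M x u \<in> \<int>" if *: "\<forall>p\<in>points M \<times> points K. form (M \<oplus>\<^sub>L K) (x, y) p \<in> \<int>" and u: "u \<in> points M" for x y u
      using bspec[OF *, of "(u, 0)"] u z[OF \<open>is_lattice K\<close>] by (simp add: form_simps[OF is_latticeD(1)[OF \<open>is_lattice K\<close>]])
    have 2: "form K y u \<in> \<int>" if *: "\<forall>p\<in>points M \<times> points K. form (M \<oplus>\<^sub>L K) (x, y) p \<in> \<int>" and u: "u \<in> points K" for x y u
      using bspec[OF *, of "(0, u)"] u z[OF \<open>is_lattice M\<close>] by (simp add: form_simps[OF is_latticeD(1)[OF \<open>is_lattice M\<close>]])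
    have "(x, y) \<in> dual_points (M \<oplus>\<^sub>L K) \<longleftrightarrow> x \<in> dual_points M \<and> y \<in> dual_points K" for x y
    proof
      assume "(x, y) \<in> dual_points (M \<oplus>\<^sub>L K)"
      then have "(x, y) \<in> span (points M) \<times> span (points K)" and *: "\<forall>p\<in>points M \<times> points K. form (M \<oplus>\<^sub>L K) (x, y) p \<in> \<int>"
        unfolding dual_points_def points_sum span_sum[OF that, unfolded points_sum] by blast+
      then show "x \<in> dual_points M \<and> y \<in> dual_points K"
        using 1[OF *] 2[OF *] by (simp add: dual_points_def)
    next
      assume "x \<in> dual_points M \<and> y \<in> dual_points K"
      then show "(x, y) \<in> dual_points (M \<oplus>\<^sub>L K)"
        unfolding dual_points_def points_sum span_sum[OF that, unfolded points_sum] by (simp add: Ints_add)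
    qed
    then show ?thesis by auto
  qed
  have FD: "F ` (dual_points M1 \<times> points K1) = dual_points M2 \<times> points K2"
    using isometric_dual_image[OF F(1,3,7)] by (simp add: dual_sum M KL Kd)
  note d1 = additive_subgroupD[OF dual_subgroup[OF M(1)]] and d2 = additive_subgroupD[OF dual_subgroup[OF M(2)]]
  note p1 = additive_subgroupD[OF is_latticeD(5)[OF M(1)]] and p2 = additive_subgroupD[OF is_latticeD(5)[OF M(2)]]
  note k1 = additive_subgroupD[OF is_latticeD(5)[OF KL(1)]] and k2 = additive_subgroupD[OF is_latticeD(5)[OF KL(2)]]
  note pd1 = subsetD[OF points_subset_dual[OF M(1)]] and pd2 = subsetD[OF points_subset_dual[OF M(2)]]
  define R where "R = {(x, y). x \<in> dual_points M1 \<and> y \<in> dual_points M2 \<and> (\<exists>m\<in>points M2. \<exists>l\<in>points K2. F (x, 0) = (y + m, l))}"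
  have RI: "(x, y) \<in> R" if "x \<in> dual_points M1" "y \<in> dual_points M2" "m \<in> points M2" "l \<in> points K2" "F (x, 0) = (y + m, l)" for x y m l
    using that by (auto simp: R_def)
  have RE: "\<exists>m l. x \<in> dual_points M1 \<and> y \<in> dual_points M2 \<and> m \<in> points M2 \<and> l \<in> points K2 \<and> F (x, 0) = (y + m, l)" if "(x, y) \<in> R" for x y
    using that by (auto simp: R_def)
  have Fp: "F (x, k) \<in> points M2 \<times> points K2 \<longleftrightarrow> x \<in> points M1 \<and> k \<in> points K1" if "x \<in> dual_points M1" "k \<in> points K1" for x k
  proof -
    have sp: "(x, k) \<in> span (points (M1 \<oplus>\<^sub>L K1))" using that dual_span unfolding span_sum[OF M(1) KL(1)] by (auto intro: span_base)
    have "(x, k) \<in> points M1 \<times> points K1" if "F (x, k) \<in> points M2 \<times> points K2"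
      using F(4,5) sp that by (metis imageI points_sum)
    moreover have "F (x, k) \<in> points M2 \<times> points K2" if "(x, k) \<in> points M1 \<times> points K1"
      using F(3) that by (metis imageI points_sum)
    ultimately show ?thesis by (metis mem_Sigma_iff)
  qed
  have "glue M1 M2 R" unfolding glue_def
  proof (intro conjI ballI allI impI subsetI)
    show "additive_subgroup R" unfolding additive_subgroup_def
    proof (intro conjI ballI)
      show "0 \<in> R" unfolding zero_prod_def
        by (rule RI[OF d1(1) d2(1) p2(1) k2(1)]) (use linear_0[OF F(1)] in \<open>simp add: zero_prod_def\<close>)
      fix r s assume rs: "r \<in> R" "s \<in> R"
      obtain x y x' y' where r: "r = (x, y)" "s = (x', y')" by (cases r; cases s)
      obtain m l where ml: "x \<in> dual_points M1" "y \<in> dual_points M2" "m \<in> points M2" "l \<in> points K2" "F (x, 0) = (y + m, l)" using RE rs r by blast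
      obtain m' l' where ml': "x' \<in> dual_points M1" "y' \<in> dual_points M2" "m' \<in> points M2" "l' \<in> points K2" "F (x', 0) = (y' + m', l')" using RE rs r by blast
      have "F (x - x', 0) = F (x, 0) - F (x', 0)" by (simp add: linear_diff[OF F(1), symmetric])
      then have "(x - x', y - y') \<in> R"
        by (intro RI[OF d1(2)[OF ml(1) ml'(1)] d2(2)[OF ml(2) ml'(2)] p2(2)[OF ml(3) ml'(3)] k2(2)[OF ml(4) ml'(4)]]) (simp add: ml ml')
      then show "r - s \<in> R" by (simp add: r)
    qed
    fix r assume "r \<in> R" then show "r \<in> dual_points M1 \<times> dual_points M2" by (auto simp: R_def)
  next
    fix x assume x: "x \<in> dual_points M1"
    then have "F (x, 0) \<in> dual_points M2 \<times> points K2" using FD k1(1) by blast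
    then obtain y l where "F (x, 0) = (y + 0, l)" "y \<in> dual_points M2" "l \<in> points K2" by auto
    then show "\<exists>y. (x, y) \<in> R" using RI[OF x _ p2(1)] by blast
  next
    fix y assume y: "y \<in> dual_points M2"
    then have "(y, 0) \<in> F ` (dual_points M1 \<times> points K1)" unfolding FD using k2(1) by blast
    then obtain x k where xk: "F (x, k) = (y, 0)" "x \<in> dual_points M1" "k \<in> points K1" by auto
    \<comment> \<open>The preimage of \<open>(y, 0)\<close> may have a component \<open>k\<close> in
      \<open>K1\<close>; its image is a lattice point, so dropping it does not change the gluing
      relation.\<close>
    have "F (0, k) \<in> points M2 \<times> points K2" using Fp[OF d1(1) xk(3)] p1(1) xk(3) by metis
    then obtain m l where ml: "F (0, k) = (m, l)" "m \<in> points M2" "l \<in> points K2" by auto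
    have "F (x, 0) = F (x, k) - F (0, k)" by (simp add: linear_diff[OF F(1), symmetric])
    then have "F (x, 0) = (y + - m, - l)" by (simp add: xk ml)
    then show "\<exists>x. (x, y) \<in> R" using RI[OF xk(2) y p2(3)[OF ml(2)] k2(3)[OF ml(3)]] by blast
  next
    fix x y assume "(x, y) \<in> R"
    then obtain m l where ml: "x \<in> dual_points M1" "y \<in> dual_points M2" "m \<in> points M2" "l \<in> points K2" "F (x, 0) = (y + m, l)" using RE by blast
    have "x \<in> points M1 \<longleftrightarrow> F (x, 0) \<in> points M2 \<times> points K2" using Fp[OF ml(1) k1(1)] k1(1) by metis
    also have "\<dots> \<longleftrightarrow> y + m \<in> points M2" using ml by simp
    also have "\<dots> \<longleftrightarrow> y \<in> points M2" using p2(4)[of y m] p2(2)[of "y + m" m] ml(3) by auto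
    finally show "x \<in> points M1 \<longleftrightarrow> y \<in> points M2" .
  next
    fix r assume "r \<in> points M1 \<times> points M2"
    then obtain x y where r: "r = (x, y)" "x \<in> points M1" "y \<in> points M2" by auto
    have "F (x, 0) \<in> points M2 \<times> points K2" using Fp[OF pd1[OF r(2)] k1(1)] r k1(1) by metis
    then obtain m l where ml: "F (x, 0) = (m, l)" "m \<in> points M2" "l \<in> points K2" by auto
    show "r \<in> R" unfolding r(1)
      by (rule RI[OF pd1[OF r(2)] pd2[OF r(3)] p2(2)[OF ml(2) r(3)] ml(3)]) (simp add: ml)
  next
    fix x y x' y' assume rs: "(x, y) \<in> R" "(x', y') \<in> R"
    obtain m l where ml: "x \<in> dual_points M1" "y \<in> dual_points M2" "m \<in> points M2" "l \<in> points K2" "F (x, 0) = (y + m, l)" using RE rs by blast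
    obtain m' l' where ml': "x' \<in> dual_points M1" "y' \<in> dual_points M2" "m' \<in> points M2" "l' \<in> points K2" "F (x', 0) = (y' + m', l')" using RE rs by blast
    have sp: "(x, 0) \<in> span (points (M1 \<oplus>\<^sub>L K1))" "(x', 0) \<in> span (points (M1 \<oplus>\<^sub>L K1))"
      unfolding span_sum[OF M(1) KL(1)] using dual_span ml(1) ml'(1) by (auto intro: span_zero)
    have "form M1 x x' = form M2 (y + m) (y' + m') + form K2 l l'"
      using F(7)[OF sp] unfolding ml ml' by (simp add: form_simps[OF is_latticeD(1)[OF KL(1)]])
    also have "\<dots> = form M2 y y' + (form M2 y m' + form M2 m y' + form M2 m m' + form K2 l l')"
      by (simp add: form_simps[OF is_latticeD(1)[OF M(2)]])
    finally show "form M1 x x' - form M2 y y' \<in> \<int>"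
      using dual_form[OF ml(2) ml'(3)] dual_form'[OF M(2) ml'(2) ml(3)] is_latticeD(2)[OF M(2) ml(3) ml'(3)] is_latticeD(2)[OF KL(2) ml(4) ml'(4)]
      by simp
  qed
  then show ?thesis by blast
qed

text \<open>Cramer's rule: the determinant of the Gram matrix annihilates the discriminant
  group.\<close>

lemma scaled_dual:
  assumes "binary M v1 v2 a b c" "x \<in> dual_points M"
  shows "of_int (4 * a * c - b * b) *\<^sub>R x \<in> points M"
proof -
  have M: "is_lattice M" and v: "v1 \<noteq> v2" "points M = int_span {v1, v2}"
    using assms(1) unfolding binary_def even_lattice_def by auto
  have "x \<in> span {v1, v2}" using dual_span[OF assms(2)] by (simp add: v span_int_span)
  then obtain s t where x: "x = s *\<^sub>R v1 + t *\<^sub>R v2" by (auto simp: span_insert span_singleton algebra_simps)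
  have m: "v1 \<in> points M" "v2 \<in> points M" unfolding v by (auto intro: int_span_base)
  note f = binary_form_expand[OF assms(1)]
  obtain k where k: "form M x v1 = of_int k" using dual_form[OF assms(2) m(1)] by (auto elim!: Ints_cases)
  obtain l where l: "form M x v2 = of_int l" using dual_form[OF assms(2) m(2)] by (auto elim!: Ints_cases)
  have k': "2 * of_int a * s + of_int b * t = of_int k" using k f[of s t 1 0] by (simp add: x)
  have l': "of_int b * s + 2 * of_int c * t = of_int l" using l f[of s t 0 1] by (simp add: x)
  have "of_int (4 * a * c - b * b) * s = of_int (2 * c * k - b * l)" unfolding of_int_diff of_int_mult k'[symmetric] l'[symmetric]
    by (simp add: algebra_simps)
  moreover have "of_int (4 * a * c - b * b) * t = of_int (2 * a * l - b * k)" unfolding of_int_diff of_int_mult k'[symmetric] l'[symmetric]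
    by (simp add: algebra_simps)
  ultimately have "of_int (4 * a * c - b * b) *\<^sub>R x = of_int (2 * c * k - b * l) *\<^sub>R v1 + of_int (2 * a * l - b * k) *\<^sub>R v2"
    unfolding x scaleR_add_right scaleR_scaleR by simp
  then show ?thesis unfolding v(2) int_span_pair[OF v(1)] by blast
qed

text \<open>The dual basis \<open>d1\<close>, \<open>d2\<close> is given by the rows of the inverse
  Gram matrix, and pairing with it reads off the coordinates of \<open>y\<close>.\<close>

lemma double_dual:
  assumes "binary M v1 v2 a b c" "4 * a * c - b * b < 0" "y \<in> span (points M)" "\<And>x. x \<in> dual_points M \<Longrightarrow> form M x y \<in> \<int>"
  shows "y \<in> points M"
proof -
  have v: "v1 \<noteq> v2" "points M = int_span {v1, v2}"
    using assms(1) unfolding binary_def even_lattice_def by auto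
  have m: "v1 \<in> span (points M)" "v2 \<in> span (points M)" unfolding v by (auto intro!: span_base int_span_base)
  note f = binary_form_expand[OF assms(1)]
  have "y \<in> span {v1, v2}" using assms(3) by (simp add: v span_int_span)
  then obtain s t where y: "y = s *\<^sub>R v1 + t *\<^sub>R v2" by (auto simp: span_insert span_singleton algebra_simps)
  define \<delta> where "\<delta> = real_of_int (4 * a * c - b * b)"
  have \<delta>: "\<delta> \<noteq> 0" "\<delta> = 4 * of_int a * of_int c - of_int b * of_int b" 
    using assms(2) by (simp_all only: \<delta>_def of_int_eq_0_iff) simp_all
  define d1 where "d1 = (2 * of_int c / \<delta>) *\<^sub>R v1 + (- of_int b / \<delta>) *\<^sub>R v2"
  define d2 where "d2 = (- of_int b / \<delta>) *\<^sub>R v1 + (2 * of_int a / \<delta>) *\<^sub>R v2"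
  have f1: "form M d1 (s' *\<^sub>R v1 + t' *\<^sub>R v2) = s'" for s' t'
  proof -
    have "form M d1 (s' *\<^sub>R v1 + t' *\<^sub>R v2) = (4 * of_int a * of_int c - of_int b * of_int b) * s' / \<delta>"
      unfolding d1_def f using \<delta>(1) by (simp add: field_simps)
    then show ?thesis using \<delta> by simp
  qed
  have f2: "form M d2 (s' *\<^sub>R v1 + t' *\<^sub>R v2) = t'" for s' t'
  proof -
    have "form M d2 (s' *\<^sub>R v1 + t' *\<^sub>R v2) = (4 * of_int a * of_int c - of_int b * of_int b) * t' / \<delta>"
      unfolding d2_def f using \<delta>(1) by (simp add: field_simps)
    then show ?thesis using \<delta> by simp
  qed
  have "d1 \<in> dual_points M" "d2 \<in> dual_points M"
  proof -
    have "d1 \<in> span (points M)" "d2 \<in> span (points M)" unfolding d1_def d2_def by (intro span_add span_scale m)+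
    moreover have "form M d1 x \<in> \<int> \<and> form M d2 x \<in> \<int>" if "x \<in> points M" for x
      using that unfolding v(2) int_span_pair[OF v(1)] by (auto simp: f1 f2)
    ultimately show "d1 \<in> dual_points M" "d2 \<in> dual_points M" unfolding dual_points_def by blast+
  qed
  then have "s \<in> \<int>" "t \<in> \<int>" using assms(4) f1[of s t] f2[of s t] unfolding y by metis+
  then show ?thesis unfolding v(2) int_span_pair[OF v(1)] y by (auto elim!: Ints_cases)
qed

lemma indefinite_value:
  fixes a b c :: int
  assumes "4 * a * c - b * b < 0"
  shows "\<exists>x y. a * x * x + b * x * y + c * y * y > 0"
proof (cases "a = 0")
  case True
  then have "b * b > 0" using assms by simp
  \<comment> \<open>At \<open>(b k, 1)\<close> the value is \<open>b^2 k + c\<close>, and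
    \<open>k > |c|\<close>.\<close>
  define k where "k = \<bar>c\<bar> + 1"
  have "1 * k \<le> b * b * k" using \<open>b * b > 0\<close> by (intro mult_right_mono) (auto simp: k_def)
  then have "k \<le> b * (b * k)" by (simp add: mult.assoc)
  moreover have "c > - k" by (simp add: k_def)
  ultimately have "b * (b * k) + c > 0" by linarith
  then show ?thesis using True by (intro exI[of _ "b * k"] exI[of _ 1]) simp
next
  case False
  show ?thesis
  proof (cases "a > 0")
    case True then show ?thesis by (intro exI[of _ 1] exI[of _ 0]) simp
  next
    case a: False
    \<comment> \<open>For negative \<open>a\<close> the vector orthogonal to the first basis vector
      is taken; its value is \<open>a\<close> times the determinant, a product of two negative
      numbers.\<close>
    have "a * b * b + b * b * (- 2 * a) + c * (- 2 * a) * (- 2 * a) = a * (4 * a * c - b * b)" by (simp add: algebra_simps)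
    also have "\<dots> > 0" using a False assms by (intro mult_neg_neg) auto
    finally show ?thesis by (intro exI[of _ b] exI[of _ "- 2 * a"])
  qed
qed

locale binary_glue =
  fixes M1 :: "'a::real_vector quad_lattice" and M2 :: "'b::real_vector quad_lattice"
    and p1 p2 a1 b1 c1 r1 r2 a2 b2 c2 R
  assumes b1: "binary M1 p1 p2 a1 b1 c1" and n1: "4 * a1 * c1 - b1 * b1 < 0"
    and b2: "binary M2 r1 r2 a2 b2 c2" and n2: "4 * a2 * c2 - b2 * b2 < 0"
    and glue: "glue M1 M2 R"
begin

lemma lattices: "is_lattice M1" "is_lattice M2"
  using b1 b2 by (auto simp: binary_def even_lattice_def)

lemma evens: "x \<in> points M1 \<Longrightarrow> even_real (form M1 x x)" "y \<in> points M2 \<Longrightarrow> even_real (form M2 y y)"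
  using b1 b2 even_latticeD(2) by (auto simp: binary_def)

lemma zero_points: "0 \<in> points M1" "0 \<in> points M2"
  using is_latticeD(5)[OF lattices(1)] is_latticeD(5)[OF lattices(2)] additive_subgroupD(1) by blast+

definition Q :: "'a \<times> 'b \<Rightarrow> 'a \<times> 'b \<Rightarrow> real" where
  "Q = (\<lambda>(x, y) (x', y'). form M1 x x' - form M2 y y')"

definition q :: "4 \<Rightarrow> 'a \<times> 'b" where "q = quad (p1, 0) (p2, 0) (0, r1) (0, r2)"

lemma bilinear_Q: "bilinear Q"
  unfolding bilinear_def Q_def
  by (auto intro!: linearI simp: form_simps[OF is_latticeD(1)[OF lattices(1)]] form_simps[OF is_latticeD(1)[OF lattices(2)]] algebra_simps)

lemma range_q: "range q = (\<lambda>x. (x, 0)) ` {p1, p2} \<union> Pair 0 ` {r1, r2}"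
  unfolding q_def by (auto simp: UNIV_4)

lemma basis_facts:
  "p1 \<noteq> p2" "r1 \<noteq> r2" "independent {p1, p2}" "independent {r1, r2}"
  "points M1 = int_span {p1, p2}" "points M2 = int_span {r1, r2}"
  using b1 b2 unfolding binary_def by auto

lemma independent_range_q: "independent (range q)"
  unfolding range_q by (intro independent_Times basis_facts) auto

lemma inj_q: "inj q"
proof -
  have "p1 \<noteq> 0" "p2 \<noteq> 0" using basis_facts(3) dependent_zero[of "{p1, p2}"] by auto
  then have "card (range q) = 4" unfolding range_q using basis_facts(1,2) by simp
  then show ?thesis by (intro eq_card_imp_inj_on) simp_all
qed

lemma int_span_q: "int_span (range q) = points M1 \<times> points M2"
  unfolding range_q basis_facts(5,6) by (intro int_span_Times basis_facts) auto

sublocale unimodular_22 R Q q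
proof
  note l1 = is_latticeD[OF lattices(1)] and l2 = is_latticeD[OF lattices(2)]
  note G = glueD[OF glue]
  show "bilinear Q" by (rule bilinear_Q)
  show "inj q" by (rule inj_q)
  show "independent (range q)" by (rule independent_range_q)
  show "Q x y = Q y x" if "x \<in> R" "y \<in> R" for x y
  proof -
    obtain u v u' v' where xy: "x = (u, v)" "y = (u', v')" by (cases x; cases y)
    have "form M1 u u' = form M1 u' u" "form M2 v v' = form M2 v' v"
      using that unfolding xy by (meson G(2,3) dual_span lattice_form_commute lattices)+
    then show ?thesis by (simp add: xy Q_def)
  qed
  show "Q x y \<in> \<int>" if "x \<in> R" "y \<in> R" for x y
    using that G(8) by (cases x; cases y) (simp add: Q_def)
  have sub: "points M1 \<times> points M2 \<subseteq> R" using G(7) by auto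
  show "q i \<in> R" for i
    using sub int_span_base[of "range q" "q i"] unfolding int_span_q by auto
  \<comment> \<open>The product of the determinants annihilates both discriminant groups, so
    \<open>R\<close> lies between \<open>M1 \<times> M2\<close> and its multiple by
    \<open>1 / \<delta>\<close>. This bounds its span and yields an integral basis.\<close>
  define \<delta> where "\<delta> = (4 * a1 * c1 - b1 * b1) * (4 * a2 * c2 - b2 * b2)"
  have \<delta>: "\<delta> \<noteq> 0" using n1 n2 by (simp add: \<delta>_def)
  have scaled: "of_int \<delta> *\<^sub>R x \<in> int_span (range q)" if "x \<in> R" for x
  proof -
    obtain u v where x: "x = (u, v)" by (cases x)
    have "of_int (4 * a1 * c1 - b1 * b1) *\<^sub>R u \<in> points M1" "of_int (4 * a2 * c2 - b2 * b2) *\<^sub>R v \<in> points M2"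
      using scaled_dual[OF b1] scaled_dual[OF b2] G(2,3) that unfolding x by blast+
    then have "of_int (4 * a2 * c2 - b2 * b2) *\<^sub>R of_int (4 * a1 * c1 - b1 * b1) *\<^sub>R u \<in> points M1"
      "of_int (4 * a1 * c1 - b1 * b1) *\<^sub>R of_int (4 * a2 * c2 - b2 * b2) *\<^sub>R v \<in> points M2"
      using additive_subgroupD(5) l1(5) l2(5) by blast+
    then show ?thesis unfolding int_span_q x by (simp add: \<delta>_def mult.commute)
  qed
  show "R \<subseteq> span (range q)"
  proof
    fix x assume "x \<in> R"
    then have "(1 / of_int \<delta>) *\<^sub>R of_int \<delta> *\<^sub>R x \<in> span (range q)"
      using scaled int_span_subset_span by (blast intro: span_scale)
    then show "x \<in> span (range q)" using \<delta> by simp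
  qed
  show "\<exists>C. finite C \<and> independent C \<and> R = int_span C"
  proof (rule subgroup_int_span_basis)
    let ?F = "\<lambda>x :: 'a \<times> 'b. (1 / of_int \<delta>) *\<^sub>R x"
    have F: "linear ?F" "inj ?F" using \<delta> by (auto intro!: linearI simp: inj_on_def scaleR_add_right)
    show "finite (?F ` range q)" by simp
    show "independent (?F ` range q)" by (rule linear_independent_injective_image[OF F(1) independent_range_q]) (rule inj_on_subset[OF F(2)], simp)
    show "additive_subgroup R" by (rule G(1))
    have F_span: "int_span (?F ` range q) = ?F ` int_span (range q)"
      by (rule int_span_linear_image[OF F(1)]) (rule inj_on_subset[OF F(2)], simp)
    show "R \<subseteq> int_span (?F ` range q)"
    proof
      fix x assume "x \<in> R"
      then have "?F (of_int \<delta> *\<^sub>R x) \<in> ?F ` int_span (range q)" by (intro imageI scaled)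
      then show "x \<in> int_span (?F ` range q)" unfolding F_span using \<delta> by simp
    qed
  qed
  have m: "p1 \<in> points M1" "p2 \<in> points M1" "r1 \<in> points M2" "r2 \<in> points M2"
    unfolding basis_facts(5,6) by (auto intro: int_span_base)
  show "det (\<chi> i j. Q (q i) (q j)) > 0"
  proof -
    have f: "form M1 p1 p1 = 2 * of_int a1" "form M1 p1 p2 = of_int b1" "form M1 p2 p1 = of_int b1" "form M1 p2 p2 = 2 * of_int c1"
      "form M2 r1 r1 = 2 * of_int a2" "form M2 r1 r2 = of_int b2" "form M2 r2 r1 = of_int b2" "form M2 r2 r2 = 2 * of_int c2"
      using b1 b2 l1(3)[OF m(1,2)] l2(3)[OF m(3,4)] unfolding binary_def by auto
    \<comment> \<open>In rank two the sign change of the second form leaves its determinant alone,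
      so two negative determinants are multiplied.\<close>
    have "det (\<chi> i j. Q (q i) (q j)) = of_int ((4 * a1 * c1 - b1 * b1) * (4 * a2 * c2 - b2 * b2))"
      unfolding det_4 by (simp add: Q_def q_def f form_simps[OF l1(1)] form_simps[OF l2(1)] algebra_simps)
    also have "\<dots> > 0" using mult_neg_neg[OF n1 n2] by (simp only: of_int_0_less_iff)
    finally show ?thesis .
  qed
  have span_q: "span (range q) \<subseteq> span (points M1) \<times> span (points M2)"
    unfolding range_q basis_facts(5,6) by (rule span_minimal) (auto simp: span_int_span intro: span_base span_zero subspace_Times)
  show "x \<in> R" if x: "x \<in> span (range q)" "\<And>y. y \<in> R \<Longrightarrow> Q x y \<in> \<int>" for x
  proof -
    obtain u v where uv: "x = (u, v)" by (cases x)
    have s: "u \<in> span (points M1)" "v \<in> span (points M2)" using x(1) span_q unfolding uv by auto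
    have "form M1 u y \<in> \<int>" if "y \<in> points M1" for y
      using x(2)[OF G(7)[OF that zero_points(2)]] by (simp add: uv Q_def form_simps[OF l2(1)])
    then have u: "u \<in> dual_points M1" using s by (simp add: dual_points_def)
    obtain v' where v': "(u, v') \<in> R" using G(4)[OF u] by blast
    have v's: "v' \<in> span (points M2)" using G(3)[OF v'] dual_span by blast
    \<comment> \<open>After a glue vector with the same first component is subtracted, the rest
      pairs integrally with every dual vector of \<open>M2\<close>, because each of these occurs in
      \<open>R\<close>. Double duality places it in \<open>M2\<close>.\<close>
    have "v - v' \<in> points M2"
    proof (rule double_dual[OF b2 n2])
      show "v - v' \<in> span (points M2)" using s v's by (intro span_diff)
      fix y assume y: "y \<in> dual_points M2"
      then obtain z where z: "(z, y) \<in> R" using G(5) by blast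
      have "(form M1 u z - form M2 v' y) - Q x (z, y) \<in> \<int>" by (rule Ints_diff[OF G(8)[OF v' z] x(2)[OF z]])
      then have "form M2 (v - v') y \<in> \<int>" by (simp add: uv Q_def form_simps[OF l2(1)])
      then show "form M2 y (v - v') \<in> \<int>"
        using lattice_form_commute[OF lattices(2) dual_span[OF y] span_diff[OF s(2) v's]] by simp
    qed
    then have "(u, v') + (0, v - v') \<in> R" using additive_subgroupD(4)[OF G(1) v'] G(7)[OF zero_points(1)] by blast
    then show ?thesis by (simp add: uv)
  qed
  have pt: "of_int s *\<^sub>R p1 + of_int t *\<^sub>R p2 \<in> points M1" for s t
    unfolding basis_facts(5) int_span_pair[OF basis_facts(1)] by blast
  have Qp: "Q (of_int s *\<^sub>R p1 + of_int t *\<^sub>R p2, 0) (of_int s *\<^sub>R p1 + of_int t *\<^sub>R p2, 0) = 2 * of_int (a1 * s * s + b1 * s * t + c1 * t * t)" for s t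
    unfolding Q_def by (simp add: binary_form_expand[OF b1] form_simps[OF l2(1)] algebra_simps)
  \<comment> \<open>Both signs already occur on \<open>M1\<close>, which is indefinite by
    \<open>n1\<close>.\<close>
  show "\<exists>x\<in>R. Q x x > 0"
  proof -
    obtain s t where "a1 * s * s + b1 * s * t + c1 * t * t > 0" using indefinite_value[OF n1] by blast
    then show ?thesis using Qp[of s t] G(7)[OF pt[of s t] zero_points(2)] 
      by (intro bexI[of _ "(of_int s *\<^sub>R p1 + of_int t *\<^sub>R p2, 0)"]) (simp_all del: of_int_add of_int_mult)
  qed
  show "\<exists>x\<in>R. Q x x < 0"
  proof -
    obtain s t where "- a1 * s * s + - b1 * s * t + - c1 * t * t > 0" using indefinite_value[of "- a1" "- c1" "- b1"] n1 by auto
    then have "a1 * s * s + b1 * s * t + c1 * t * t < 0" by simp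
    then show ?thesis using Qp[of s t] G(7)[OF pt[of s t] zero_points(2)] 
      by (intro bexI[of _ "(of_int s *\<^sub>R p1 + of_int t *\<^sub>R p2, 0)"]) (simp_all del: of_int_add of_int_mult)
  qed
qed

text \<open>
  The vector \<open>m z + m' e\<close> is characteristic and isotropic, hence every characteristic vector has
  norm divisible by 8. For a characteristic vector of the form \<open>(2c, 0)\<close> the transvection
  \<open>x \<mapsto> x + 2(c\<cdot>x) c\<close> of the discriminant group corrects the quadratic form.
\<close>

lemma characteristic_vector:
  "\<exists>w\<in>R. Q w w = 0 \<and> (\<forall>x\<in>R. even_real (Q x x - Q w x))"
proof -
  obtain z f e g where z: "z \<in> R" "f \<in> R" "e \<in> R" "g \<in> R"
    "Q z z = 0" "Q z f = 1" "Q e e = 0" "Q e g = 1" "Q z e = 0" "Q z g = 0" "Q f e = 0" "Q f g = 0"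
    "\<And>x. x \<in> R \<Longrightarrow> \<exists>i j k l :: int. x = of_int i *\<^sub>R z + of_int j *\<^sub>R f + of_int k *\<^sub>R e + of_int l *\<^sub>R g"
    using hyperbolic_basis by metis
  note c = commute[OF z(2,1)] commute[OF z(3,1)] commute[OF z(4,1)] commute[OF z(3,2)] commute[OF z(4,2)] commute[OF z(4,3)]
  obtain m m' where m: "Q f f = of_int m" "Q g g = of_int m'" using integral z(2,4) by (meson Ints_cases)
  \<comment> \<open>Only \<open>f\<close> and \<open>g\<close> can have odd norm, so
    \<open>Q x x\<close> has the parity of \<open>m j + m' l\<close>; the coordinates
    \<open>j\<close>, \<open>l\<close> are the pairings with \<open>z\<close> and
    \<open>e\<close>.\<close>
  define w where "w = of_int m *\<^sub>R z + of_int m' *\<^sub>R e"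
  show ?thesis
  proof (intro bexI[of _ w] conjI ballI)
    show "w \<in> R" unfolding w_def by (intro R_closed z)
    show "Q w w = 0" unfolding w_def by (simp add: B_simps z c)
    fix x assume "x \<in> R"
    then obtain i j k l :: int where x: "x = of_int i *\<^sub>R z + of_int j *\<^sub>R f + of_int k *\<^sub>R e + of_int l *\<^sub>R g" using z(13) by blast
    have "Q x x - Q w x = of_int (2 * (i * j) + m * (j * (j - 1)) + 2 * (k * l) + m' * (l * (l - 1)))"
      unfolding w_def x by (simp add: B_simps z c m algebra_simps)
    moreover have "even (2 * (i * j) + m * (j * (j - 1)) + 2 * (k * l) + m' * (l * (l - 1)))" by simp
    ultimately show "even_real (Q x x - Q w x)" by (simp only: even_real_of_int)
  qed
qed

lemma even_glue_exists: "\<exists>R'. even_glue M1 M2 R'"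
proof -
  note l1 = is_latticeD[OF lattices(1)] and l2 = is_latticeD[OF lattices(2)]
  note G = glueD[OF glue]
  note F1 = form_simps[OF l1(1)] and F2 = form_simps[OF l2(1)]
  note D1 = additive_subgroupD[OF dual_subgroup[OF lattices(1)]]
  note P1 = additive_subgroupD[OF l1(5)]
  obtain w where w: "w \<in> R" "Q w w = 0" "\<And>x. x \<in> R \<Longrightarrow> even_real (Q x x - Q w x)" using characteristic_vector by blast
  obtain w1 w2 where w12: "w = (w1, w2)" by (cases w)
  have w12R: "(w1, w2) \<in> R" using w(1) w12 by simp
  have wd: "w1 \<in> dual_points M1" "w2 \<in> dual_points M2" using G(2,3)[OF w12R] .
  \<comment> \<open>Norms on \<open>M1\<close> are even, so a characteristic vector pairs evenly
    with it, and half of its first component is a dual vector.\<close>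
  have "even_real (form M1 w1 x)" if "x \<in> points M1" for x
  proof -
    have "even_real (form M1 x x - form M1 w1 x)" using w(3)[OF G(7)[OF that zero_points(2)]] by (simp add: Q_def w12 F2)
    from even_real_diff[OF evens(1)[OF that] this] show ?thesis by simp
  qed
  then have w1h: "(1 / 2) *\<^sub>R w1 \<in> dual_points M1"
    using dual_span[OF wd(1)] even_real_half unfolding dual_points_def by (auto simp: F1 intro: span_scale)
  have "even_real (form M2 w2 y)" if "y \<in> points M2" for y
  proof -
    have "even_real (- form M2 y y + form M2 w2 y)" using w(3)[OF G(7)[OF zero_points(1) that]] by (simp add: Q_def w12 F1)
    from even_real_add[OF evens(2)[OF that] this] show ?thesis by simp
  qed
  then have "(1 / 2) *\<^sub>R w2 \<in> dual_points M2"
    using dual_span[OF wd(2)] even_real_half unfolding dual_points_def by (auto simp: F2 intro: span_scale)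
  \<comment> \<open>A glue vector over \<open>w2 / 2\<close> lets the second component be removed
    from \<open>w\<close> modulo \<open>2 R\<close>.\<close>
  then obtain d where d: "(d, (1 / 2) *\<^sub>R w2) \<in> R" using G(5) by blast
  define h where "h = (d, (1 / 2) *\<^sub>R w2)"
  have hR: "h \<in> R" using d by (simp add: h_def)
  define c where "c = (1 / 2) *\<^sub>R w1 - d"
  have c_dual: "c \<in> dual_points M1" unfolding c_def using w1h G(2)[OF d] by (intro D1)
  have w': "w - of_int 2 *\<^sub>R h = (2 *\<^sub>R c, 0)" by (simp add: w12 h_def c_def scaleR_diff_right)
  have w'R: "(2 *\<^sub>R c, 0) \<in> R" unfolding w'[symmetric] by (intro R_closed w hR)
  then have c2: "2 *\<^sub>R c \<in> points M1" using glue_swap_points(1)[OF glue lattices] by blast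
  \<comment> \<open>The isotropy of \<open>w\<close> leaves four times \<open>Q h h - Q w h\<close>,
    which is even because \<open>w\<close> is characteristic.\<close>
  have "4 * form M1 c c = Q (2 *\<^sub>R c, 0) (2 *\<^sub>R c, 0)" by (simp add: Q_def F1 F2)
  also have "\<dots> = 4 * (Q h h - Q w h)"
    unfolding w'[symmetric] by (simp add: B_simps w(2) commute[OF hR w(1)] algebra_simps)
  finally have "form M1 c c = Q h h - Q w h" by simp
  then have cc: "even_real (form M1 c c)" using w(3)[OF hR] by simp
  have ch: "even_real (form M1 x x - form M2 y y - 2 * form M1 c x)" if "(x, y) \<in> R" for x y
  proof -
    have "Q (2 *\<^sub>R c, 0) (x, y) = Q w (x, y) - 2 * Q h (x, y)" unfolding w'[symmetric] by (simp add: B_simps)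
    then have "form M1 x x - form M2 y y - 2 * form M1 c x = (Q (x, y) (x, y) - Q w (x, y)) + 2 * Q h (x, y)"
      by (simp add: Q_def F1 F2)
    moreover have "even_real \<dots>" using w(3)[OF that] integral[OF hR that] by (intro even_real_add even_real_2)
    ultimately show ?thesis by simp
  qed
  have c_span: "c \<in> span (points M1)" by (rule dual_span[OF c_dual])
  have cx_int: "2 * form M1 c x \<in> \<int>" if "x \<in> dual_points M1" for x
    using dual_form'[OF lattices(1) that c2] by (simp add: F1)
  have cx_pt: "form M1 c x \<in> \<int>" if "x \<in> points M1" for x using dual_form[OF c_dual that] .
  \<comment> \<open>The transvection acts on the first components of \<open>R\<close>. Its
    coefficient \<open>2 c.x\<close> matters only modulo 2, because \<open>2 c\<close> lies in
    \<open>M1\<close>; allowing every \<open>h\<close> of that parity makes \<open>R'\<close> closed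
    under translation by \<open>2 c\<close>.\<close>
  define R' where "R' = {(x + of_int h *\<^sub>R c, y) |x y h. (x, y) \<in> R \<and> even_real (of_int h - 2 * form M1 c x)}"
  have R'I: "(x + of_int h *\<^sub>R c, y) \<in> R'" if "(x, y) \<in> R" "even_real (of_int h - 2 * form M1 c x)" for x y h
    using that by (auto simp: R'_def)
  have R'E: "\<exists>x h. u = x + of_int h *\<^sub>R c \<and> (x, v) \<in> R \<and> even_real (of_int h - 2 * form M1 c x)" if "(u, v) \<in> R'" for u v
    using that by (auto simp: R'_def)
  have ec: "of_int h *\<^sub>R c \<in> points M1" if "even_real (of_int h)" for h
  proof -
    have "even h" using that even_real_of_int by blast
    then obtain k where "h = 2 * k" by blast
    then show ?thesis using P1(5)[OF c2, of k] by (simp add: mult.commute)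
  qed
  have R'even: "even_real (form M1 u u - form M2 v v)" if "(u, v) \<in> R'" for u v
  proof -
    obtain x h where xh: "u = x + of_int h *\<^sub>R c" "(x, v) \<in> R" "even_real (of_int h - 2 * form M1 c x)" using R'E \<open>(u, v) \<in> R'\<close> by blast
    have xs: "x \<in> span (points M1)" using G(2)[OF xh(2)] dual_span by blast
    \<comment> \<open>The cross term of \<open>x + h c\<close> is \<open>2 h (c.x)\<close>, which
      has the parity of \<open>h^2\<close>, hence of \<open>h\<close>, hence of the defect
      \<open>2 c.x\<close>; the term in \<open>c.c\<close> is even.\<close>
    have "form M1 u u - form M2 v v = (form M1 x x - form M2 v v - 2 * form M1 c x) + form M1 c c * of_int (h * h)
       - (of_int h - 2 * form M1 c x) * of_int (1 + h) + of_int (h * (h + 1))"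
      unfolding xh(1) by (simp add: F1 lattice_form_commute[OF lattices(1) xs c_span] algebra_simps)
    moreover have "even_real (of_int (h * (h + 1)))" unfolding even_real_of_int by simp
    ultimately show ?thesis
      using even_real_mult[OF cc, of "of_int (h * h)"] even_real_mult[OF xh(3), of "of_int (1 + h)"] ch[OF xh(2)]
      by (simp only: even_real_add even_real_diff Ints_of_int)
  qed
  have sub: "additive_subgroup R'" unfolding additive_subgroup_def
  proof (intro conjI ballI)
    have "(0 + of_int 0 *\<^sub>R c, 0) \<in> R'" using G(1)[THEN additive_subgroupD(1)]
      by (intro R'I) (auto simp: zero_prod_def F1 even_real_def intro!: exI[of _ 0])
    then show "0 \<in> R'" by (simp add: zero_prod_def)
    fix r s assume rs: "r \<in> R'" "s \<in> R'"
    obtain u v u' v' where r: "r = (u, v)" "s = (u', v')" by (cases r; cases s)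
    obtain x h where xh: "u = x + of_int h *\<^sub>R c" "(x, v) \<in> R" "even_real (of_int h - 2 * form M1 c x)" using R'E rs r by blast
    obtain x' h' where xh': "u' = x' + of_int h' *\<^sub>R c" "(x', v') \<in> R" "even_real (of_int h' - 2 * form M1 c x')" using R'E rs r by blast
    have "(x - x', v - v') \<in> R" using R_closed(2)[OF xh(2) xh'(2)] by simp
    moreover have "even_real (of_int (h - h') - 2 * form M1 c (x - x'))"
      using even_real_diff[OF xh(3) xh'(3)] by (simp add: F1 algebra_simps)
    ultimately have "((x - x') + of_int (h - h') *\<^sub>R c, v - v') \<in> R'" by (rule R'I)
    then show "r - s \<in> R'" by (simp add: r xh xh' algebra_simps)
  qed
  have mem: "u \<in> points M1 \<longleftrightarrow> v \<in> points M2" "u \<in> dual_points M1" "v \<in> dual_points M2" if "(u, v) \<in> R'" for u v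
  proof -
    obtain x h where xh: "u = x + of_int h *\<^sub>R c" "(x, v) \<in> R" "even_real (of_int h - 2 * form M1 c x)" using R'E \<open>(u, v) \<in> R'\<close> by blast
    show "u \<in> dual_points M1" unfolding xh(1) by (intro D1(4,5) c_dual G(2)[OF xh(2)])
    show "v \<in> dual_points M2" by (rule G(3)[OF xh(2)])
    have h1: "even_real (of_int h)" if "x \<in> points M1"
      using even_real_add[OF xh(3) even_real_2[OF cx_pt[OF that]]] by simp
    have h2: "even_real (of_int h)" if "u \<in> points M1"
    proof -
      have "of_int h = (of_int h - 2 * form M1 c x) + 2 * form M1 c u - form M1 c c * of_int (2 * h)"
        by (simp add: xh(1) F1)
      moreover have "even_real \<dots>"
        by (intro even_real_diff even_real_add xh(3) even_real_2 cx_pt that even_real_mult cc) simp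
      ultimately show ?thesis by metis
    qed
    have "u \<in> points M1 \<longleftrightarrow> x \<in> points M1"
    proof
      assume "u \<in> points M1"
      then have "u - of_int h *\<^sub>R c \<in> points M1" using P1(2) ec h2 by blast
      then show "x \<in> points M1" by (simp add: xh(1))
    next
      assume "x \<in> points M1"
      then show "u \<in> points M1" unfolding xh(1) using P1(4) ec h1 by blast
    qed
    then show "u \<in> points M1 \<longleftrightarrow> v \<in> points M2" using G(6)[OF xh(2)] by blast
  qed
  have "glue M1 M2 R'" unfolding glue_def
  proof (intro conjI ballI allI impI subsetI)
    show "additive_subgroup R'" by (rule sub)
    fix r assume "r \<in> R'" then show "r \<in> dual_points M1 \<times> dual_points M2" using mem by (cases r) auto
  next
    fix u assume u: "u \<in> dual_points M1"
    obtain h where h: "2 * form M1 c u = of_int h" using cx_int[OF u] by (auto elim!: Ints_cases)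
    \<comment> \<open>Modulo \<open>M1\<close> the transvection is its own inverse, since
      \<open>c.c\<close> is even; so \<open>u\<close> is reached from \<open>u - h c\<close> with
      the coefficient computed at \<open>u\<close>.\<close>
    define x where "x = u - of_int h *\<^sub>R c"
    have "x \<in> dual_points M1" unfolding x_def by (intro D1 u c_dual)
    then obtain y where y: "(x, y) \<in> R" using G(4) by blast
    have "of_int h - 2 * form M1 c x = form M1 c c * of_int (2 * h)" by (simp add: x_def F1 h[symmetric] algebra_simps)
    then have "even_real (of_int h - 2 * form M1 c x)" using even_real_mult[OF cc, of "of_int (2 * h)"] by (simp only: Ints_of_int)
    from R'I[OF y this] show "\<exists>y. (u, y) \<in> R'" by (auto simp: x_def)
  next
    fix v assume "v \<in> dual_points M2"
    then obtain x where x: "(x, v) \<in> R" using G(5) by blast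
    obtain h where h: "2 * form M1 c x = of_int h" using cx_int[OF G(2)[OF x]] by (auto elim!: Ints_cases)
    have "even_real (of_int h - 2 * form M1 c x)" by (simp add: h even_real_def)
    from R'I[OF x this] show "\<exists>x. (x, v) \<in> R'" by blast
  next
    show "u \<in> points M1 \<longleftrightarrow> v \<in> points M2" if "(u, v) \<in> R'" for u v using mem(1)[OF that] .
    fix r assume "r \<in> points M1 \<times> points M2"
    then obtain x y where xy: "r = (x, y)" "x \<in> points M1" "y \<in> points M2" by blast
    have "even_real (0 - 2 * form M1 c x)" using even_real_2[of "- form M1 c x"] cx_pt[OF xy(2)] by simp
    then show "r \<in> R'" using R'I[OF G(7)[OF xy(2,3)], of 0] by (simp add: xy(1))
  next
    fix u v u' v' assume rs: "(u, v) \<in> R'" "(u', v') \<in> R'"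
    have "(u + u', v + v') \<in> R'" using additive_subgroupD(4)[OF sub rs] by simp
    have sp: "u \<in> span (points M1)" "u' \<in> span (points M1)" "v \<in> span (points M2)" "v' \<in> span (points M2)"
      using mem(2,3)[OF rs(1)] mem(2,3)[OF rs(2)] dual_span by blast+
    have "form M1 u u' - form M2 v v' = ((form M1 (u + u') (u + u') - form M2 (v + v') (v + v')) - (form M1 u u - form M2 v v) - (form M1 u' u' - form M2 v' v')) / 2"
      by (simp add: F1 F2 lattice_form_commute[OF lattices(1) sp(1,2)] lattice_form_commute[OF lattices(2) sp(3,4)])
    also have "\<dots> \<in> \<int>"
      by (intro even_real_half even_real_diff R'even rs \<open>(u + u', v + v') \<in> R'\<close>)
    finally show "form M1 u u' - form M2 v v' \<in> \<int>" .
  qed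
  then show ?thesis using R'even unfolding even_glue_def by blast
qed

text \<open>An even \<open>R\<close> is U^2 itself. Vectors of \<open>R\<close> with first component
  0 are exactly the points of \<open>M2\<close>, which makes that copy saturated; orthogonality to
  it forces the second component to vanish by nondegeneracy, so its complement is
  \<open>M1\<close>.\<close>

lemma even_glue_embedding:
  assumes "even_glue M1 M2 R"
  shows "\<exists>\<iota>. primitive_embedding \<iota> (neg_lattice M2) (hyp_plane \<oplus>\<^sub>L hyp_plane) \<and>
     M1 \<cong>\<^sub>L ortho_compl (\<iota> ` points M2) (hyp_plane \<oplus>\<^sub>L hyp_plane)"
proof -
  note l1 = is_latticeD[OF lattices(1)] and l2 = is_latticeD[OF lattices(2)]
  note F1 = form_simps[OF l1(1)] and F2 = form_simps[OF l2(1)]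
  note G = glueD[OF glue]
  let ?U = "hyp_plane \<oplus>\<^sub>L hyp_plane"
  obtain z f e g where z: "z \<in> R" "f \<in> R" "e \<in> R" "g \<in> R"
    "Q z z = 0" "Q z f = 1" "Q e e = 0" "Q e g = 1" "Q z e = 0" "Q z g = 0" "Q f e = 0" "Q f g = 0"
    "\<And>x. x \<in> R \<Longrightarrow> \<exists>i j k l :: int. x = of_int i *\<^sub>R z + of_int j *\<^sub>R f + of_int k *\<^sub>R e + of_int l *\<^sub>R g"
    using hyperbolic_basis by metis
  note c = commute[OF z(2,1)] commute[OF z(3,1)] commute[OF z(4,1)] commute[OF z(3,2)] commute[OF z(4,2)] commute[OF z(4,3)]
  have ev: "even_real (Q x x)" if "x \<in> R" for x
    using assms that unfolding even_glue_def by (cases x) (auto simp: Q_def)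
  obtain m m' where m: "Q f f = 2 * of_int m" "Q g g = 2 * of_int m'" using ev z(2,4) unfolding even_real_def by meson
  \<comment> \<open>Half the norm is an integer because \<open>R\<close> is even, so
    \<open>f\<close> can be made isotropic inside \<open>R\<close>; likewise
    \<open>g\<close>.\<close>
  define f' where "f' = f - of_int m *\<^sub>R z"
  define g' where "g' = g - of_int m' *\<^sub>R e"
  have fgR: "f' \<in> R" "g' \<in> R" unfolding f'_def g'_def by (intro R_closed z)+
  have Qf: "Q z f' = 1" "Q f' f' = 0" "Q e g' = 1" "Q g' g' = 0" "Q z g' = 0" "Q f' e = 0" "Q f' g' = 0"
    unfolding f'_def g'_def by (simp_all add: B_simps z c m)
  note c' = commute[OF fgR(1) z(1)] commute[OF z(3,1)] commute[OF fgR(2) z(1)] commute[OF z(3) fgR(1)] commute[OF fgR(2,1)] commute[OF fgR(2) z(3)]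
  \<comment> \<open>Coordinates in a hyperbolic basis are pairings with the partner vector, which
    explains the crossed order.\<close>
  define \<psi> where "\<psi> x = ((Q x f', Q x z), (Q x g', Q x e))" for x
  define \<phi> where "\<phi> = (\<lambda>((i, j), (k, l)). i *\<^sub>R z + j *\<^sub>R f' + k *\<^sub>R e + l *\<^sub>R g')"
  have \<psi>\<phi>: "\<psi> (\<phi> p) = p" for p
    by (auto simp: \<psi>_def \<phi>_def B_simps Qf c' z split: prod.splits)
  have \<phi>R: "\<phi> p \<in> R" if "p \<in> points ?U" for p
    using that by (auto simp: \<phi>_def intro!: R_closed(4) R_scale z fgR)
  have \<psi>p: "\<psi> x \<in> points ?U" if "x \<in> R" for x
    using that by (auto simp: \<psi>_def intro!: integral z fgR)
  have \<phi>\<psi>: "\<phi> (\<psi> x) = x" if xR: "x \<in> R" for x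
  proof -
    obtain i j k l :: int where x: "x = of_int i *\<^sub>R z + of_int j *\<^sub>R f + of_int k *\<^sub>R e + of_int l *\<^sub>R g" using z(13)[OF xR] by blast
    have "x = \<phi> ((of_int i + of_int j * of_int m, of_int j), (of_int k + of_int l * of_int m', of_int l))"
      unfolding x \<phi>_def f'_def g'_def by (simp add: algebra_simps)
    then show ?thesis using \<psi>\<phi> by metis
  qed
  have \<psi>f: "form ?U (\<psi> x) (\<psi> y) = Q x y" if "x \<in> R" "y \<in> R" for x y
  proof -
    have "Q x y = Q (\<phi> (\<psi> x)) y" by (simp add: \<phi>\<psi> that)
    also have "\<dots> = Q x f' * Q z y + Q x z * Q f' y + Q x g' * Q e y + Q x e * Q g' y"
      by (simp add: \<phi>_def \<psi>_def B_simps)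
    finally show ?thesis using commute[OF z(1) that(2)] commute[OF fgR(1) that(2)] commute[OF z(3) that(2)] commute[OF fgR(2) that(2)]
      by (simp add: \<psi>_def)
  qed
  have \<psi>a: "\<psi> (x + y) = \<psi> x + \<psi> y" for x y by (simp add: \<psi>_def B_simps)
  have \<psi>s: "\<psi> (t *\<^sub>R x) = t *\<^sub>R \<psi> x" for t x by (simp add: \<psi>_def B_simps)
  have \<psi>i: "x = y" if "x \<in> R" "y \<in> R" "\<psi> x = \<psi> y" for x y using \<phi>\<psi> that by metis
  have in1: "(x, 0) \<in> R \<longleftrightarrow> x \<in> points M1" and in2: "(0, y) \<in> R \<longleftrightarrow> y \<in> points M2" for x y
    using glue_swap_points[OF glue lattices] by blast+
  define \<iota> where "\<iota> y = \<psi> (0, y)" for y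
  have "lattice_embedding \<iota> (neg_lattice M2) ?U" unfolding lattice_embedding_def
  proof (intro conjI ballI inj_onI)
    show "\<iota> ` points (neg_lattice M2) \<subseteq> points ?U" unfolding \<iota>_def by (intro image_subsetI \<psi>p) (simp add: in2)
    show "x = y" if "x \<in> points (neg_lattice M2)" "y \<in> points (neg_lattice M2)" "\<iota> x = \<iota> y" for x y
      using \<psi>i[of "(0, x)" "(0, y)"] that in2 unfolding \<iota>_def by auto
    show "\<iota> (x + y) = \<iota> x + \<iota> y" for x y unfolding \<iota>_def \<psi>a[symmetric] by simp
    show "form ?U (\<iota> x) (\<iota> y) = form (neg_lattice M2) x y" if "x \<in> points (neg_lattice M2)" "y \<in> points (neg_lattice M2)" for x y
      using \<psi>f[of "(0, x)" "(0, y)"] that in2 unfolding \<iota>_def by (simp add: Q_def F1)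
  qed
  moreover have "p \<in> \<iota> ` points M2" if p: "p \<in> points ?U" "n > 0" "of_nat n *\<^sub>R p \<in> \<iota> ` points M2" for p and n :: nat
  proof -
    obtain y where y: "y \<in> points M2" "of_nat n *\<^sub>R p = \<iota> y" using p(3) by blast
    obtain u v where uv: "\<phi> p = (u, v)" by (cases "\<phi> p")
    have uvR: "(u, v) \<in> R" using \<phi>R[OF p(1)] uv by simp
    have p_eq: "p = \<psi> (u, v)" using \<psi>\<phi>[of p] uv by simp
    have "\<psi> (of_nat n *\<^sub>R (u, v)) = \<psi> (0, y)" unfolding \<psi>s p_eq[symmetric] y(2) \<iota>_def ..
    moreover have "of_int (int n) *\<^sub>R (u, v) \<in> R" by (rule R_closed(5)[OF uvR])
    ultimately have "of_nat n *\<^sub>R (u, v) = (0, y)" using \<psi>i[of "of_nat n *\<^sub>R (u, v)" "(0, y)"] in2 y(1) by simp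
    then have "u = 0" using p(2) by simp
    then have "v \<in> points M2" using uvR in2 by simp
    then show ?thesis unfolding p_eq \<iota>_def using \<open>u = 0\<close> by blast
  qed
  ultimately have "primitive_embedding \<iota> (neg_lattice M2) ?U" unfolding primitive_embedding_def by auto
  moreover have "M1 \<cong>\<^sub>L ortho_compl (\<iota> ` points M2) ?U"
    unfolding isometric_def
  proof (intro exI conjI)
    let ?\<kappa> = "\<lambda>x. \<psi> (x, 0)"
    have im: "?\<kappa> ` points M1 = points (ortho_compl (\<iota> ` points M2) ?U)"
    proof (intro equalityI subsetI)
      fix p assume "p \<in> ?\<kappa> ` points M1"
      then obtain x where x: "x \<in> points M1" "p = \<psi> (x, 0)" by blast
      have "form ?U p (\<iota> y) = 0" if "y \<in> points M2" for y
        using \<psi>f[of "(x, 0)" "(0, y)"] that x in1 in2 unfolding \<iota>_def by (simp add: Q_def F1 F2)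
      then show "p \<in> points (ortho_compl (\<iota> ` points M2) ?U)"
        using \<psi>p[of "(x, 0)"] x in1 unfolding ortho_compl_def by auto
    next
      fix p assume p: "p \<in> points (ortho_compl (\<iota> ` points M2) ?U)"
      then have pU: "p \<in> points ?U" and po: "form ?U p (\<iota> y) = 0" if "y \<in> points M2" for y
        using that unfolding ortho_compl_def by auto
      have pU: "p \<in> points ?U" using p unfolding ortho_compl_def by simp
      obtain u v where uv: "\<phi> p = (u, v)" by (cases "\<phi> p")
      have uvR: "(u, v) \<in> R" using \<phi>R[OF pU] uv by simp
      have p_eq: "p = \<psi> (u, v)" using \<psi>\<phi>[of p] uv by simp
      have "form M2 v y = 0" if "y \<in> points M2" for y
        using po[OF that] \<psi>f[OF uvR, of "(0, y)"] that in2 unfolding p_eq \<iota>_def by (simp add: Q_def F1)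
      then have v_ort: "form M2 v y = 0" if "y \<in> span (points M2)" for y
        using linear_eq_0_on_span[of "form M2 v" "points M2" y] that l2(1) unfolding bilinear_def by blast
      have vs: "v \<in> span (points M2)" using G(3)[OF uvR] dual_span by blast
      have "of_int (4 * a2 * c2 - b2 * b2) *\<^sub>R v \<in> points M2" by (rule scaled_dual[OF b2 G(3)[OF uvR]])
      then have "of_int (4 * a2 * c2 - b2 * b2) *\<^sub>R v = 0"
        by (rule l2(4)) (use v_ort in \<open>simp add: F2 span_base\<close>)
      moreover have "4 * a2 * c2 - b2 * b2 \<noteq> 0" using n2 by linarith
      ultimately have "v = 0" by (metis scaleR_eq_0_iff of_int_eq_0_iff)
      then show "p \<in> ?\<kappa> ` points M1" using uvR in1 unfolding p_eq by blast
    qed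
    then show "?\<kappa> ` points M1 = points (ortho_compl (\<iota> ` points M2) ?U)" .
    show "lattice_embedding ?\<kappa> M1 (ortho_compl (\<iota> ` points M2) ?U)" unfolding lattice_embedding_def
    proof (intro conjI ballI inj_onI)
      show "?\<kappa> ` points M1 \<subseteq> points (ortho_compl (\<iota> ` points M2) ?U)" using im by simp
      show "x = y" if "x \<in> points M1" "y \<in> points M1" "\<psi> (x, 0) = \<psi> (y, 0)" for x y
        using \<psi>i[of "(x, 0)" "(y, 0)"] that in1 by auto
      show "\<psi> (x + y, 0) = \<psi> (x, 0) + \<psi> (y, 0)" for x y unfolding \<psi>a[symmetric] by simp
      show "form (ortho_compl (\<iota> ` points M2) ?U) (\<psi> (x, 0)) (\<psi> (y, 0)) = form M1 x y" if "x \<in> points M1" "y \<in> points M1" for x y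
        using \<psi>f[of "(x, 0)" "(y, 0)"] that in1 by (simp add: ortho_compl_def Q_def F2)
    qed
  qed
  ultimately show ?thesis by blast
qed

end

section \<open>Discriminant forms\<close>

definition lattice_coset :: "'a::real_vector quad_lattice \<Rightarrow> 'a \<Rightarrow> 'a set" where
  "lattice_coset M x = (\<lambda>h. h + x) ` points M"

lemma lattice_coset_eq:
  assumes "additive_subgroup (points M)"
  shows "lattice_coset M x = lattice_coset M y \<longleftrightarrow> x - y \<in> points M"
proof
  assume "lattice_coset M x = lattice_coset M y"
  moreover have "x \<in> lattice_coset M x" unfolding lattice_coset_def
    using additive_subgroupD(1)[OF assms] by (intro image_eqI[of _ _ 0]) auto
  ultimately obtain h where "h \<in> points M" "x = h + y" unfolding lattice_coset_def by blast
  then show "x - y \<in> points M" by simp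
next
  assume d: "x - y \<in> points M"
  have sub: "lattice_coset M x \<subseteq> lattice_coset M y" if "x - y \<in> points M" for x y
    unfolding lattice_coset_def
  proof clarify
    fix h assume "h \<in> points M"
    then have "h + (x - y) \<in> points M" using additive_subgroupD(4)[OF assms] that by blast
    then show "h + x \<in> (\<lambda>h. h + y) ` points M" by (intro image_eqI[of _ _ "h + (x - y)"]) auto
  qed
  have "y - x \<in> points M" using additive_subgroupD(3)[OF assms d] by simp
  then show "lattice_coset M x = lattice_coset M y" using sub d by blast
qed

lemma carrier_disc_group: "carrier (disc_group M) = lattice_coset M ` dual_points M"
  unfolding disc_group_def FactGroup_def RCOSETS_def r_coset_def lattice_coset_def by auto

lemma mult_disc_group:
  assumes "additive_subgroup (points M)"
  shows "lattice_coset M x \<otimes>\<^bsub>disc_group M\<^esub> lattice_coset M y = lattice_coset M (x + y)"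
proof -
  note S = additive_subgroupD[OF assms]
  have "(\<Union>h\<in>lattice_coset M x. \<Union>k\<in>lattice_coset M y. {h + k}) = lattice_coset M (x + y)"
  proof (intro equalityI subsetI)
    fix z assume "z \<in> (\<Union>h\<in>lattice_coset M x. \<Union>k\<in>lattice_coset M y. {h + k})"
    then obtain h k where "h \<in> points M" "k \<in> points M" "z = (h + x) + (k + y)" unfolding lattice_coset_def by blast
    then have "h + k \<in> points M" "z = (h + k) + (x + y)" using S(4) by auto
    then show "z \<in> lattice_coset M (x + y)" unfolding lattice_coset_def by blast
  next
    fix z assume "z \<in> lattice_coset M (x + y)"
    then obtain h where h: "h \<in> points M" "z = h + (x + y)" unfolding lattice_coset_def by blast
    then have "z = (h + x) + (0 + y)" by simp
    moreover have "h + x \<in> lattice_coset M x" "0 + y \<in> lattice_coset M y" using h S(1) unfolding lattice_coset_def by blast+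
    ultimately show "z \<in> (\<Union>h\<in>lattice_coset M x. \<Union>k\<in>lattice_coset M y. {h + k})" by blast
  qed
  then show ?thesis unfolding disc_group_def FactGroup_def set_mult_def by simp
qed

text \<open>Changing the representative by a lattice vector \<open>h\<close> adds the norm of
  \<open>h\<close> and twice an integral pairing, both even.\<close>

lemma disc_form_coset:
  assumes "even_lattice M" "x \<in> dual_points M"
  shows "disc_form M (lattice_coset M x) = {t. even_real (t - form M x x)}"
proof (intro equalityI subsetI)
  note M = even_latticeD(1)[OF assms(1)]
  fix t assume "t \<in> disc_form M (lattice_coset M x)"
  then obtain h k where h: "h \<in> points M" "t = form M (h + x) (h + x) + 2 * of_int k"
    unfolding disc_form_def lattice_coset_def by auto
  have "t - form M x x = form M h h + 2 * form M x h + 2 * of_int k"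
    unfolding h(2) using lattice_form_commute[OF M span_base[OF h(1)] dual_span[OF assms(2)]]
    by (simp add: form_simps[OF is_latticeD(1)[OF M]])
  moreover have "even_real \<dots>"
    by (intro even_real_add even_real_2 even_latticeD(2)[OF assms(1)] h dual_form[OF assms(2)] Ints_of_int)
  ultimately show "t \<in> {t. even_real (t - form M x x)}" by simp
next
  note M = even_latticeD(1)[OF assms(1)]
  fix t assume "t \<in> {t. even_real (t - form M x x)}"
  then obtain k where "t - form M x x = 2 * of_int k" by (auto simp: even_real_def)
  then have "t = form M x x + 2 * of_int k" by simp
  moreover have "x \<in> lattice_coset M x" unfolding lattice_coset_def
    using additive_subgroupD(1)[OF is_latticeD(5)[OF M]] by (intro image_eqI[of _ _ 0]) auto
  ultimately show "t \<in> disc_form M (lattice_coset M x)" unfolding disc_form_def by blast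
qed

lemma disc_form_coset_eq:
  assumes "even_lattice M1" "even_lattice M2" "x \<in> dual_points M1" "y \<in> dual_points M2"
  shows "disc_form M1 (lattice_coset M1 x) = disc_form M2 (lattice_coset M2 y) \<longleftrightarrow> even_real (form M1 x x - form M2 y y)"
  unfolding disc_form_coset[OF assms(1,3)] disc_form_coset[OF assms(2,4)]
proof
  assume "{t. even_real (t - form M1 x x)} = {t. even_real (t - form M2 y y)}"
  moreover have "form M1 x x \<in> {t. even_real (t - form M1 x x)}" by (simp add: even_real_def)
  ultimately show "even_real (form M1 x x - form M2 y y)" by blast
next
  assume e: "even_real (form M1 x x - form M2 y y)"
  have "even_real (t - form M2 y y)" if "even_real (t - form M1 x x)" for t
    using even_real_add[OF that e] by simp
  moreover have "even_real (t - form M1 x x)" if "even_real (t - form M2 y y)" for t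
    using even_real_diff[OF that e] by simp
  ultimately show "{t. even_real (t - form M1 x x)} = {t. even_real (t - form M2 y y)}" by blast
qed

text \<open>Integrality of the bilinear form need not be checked separately: it is half of an even
  number by polarization.\<close>

lemma even_glueI:
  assumes M: "is_lattice M1" "is_lattice M2"
    and sub: "additive_subgroup R" and R: "R \<subseteq> dual_points M1 \<times> dual_points M2"
    and s1: "\<And>x. x \<in> dual_points M1 \<Longrightarrow> \<exists>y. (x, y) \<in> R" and s2: "\<And>y. y \<in> dual_points M2 \<Longrightarrow> \<exists>x. (x, y) \<in> R"
    and p: "\<And>x y. (x, y) \<in> R \<Longrightarrow> x \<in> points M1 \<longleftrightarrow> y \<in> points M2" and pp: "points M1 \<times> points M2 \<subseteq> R"
    and e: "\<And>x y. (x, y) \<in> R \<Longrightarrow> even_real (form M1 x x - form M2 y y)"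
  shows "even_glue M1 M2 R"
  unfolding even_glue_def glue_def
proof (intro conjI ballI allI impI)
  fix u v u' v' assume rs: "(u, v) \<in> R" "(u', v') \<in> R"
  have a: "(u + u', v + v') \<in> R" using additive_subgroupD(4)[OF sub rs] by simp
  have sp: "u \<in> span (points M1)" "u' \<in> span (points M1)" "v \<in> span (points M2)" "v' \<in> span (points M2)"
    using R rs dual_span by blast+
  have "form M1 u u' - form M2 v v' = ((form M1 (u + u') (u + u') - form M2 (v + v') (v + v')) - (form M1 u u - form M2 v v) - (form M1 u' u' - form M2 v' v')) / 2"
    by (simp add: form_simps[OF is_latticeD(1)[OF M(1)]] form_simps[OF is_latticeD(1)[OF M(2)]] lattice_form_commute[OF M(1) sp(1,2)] lattice_form_commute[OF M(2) sp(3,4)])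
  also have "\<dots> \<in> \<int>" by (intro even_real_half even_real_diff e rs a)
  finally show "form M1 u u' - form M2 v v' \<in> \<int>" .
qed (use assms in auto)

text \<open>\<open>R\<close> is the graph of \<open>f\<close> pulled back to the dual lattices.
  Injectivity and surjectivity of \<open>f\<close> give the conditions on points and on second
  components.\<close>

lemma disc_forms_isomorphic_imp_even_glue:
  assumes M: "even_lattice M1" "even_lattice M2" and "disc_forms_isomorphic M1 M2"
  shows "\<exists>R. even_glue M1 M2 R"
proof -
  obtain f where f: "f \<in> iso (disc_group M1) (disc_group M2)"
    and q: "\<And>a. a \<in> carrier (disc_group M1) \<Longrightarrow> disc_form M1 a = disc_form M2 (f a)"
    using assms(3) unfolding disc_forms_isomorphic_def by blast
  note L1 = even_latticeD(1)[OF M(1)] and L2 = even_latticeD(1)[OF M(2)]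
  note S1 = is_latticeD(5)[OF L1] and S2 = is_latticeD(5)[OF L2]
  note D1 = additive_subgroupD[OF dual_subgroup[OF L1]] and D2 = additive_subgroupD[OF dual_subgroup[OF L2]]
  note pd1 = subsetD[OF points_subset_dual[OF L1]] and pd2 = subsetD[OF points_subset_dual[OF L2]]
  let ?c1 = "lattice_coset M1" and ?c2 = "lattice_coset M2"
  have bij: "bij_betw f (?c1 ` dual_points M1) (?c2 ` dual_points M2)"
    using f by (simp add: iso_def carrier_disc_group)
  have hom: "f (?c1 (x + y)) = f (?c1 x) \<otimes>\<^bsub>disc_group M2\<^esub> f (?c1 y)" if "x \<in> dual_points M1" "y \<in> dual_points M1" for x y
    using f that hom_mult[of f "disc_group M1" "disc_group M2" "?c1 x" "?c1 y"]
    by (simp add: iso_def carrier_disc_group mult_disc_group[OF S1])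
  define R where "R = {(x, y). x \<in> dual_points M1 \<and> y \<in> dual_points M2 \<and> f (?c1 x) = ?c2 y}"
  have RI: "(x, y) \<in> R" if "x \<in> dual_points M1" "y \<in> dual_points M2" "f (?c1 x) = ?c2 y" for x y using that by (simp add: R_def)
  have RD: "x \<in> dual_points M1" "y \<in> dual_points M2" "f (?c1 x) = ?c2 y" if "(x, y) \<in> R" for x y using that by (simp_all add: R_def)
  have ex: "\<exists>y. (x, y) \<in> R" if "x \<in> dual_points M1" for x
    using bij_betw_apply[OF bij imageI[OF that]] RI[OF that] by blast
  have f_add: "f (?c1 (x + x')) = ?c2 (y + y')" if "(x, y) \<in> R" "(x', y') \<in> R" for x y x' y'
    using hom[of x x'] RD[OF that(1)] RD[OF that(2)] by (simp add: mult_disc_group[OF S2])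
  have diff: "(x - x', y - y') \<in> R" if r: "(x, y) \<in> R" "(x', y') \<in> R" for x y x' y'
  proof -
    have d: "x - x' \<in> dual_points M1" by (rule D1(2)[OF RD(1)[OF r(1)] RD(1)[OF r(2)]])
    then obtain v where v: "(x - x', v) \<in> R" using ex by blast
    \<comment> \<open>Additivity of \<open>f\<close> identifies the class of any partner
      \<open>v\<close> of the difference with that of \<open>y - y'\<close>, without speaking of
      inverses in the quotient group.\<close>
    have "?c2 y = ?c2 (v + y')" using f_add[OF v r(2)] RD(3)[OF r(1)] by simp
    then have "?c2 v = ?c2 (y - y')" unfolding lattice_coset_eq[OF S2] using additive_subgroupD(3)[OF S2] by (metis diff_diff_eq2 minus_diff_eq add.commute)
    then show ?thesis using RD(3)[OF v] by (intro RI d D2(2)[OF RD(2)[OF r(1)] RD(2)[OF r(2)]]) simp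
  qed
  have zero: "(0, 0) \<in> R"
  proof -
    obtain y where y: "(0, y) \<in> R" using ex[OF D1(1)] by blast
    from diff[OF this this] show ?thesis by simp
  qed
  have f0: "f (?c1 0) = ?c2 0" by (rule RD(3)[OF zero])
  have pts: "x \<in> points M1 \<longleftrightarrow> ?c1 x = ?c1 0" "y \<in> points M2 \<longleftrightarrow> ?c2 y = ?c2 0" for x y
    unfolding lattice_coset_eq[OF S1] lattice_coset_eq[OF S2] by simp_all
  have "even_glue M1 M2 R"
  proof (rule even_glueI[OF L1 L2])
    show "additive_subgroup R" unfolding additive_subgroup_def using zero diff by (auto simp: zero_prod_def)
    show "R \<subseteq> dual_points M1 \<times> dual_points M2" using RD by auto
    show "\<exists>y. (x, y) \<in> R" if "x \<in> dual_points M1" for x by (rule ex[OF that])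
    show "\<exists>x. (x, y) \<in> R" if "y \<in> dual_points M2" for y
    proof -
      have "?c2 y \<in> f ` ?c1 ` dual_points M1" unfolding bij_betw_imp_surj_on[OF bij] using that by (rule imageI)
      then obtain x where "x \<in> dual_points M1" "?c2 y = f (?c1 x)" by (elim imageE) simp
      then show ?thesis using RI[OF _ that, of x] by (intro exI[of _ x]) simp
    qed
    show "x \<in> points M1 \<longleftrightarrow> y \<in> points M2" if "(x, y) \<in> R" for x y
    proof -
      have "x \<in> points M1 \<longleftrightarrow> f (?c1 x) = f (?c1 0)"
        unfolding pts using inj_on_eq_iff[OF bij_betw_imp_inj_on[OF bij], of "?c1 x" "?c1 0"] RD(1)[OF that] D1(1) by blast
      then show ?thesis unfolding f0 RD(3)[OF that] pts .
    qed
    show "points M1 \<times> points M2 \<subseteq> R"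
    proof clarify
      fix x y assume xy: "x \<in> points M1" "y \<in> points M2"
      then have "?c1 x = ?c1 0" "?c2 y = ?c2 0" using pts by blast+
      then show "(x, y) \<in> R" using f0 pd1 pd2 xy by (intro RI) auto
    qed
    show "even_real (form M1 x x - form M2 y y)" if "(x, y) \<in> R" for x y
      using q[of "?c1 x"] RD[OF that] disc_form_coset_eq[OF M RD(1,2)[OF that]] by (simp add: carrier_disc_group)
  qed
  then show ?thesis by blast
qed

text \<open>\<open>R\<close> contains \<open>M1 \<times> M2\<close>, so its relational image of a
  class is a whole class, and \<open>Image R\<close> is the isomorphism without any choice of
  representatives.\<close>

lemma even_glue_imp_disc_forms_isomorphic:
  assumes M: "even_lattice M1" "even_lattice M2" and R: "even_glue M1 M2 R"
  shows "disc_forms_isomorphic M1 M2"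
proof -
  have g: "glue M1 M2 R" and e: "\<And>x y. (x, y) \<in> R \<Longrightarrow> even_real (form M1 x x - form M2 y y)"
    using R by (auto simp: even_glue_def)
  note G = glueD[OF g]
  note L1 = even_latticeD(1)[OF M(1)] and L2 = even_latticeD(1)[OF M(2)]
  note S1 = is_latticeD(5)[OF L1] and S2 = is_latticeD(5)[OF L2]
  note D1 = additive_subgroupD[OF dual_subgroup[OF L1]]
  note RS = additive_subgroupD[OF G(1)]
  let ?c1 = "lattice_coset M1" and ?c2 = "lattice_coset M2"
  note in1 = glue_swap_points(1)[OF g L1 L2] and in2 = glue_swap_points(2)[OF g L1 L2]
  define f where "f = Image R"
  have f: "f (?c1 x) = ?c2 y" if r: "(x, y) \<in> R" for x y
  proof (intro equalityI subsetI)
    fix v assume "v \<in> f (?c1 x)"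
    then obtain h where h: "h \<in> points M1" "(h + x, v) \<in> R" unfolding f_def lattice_coset_def by auto
    have "(h + x, v) - (x, y) - (h, 0) \<in> R" using in1 h by (intro RS r) auto
    then have "v - y \<in> points M2" using in2 by simp
    then show "v \<in> ?c2 y" unfolding lattice_coset_def by (intro image_eqI[of _ _ "v - y"]) auto
  next
    fix v assume "v \<in> ?c2 y"
    then obtain h where h: "h \<in> points M2" "v = h + y" unfolding lattice_coset_def by blast
    have "(0, h) + (x, y) \<in> R" using in2 h by (intro RS r) auto
    then show "v \<in> f (?c1 x)" unfolding f_def lattice_coset_def h(2)
      using additive_subgroupD(1)[OF S1] by (auto intro!: ImageI[of x] image_eqI[of _ _ 0])
  qed
  have "bij_betw f (?c1 ` dual_points M1) (?c2 ` dual_points M2)" unfolding bij_betw_def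
  proof
    show "inj_on f (?c1 ` dual_points M1)"
    proof (intro inj_onI)
      fix a b assume ab: "a \<in> ?c1 ` dual_points M1" "b \<in> ?c1 ` dual_points M1" "f a = f b"
      then obtain x x' where x: "a = ?c1 x" "x \<in> dual_points M1" "b = ?c1 x'" "x' \<in> dual_points M1" by blast
      obtain y y' where y: "(x, y) \<in> R" "(x', y') \<in> R" using G(4) x by meson
      have "y - y' \<in> points M2" using ab(3) unfolding x f[OF y(1)] f[OF y(2)] lattice_coset_eq[OF S2] .
      moreover have "(x - x', y - y') \<in> R" using RS(2)[OF y] by simp
      ultimately have "x - x' \<in> points M1" using G(6) by blast
      then show "a = b" unfolding x lattice_coset_eq[OF S1] .
    qed
    show "f ` ?c1 ` dual_points M1 = ?c2 ` dual_points M2"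
    proof (intro equalityI subsetI)
      fix b assume "b \<in> f ` ?c1 ` dual_points M1"
      then obtain x where "x \<in> dual_points M1" "b = f (?c1 x)" by blast
      then show "b \<in> ?c2 ` dual_points M2" using G(3,4) f by (metis imageI)
    next
      fix b assume "b \<in> ?c2 ` dual_points M2"
      then obtain y where y: "y \<in> dual_points M2" "b = ?c2 y" by blast
      then obtain x where "(x, y) \<in> R" using G(5) by blast
      then show "b \<in> f ` ?c1 ` dual_points M1" using f G(2) y by blast
    qed
  qed
  moreover have "f \<in> hom (disc_group M1) (disc_group M2)"
  proof (rule homI)
    fix a assume "a \<in> carrier (disc_group M1)"
    then show "f a \<in> carrier (disc_group M2)" using bij_betw_apply[OF calculation] by (simp add: carrier_disc_group)
  next
    fix a b assume "a \<in> carrier (disc_group M1)" "b \<in> carrier (disc_group M1)"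
    then obtain x x' where x: "a = ?c1 x" "x \<in> dual_points M1" "b = ?c1 x'" "x' \<in> dual_points M1" by (auto simp: carrier_disc_group)
    obtain y y' where y: "(x, y) \<in> R" "(x', y') \<in> R" using G(4) x by meson
    have "(x + x', y + y') \<in> R" using RS(4)[OF y] by simp
    then show "f (a \<otimes>\<^bsub>disc_group M1\<^esub> b) = f a \<otimes>\<^bsub>disc_group M2\<^esub> f b"
      by (simp add: x mult_disc_group[OF S1] mult_disc_group[OF S2] f[OF y(1)] f[OF y(2)] f)
  qed
  moreover have "disc_form M1 a = disc_form M2 (f a)" if a: "a \<in> carrier (disc_group M1)" for a
  proof -
    obtain x where x: "a = ?c1 x" "x \<in> dual_points M1" using a by (auto simp: carrier_disc_group)
    obtain y where y: "(x, y) \<in> R" using G(4) x by meson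
    show ?thesis using disc_form_coset_eq[OF M x(2) G(3)[OF y]] e[OF y] by (simp add: x f[OF y])
  qed
  ultimately show ?thesis unfolding disc_forms_isomorphic_def iso_def by (auto simp: carrier_disc_group)
qed

lemma even_glue_refl:
  assumes "even_lattice M"
  shows "even_glue M M {(x, y). x \<in> dual_points M \<and> y \<in> dual_points M \<and> x - y \<in> points M}" (is "even_glue M M ?R")
proof (rule even_glueI)
  note L = even_latticeD(1)[OF assms]
  note S = additive_subgroupD[OF is_latticeD(5)[OF L]] and D = additive_subgroupD[OF dual_subgroup[OF L]]
  note pd = subsetD[OF points_subset_dual[OF L]]
  show "is_lattice M" "is_lattice M" by (rule L)+
  show "additive_subgroup ?R" unfolding additive_subgroup_def
  proof (intro conjI ballI)
    show "0 \<in> ?R" using S(1) D(1) by (simp add: zero_prod_def)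
    fix r s assume "r \<in> ?R" "s \<in> ?R"
    then obtain x y x' y' where r: "r = (x, y)" "s = (x', y')" "x \<in> dual_points M" "y \<in> dual_points M" "x' \<in> dual_points M" "y' \<in> dual_points M"
      "x - y \<in> points M" "x' - y' \<in> points M" by auto
    have "(x - y) - (x' - y') \<in> points M" by (intro S r)
    then have "(x - x') - (y - y') \<in> points M" by (simp add: algebra_simps)
    then show "r - s \<in> ?R" using D(2) r by simp
  qed
  show "?R \<subseteq> dual_points M \<times> dual_points M" by auto
  show "\<exists>y. (x, y) \<in> ?R" "\<exists>y. (y, x) \<in> ?R" if "x \<in> dual_points M" for x
    using that S(1) by (auto intro!: exI[of _ x])
  show "x \<in> points M \<longleftrightarrow> y \<in> points M" if "(x, y) \<in> ?R" for x y
    using that S(2)[of x "x - y"] S(4)[of "x - y" y] by auto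
  show "points M \<times> points M \<subseteq> ?R" using pd S(2) by auto
  show "even_real (form M x x - form M y y)" if "(x, y) \<in> ?R" for x y
  proof -
    have xy: "x \<in> dual_points M" "y \<in> dual_points M" "x - y \<in> points M" using that by auto
    have "form M x x - form M y y = form M (x - y) (x - y) + 2 * form M y (x - y)"
      by (simp add: form_simps[OF is_latticeD(1)[OF L]] lattice_form_commute[OF L dual_span[OF xy(1)] dual_span[OF xy(2)]])
    moreover have "even_real \<dots>" by (intro even_real_add even_real_2 even_latticeD(2)[OF assms] dual_form xy)
    ultimately show ?thesis by simp
  qed
qed

section \<open>Orthogonal complements of binary lattices\<close>

text \<open>Gaussian elimination without division: the other equations are multiplied by the pivot
  \<open>a m k\<close>, and in the end so are the other unknowns, which keeps the solution
  integral.\<close>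

lemma integer_system_nontrivial_solution:
  fixes a :: "nat \<Rightarrow> 'j \<Rightarrow> int"
  assumes "finite J" "m < card J"
  shows "\<exists>x. (\<exists>j\<in>J. x j \<noteq> 0) \<and> (\<forall>i<m. (\<Sum>j\<in>J. a i j * x j) = 0)"
  using assms
proof (induction m arbitrary: J a)
  case 0
  then obtain j where "j \<in> J" by fastforce
  then show ?case by (intro exI[of _ "\<lambda>_. 1"]) auto
next
  case (Suc m)
  show ?case
  proof (cases "\<forall>j\<in>J. a m j = 0")
    case True
    obtain x where x: "\<exists>j\<in>J. x j \<noteq> 0" "\<forall>i<m. (\<Sum>j\<in>J. a i j * x j) = 0"
      using Suc.IH[of J a] Suc.prems by auto
    have "(\<Sum>j\<in>J. a m j * x j) = 0" using True by simp
    then show ?thesis using x by (intro exI[of _ x]) (auto simp: less_Suc_eq)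
  next
    case False
    then obtain k where k: "k \<in> J" "a m k \<noteq> 0" by blast
    let ?J = "J - {k}"
    have "m < card ?J" using Suc.prems k by simp
    then obtain y where y: "\<exists>j\<in>?J. y j \<noteq> 0"
      "\<And>i. i < m \<Longrightarrow> (\<Sum>j\<in>?J. (a m k * a i j - a i k * a m j) * y j) = 0"
      using Suc.IH[of ?J "\<lambda>i j. a m k * a i j - a i k * a m j"] Suc.prems(1) by auto
    define x where "x j = (if j = k then - (\<Sum>j\<in>?J. a m j * y j) else a m k * y j)" for j
    have s: "(\<Sum>j\<in>J. a i j * x j) = (\<Sum>j\<in>?J. (a m k * a i j - a i k * a m j) * y j)" for i
    proof -
      have "(\<Sum>j\<in>J. a i j * x j) = a i k * x k + (\<Sum>j\<in>?J. a i j * x j)"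
        using sum.remove[OF Suc.prems(1) k(1)] by blast
      also have "(\<Sum>j\<in>?J. a i j * x j) = (\<Sum>j\<in>?J. a m k * a i j * y j)"
        by (intro sum.cong) (auto simp: x_def)
      also have "a i k * x k = - (\<Sum>j\<in>?J. a i k * a m j * y j)"
        by (simp add: x_def sum_distrib_left mult.assoc)
      finally show ?thesis by (simp add: left_diff_distrib sum_subtractf)
    qed
    have "(\<Sum>j\<in>J. a i j * x j) = 0" if "i < Suc m" for i
      using that y(2) unfolding s by (cases "i = m") (auto simp: less_Suc_eq mult.commute)
    moreover have "\<exists>j\<in>J. x j \<noteq> 0" using y(1) k(2) by (auto simp: x_def)
    ultimately show ?thesis by blast
  qed
qed

abbreviation hyp3 :: "((real \<times> real) \<times> (real \<times> real) \<times> (real \<times> real)) quad_lattice" where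
  "hyp3 \<equiv> hyp_plane \<oplus>\<^sub>L hyp_plane \<oplus>\<^sub>L hyp_plane"

definition vec6 :: "int6 \<Rightarrow> (real \<times> real) \<times> (real \<times> real) \<times> (real \<times> real)" where
  "vec6 = (\<lambda>(a, b, c, d, e, f). ((of_int a, of_int b), (of_int c, of_int d), (of_int e, of_int f)))"

lemma vec6_add: "vec6 (x + y) = vec6 x + vec6 y"
  by (cases x; cases y; simp add: vec6_def)

lemma vec6_smul6: "vec6 (smul6 k x) = of_int k *\<^sub>R vec6 x"
  by (cases x; simp add: vec6_def smul6_def)

lemma vec6_form: "form hyp3 (vec6 x) (vec6 y) = of_int (hyp6 x y)"
  by (cases x; cases y; simp add: vec6_def hyp6_def hyp4_def)

lemma range_vec6: "range vec6 = points hyp3"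
proof (intro equalityI subsetI)
  fix p assume "p \<in> points hyp3"
  then obtain a b c d e f :: int where "p = ((of_int a, of_int b), (of_int c, of_int d), (of_int e, of_int f))"
    by (auto elim!: Ints_cases)
  then have "p = vec6 (a, b, c, d, e, f)" by (simp add: vec6_def)
  then show "p \<in> range vec6" by blast
qed (auto simp: vec6_def)

lemma is_lattice_neg:
  assumes "is_lattice M" shows "is_lattice (neg_lattice M)"
proof -
  note M = is_latticeD[OF assms]
  have "bilinear (form (neg_lattice M))"
    unfolding bilinear_def by (auto intro!: linearI simp: form_simps[OF M(1)])
  then show ?thesis using assms M(2,3) unfolding is_lattice_def by simp
qed

text \<open>The difference of two points with the same image pairs to zero with every point of the
  nondegenerate \<open>M\<close>.\<close>

lemma is_lattice_embedding_inj:
  assumes M: "is_lattice M" and add: "\<And>x y. x \<in> points M \<Longrightarrow> y \<in> points M \<Longrightarrow> f (x - y) = f x - f y"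
    and b: "bilinear (form L)" and form: "\<And>x y. x \<in> points M \<Longrightarrow> y \<in> points M \<Longrightarrow> form L (f x) (f y) = form M x y"
  shows "inj_on f (points M)"
proof (rule inj_onI)
  fix x y assume xy: "x \<in> points M" "y \<in> points M" "f x = f y"
  have d: "x - y \<in> points M" using additive_subgroupD(2)[OF is_latticeD(5)[OF M]] xy by blast
  have "form M (x - y) z = 0" if "z \<in> points M" for z
    using form[OF d that] add[OF xy(1,2)] xy(3) by (simp add: bilinear_lzero[OF b])
  then have "x - y = 0" using is_latticeD(4)[OF M d] by blast
  then show "x = y" by simp
qed

text \<open>Carries \<open>split_complement\<close> from integer tuples to lattices: injectivity and
  primitivity of the embedding become \<open>independent_primitive\<close>, and the isometry sends
  the basis of \<open>N\<close> to \<open>w1\<close>, \<open>w2\<close> and that of U to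
  \<open>p\<close>, \<open>q\<close>.\<close>

lemma binary_ortho_compl_hyp3:
  assumes N: "binary N n1 n2 a b c" and \<iota>: "primitive_embedding \<iota> N hyp3"
  shows "neg_lattice N \<oplus>\<^sub>L hyp_plane \<cong>\<^sub>L ortho_compl (\<iota> ` points N) hyp3"
proof -
  have NL: "is_lattice N" and n: "n1 \<noteq> n2" "independent {n1, n2}" "points N = int_span {n1, n2}"
    using N unfolding binary_def even_lattice_def by auto
  note S = additive_subgroupD[OF is_latticeD(5)[OF NL]]
  have pN: "points N = {of_int i *\<^sub>R n1 + of_int j *\<^sub>R n2 |i j. True}" unfolding n(3) by (rule int_span_pair[OF n(1)])
  have nm: "n1 \<in> points N" "n2 \<in> points N" unfolding n(3) by (auto intro: int_span_base)
  have emb: "\<iota> ` points N \<subseteq> points hyp3" "inj_on \<iota> (points N)"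
    "\<And>x y. x \<in> points N \<Longrightarrow> y \<in> points N \<Longrightarrow> \<iota> (x + y) = \<iota> x + \<iota> y"
    "\<And>x y. x \<in> points N \<Longrightarrow> y \<in> points N \<Longrightarrow> form hyp3 (\<iota> x) (\<iota> y) = form N x y"
    and prim: "\<And>x m :: nat. x \<in> points hyp3 \<Longrightarrow> m > 0 \<Longrightarrow> of_nat m *\<^sub>R x \<in> \<iota> ` points N \<Longrightarrow> x \<in> \<iota> ` points N"
    using \<iota> unfolding primitive_embedding_def lattice_embedding_def by blast+
  obtain F where F: "linear F" "\<And>x. x \<in> points N \<Longrightarrow> F x = \<iota> x"
    using additive_extends_linear[of "{n1, n2}" \<iota>] emb(3) n(2) unfolding n(3) by auto
  obtain v1 v2 where v: "vec6 v1 = \<iota> n1" "vec6 v2 = \<iota> n2"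
    using emb(1) nm unfolding range_vec6[symmetric] by (metis image_iff image_subset_iff)
  have \<iota>_comb: "\<iota> (of_int i *\<^sub>R n1 + of_int j *\<^sub>R n2) = vec6 (smul6 i v1 + smul6 j v2)" for i j
  proof -
    have "of_int i *\<^sub>R n1 + of_int j *\<^sub>R n2 \<in> points N" unfolding pN by blast
    then have "\<iota> (of_int i *\<^sub>R n1 + of_int j *\<^sub>R n2) = F (of_int i *\<^sub>R n1 + of_int j *\<^sub>R n2)" by (simp add: F(2))
    also have "\<dots> = of_int i *\<^sub>R \<iota> n1 + of_int j *\<^sub>R \<iota> n2"
      by (simp add: linear_add[OF F(1)] linear_scale[OF F(1)] F(2) nm)
    finally show ?thesis by (simp add: vec6_add vec6_smul6 v)
  qed
  have "independent_primitive v1 v2" unfolding independent_primitive_def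
  proof (intro allI impI)
    fix i j d x assume *: "smul6 d x = smul6 i v1 + smul6 j v2"
    let ?y = "of_int i *\<^sub>R n1 + of_int j *\<^sub>R n2"
    have y: "?y \<in> points N" unfolding pN by blast
    have eq: "of_int d *\<^sub>R vec6 x = \<iota> ?y" unfolding \<iota>_comb *[symmetric] vec6_smul6 ..
    show "d dvd i \<and> d dvd j"
    proof (cases "d = 0")
      case True
      have "\<iota> 0 = 0" using emb(3)[OF S(1) S(1)] by simp
      then have "\<iota> ?y = \<iota> 0" using eq True by simp
      then have "?y = 0" by (rule inj_onD[OF emb(2) _ y S(1)])
      then show ?thesis using independent_pair[OF n(2,1)] by fastforce
    next
      case False
      \<comment> \<open>Primitivity of an embedding is stated for positive multiples, so the sign of
        \<open>d\<close> is moved into the vector.\<close>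
      define x' where "x' = smul6 (sgn d) x"
      have "of_nat (nat \<bar>d\<bar>) *\<^sub>R vec6 x' = of_int d *\<^sub>R vec6 x"
        unfolding x'_def vec6_smul6 by (simp add: abs_if sgn_if)
      then have "vec6 x' \<in> \<iota> ` points N"
        using prim[of "vec6 x'" "nat \<bar>d\<bar>"] False y unfolding range_vec6[symmetric] eq by simp
      then obtain i' j' where ij: "vec6 x' = \<iota> (of_int i' *\<^sub>R n1 + of_int j' *\<^sub>R n2)" unfolding pN by blast
      have "vec6 (smul6 i v1 + smul6 j v2) = of_int (sgn d) *\<^sub>R of_int d *\<^sub>R of_int (sgn d) *\<^sub>R vec6 x"
        unfolding \<iota>_comb[symmetric] eq[symmetric] using False by (simp add: sgn_if)
      also have "\<dots> = of_int (sgn d * d) *\<^sub>R vec6 x'" unfolding x'_def vec6_smul6 by simp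
      also have "\<dots> = vec6 (smul6 (sgn d * d) (smul6 i' v1 + smul6 j' v2))" unfolding ij \<iota>_comb vec6_smul6 ..
      also have "\<dots> = vec6 (smul6 (sgn d * d * i') v1 + smul6 (sgn d * d * j') v2)" by (simp add: smul6_add)
      finally have "\<iota> ?y = \<iota> (of_int (sgn d * d * i') *\<^sub>R n1 + of_int (sgn d * d * j') *\<^sub>R n2)" unfolding \<iota>_comb .
      moreover have "of_int (sgn d * d * i') *\<^sub>R n1 + of_int (sgn d * d * j') *\<^sub>R n2 \<in> points N" unfolding pN by blast
      ultimately have "?y = of_int (sgn d * d * i') *\<^sub>R n1 + of_int (sgn d * d * j') *\<^sub>R n2"
        using emb(2) y by (meson inj_onD)
      then have "of_int (i - sgn d * d * i') *\<^sub>R n1 + of_int (j - sgn d * d * j') *\<^sub>R n2 = 0" by (simp add: algebra_simps)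
      then have "real_of_int (i - sgn d * d * i') = 0" "real_of_int (j - sgn d * d * j') = 0"
        using independent_pair[OF n(2,1)] by blast+
      then have "i = d * (sgn d * i')" "j = d * (sgn d * j')" unfolding of_int_eq_0_iff by simp_all
      then show ?thesis by (metis dvd_triv_left)
    qed
  qed
  then have "split_complement v1 v2" by (rule split_complement)
  then obtain w1 w2 p q where w: "hyp6 w1 w1 = - hyp6 v1 v1" "hyp6 w1 w2 = - hyp6 v1 v2" "hyp6 w2 w2 = - hyp6 v2 v2"
     "hyp6 p p = 0" "hyp6 q q = 0" "hyp6 p q = 1"
     "hyp6 w1 p = 0" "hyp6 w1 q = 0" "hyp6 w2 p = 0" "hyp6 w2 q = 0"
     "hyp6 w1 v1 = 0" "hyp6 w1 v2 = 0" "hyp6 w2 v1 = 0" "hyp6 w2 v2 = 0" "hyp6 p v1 = 0" "hyp6 p v2 = 0" "hyp6 q v1 = 0" "hyp6 q v2 = 0"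
     and comp: "\<And>x. hyp6 x v1 = 0 \<and> hyp6 x v2 = 0 \<Longrightarrow>
        \<exists>i j k l. x = smul6 i w1 + smul6 j w2 + smul6 k p + smul6 l q"
    unfolding split_complement_def by auto
  have w': "hyp6 w2 w1 = - hyp6 v1 v2" "hyp6 p w1 = 0" "hyp6 p w2 = 0" "hyp6 q w1 = 0" "hyp6 q w2 = 0" "hyp6 q p = 1"
    using w hyp6_commute by metis+
  obtain H where H: "linear H" "H n1 = vec6 w1" "H n2 = vec6 w2"
    using linear_independent_extend[OF n(2), of "\<lambda>x. if x = n1 then vec6 w1 else vec6 w2"] n(1) by auto
  define \<Phi> where "\<Phi> = (\<lambda>(y, (k, l)). H y + k *\<^sub>R vec6 p + l *\<^sub>R vec6 q)"
  let ?L = "neg_lattice N \<oplus>\<^sub>L hyp_plane" and ?K = "ortho_compl (\<iota> ` points N) hyp3"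
  have bH: "bilinear (form hyp3)" by (intro bilinear_form_sum bilinear_hyp_plane)
  have form_n: "form hyp3 (vec6 v1) (vec6 v1) = form N n1 n1" "form hyp3 (vec6 v1) (vec6 v2) = form N n1 n2" "form hyp3 (vec6 v2) (vec6 v2) = form N n2 n2"
    unfolding v using emb(4) nm by auto
  have hv: "of_int (hyp6 v1 v1) = form N n1 n1" "of_int (hyp6 v1 v2) = form N n1 n2" "of_int (hyp6 v2 v2) = form N n2 n2"
    using form_n unfolding vec6_form .
  have \<Phi>_pt: "\<Phi> (of_int i *\<^sub>R n1 + of_int j *\<^sub>R n2, (of_int k, of_int l)) = vec6 (smul6 i w1 + smul6 j w2 + smul6 k p + smul6 l q)" for i j k l
    by (simp add: \<Phi>_def linear_add[OF H(1)] linear_scale[OF H(1)] H vec6_add vec6_smul6)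
  have L_pt: "\<exists>i j k l. x = (of_int i *\<^sub>R n1 + of_int j *\<^sub>R n2, (of_int k, of_int l))" if "x \<in> points ?L" for x
    using that unfolding points_sum neg_lattice_simps pN by (auto elim!: Ints_cases)
  have pt_L: "(of_int i *\<^sub>R n1 + of_int j *\<^sub>R n2, (of_int k, of_int l)) \<in> points ?L" for i j k l
    unfolding points_sum neg_lattice_simps pN by auto
  have \<Phi>_form: "form hyp3 (\<Phi> x) (\<Phi> y) = form ?L x y" if xy: "x \<in> points ?L" "y \<in> points ?L" for x y
  proof -
    obtain i j k l where x: "x = (of_int i *\<^sub>R n1 + of_int j *\<^sub>R n2, (of_int k, of_int l))" using L_pt[OF xy(1)] by blast
    obtain i' j' k' l' where y: "y = (of_int i' *\<^sub>R n1 + of_int j' *\<^sub>R n2, (of_int k', of_int l'))" using L_pt[OF xy(2)] by blast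
    have "form hyp3 (\<Phi> x) (\<Phi> y) = of_int (hyp6 (smul6 i w1 + smul6 j w2 + smul6 k p + smul6 l q) (smul6 i' w1 + smul6 j' w2 + smul6 k' p + smul6 l' q))"
      unfolding x y \<Phi>_pt vec6_form ..
    also have "\<dots> = - (of_int i * of_int i' * of_int (hyp6 v1 v1) + (of_int i * of_int j' + of_int j * of_int i') * of_int (hyp6 v1 v2) + of_int j * of_int j' * of_int (hyp6 v2 v2))
       + (of_int k * of_int l' + of_int l * of_int k')"
      by (simp add: hyp6_add w w' algebra_simps)
    also have "\<dots> = form ?L x y"
      unfolding hv x y form_sum neg_lattice_simps form_hyp_plane binary_form_expand[OF N]
      using N unfolding binary_def by (simp add: algebra_simps)
    finally show ?thesis .
  qed
  have \<Phi>_add: "\<Phi> (x + y) = \<Phi> x + \<Phi> y" "\<Phi> (x - y) = \<Phi> x - \<Phi> y" for x y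
    by (cases x; cases y; simp add: \<Phi>_def linear_add[OF H(1)] linear_diff[OF H(1)] algebra_simps split_beta)+
  have im: "\<Phi> ` points ?L = points ?K"
  proof (intro equalityI subsetI)
    fix z assume "z \<in> \<Phi> ` points ?L"
    then obtain i j k l where z: "z = vec6 (smul6 i w1 + smul6 j w2 + smul6 k p + smul6 l q)" using L_pt \<Phi>_pt by blast
    have "form hyp3 z (\<iota> y) = 0" if y: "y \<in> points N" for y
    proof -
      obtain i' j' where "y = of_int i' *\<^sub>R n1 + of_int j' *\<^sub>R n2" using y unfolding pN by blast
      then show ?thesis unfolding z by (simp add: \<iota>_comb vec6_form hyp6_add w)
    qed
    moreover have "z \<in> points hyp3" unfolding z range_vec6[symmetric] by blast
    ultimately show "z \<in> points ?K" unfolding ortho_compl_def by auto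
  next
    fix z assume z: "z \<in> points ?K"
    then have "z \<in> points hyp3" unfolding ortho_compl_def by simp
    then obtain x where x: "z = vec6 x" unfolding range_vec6[symmetric] by blast
    have "form hyp3 z (\<iota> n1) = 0" "form hyp3 z (\<iota> n2) = 0" using z nm unfolding ortho_compl_def by auto
    then have "hyp6 x v1 = 0 \<and> hyp6 x v2 = 0" unfolding x v[symmetric] vec6_form by simp
    then obtain i j k l where "x = smul6 i w1 + smul6 j w2 + smul6 k p + smul6 l q" using comp by blast
    then have "z = \<Phi> (of_int i *\<^sub>R n1 + of_int j *\<^sub>R n2, (of_int k, of_int l))" unfolding \<Phi>_pt x by simp
    then show "z \<in> \<Phi> ` points ?L" using pt_L by blast
  qed
  have "inj_on \<Phi> (points ?L)"
    by (rule is_lattice_embedding_inj[OF is_lattice_sum[OF is_lattice_neg[OF NL] is_lattice_hyp_plane] \<Phi>_add(2) bH \<Phi>_form])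
  moreover have "form ?K = form hyp3" by (simp add: ortho_compl_def)
  ultimately have "lattice_embedding \<Phi> ?L ?K"
    unfolding lattice_embedding_def using im \<Phi>_add(1) \<Phi>_form by (intro conjI ballI) (simp_all only: order_refl)
  then show ?thesis unfolding isometric_def using im by blast
qed

lemma ortho_compl_isometry:
  assumes g: "lattice_embedding g L L'" "g ` points L = points L'" and S: "S \<subseteq> points L"
  shows "ortho_compl S L \<cong>\<^sub>L ortho_compl (g ` S) L'"
proof -
  have gf: "form L' (g x) (g y) = form L x y" if "x \<in> points L" "y \<in> points L" for x y
    using g(1) that by (simp add: lattice_embedding_def)
  have im: "g ` points (ortho_compl S L) = points (ortho_compl (g ` S) L')"
  proof (intro equalityI subsetI)
    fix y assume "y \<in> g ` points (ortho_compl S L)"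
    then obtain x where "x \<in> points L" "\<And>s. s \<in> S \<Longrightarrow> form L x s = 0" "y = g x" by (auto simp: ortho_compl_def)
    then show "y \<in> points (ortho_compl (g ` S) L')" using g(2) gf S by (auto simp: ortho_compl_def)
  next
    fix y assume "y \<in> points (ortho_compl (g ` S) L')"
    then have y: "y \<in> points L'" "\<And>s. s \<in> S \<Longrightarrow> form L' y (g s) = 0" by (auto simp: ortho_compl_def)
    then obtain x where x: "x \<in> points L" "y = g x" unfolding g(2)[symmetric] by blast
    then have "form L x s = 0" if "s \<in> S" for s using y(2)[OF that] gf[OF x(1)] S that by auto
    then show "y \<in> g ` points (ortho_compl S L)" using x by (auto simp: ortho_compl_def)
  qed
  have sub: "points (ortho_compl S L) \<subseteq> points L" by (auto simp: ortho_compl_def)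
  have "lattice_embedding g (ortho_compl S L) (ortho_compl (g ` S) L')"
    unfolding lattice_embedding_def im
    using g(1) sub inj_on_subset[OF _ sub, of g] unfolding lattice_embedding_def
    by (auto simp: ortho_compl_def)
  then show ?thesis unfolding isometric_def using im by blast
qed

text \<open>The version for an abstract copy of U^3, to be applied to the second cohomology of a
  torus.\<close>

theorem binary_ortho_compl:
  assumes N: "binary N n1 n2 a b c" and \<iota>: "primitive_embedding \<iota> N L" and L: "additive_subgroup (points L)" "L \<cong>\<^sub>L hyp3"
  shows "neg_lattice N \<oplus>\<^sub>L hyp_plane \<cong>\<^sub>L ortho_compl (\<iota> ` points N) L"
proof -
  have NL: "is_lattice N" using N unfolding binary_def even_lattice_def by auto
  obtain g where g: "lattice_embedding g L hyp3" "g ` points L = points hyp3" using L(2) unfolding isometric_def by blast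
  note ge = g(1)[unfolded lattice_embedding_def]
  have \<iota>e: "\<iota> ` points N \<subseteq> points L" "lattice_embedding \<iota> N L"
    and prim: "\<And>x m :: nat. x \<in> points L \<Longrightarrow> m > 0 \<Longrightarrow> of_nat m *\<^sub>R x \<in> \<iota> ` points N \<Longrightarrow> x \<in> \<iota> ` points N"
    using \<iota> unfolding primitive_embedding_def lattice_embedding_def by blast+
  note S = additive_subgroupD[OF L(1)]
  have g0: "g 0 = 0" using ge S(1) by (metis add_cancel_right_right add.right_neutral)
  have g_mult: "g (of_nat m *\<^sub>R x) = of_nat m *\<^sub>R g x" if x: "x \<in> points L" for x and m :: nat
  proof (induction m)
    case (Suc m)
    have "of_nat m *\<^sub>R x \<in> points L" using S(5)[OF x, of "int m"] by simp
    then have "g (x + of_nat m *\<^sub>R x) = g x + g (of_nat m *\<^sub>R x)" using ge x by blast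
    then show ?case using Suc by (simp add: scaleR_left_distrib)
  qed (simp add: g0)
  have "lattice_embedding (g \<circ> \<iota>) N hyp3"
  proof -
    have "inj_on (g \<circ> \<iota>) (points N)"
      using ge \<iota>e by (intro comp_inj_on) (auto simp: lattice_embedding_def intro: inj_on_subset)
    then show ?thesis using ge \<iota>e unfolding lattice_embedding_def by (simp add: image_subset_iff)
  qed
  moreover have "x \<in> (g \<circ> \<iota>) ` points N" if x: "x \<in> points hyp3" "m > 0" "of_nat m *\<^sub>R x \<in> (g \<circ> \<iota>) ` points N" for x and m :: nat
  proof -
    obtain y where y: "y \<in> points L" "x = g y" using x(1) unfolding g(2)[symmetric] by blast
    obtain n where n: "n \<in> points N" "of_nat m *\<^sub>R x = g (\<iota> n)" using x(3) by auto
    have "g (of_nat m *\<^sub>R y) = g (\<iota> n)" using n(2) unfolding y(2) g_mult[OF y(1)] .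
    moreover have "of_nat m *\<^sub>R y \<in> points L" using S(5)[OF y(1), of "int m"] by simp
    ultimately have "of_nat m *\<^sub>R y = \<iota> n" using ge n(1) \<iota>e(1) by (meson image_subset_iff inj_onD)
    then have "y \<in> \<iota> ` points N" using prim[OF y(1) x(2)] n(1) by simp
    then show ?thesis using y(2) by auto
  qed
  ultimately have "primitive_embedding (g \<circ> \<iota>) N hyp3" unfolding primitive_embedding_def by blast
  from binary_ortho_compl_hyp3[OF N this]
  have 1: "neg_lattice N \<oplus>\<^sub>L hyp_plane \<cong>\<^sub>L ortho_compl (g ` \<iota> ` points N) hyp3" by (simp add: image_comp)
  have "additive_subgroup (points (ortho_compl (\<iota> ` points N) L))"
  proof -
    have l: "form L (x - y) (\<iota> n) = form L x (\<iota> n) - form L y (\<iota> n)" if "x \<in> points L" "y \<in> points L" "n \<in> points N" for x y n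
    proof -
      have d: "x - y \<in> points L" "\<iota> n \<in> points L" using S(2) that \<iota>e(1) by auto
      have b3: "bilinear (form hyp3)" by (intro bilinear_form_sum bilinear_hyp_plane)
      have "g x = g (x - y) + g y" using ge d(1) that(2) by (metis diff_add_cancel)
      then have "form hyp3 (g x) (g (\<iota> n)) = form hyp3 (g (x - y)) (g (\<iota> n)) + form hyp3 (g y) (g (\<iota> n))" by (simp only: bilinear_ladd[OF b3])
      then show ?thesis using ge d that by simp
    qed
    have z: "form L 0 (\<iota> n) = 0" if "n \<in> points N" for n using l[OF S(1) S(1) that] by simp
    show ?thesis unfolding additive_subgroup_def ortho_compl_def using S(1,2) l z by auto
  qed
  then have "ortho_compl (g ` \<iota> ` points N) hyp3 \<cong>\<^sub>L ortho_compl (\<iota> ` points N) L"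
    by (rule isometric_sym[OF _ ortho_compl_isometry[OF g \<iota>e(1)]])
  with 1 show ?thesis by (rule isometric_trans)
qed

lemma is_lattice_U2: "is_lattice (hyp_plane \<oplus>\<^sub>L hyp_plane)"
  by (intro is_lattice_sum is_lattice_hyp_plane)

text \<open>Condition (1) does not mention the rank of \<open>N\<close>; it is found by counting in
  rank four. With rank above 2, a relation between the images of \<open>N\<close> and
  \<open>M\<close> gives a vector of \<open>N\<close> orthogonal to \<open>N\<close>. With rank
  below 2, some nonzero vector is orthogonal to both images, hence lies in the complement
  \<open>M\<close> and in its radical.\<close>

lemma dim_2_of_ortho_compl_binary:
  fixes N :: "'c::real_vector quad_lattice"
  assumes N: "even_lattice N" and \<iota>: "lattice_embedding \<iota> N (hyp_plane \<oplus>\<^sub>L hyp_plane)"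
    and M: "binary M p1 p2 a b c" and iso: "M \<cong>\<^sub>L ortho_compl (\<iota> ` points N) (hyp_plane \<oplus>\<^sub>L hyp_plane)"
  shows "dim (points N) = 2"
proof -
  let ?U = "hyp_plane \<oplus>\<^sub>L hyp_plane"
  note NL = even_latticeD(1)[OF N]
  note NS = additive_subgroupD[OF is_latticeD(5)[OF NL]]
  note bU = is_latticeD(1)[OF is_lattice_U2]
  have latM: "is_lattice M" and p: "p1 \<noteq> p2" "independent {p1, p2}" "points M = int_span {p1, p2}"
    using M unfolding binary_def even_lattice_def by auto
  obtain C where C: "finite C" "independent C" "points N = int_span C" using NL by (rule lattice_basis)
  have CN: "C \<subseteq> points N" unfolding C(3) using int_span_base[OF C(1)] by blast
  have emb: "\<iota> ` points N \<subseteq> points ?U"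
    "\<And>x y. x \<in> points N \<Longrightarrow> y \<in> points N \<Longrightarrow> \<iota> (x + y) = \<iota> x + \<iota> y"
    "\<And>x y. x \<in> points N \<Longrightarrow> y \<in> points N \<Longrightarrow> form ?U (\<iota> x) (\<iota> y) = form N x y"
    using \<iota> unfolding lattice_embedding_def by blast+
  obtain F where F: "linear F" "\<And>x. x \<in> points N \<Longrightarrow> F x = \<iota> x"
    using additive_extends_linear[OF C(1,2), of \<iota>] emb(2) unfolding C(3) by auto
  have FU: "F x \<in> points ?U" if "x \<in> points N" for x
    unfolding F(2)[OF that] by (rule subsetD[OF emb(1) imageI[OF that]])
  obtain h where h: "lattice_embedding h M (ortho_compl (\<iota> ` points N) ?U)" "h ` points M = points (ortho_compl (\<iota> ` points N) ?U)"
    using iso unfolding isometric_def by blast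
  have h_add: "h (x + y) = h x + h y" if "x \<in> points M" "y \<in> points M" for x y
    using h(1) that by (simp add: lattice_embedding_def)
  obtain H where H: "linear H" "\<And>x. x \<in> points M \<Longrightarrow> H x = h x"
    using additive_extends_linear[of "{p1, p2}" h] h_add p(2) unfolding p(3) by auto
  have pm: "p1 \<in> points M" "p2 \<in> points M" unfolding p by (auto intro: int_span_base)
  have H_mem: "H x \<in> points ?U" "form ?U (H x) (\<iota> y) = 0" if "x \<in> points M" "y \<in> points N" for x y
  proof -
    have "H x \<in> points (ortho_compl (\<iota> ` points N) ?U)" using h(2) H(2) that by (metis imageI)
    then show "H x \<in> points ?U" "form ?U (H x) (\<iota> y) = 0" using that(2) by (auto simp: ortho_compl_def)
  qed
  have H_form: "form ?U (H x) (H y) = form M x y" if "x \<in> points M" "y \<in> points M" for x y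
    using h(1) that by (simp add: lattice_embedding_def H(2) ortho_compl_def)
  have H_inj: "x = y" if "x \<in> points M" "y \<in> points M" "H x = H y" for x y
    using h(1) that by (auto simp: lattice_embedding_def H(2) dest: inj_onD)
  define co :: "nat \<Rightarrow> (real \<times> real) \<times> (real \<times> real) \<Rightarrow> real" where
    "co i v = (if i = 0 then fst (fst v) else if i = 1 then snd (fst v) else if i = 2 then fst (snd v) else snd (snd v))" for i v
  have "linear (co i)" for i by (rule linearI) (simp_all add: co_def)
  have co_int: "co i v \<in> \<int>" if "v \<in> points ?U" for i v using that by (auto simp: co_def)
  have "card C \<le> 2"
  proof (rule ccontr)
    assume "\<not> card C \<le> 2"
    \<comment> \<open>The index set joins the basis of \<open>N\<close> with two labels for the
      basis of \<open>M\<close>, giving more than four vectors in rank four.\<close>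
    define J :: "('c + bool) set" where "J = Inl ` C \<union> range Inr"
    have J: "finite J" using C(1) by (simp add: J_def)
    have "card J = card (Inl ` C :: ('c + bool) set) + card (range Inr :: ('c + bool) set)"
      unfolding J_def using C(1) by (intro card_Un_disjoint) auto
    also have "card (Inl ` C :: ('c + bool) set) = card C" by (simp add: card_image)
    also have "card (range Inr :: ('c + bool) set) = 2" by (simp add: card_image)
    finally have card_J: "card J = card C + 2" .
    define V where "V j = (case j of Inl c \<Rightarrow> F c | Inr t \<Rightarrow> H (if t then p1 else p2))" for j :: "'c + bool"
    have VU: "V j \<in> points ?U" if "j \<in> J" for j
      using that subsetD[OF CN] FU H_mem(1)[OF _ NS(1)] pm by (auto simp: J_def V_def simp del: points_sum)
    define A where "A i j = \<lfloor>co i (V j)\<rfloor>" for i j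
    have A: "real_of_int (A i j) = co i (V j)" if "j \<in> J" for i j
      using co_int[OF VU[OF that]] by (auto simp: A_def elim!: Ints_cases)
    have "4 < card J" using card_J \<open>\<not> card C \<le> 2\<close> by simp
    from integer_system_nontrivial_solution[OF J this, of A] obtain x where x: "\<exists>j\<in>J. x j \<noteq> 0"
      "\<And>i. i < 4 \<Longrightarrow> (\<Sum>j\<in>J. A i j * x j) = 0" by blast
    define s where "s = (\<Sum>j\<in>J. of_int (x j) *\<^sub>R V j)"
    have "co i s = 0" if "i < 4" for i
    proof -
      have "co i s = (\<Sum>j\<in>J. of_int (x j) * co i (V j))"
        unfolding s_def by (simp add: linear_sum[OF \<open>linear (co i)\<close>] linear_scale[OF \<open>linear (co i)\<close>])
      also have "\<dots> = (\<Sum>j\<in>J. of_int (A i j * x j))" by (intro sum.cong) (simp_all add: A)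
      also have "\<dots> = 0" unfolding of_int_sum[symmetric] x(2)[OF that] by simp
      finally show ?thesis .
    qed
    from this[of 0] this[of 1] this[of 2] this[of 3] have "s = 0" by (simp add: co_def prod_eq_iff)
    define y where "y = (\<Sum>c\<in>C. of_int (x (Inl c)) *\<^sub>R c)"
    define m where "m = of_int (x (Inr True)) *\<^sub>R p1 + of_int (x (Inr False)) *\<^sub>R p2"
    have y: "y \<in> points N" unfolding y_def C(3) int_span_def by (rule range_eqI[of _ _ "\<lambda>c. x (Inl c)"]) simp
    have m: "m \<in> points M" unfolding m_def p(3) int_span_pair[OF p(1)] by blast
    have "s = (\<Sum>j\<in>Inl ` C. of_int (x j) *\<^sub>R V j) + (\<Sum>j\<in>range Inr. of_int (x j) *\<^sub>R V j)"
      unfolding s_def J_def by (intro sum.union_disjoint) (use C(1) in auto)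
    also have "(\<Sum>j\<in>Inl ` C. of_int (x j) *\<^sub>R V j) = F y"
      by (simp add: sum.reindex inj_on_def V_def y_def linear_sum[OF F(1)] linear_scale[OF F(1)])
    also have "(\<Sum>j\<in>range Inr. of_int (x j) *\<^sub>R V j) = H m"
      by (simp add: sum.reindex inj_on_def V_def m_def UNIV_bool linear_add[OF H(1)] linear_scale[OF H(1)])
    finally have FH: "F y + H m = 0" using \<open>s = 0\<close> by simp
    have "form N y z = 0" if z: "z \<in> points N" for z
    proof -
      have "form N y z = form ?U (F y) (\<iota> z)" using emb(3)[OF y z] F(2)[OF y] by simp
      also have "F y = - H m" using FH by (simp add: eq_neg_iff_add_eq_0)
      also have "form ?U (- H m) (\<iota> z) = 0" using H_mem(2)[OF m z] by (simp only: bilinear_lneg[OF bU]) 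
      finally show ?thesis .
    qed
    then have y0: "y = 0" using is_latticeD(4)[OF NL y] by blast
    then have "H m = 0" using FH by (simp add: linear_0[OF F(1)])
    then have "m = 0" using H_inj[OF m] additive_subgroupD(1)[OF is_latticeD(5)[OF latM]] linear_0[OF H(1)] by metis
    then have "x (Inr True) = 0" "x (Inr False) = 0" using independent_pair[OF p(2,1)] unfolding m_def by force+
    moreover have "x (Inl c) = 0" if "c \<in> C" for c
      using independentD[OF C(2,1) order_refl, of "\<lambda>c. of_int (x (Inl c))" c] y0 that unfolding y_def by simp
    moreover have "j \<in> range Inr \<Longrightarrow> j = Inr True \<or> j = Inr False" for j :: "'c + bool" by (auto simp: UNIV_bool)
    ultimately show False using x(1) unfolding J_def by auto
  qed
  moreover have "card C \<ge> 2"
  proof (rule ccontr)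
    assume small: "\<not> card C \<ge> 2"
    obtain c0 where c0: "C \<subseteq> {c0}"
    proof (cases "C = {}")
      case False
      then have "card C = 1" using small C(1) by (metis One_nat_def Suc_1 card_0_eq less_2_cases not_le)
      then show ?thesis using that by (metis card_1_singletonE order_refl)
    qed (use that in blast)
    \<comment> \<open>Three orthogonality conditions on four coordinates; \<open>0\<close> stands in
      for the image of a generator when \<open>N\<close> is zero.\<close>
    define W where "W i = (if i = 0 then H p1 else if i = 1 then H p2 else if C = {} then 0 else F c0)" for i :: nat
    have WU: "W i \<in> points ?U" for i
      using H_mem(1)[OF pm(1) NS(1)] H_mem(1)[OF pm(2) NS(1)] c0 CN FU additive_subgroupD(1)[OF is_latticeD(5)[OF is_lattice_U2]]
      by (auto simp: W_def simp del: points_sum)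
    define E :: "nat \<Rightarrow> (real \<times> real) \<times> (real \<times> real)" where
      "E j = (if j = 0 then ((1, 0), (0, 0)) else if j = 1 then ((0, 1), (0, 0)) else if j = 2 then ((0, 0), (1, 0)) else ((0, 0), (0, 1)))" for j
    have EU: "E j \<in> points ?U" for j by (simp add: E_def)
    define A where "A i j = \<lfloor>form ?U (E j) (W i)\<rfloor>" for i j
    have A: "real_of_int (A i j) = form ?U (E j) (W i)" for i j
      using is_latticeD(2)[OF is_lattice_U2 EU WU] by (auto simp: A_def elim!: Ints_cases)
    obtain x where x: "\<exists>j\<in>{..<4::nat}. x j \<noteq> 0" "\<And>i. i < 3 \<Longrightarrow> (\<Sum>j<4. A i j * x j) = 0"
      using integer_system_nontrivial_solution[of "{..<4::nat}" 3 A] by auto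
    define v where "v = (\<Sum>j<4. of_int (x j) *\<^sub>R E j)"
    have v_eq: "v = ((of_int (x 0), of_int (x 1)), (of_int (x 2), of_int (x 3)))"
      unfolding v_def by (simp add: eval_nat_numeral E_def)
    have vU: "v \<in> points ?U" unfolding v_eq by simp
    have v0: "v \<noteq> 0"
    proof
      assume "v = 0"
      then have "x 0 = 0" "x 1 = 0" "x 2 = 0" "x 3 = 0" unfolding v_eq by (simp_all add: zero_prod_def)
      moreover obtain j where "j < 4" "x j \<noteq> 0" using x(1) by auto
      ultimately show False by (auto simp: eval_nat_numeral less_Suc_eq)
    qed
    have vW: "form ?U v (W i) = 0" if "i < 3" for i
    proof -
      have l: "linear (\<lambda>v. form ?U v (W i))" using bU unfolding bilinear_def by blast
      have "form ?U v (W i) = (\<Sum>j<4. of_int (x j) * form ?U (E j) (W i))"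
        unfolding v_def by (simp add: linear_sum[OF l] linear_scale[OF l])
      also have "\<dots> = of_int (\<Sum>j<4. A i j * x j)" by (simp add: A[symmetric] mult.commute)
      finally show ?thesis using x(2)[OF that] by simp
    qed
    have "form ?U v (\<iota> z) = 0" if z: "z \<in> points N" for z
    proof -
      have "z \<in> span C" using z int_span_subset_span unfolding C(3) by blast
      have "linear (form ?U v)" using bU unfolding bilinear_def by blast
      then have l: "linear (\<lambda>z. form ?U v (F z))" using linear_compose[OF F(1), of "form ?U v"] by (simp add: o_def)
      have "form ?U v (F z) = 0"
      proof (rule linear_eq_0_on_span[OF l _ \<open>z \<in> span C\<close>])
        fix c assume "c \<in> C"
        then have "W 2 = F c" using c0 by (auto simp: W_def)
        then show "form ?U v (F c) = 0" using vW[of 2] by simp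
      qed
      then show ?thesis using F(2)[OF z] by simp
    qed
    \<comment> \<open>Orthogonality to \<open>N\<close> alone places \<open>v\<close> in the image
      of \<open>M\<close>; the two remaining conditions then put it in the radical.\<close>
    then have "v \<in> h ` points M" unfolding h(2) using vU by (auto simp: ortho_compl_def)
    then obtain y where y: "y \<in> points M" "v = H y" using H(2) by auto
    have "form M y z = 0" if z: "z \<in> points M" for z
    proof -
      have l: "linear (form M y)" using is_latticeD(1)[OF latM] by (auto simp: bilinear_def)
      have zs: "z \<in> span {p1, p2}" using z int_span_subset_span unfolding p(3) by blast
      show ?thesis
      proof (rule linear_eq_0_on_span[OF l _ zs])
        fix b assume "b \<in> {p1, p2}"
        then show "form M y b = 0" using H_form[OF y(1)] pm vW[of 0] vW[of 1] unfolding y(2) by (auto simp: W_def)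
      qed
    qed
    then have "y = 0" using is_latticeD(4)[OF latM y(1)] by blast
    then show False using v0 y(2) linear_0[OF H(1)] by simp
  qed
  ultimately have "card C = 2" by simp
  moreover have "dim (points N) = card C"
    unfolding C(3) using C(1,2) by (metis dim_span dim_eq_card_independent span_int_span)
  ultimately show ?thesis by simp
qed

lemma isometric_sum_commute: "M \<oplus>\<^sub>L L \<cong>\<^sub>L L \<oplus>\<^sub>L M"
  unfolding isometric_def
  by (rule exI[of _ prod.swap]) (auto simp: lattice_embedding_def inj_on_def)

text \<open>With \<open>N\<close> placed in the last two planes of U^3, its complement is visibly U
  plus \<open>M\<close>; the rank count makes \<open>N\<close> binary, so the complement formula
  applies as well.\<close>

lemma common_complement_imp_isometric_sum:
  fixes N :: "'c::real_vector quad_lattice"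
  assumes M: "binary M p1 p2 a b c" and N: "even_lattice N" and \<iota>: "primitive_embedding \<iota> N (hyp_plane \<oplus>\<^sub>L hyp_plane)"
    and iso: "M \<cong>\<^sub>L ortho_compl (\<iota> ` points N) (hyp_plane \<oplus>\<^sub>L hyp_plane)"
  shows "M \<oplus>\<^sub>L hyp_plane \<cong>\<^sub>L neg_lattice N \<oplus>\<^sub>L hyp_plane"
proof -
  let ?U = "hyp_plane \<oplus>\<^sub>L hyp_plane"
  have "lattice_embedding \<iota> N ?U" using \<iota> unfolding primitive_embedding_def by blast
  from dim_2_of_ortho_compl_binary[OF N this M iso] obtain n1 n2 a' b' c' where Nb: "binary N n1 n2 a' b' c'"
    using even_rank2_binary[OF N] by blast
  note NL = even_latticeD(1)[OF N]
  have latM: "is_lattice M" using M unfolding binary_def even_lattice_def by auto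
  define \<iota>' where "\<iota>' x = ((0, 0) :: real \<times> real, \<iota> x)" for x
  have "primitive_embedding \<iota>' N hyp3"
    unfolding primitive_embedding_def
  proof (intro conjI ballI allI impI)
    show "lattice_embedding \<iota>' N hyp3"
      using \<iota> unfolding primitive_embedding_def lattice_embedding_def \<iota>'_def
      by (simp add: inj_on_def image_subset_iff)
    fix x and m :: nat assume x: "x \<in> points hyp3" and m: "0 < m \<and> of_nat m *\<^sub>R x \<in> \<iota>' ` points N"
    obtain u y where xy: "x = (u, y)" "y \<in> points ?U" using x by (cases x) simp
    have "of_nat m *\<^sub>R u = 0" and y: "of_nat m *\<^sub>R y \<in> \<iota> ` points N" using m by (auto simp: xy \<iota>'_def zero_prod_def)
    then have "u = (0, 0)" using m by (simp add: zero_prod_def[symmetric])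
    moreover have "y \<in> \<iota> ` points N" using \<iota> y xy(2) m unfolding primitive_embedding_def by blast
    ultimately show "x \<in> \<iota>' ` points N" by (auto simp: xy \<iota>'_def)
  qed
  moreover have "additive_subgroup (points hyp3)" by (intro is_latticeD(5) is_lattice_sum is_lattice_hyp_plane)
  ultimately have 1: "neg_lattice N \<oplus>\<^sub>L hyp_plane \<cong>\<^sub>L ortho_compl (\<iota>' ` points N) hyp3"
    by (rule binary_ortho_compl[OF Nb _ _ isometric_refl])
  have "ortho_compl (\<iota>' ` points N) hyp3 = hyp_plane \<oplus>\<^sub>L ortho_compl (\<iota> ` points N) ?U"
  proof -
    have "form hyp3 (u, y) (\<iota>' n) = form ?U y (\<iota> n)" for u y n
      unfolding \<iota>'_def by (cases u) (simp add: lattice_sum_def split_beta)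
    then have "points (ortho_compl (\<iota>' ` points N) hyp3) = points hyp_plane \<times> points (ortho_compl (\<iota> ` points N) ?U)"
      by (simp only: ortho_compl_def quad_lattice.simps points_sum) auto
    then show ?thesis by (simp add: ortho_compl_def lattice_sum_def)
  qed
  moreover have "M \<oplus>\<^sub>L hyp_plane \<cong>\<^sub>L hyp_plane \<oplus>\<^sub>L ortho_compl (\<iota> ` points N) ?U"
    by (rule isometric_trans[OF isometric_sum_commute isometric_sum[OF isometric_refl iso]])
  moreover have "ortho_compl (\<iota>' ` points N) hyp3 \<cong>\<^sub>L neg_lattice N \<oplus>\<^sub>L hyp_plane"
    using is_latticeD(5)[OF is_lattice_sum[OF is_lattice_neg[OF NL] is_lattice_hyp_plane]] 1 by (rule isometric_sym)
  ultimately show ?thesis using isometric_trans by metis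
qed

definition common_complement :: "'a::real_vector quad_lattice \<Rightarrow> 'b::real_vector quad_lattice \<Rightarrow> bool" where
  "common_complement M1 M2 \<longleftrightarrow> (\<exists>(N::std_lattice) \<iota>1 \<iota>2. even_lattice N \<and>
           primitive_embedding \<iota>1 N (hyp_plane \<oplus>\<^sub>L hyp_plane) \<and>
           primitive_embedding \<iota>2 N (hyp_plane \<oplus>\<^sub>L hyp_plane) \<and>
           M1 \<cong>\<^sub>L ortho_compl (\<iota>1 ` points N) (hyp_plane \<oplus>\<^sub>L hyp_plane) \<and>
           M2 \<cong>\<^sub>L ortho_compl (\<iota>2 ` points N) (hyp_plane \<oplus>\<^sub>L hyp_plane))"

lemma common_complement_imp_sum_hyp:
  assumes "binary M1 p1 p2 a1 b1 c1" "binary M2 r1 r2 a2 b2 c2" "common_complement M1 M2"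
  shows "M1 \<oplus>\<^sub>L hyp_plane \<cong>\<^sub>L M2 \<oplus>\<^sub>L hyp_plane"
proof -
  obtain N :: std_lattice and \<iota>1 \<iota>2 where N: "even_lattice N" and
           1: "primitive_embedding \<iota>1 N (hyp_plane \<oplus>\<^sub>L hyp_plane)" and
           2: "primitive_embedding \<iota>2 N (hyp_plane \<oplus>\<^sub>L hyp_plane)" and
           M1: "M1 \<cong>\<^sub>L ortho_compl (\<iota>1 ` points N) (hyp_plane \<oplus>\<^sub>L hyp_plane)" and
           M2: "M2 \<cong>\<^sub>L ortho_compl (\<iota>2 ` points N) (hyp_plane \<oplus>\<^sub>L hyp_plane)"
    using assms(3) unfolding common_complement_def by (elim exE conjE)
  have "is_lattice M2" using assms(2) unfolding binary_def even_lattice_def by auto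
  then have "neg_lattice N \<oplus>\<^sub>L hyp_plane \<cong>\<^sub>L M2 \<oplus>\<^sub>L hyp_plane"
    by (intro isometric_sym[OF _ common_complement_imp_isometric_sum[OF assms(2) N 2 M2]] is_latticeD(5) is_lattice_sum is_lattice_hyp_plane)
  with common_complement_imp_isometric_sum[OF assms(1) N 1 M1] show ?thesis by (rule isometric_trans)
qed

lemma primitive_embedding_isometry:
  assumes "lattice_embedding f N N'" "f ` points N = points N'" "primitive_embedding \<iota> N' L"
  shows "primitive_embedding (\<iota> \<circ> f) N L" "(\<iota> \<circ> f) ` points N = \<iota> ` points N'"
proof -
  show im: "(\<iota> \<circ> f) ` points N = \<iota> ` points N'" using assms(2) by (metis image_comp)
  have \<iota>: "lattice_embedding \<iota> N' L" using assms(3) by (simp add: primitive_embedding_def)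
  have fN: "f x \<in> points N'" if "x \<in> points N" for x using that assms(2) by blast
  have "inj_on (\<iota> \<circ> f) (points N)"
    using assms(1) \<iota> by (intro comp_inj_on) (simp_all add: lattice_embedding_def assms(2))
  then have "lattice_embedding (\<iota> \<circ> f) N L"
    unfolding lattice_embedding_def im using \<iota> assms(1) fN by (simp add: lattice_embedding_def)
  then show "primitive_embedding (\<iota> \<circ> f) N L" using assms(3) unfolding primitive_embedding_def im by simp
qed

lemma even_glue_imp_common_complement:
  assumes 1: "binary M1 p1 p2 a1 b1 c1" "4 * a1 * c1 - b1 * b1 < 0"
    and 2: "binary M2 r1 r2 a2 b2 c2" "4 * a2 * c2 - b2 * b2 < 0" and R: "even_glue M1 M2 R"
  shows "common_complement M1 M2"
proof -
  have M2: "even_lattice M2" using 2(1) by (simp add: binary_def)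
  have R2: "even_glue M2 M2 {(x, y). x \<in> dual_points M2 \<and> y \<in> dual_points M2 \<and> x - y \<in> points M2}"
    by (rule even_glue_refl[OF M2])
  interpret g1: binary_glue M1 M2 p1 p2 a1 b1 c1 r1 r2 a2 b2 c2 R
    using 1 2 R by unfold_locales (auto simp: even_glue_def)
  interpret g2: binary_glue M2 M2 r1 r2 a2 b2 c2 r1 r2 a2 b2 c2 "{(x, y). x \<in> dual_points M2 \<and> y \<in> dual_points M2 \<and> x - y \<in> points M2}"
    using 2 R2 by unfold_locales (auto simp: even_glue_def)
  obtain \<iota>1 where \<iota>1: "primitive_embedding \<iota>1 (neg_lattice M2) (hyp_plane \<oplus>\<^sub>L hyp_plane)"
     "M1 \<cong>\<^sub>L ortho_compl (\<iota>1 ` points M2) (hyp_plane \<oplus>\<^sub>L hyp_plane)" using g1.even_glue_embedding[OF R] by blast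
  obtain \<iota>2 where \<iota>2: "primitive_embedding \<iota>2 (neg_lattice M2) (hyp_plane \<oplus>\<^sub>L hyp_plane)"
     "M2 \<cong>\<^sub>L ortho_compl (\<iota>2 ` points M2) (hyp_plane \<oplus>\<^sub>L hyp_plane)" using g2.even_glue_embedding[OF R2] by blast
  have L: "is_lattice (neg_lattice M2)" by (intro is_lattice_neg even_latticeD[OF M2])
  obtain N :: std_lattice where N: "is_lattice N" "neg_lattice M2 \<cong>\<^sub>L N" using lattice_standard_copy[OF L] by blast
  have "N \<cong>\<^sub>L neg_lattice M2" by (rule isometric_sym[OF is_latticeD(5)[OF L] N(2)])
  then obtain f where f: "lattice_embedding f N (neg_lattice M2)" "f ` points N = points (neg_lattice M2)" unfolding isometric_def by blast
  have "even_lattice N" unfolding even_lattice_def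
  proof (intro conjI ballI N(1))
    fix x assume x: "x \<in> points N"
    then have fx: "f x \<in> points M2" using f(2) by auto
    have "form N x x = - form M2 (f x) (f x)" using f(1) x by (simp add: lattice_embedding_def)
    moreover obtain k where "form M2 (f x) (f x) = 2 * of_int k" using even_latticeD(2)[OF M2 fx] by (auto simp: even_real_def)
    ultimately show "\<exists>k::int. form N x x = 2 * of_int k" by (intro exI[of _ "- k"]) simp
  qed
  moreover note primitive_embedding_isometry[OF f \<iota>1(1)] primitive_embedding_isometry[OF f \<iota>2(1)]
  ultimately show ?thesis unfolding common_complement_def using \<iota>1(2) \<iota>2(2)
    by (intro exI[of _ N] exI[of _ "\<iota>1 \<circ> f"] exI[of _ "\<iota>2 \<circ> f"]) simp
qed

text \<open>The cycle (2), (1), (3), (4), (2). It is stated with Gram matrices so that it also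
  covers Neron-Severi lattices, whose negative determinant comes from the Hodge index
  inequality.\<close>

theorem binary_stable_equivalence:
  assumes 1: "binary M1 p1 p2 a1 b1 c1" "4 * a1 * c1 - b1 * b1 < 0"
    and 2: "binary M2 r1 r2 a2 b2 c2" "4 * a2 * c2 - b2 * b2 < 0"
  shows "common_complement M1 M2 \<longleftrightarrow> disc_forms_isomorphic M1 M2"
    "disc_forms_isomorphic M1 M2 \<longleftrightarrow> M1 \<oplus>\<^sub>L hyp_plane \<cong>\<^sub>L M2 \<oplus>\<^sub>L hyp_plane"
    "M1 \<oplus>\<^sub>L hyp_plane \<cong>\<^sub>L M2 \<oplus>\<^sub>L hyp_plane \<longleftrightarrow> stably_equivalent M1 M2"
proof -
  have M: "even_lattice M1" "even_lattice M2" using 1(1) 2(1) by (simp_all add: binary_def)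
  note L = even_latticeD(1)[OF M(1)] even_latticeD(1)[OF M(2)]
  have 12: "disc_forms_isomorphic M1 M2 \<Longrightarrow> common_complement M1 M2"
    using disc_forms_isomorphic_imp_even_glue[OF M] even_glue_imp_common_complement[OF 1 2] by blast
  have 13: "common_complement M1 M2 \<Longrightarrow> M1 \<oplus>\<^sub>L hyp_plane \<cong>\<^sub>L M2 \<oplus>\<^sub>L hyp_plane"
    by (rule common_complement_imp_sum_hyp[OF 1(1) 2(1)])
  have 34: "M1 \<oplus>\<^sub>L hyp_plane \<cong>\<^sub>L M2 \<oplus>\<^sub>L hyp_plane \<Longrightarrow> stably_equivalent M1 M2"
    by (rule isometric_sum_hyp_imp_stably_equivalent)
  have 42: "disc_forms_isomorphic M1 M2" if st: "stably_equivalent M1 M2"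
  proof -
    obtain R where R: "glue M1 M2 R" using stably_equivalent_imp_glue[OF L st] by blast
    interpret g: binary_glue M1 M2 p1 p2 a1 b1 c1 r1 r2 a2 b2 c2 R
      using 1 2 R by unfold_locales auto
    show ?thesis using g.even_glue_exists even_glue_imp_disc_forms_isomorphic[OF M] by blast
  qed
  show "common_complement M1 M2 \<longleftrightarrow> disc_forms_isomorphic M1 M2"
    "disc_forms_isomorphic M1 M2 \<longleftrightarrow> M1 \<oplus>\<^sub>L hyp_plane \<cong>\<^sub>L M2 \<oplus>\<^sub>L hyp_plane"
    "M1 \<oplus>\<^sub>L hyp_plane \<cong>\<^sub>L M2 \<oplus>\<^sub>L hyp_plane \<longleftrightarrow> stably_equivalent M1 M2"
    using 12 13 34 42 by blast+
qed

section \<open>Forms on complex tori\<close>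

text \<open>The alternating form with upper entries \<open>e12\<close> to \<open>e34\<close>,
  evaluated at two coordinate vectors; the combinations in brackets are their Pluecker
  coordinates.\<close>

definition skew_value :: "real \<Rightarrow> real \<Rightarrow> real \<Rightarrow> real \<Rightarrow> real \<Rightarrow> real \<Rightarrow> real \<Rightarrow> real \<Rightarrow> real \<Rightarrow> real \<Rightarrow> real \<Rightarrow> real \<Rightarrow> real \<Rightarrow> real \<Rightarrow> real" where
  "skew_value e12 e13 e14 e23 e24 e34 x1 x2 x3 x4 y1 y2 y3 y4 =
     (x1 * y2 - x2 * y1) * e12 + (x1 * y3 - x3 * y1) * e13 + (x1 * y4 - x4 * y1) * e14
     + (x2 * y3 - x3 * y2) * e23 + (x2 * y4 - x4 * y2) * e24 + (x3 * y4 - x4 * y3) * e34"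

text \<open>The rule Pf(A E A^T) = det(A) Pf(E) in size four, where \<open>a\<close>,
  \<open>b\<close>, \<open>c\<close>, \<open>d\<close> are the rows of A.\<close>

lemma pfaffian_base_change:
  fixes e12 e13 e14 e23 e24 e34 :: real
  defines "f \<equiv> skew_value e12 e13 e14 e23 e24 e34"
  shows "f a1 a2 a3 a4 b1 b2 b3 b4 * f c1 c2 c3 c4 d1 d2 d3 d4 - f a1 a2 a3 a4 c1 c2 c3 c4 * f b1 b2 b3 b4 d1 d2 d3 d4
       + f a1 a2 a3 a4 d1 d2 d3 d4 * f b1 b2 b3 b4 c1 c2 c3 c4
     = (a1 * (b2 * (c3 * d4 - c4 * d3) - b3 * (c2 * d4 - c4 * d2) + b4 * (c2 * d3 - c3 * d2))
      - a2 * (b1 * (c3 * d4 - c4 * d3) - b3 * (c1 * d4 - c4 * d1) + b4 * (c1 * d3 - c3 * d1))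
      + a3 * (b1 * (c2 * d4 - c4 * d2) - b2 * (c1 * d4 - c4 * d1) + b4 * (c1 * d2 - c2 * d1))
      - a4 * (b1 * (c2 * d3 - c3 * d2) - b2 * (c1 * d3 - c3 * d1) + b3 * (c1 * d2 - c2 * d1)))
      * (e12 * e34 - e13 * e24 + e14 * e23)"
  unfolding f_def skew_value_def by algebra

definition alternating :: "real_form \<Rightarrow> bool" where "alternating E \<longleftrightarrow> (\<forall>v. form_apply E v v = 0)"

lemmas form_apply_simps = blinfun.bilinear_simps

lemma alternating_self: "alternating E \<Longrightarrow> form_apply E v v = 0" by (simp add: alternating_def)

lemma alternating_skew: assumes "alternating E" shows "form_apply E w v = - form_apply E v w"
proof -
  have "form_apply E (v + w) (v + w) = form_apply E v w + form_apply E w v"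
    using alternating_self[OF assms, of v] alternating_self[OF assms, of w] by (simp add: form_apply_simps)
  then show ?thesis using alternating_self[OF assms, of "v + w"] by simp
qed

lemma subspace_alternating: "subspace {E. alternating E}"
  unfolding subspace_def alternating_def by (auto simp: form_apply_simps)

lemma alternating_expand:
  assumes "alternating E"
  shows "form_apply E (\<Sum>k\<in>UNIV. x k *\<^sub>R b k) (\<Sum>k\<in>UNIV. y k *\<^sub>R b k) =
    (x 1 * y 2 - x 2 * y 1) * form_apply E (b 1) (b 2) + (x 1 * y 3 - x 3 * y 1) * form_apply E (b 1) (b 3)
    + (x 1 * y 4 - x 4 * y 1) * form_apply E (b 1) (b 4) + (x 2 * y 3 - x 3 * y 2) * form_apply E (b 2) (b 3)
    + (x 2 * y 4 - x 4 * y 2) * form_apply E (b 2) (b 4) + (x 3 * y 4 - x 4 * y 3) * form_apply E (b 3) (b (4::4))"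
  unfolding sum_4
  by (simp add: form_apply_simps alternating_self[OF assms] alternating_skew[OF assms, of "b 1" "b 2"]
     alternating_skew[OF assms, of "b 1" "b 3"] alternating_skew[OF assms, of "b 1" "b 4"] alternating_skew[OF assms, of "b 2" "b 3"]
     alternating_skew[OF assms, of "b 2" "b 4"] alternating_skew[OF assms, of "b 3" "b 4"] algebra_simps)

lemma vector_4: "(vector [a, b, c, d] :: 'a::zero^4) $ 1 = a" "(vector [a, b, c, d] :: 'a::zero^4) $ 2 = b"
  "(vector [a, b, c, d] :: 'a::zero^4) $ 3 = c" "(vector [a, b, c, d] :: 'a::zero^4) $ 4 = d"
  unfolding vector_def by simp_all

lemma real_coords_simps: "real_coords v $ 1 = Re (v $ 1)" "real_coords v $ 2 = Im (v $ 1)"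
  "real_coords v $ 3 = Re (v $ 2)" "real_coords v $ 4 = Im (v $ 2)"
  by (simp_all add: real_coords_def vector_4)

lemma linear_real_coords: "linear real_coords"
  by (rule linearI) (simp_all add: vec_eq_iff forall_4 real_coords_simps)

lemma real_coords_inj: "real_coords v = real_coords w \<Longrightarrow> v = w"
  by (simp add: vec_eq_iff forall_4 forall_2 real_coords_simps complex_eq_iff)

definition std_basis :: "4 \<Rightarrow> complex^2" where
  "std_basis = quad (vector [1, 0]) (vector [\<i>, 0]) (vector [0, 1]) (vector [0, \<i>])"

lemma std_basis_expand: "v = (\<Sum>k\<in>UNIV. real_coords v $ k *\<^sub>R std_basis k)"
  by (simp add: sum_4 std_basis_def vec_eq_iff forall_2 real_coords_simps complex_eq_iff)

lemma form_apply_std: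
  assumes "alternating E"
  shows "form_apply E v w =
    (Re (v $ 1) * Im (w $ 1) - Im (v $ 1) * Re (w $ 1)) * form_apply E (std_basis 1) (std_basis 2)
    + (Re (v $ 1) * Re (w $ 2) - Re (v $ 2) * Re (w $ 1)) * form_apply E (std_basis 1) (std_basis 3)
    + (Re (v $ 1) * Im (w $ 2) - Im (v $ 2) * Re (w $ 1)) * form_apply E (std_basis 1) (std_basis 4)
    + (Im (v $ 1) * Re (w $ 2) - Re (v $ 2) * Im (w $ 1)) * form_apply E (std_basis 2) (std_basis 3)
    + (Im (v $ 1) * Im (w $ 2) - Im (v $ 2) * Im (w $ 1)) * form_apply E (std_basis 2) (std_basis 4)
    + (Re (v $ 2) * Im (w $ 2) - Im (v $ 2) * Re (w $ 2)) * form_apply E (std_basis 3) (std_basis 4)"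
proof -
  have "form_apply E v w = form_apply E (\<Sum>k\<in>UNIV. real_coords v $ k *\<^sub>R std_basis k) (\<Sum>k\<in>UNIV. real_coords w $ k *\<^sub>R std_basis k)"
    unfolding std_basis_expand[symmetric] ..
  then show ?thesis unfolding alternating_expand[OF assms] real_coords_simps .
qed

abbreviation coords_matrix :: "(complex^2)^4 \<Rightarrow> real^4^4" where
  "coords_matrix \<omega> \<equiv> \<chi> i. real_coords (\<omega> $ i)"

abbreviation std_frame :: "(complex^2)^4" where "std_frame \<equiv> \<chi> i. std_basis i"

lemma bilinear_wedge: "bilinear (wedge_eval \<omega>)"
  unfolding bilinear_def wedge_eval_def Let_def
  by (auto intro!: linearI simp: form_apply_simps algebra_simps)

lemma wedge_commute: "wedge_eval \<omega> E F = wedge_eval \<omega> F E"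
  by (simp add: wedge_eval_def Let_def algebra_simps)

text \<open>The wedge square of \<open>E\<close> is twice the Pfaffian of its matrix, so the
  Pfaffian rule settles the diagonal case and polarization the rest.\<close>

lemma wedge_base_change:
  assumes "alternating E" "alternating F"
  shows "wedge_eval \<omega> E F = det (coords_matrix \<omega>) * wedge_eval std_frame E F"
proof -
  have sq: "wedge_eval \<omega> E E = det (coords_matrix \<omega>) * wedge_eval std_frame E E" if E: "alternating E" for E
  proof -
    define e where "e i j = form_apply E (std_basis i) (std_basis j)" for i j
    have wedge: "wedge_eval \<omega> E E = 2 * (form_apply E (\<omega> $ 1) (\<omega> $ 2) * form_apply E (\<omega> $ 3) (\<omega> $ 4)
       - form_apply E (\<omega> $ 1) (\<omega> $ 3) * form_apply E (\<omega> $ 2) (\<omega> $ 4) + form_apply E (\<omega> $ 1) (\<omega> $ 4) * form_apply E (\<omega> $ 2) (\<omega> $ 3))" for \<omega>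
      by (simp add: wedge_eval_def Let_def)
    have entry: "form_apply E v w = skew_value (e 1 2) (e 1 3) (e 1 4) (e 2 3) (e 2 4) (e 3 4)
        (Re (v $ 1)) (Im (v $ 1)) (Re (v $ 2)) (Im (v $ 2)) (Re (w $ 1)) (Im (w $ 1)) (Re (w $ 2)) (Im (w $ 2))" for v w
      unfolding form_apply_std[OF E, of v w] skew_value_def e_def ..
    have "wedge_eval \<omega> E E = 2 * (det (coords_matrix \<omega>) * (e 1 2 * e 3 4 - e 1 3 * e 2 4 + e 1 4 * e 2 3))"
      unfolding wedge entry pfaffian_base_change det_4 by (simp only: vec_lambda_beta real_coords_simps)
    also have "\<dots> = det (coords_matrix \<omega>) * wedge_eval std_frame E E"
      unfolding wedge by (simp add: e_def)
    finally show ?thesis .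
  qed
  note b = bilinear_wedge
  have EF: "alternating (E + F)" using subspace_add[OF subspace_alternating, of E F] assms by simp
  have "wedge_eval \<omega> (E + F) (E + F) = wedge_eval \<omega> E E + wedge_eval \<omega> F F + 2 * wedge_eval \<omega> E F" for \<omega>
    by (simp add: bilinear_ladd[OF b] bilinear_radd[OF b] wedge_commute[of \<omega> F E])
  then have h: "wedge_eval \<omega> E F = (wedge_eval \<omega> (E + F) (E + F) - wedge_eval \<omega> E E - wedge_eval \<omega> F F) / 2" for \<omega>
    by simp
  show ?thesis unfolding h[of \<omega>] h[of std_frame] sq[OF EF] sq[OF assms(1)] sq[OF assms(2)]
    by (simp add: field_simps)
qed

lemma oriented_basis_mem:
  assumes "oriented_period_basis \<omega> \<Lambda>" shows "\<omega> $ i \<in> \<Lambda>"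
proof -
  have "\<omega> $ i = (\<Sum>j\<in>UNIV. if j = i then \<omega> $ i else 0)" by simp
  also have "\<dots> = (\<Sum>j\<in>UNIV. of_int (if j = i then 1 else 0) *\<^sub>R (\<omega> $ j))" by (intro sum.cong) auto
  finally have e: "\<omega> $ i = (\<Sum>j\<in>UNIV. of_int (if j = i then 1 else 0) *\<^sub>R (\<omega> $ j))" .
  have \<Lambda>: "\<Lambda> = range (\<lambda>c :: 4 \<Rightarrow> int. \<Sum>i\<in>UNIV. of_int (c i) *\<^sub>R (\<omega> $ i))"
    using assms by (simp add: oriented_period_basis_def)
  show ?thesis unfolding \<Lambda> by (rule range_eqI[where x = "\<lambda>j. if j = i then 1 else 0"]) (rule e)
qed

lemma oriented_basis_int_comb:
  assumes "oriented_period_basis \<omega> \<Lambda>" "v \<in> \<Lambda>"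
  obtains c :: "4 \<Rightarrow> int" where "v = (\<Sum>i\<in>UNIV. of_int (c i) *\<^sub>R (\<omega> $ i))"
  using assms unfolding oriented_period_basis_def by auto

lemma oriented_basis_change:
  assumes "oriented_period_basis \<omega> \<Lambda>" "oriented_period_basis \<omega>' \<Lambda>"
  shows "\<exists>n :: int. n > 0 \<and> det (coords_matrix \<omega>') = of_int n * det (coords_matrix \<omega>)"
proof -
  have "\<exists>c :: 4 \<Rightarrow> int. \<omega>' $ i = (\<Sum>j\<in>UNIV. of_int (c j) *\<^sub>R (\<omega> $ j))" for i
    using oriented_basis_int_comb[OF assms(1) oriented_basis_mem[OF assms(2)]] by metis
  then obtain A0 :: "4 \<Rightarrow> 4 \<Rightarrow> int" where A0: "\<And>i. \<omega>' $ i = (\<Sum>j\<in>UNIV. of_int (A0 i j) *\<^sub>R (\<omega> $ j))" by metis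
  define A :: "real^4^4" where "A = (\<chi> i j. of_int (A0 i j))"
  have "coords_matrix \<omega>' = A ** coords_matrix \<omega>"
    unfolding vec_eq_iff matrix_matrix_mult_def A0 A_def
    by (simp add: linear_sum[OF linear_real_coords] linear_scale[OF linear_real_coords])
  then have d: "det (coords_matrix \<omega>') = det A * det (coords_matrix \<omega>)" by (simp add: det_mul)
  have "det A \<in> \<int>" unfolding det_4 A_def by simp
  then obtain n where n: "det A = of_int n" by (auto elim!: Ints_cases)
  have "det (coords_matrix \<omega>) > 0" "det (coords_matrix \<omega>') > 0" using assms by (auto simp: oriented_period_basis_def)
  then have "n > 0" using d unfolding n by (simp add: zero_less_mult_iff)
  then show ?thesis using d n by auto
qed

text \<open>Each basis is an integral combination of the other, so the positive determinants are
  integral multiples of each other. Hence the choice by \<open>SOME\<close> in \<open>H2\<close>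
  does not affect the form.\<close>

lemma oriented_basis_det:
  assumes "oriented_period_basis \<omega> \<Lambda>" "oriented_period_basis \<omega>' \<Lambda>"
  shows "det (coords_matrix \<omega>') = det (coords_matrix \<omega>)"
proof -
  obtain n where n: "n > 0" "det (coords_matrix \<omega>') = of_int n * det (coords_matrix \<omega>)" using oriented_basis_change[OF assms] by blast
  obtain m where m: "m > 0" "det (coords_matrix \<omega>) = of_int m * det (coords_matrix \<omega>')" using oriented_basis_change[OF assms(2,1)] by blast
  have p: "det (coords_matrix \<omega>) > 0" using assms by (auto simp: oriented_period_basis_def)
  have "1 * det (coords_matrix \<omega>) = of_int (m * n) * det (coords_matrix \<omega>)" using m(2) unfolding n(2) by simp
  then have "1 = real_of_int (m * n)" using p by (simp only: mult_cancel_right) auto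
  then have "m * n = 1" by linarith
  then have "n = 1" using n(1) m(1) by (auto simp: zmult_eq_1_iff)
  then show ?thesis using n(2) by simp
qed

lemma form_H2:
  assumes "oriented_period_basis \<omega> \<Lambda>" "alternating E" "alternating F"
  shows "form (H2 \<Lambda>) E F = wedge_eval \<omega> E F"
proof -
  have "oriented_period_basis (SOME \<omega>. oriented_period_basis \<omega> \<Lambda>) \<Lambda>" using assms(1) by (rule someI)
  from oriented_basis_det[OF assms(1) this] show ?thesis
    unfolding H2_def by (simp add: wedge_base_change[OF assms(2,3), of \<omega>] wedge_base_change[OF assms(2,3), of "SOME \<omega>. oriented_period_basis \<omega> \<Lambda>"])
qed

lemma dual_coordinates:
  assumes "det (coords_matrix \<omega>) \<noteq> 0"
  shows "\<exists>\<xi> :: 4 \<Rightarrow> complex^2 \<Rightarrow> real. (\<forall>k. linear (\<xi> k)) \<and> (\<forall>k l. \<xi> k (\<omega> $ l) = (if k = l then 1 else 0)) \<and>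
    (\<forall>v. v = (\<Sum>k\<in>UNIV. \<xi> k v *\<^sub>R (\<omega> $ k)))"
proof -
  let ?W = "coords_matrix \<omega>"
  obtain V where V: "?W ** V = mat 1" "V ** ?W = mat 1" using assms unfolding invertible_det_nz[symmetric] invertible_def by blast
  define \<xi> where "\<xi> k v = (\<Sum>j\<in>UNIV. real_coords v $ j * V $ j $ k)" for k v
  note l = linear_add[OF linear_real_coords] linear_scale[OF linear_real_coords]
  show ?thesis
  proof (intro exI[of _ \<xi>] conjI allI)
    show "linear (\<xi> k)" for k
      by (rule linearI) (simp_all add: \<xi>_def l sum.distrib sum_distrib_left algebra_simps)
    show "\<xi> k (\<omega> $ m) = (if k = m then 1 else 0)" for k m
    proof -
      have "\<xi> k (\<omega> $ m) = (?W ** V) $ m $ k" by (simp add: \<xi>_def matrix_matrix_mult_def)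
      then show ?thesis unfolding V by (auto simp: mat_def)
    qed
    show "v = (\<Sum>k\<in>UNIV. \<xi> k v *\<^sub>R (\<omega> $ k))" for v
    proof (rule real_coords_inj)
      have "real_coords (\<Sum>k\<in>UNIV. \<xi> k v *\<^sub>R (\<omega> $ k)) $ i = (\<Sum>j\<in>UNIV. real_coords v $ j * (V ** ?W) $ j $ i)" for i
        unfolding sum_4 l by (simp add: \<xi>_def matrix_matrix_mult_def sum_4 algebra_simps)
      also have "\<dots> i = real_coords v $ i" for i
        unfolding V by (simp add: mat_def if_distrib[of "\<lambda>x. _ * x"] cong: if_cong)
      finally show "real_coords v = real_coords (\<Sum>k\<in>UNIV. \<xi> k v *\<^sub>R (\<omega> $ k))" by (simp add: vec_eq_iff)
    qed
  qed
qed

lemma real_form_exists: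
  fixes f :: "complex^2 \<Rightarrow> complex^2 \<Rightarrow> real"
  assumes "bilinear f" obtains E :: real_form where "\<And>v w. form_apply E v w = f v w"
proof -
  have 1: "bounded_linear (f v)" for v using assms by (simp add: bilinear_def linear_conv_bounded_linear)
  have "linear (\<lambda>v. Blinfun (f v))"
  proof (rule linearI)
    show "Blinfun (f (v + w)) = Blinfun (f v) + Blinfun (f w)" for v w
      by (rule blinfun_eqI) (simp add: bounded_linear_Blinfun_apply[OF 1] blinfun.add_left bilinear_ladd[OF assms])
    show "Blinfun (f (r *\<^sub>R v)) = r *\<^sub>R Blinfun (f v)" for r v
      by (rule blinfun_eqI) (simp add: bounded_linear_Blinfun_apply[OF 1] blinfun.scaleR_left bilinear_lmul[OF assms])
  qed
  then have "bounded_linear (\<lambda>v. Blinfun (f v))" by (simp add: linear_conv_bounded_linear)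
  then have "form_apply (Blinfun (\<lambda>v. Blinfun (f v))) v w = f v w" for v w
    by (simp add: bounded_linear_Blinfun_apply 1)
  then show ?thesis by (rule that)
qed

lemma alternating_form_exists:
  assumes "det (coords_matrix \<omega>) \<noteq> 0"
  obtains E where "alternating E"
    "form_apply E (\<omega> $ 1) (\<omega> $ 2) = x12" "form_apply E (\<omega> $ 1) (\<omega> $ 3) = x13" "form_apply E (\<omega> $ 1) (\<omega> $ 4) = x14"
    "form_apply E (\<omega> $ 2) (\<omega> $ 3) = x23" "form_apply E (\<omega> $ 2) (\<omega> $ 4) = x24" "form_apply E (\<omega> $ 3) (\<omega> $ 4) = x34"
proof -
  obtain \<xi> :: "4 \<Rightarrow> complex^2 \<Rightarrow> real" where \<xi>': "\<forall>k. linear (\<xi> k)" "\<forall>k l. \<xi> k (\<omega> $ l) = (if k = l then 1 else 0)"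
    using dual_coordinates[OF assms] by (elim exE conjE)
  note \<xi> = \<xi>'[rule_format]
  define f where "f v w = x12 * (\<xi> 1 v * \<xi> 2 w - \<xi> 2 v * \<xi> 1 w) + x13 * (\<xi> 1 v * \<xi> 3 w - \<xi> 3 v * \<xi> 1 w)
     + x14 * (\<xi> 1 v * \<xi> 4 w - \<xi> 4 v * \<xi> 1 w) + x23 * (\<xi> 2 v * \<xi> 3 w - \<xi> 3 v * \<xi> 2 w)
     + x24 * (\<xi> 2 v * \<xi> 4 w - \<xi> 4 v * \<xi> 2 w) + x34 * (\<xi> 3 v * \<xi> 4 w - \<xi> 4 v * \<xi> 3 w)" for v w
  have "bilinear f" unfolding bilinear_def
    by (auto intro!: linearI simp: f_def linear_add[OF \<xi>(1)] linear_scale[OF \<xi>(1)] algebra_simps)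
  then obtain E :: real_form where E: "\<And>v w. form_apply E v w = f v w" using real_form_exists by blast
  show ?thesis
    by (rule that[of E]) (simp_all add: alternating_def E f_def \<xi>(2))
qed

text \<open>Complementary index pairs are put together, and the sign on the \<open>13\<close> entry
  is the one in the wedge product, so that the cup product becomes U^3 exactly.\<close>

definition form_coords :: "(complex^2)^4 \<Rightarrow> real_form \<Rightarrow> (real \<times> real) \<times> (real \<times> real) \<times> (real \<times> real)" where
  "form_coords \<omega> E = ((form_apply E (\<omega> $ 1) (\<omega> $ 2), form_apply E (\<omega> $ 3) (\<omega> $ 4)),
     (- form_apply E (\<omega> $ 1) (\<omega> $ 3), form_apply E (\<omega> $ 2) (\<omega> $ 4)), (form_apply E (\<omega> $ 1) (\<omega> $ 4), form_apply E (\<omega> $ 2) (\<omega> $ 3)))"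

lemma linear_form_coords: "linear (form_coords \<omega>)"
  by (rule linearI) (simp_all add: form_coords_def form_apply_simps)

lemma form_coords_wedge: "form hyp3 (form_coords \<omega> E) (form_coords \<omega> F) = wedge_eval \<omega> E F"
  by (simp add: form_coords_def wedge_eval_def Let_def)

lemma form_coords_inj:
  assumes "det (coords_matrix \<omega>) \<noteq> 0" "alternating E" "alternating F" "form_coords \<omega> E = form_coords \<omega> F"
  shows "E = F"
proof -
  obtain \<xi> :: "4 \<Rightarrow> complex^2 \<Rightarrow> real" where \<xi>': "\<forall>v. v = (\<Sum>k\<in>UNIV. \<xi> k v *\<^sub>R (\<omega> $ k))"
    using dual_coordinates[OF assms(1)] by (elim exE conjE)
  note \<xi> = \<xi>'[rule_format]
  have "form_apply E v w = form_apply F v w" for v w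
  proof -
    have "form_apply E' v w = form_apply E' (\<Sum>k\<in>UNIV. \<xi> k v *\<^sub>R (\<omega> $ k)) (\<Sum>k\<in>UNIV. \<xi> k w *\<^sub>R (\<omega> $ k))" for E' :: real_form
      using \<xi>[of v] \<xi>[of w] by simp
    then show ?thesis
      using alternating_expand[OF assms(2), of "\<lambda>k. \<xi> k v" "\<lambda>k. \<omega> $ k" "\<lambda>k. \<xi> k w"]
        alternating_expand[OF assms(3), of "\<lambda>k. \<xi> k v" "\<lambda>k. \<omega> $ k" "\<lambda>k. \<xi> k w"] assms(4)
      by (simp add: form_coords_def)
  qed
  then show ?thesis by (intro blinfun_eqI) auto
qed

lemma form_coords_surj:
  assumes "det (coords_matrix \<omega>) \<noteq> 0" shows "\<exists>E. alternating E \<and> form_coords \<omega> E = p"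
proof -
  obtain a b c d e f where p: "p = ((a, b), (c, d), (e, f))" by (cases p) auto
  obtain E where "alternating E"
    "form_apply E (\<omega> $ 1) (\<omega> $ 2) = a" "form_apply E (\<omega> $ 1) (\<omega> $ 3) = - c" "form_apply E (\<omega> $ 1) (\<omega> $ 4) = e"
    "form_apply E (\<omega> $ 2) (\<omega> $ 3) = f" "form_apply E (\<omega> $ 2) (\<omega> $ 4) = d" "form_apply E (\<omega> $ 3) (\<omega> $ 4) = b"
    by (rule alternating_form_exists[OF assms])
  then show ?thesis by (intro exI[of _ E]) (simp add: form_coords_def p)
qed

lemma H2_points_iff:
  assumes "oriented_period_basis \<omega> \<Lambda>"
  shows "E \<in> H2_points \<Lambda> \<longleftrightarrow> alternating E \<and> form_coords \<omega> E \<in> points hyp3"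
proof
  assume "E \<in> H2_points \<Lambda>"
  then show "alternating E \<and> form_coords \<omega> E \<in> points hyp3"
    using oriented_basis_mem[OF assms] by (auto simp: H2_points_def alternating_def form_coords_def)
next
  assume E: "alternating E \<and> form_coords \<omega> E \<in> points hyp3"
  then have c: "form_apply E (\<omega> $ 1) (\<omega> $ 2) \<in> \<int>" "form_apply E (\<omega> $ 3) (\<omega> $ 4) \<in> \<int>" "form_apply E (\<omega> $ 1) (\<omega> $ 3) \<in> \<int>"
    "form_apply E (\<omega> $ 2) (\<omega> $ 4) \<in> \<int>" "form_apply E (\<omega> $ 1) (\<omega> $ 4) \<in> \<int>" "form_apply E (\<omega> $ 2) (\<omega> $ 3) \<in> \<int>"
    by (auto simp: form_coords_def)
  have "form_apply E v w \<in> \<int>" if vw: "v \<in> \<Lambda>" "w \<in> \<Lambda>" for v w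
  proof -
    obtain x :: "4 \<Rightarrow> int" where x: "v = (\<Sum>i\<in>UNIV. of_int (x i) *\<^sub>R (\<omega> $ i))" using oriented_basis_int_comb[OF assms vw(1)] .
    obtain y :: "4 \<Rightarrow> int" where y: "w = (\<Sum>i\<in>UNIV. of_int (y i) *\<^sub>R (\<omega> $ i))" using oriented_basis_int_comb[OF assms vw(2)] .
    have "alternating E" using E by blast
    note * = alternating_expand[OF this, of "\<lambda>k. of_int (x k)" "\<lambda>k. \<omega> $ k" "\<lambda>k. of_int (y k)"]
    show ?thesis unfolding x y * by (intro Ints_add Ints_mult Ints_diff c Ints_of_int)
  qed
  then show "E \<in> H2_points \<Lambda>" using E by (auto simp: H2_points_def alternating_def)
qed

lemma linear_form_of_coords:
  assumes "det (coords_matrix \<omega>) \<noteq> 0"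
  obtains G where "linear G" "\<And>p. alternating (G p)" "\<And>p. form_coords \<omega> (G p) = p"
proof -
  define G where "G p = (SOME E. alternating E \<and> form_coords \<omega> E = p)" for p
  have G: "alternating (G p)" "form_coords \<omega> (G p) = p" for p
    using someI_ex[OF form_coords_surj[OF assms, of p]] unfolding G_def by auto
  note lin = linear_add[OF linear_form_coords] linear_scale[OF linear_form_coords]
  have alt: "alternating (G p + G p')" "alternating (r *\<^sub>R G p)" for p p' r
    using subspace_add[OF subspace_alternating] subspace_scale[OF subspace_alternating] G(1) by auto
  have "linear G"
  proof (rule linearI)
    show "G (p + p') = G p + G p'" for p p'
      by (rule form_coords_inj[OF assms]) (simp_all add: G alt lin)
    show "G (r *\<^sub>R p) = r *\<^sub>R G p" for r p
      by (rule form_coords_inj[OF assms]) (simp_all add: G alt lin)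
  qed
  then show ?thesis using that G by blast
qed

lemma H2_isometric_hyp3:
  assumes "oriented_period_basis \<omega> \<Lambda>"
  shows "lattice_embedding (form_coords \<omega>) (H2 \<Lambda>) hyp3" "form_coords \<omega> ` points (H2 \<Lambda>) = points hyp3"
proof -
  have d: "det (coords_matrix \<omega>) \<noteq> 0" using assms by (auto simp: oriented_period_basis_def)
  note H = H2_points_iff[OF assms]
  have pts: "points (H2 \<Lambda>) = H2_points \<Lambda>" by (simp add: H2_def)
  show im: "form_coords \<omega> ` points (H2 \<Lambda>) = points hyp3"
  proof (intro equalityI subsetI)
    fix p assume "p \<in> points hyp3"
    moreover obtain E where "alternating E" "form_coords \<omega> E = p" using form_coords_surj[OF d] by blast
    ultimately show "p \<in> form_coords \<omega> ` points (H2 \<Lambda>)" unfolding pts using H by blast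
  qed (auto simp: pts H simp del: points_sum)
  show "lattice_embedding (form_coords \<omega>) (H2 \<Lambda>) hyp3"
    unfolding lattice_embedding_def im
  proof (intro conjI ballI inj_onI)
    show "E = F" if "E \<in> points (H2 \<Lambda>)" "F \<in> points (H2 \<Lambda>)" "form_coords \<omega> E = form_coords \<omega> F" for E F
      using form_coords_inj[OF d] that H pts by blast
    show "form_coords \<omega> (E + F) = form_coords \<omega> E + form_coords \<omega> F" for E F by (rule linear_add[OF linear_form_coords])
    show "form hyp3 (form_coords \<omega> E) (form_coords \<omega> F) = form (H2 \<Lambda>) E F" if "E \<in> points (H2 \<Lambda>)" "F \<in> points (H2 \<Lambda>)" for E F
      using form_H2[OF assms, of E F] that H pts by (simp add: form_coords_wedge)
  qed simp
qed

lemma subgroup_H2_points: "additive_subgroup (H2_points \<Lambda>)"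
  unfolding additive_subgroup_def H2_points_def by (auto simp: form_apply_simps)

lemma subgroup_NS_points: "additive_subgroup (points (NS \<Lambda>))"
  unfolding additive_subgroup_def NS_def using subgroup_H2_points[of \<Lambda>]
  by (auto simp: additive_subgroup_def form_apply_simps)

section \<open>Forms of type (1,1), polarizations and the Hodge index inequality\<close>

lemma i_mult_coords: "Re ((\<i> *s v) $ 1) = - Im (v $ 1)" "Im ((\<i> *s v) $ 1) = Re (v $ 1)"
  "Re ((\<i> *s v) $ 2) = - Im (v $ 2)" "Im ((\<i> *s v) $ 2) = Re (v $ 2)" for v :: "complex^2"
  by simp_all

definition i_invariant :: "real_form \<Rightarrow> bool" where
  "i_invariant E \<longleftrightarrow> (\<forall>v w. form_apply E (\<i> *s v) (\<i> *s w) = form_apply E v w)"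

lemma i_std_basis: "\<i> *s std_basis 1 = std_basis 2" "\<i> *s std_basis 3 = std_basis 4" "\<i> *s std_basis 4 = - std_basis 3"
  by (simp_all add: std_basis_def vec_eq_iff forall_2)

text \<open>In the real frame e1, i e1, e2, i e2 type (1,1) is two linear equations on the six
  entries, leaving the four real parameters of a Hermitian matrix.\<close>

lemma i_invariant_iff:
  assumes "alternating E"
  shows "i_invariant E \<longleftrightarrow> form_apply E (std_basis 2) (std_basis 4) = form_apply E (std_basis 1) (std_basis 3) \<and>
     form_apply E (std_basis 2) (std_basis 3) = - form_apply E (std_basis 1) (std_basis 4)"
proof
  assume i: "i_invariant E"
  have "form_apply E (std_basis 2) (std_basis 4) = form_apply E (std_basis 1) (std_basis 3)"
    using i[unfolded i_invariant_def, rule_format, of "std_basis 1" "std_basis 3"] by (simp add: i_std_basis)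
  moreover have "- form_apply E (std_basis 2) (std_basis 3) = form_apply E (std_basis 1) (std_basis 4)"
    using i[unfolded i_invariant_def, rule_format, of "std_basis 1" "std_basis 4"] by (simp add: i_std_basis form_apply_simps)
  ultimately show "form_apply E (std_basis 2) (std_basis 4) = form_apply E (std_basis 1) (std_basis 3) \<and>
     form_apply E (std_basis 2) (std_basis 3) = - form_apply E (std_basis 1) (std_basis 4)" by simp
next
  assume e: "form_apply E (std_basis 2) (std_basis 4) = form_apply E (std_basis 1) (std_basis 3) \<and>
     form_apply E (std_basis 2) (std_basis 3) = - form_apply E (std_basis 1) (std_basis 4)"
  show "i_invariant E" unfolding i_invariant_def
  proof (intro allI)
    fix v w
    show "form_apply E (\<i> *s v) (\<i> *s w) = form_apply E v w"
      unfolding form_apply_std[OF assms, of "\<i> *s v"] form_apply_std[OF assms, of v] i_mult_coords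
      by (simp add: e algebra_simps)
  qed
qed

text \<open>
  An invariant alternating form is given by the Hermitian matrix with diagonal \<open>p, r\<close> and
  off-diagonal entry \<open>x + i y\<close>; the wedge square is twice its determinant.
\<close>

lemma wedge_std_invariant:
  assumes "alternating E" "alternating F" "i_invariant E" "i_invariant F"
  defines "p \<equiv> form_apply E (std_basis 1) (std_basis 2)" and "r \<equiv> form_apply E (std_basis 3) (std_basis 4)"
    and "x \<equiv> form_apply E (std_basis 1) (std_basis 3)" and "y \<equiv> form_apply E (std_basis 1) (std_basis 4)"
    and "p' \<equiv> form_apply F (std_basis 1) (std_basis 2)" and "r' \<equiv> form_apply F (std_basis 3) (std_basis 4)"
    and "x' \<equiv> form_apply F (std_basis 1) (std_basis 3)" and "y' \<equiv> form_apply F (std_basis 1) (std_basis 4)"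
  shows "wedge_eval std_frame E F = p * r' + r * p' - 2 * x * x' - 2 * y * y'"
  using assms(3)[unfolded i_invariant_iff[OF assms(1)]] assms(4)[unfolded i_invariant_iff[OF assms(2)]]
  unfolding wedge_eval_def Let_def by (simp add: p_def r_def x_def y_def p'_def r'_def x'_def y'_def)

lemma polarization_value:
  assumes "alternating E" "i_invariant E"
  defines "p \<equiv> form_apply E (std_basis 1) (std_basis 2)" and "r \<equiv> form_apply E (std_basis 3) (std_basis 4)"
    and "x \<equiv> form_apply E (std_basis 1) (std_basis 3)" and "y \<equiv> form_apply E (std_basis 1) (std_basis 4)"
  shows "form_apply E (\<i> *s v) v = - p * ((Re (v $ 1))^2 + (Im (v $ 1))^2) - r * ((Re (v $ 2))^2 + (Im (v $ 2))^2)
    + 2 * x * (Re (v $ 1) * Im (v $ 2) - Im (v $ 1) * Re (v $ 2)) - 2 * y * (Re (v $ 1) * Re (v $ 2) + Im (v $ 1) * Im (v $ 2))"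
  using assms(2)[unfolded i_invariant_iff[OF assms(1)]]
  unfolding form_apply_std[OF assms(1), of "\<i> *s v"] i_mult_coords p_def[symmetric] r_def[symmetric] x_def[symmetric] y_def[symmetric]
  by (simp add: power2_eq_square algebra_simps)

lemma polarization_definite:
  assumes E: "alternating E" "i_invariant E" and pos: "\<And>v. v \<noteq> 0 \<Longrightarrow> form_apply E (\<i> *s v) v > 0"
  shows "wedge_eval std_frame E E > 0"
proof -
  define p r x y where "p = form_apply E (std_basis 1) (std_basis 2)" "r = form_apply E (std_basis 3) (std_basis 4)"
    "x = form_apply E (std_basis 1) (std_basis 3)" "y = form_apply E (std_basis 1) (std_basis 4)"
  note val = polarization_value[OF E, folded p_r_x_y_def]
  have "r < 0" using pos[of "vector [0, 1]"] val[of "vector [0, 1]"] by (simp add: vec_eq_iff forall_2)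
  \<comment> \<open>A multiple of the projection of (1, 0) orthogonal to (0, 1) for the Hermitian
    form; its value is \<open>- r\<close> times the determinant.\<close>
  let ?v = "vector [complex_of_real r, Complex (- y) x] :: complex^2"
  have "?v \<noteq> 0" using \<open>r < 0\<close> by (simp add: vec_eq_iff forall_2)
  from pos[OF this] have "- r * (p * r - x^2 - y^2) > 0" unfolding val by (simp add: power2_eq_square algebra_simps)
  then have "p * r - x^2 - y^2 > 0" using \<open>r < 0\<close> by (simp add: mult_less_0_iff)
  then show ?thesis using wedge_std_invariant[OF E(1,1,2,2), folded p_r_x_y_def] by (simp add: power2_eq_square)
qed

text \<open>Multiplying by \<open>- p\<close> and completing squares leaves the positive determinant
  times a sum of squares; the sign of \<open>p\<close> selects positive over negative
  definite.\<close>

lemma definite_polarization: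
  assumes E: "alternating E" "i_invariant E" and pos: "wedge_eval std_frame E E > 0" and neg: "form_apply E (std_basis 1) (std_basis 2) < 0"
    and v: "v \<noteq> 0"
  shows "form_apply E (\<i> *s v) v > 0"
proof -
  define p r x y where "p = form_apply E (std_basis 1) (std_basis 2)" "r = form_apply E (std_basis 3) (std_basis 4)"
    "x = form_apply E (std_basis 1) (std_basis 3)" "y = form_apply E (std_basis 1) (std_basis 4)"
  note val = polarization_value[OF E, folded p_r_x_y_def]
  define a b c d where "a = Re (v $ 1)" "b = Im (v $ 1)" "c = Re (v $ 2)" "d = Im (v $ 2)"
  have D: "p * r - x^2 - y^2 > 0" using pos wedge_std_invariant[OF E(1,1,2,2), folded p_r_x_y_def] by (simp add: power2_eq_square)
  have p: "p < 0" using neg by (simp add: p_r_x_y_def)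
  have eq: "- p * form_apply E (\<i> *s v) v = (p * a - x * d + y * c)^2 + (p * b + x * c + y * d)^2 + (p * r - x^2 - y^2) * (c^2 + d^2)"
    unfolding val a_b_c_d_def[symmetric] by (simp add: power2_eq_square algebra_simps)
  have "(p * a - x * d + y * c)^2 + (p * b + x * c + y * d)^2 + (p * r - x^2 - y^2) * (c^2 + d^2) > 0"
  proof (cases "c = 0 \<and> d = 0")
    case True
    then have "a \<noteq> 0 \<or> b \<noteq> 0" using v by (auto simp: a_b_c_d_def vec_eq_iff forall_2 complex_eq_iff)
    then have "(p * a)^2 + (p * b)^2 > 0" using p by (simp add: sum_power2_gt_zero_iff)
    then show ?thesis using True by simp
  next
    case False
    then have "(p * r - x^2 - y^2) * (c^2 + d^2) > 0" using D by (intro mult_pos_pos) (auto simp: sum_power2_gt_zero_iff)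
    then show ?thesis by (smt (verit) zero_le_power2)
  qed
  then show ?thesis unfolding eq[symmetric] using p by (simp add: mult_less_0_iff)
qed

text \<open>The form \<open>p r - x^2 - y^2\<close> is Lorentzian and \<open>E\<close> is timelike,
  so this is the reversed Cauchy-Schwarz inequality. If the norm of \<open>F\<close> were not
  negative, orthogonality with the Cauchy-Schwarz and arithmetic-geometric inequalities would force
  all its parameters to vanish.\<close>

lemma hodge_index:
  assumes E: "alternating E" "i_invariant E" and F: "alternating F" "i_invariant F"
    and pos: "wedge_eval std_frame E E > 0" and orth: "wedge_eval std_frame E F = 0" and "F \<noteq> 0"
  shows "wedge_eval std_frame F F < 0"
proof (rule ccontr)
  assume "\<not> wedge_eval std_frame F F < 0"
  define p r x y where "p = form_apply E (std_basis 1) (std_basis 2)" "r = form_apply E (std_basis 3) (std_basis 4)"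
    "x = form_apply E (std_basis 1) (std_basis 3)" "y = form_apply E (std_basis 1) (std_basis 4)"
  define p' r' x' y' where "p' = form_apply F (std_basis 1) (std_basis 2)" "r' = form_apply F (std_basis 3) (std_basis 4)"
    "x' = form_apply F (std_basis 1) (std_basis 3)" "y' = form_apply F (std_basis 1) (std_basis 4)"
  have 1: "p * r > x^2 + y^2" using pos wedge_std_invariant[OF E(1,1,2,2), folded p_r_x_y_def] by (simp add: power2_eq_square)
  have 2: "p' * r' \<ge> x'^2 + y'^2"
    using \<open>\<not> wedge_eval std_frame F F < 0\<close> wedge_std_invariant[OF F(1,1,2,2), folded p'_r'_x'_y'_def] by (simp add: power2_eq_square)
  have 3: "p * r' + r * p' = 2 * (x * x' + y * y')"
    using orth wedge_std_invariant[OF E(1) F(1) E(2) F(2), folded p_r_x_y_def p'_r'_x'_y'_def] by simp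
  have "(x * x' + y * y')^2 \<le> (x^2 + y^2) * (x'^2 + y'^2)"
  proof -
    have "(x^2 + y^2) * (x'^2 + y'^2) - (x * x' + y * y')^2 = (x * y' - y * x')^2" by algebra
    then show ?thesis using zero_le_power2[of "x * y' - y * x'"] by linarith
  qed
  moreover have "4 * ((p * r) * (p' * r')) \<le> (p * r' + r * p')^2"
  proof -
    have "(p * r' + r * p')^2 - 4 * ((p * r) * (p' * r')) = (p * r' - r * p')^2" by algebra
    then show ?thesis using zero_le_power2[of "p * r' - r * p'"] by linarith
  qed
  moreover have "(p * r' + r * p')^2 = 4 * (x * x' + y * y')^2" unfolding 3 power_mult_distrib by simp
  \<comment> \<open>Since \<open>p r\<close> strictly exceeds \<open>x^2 + y^2\<close>, this is
    compatible with the bound on \<open>p' r'\<close> only if \<open>p' r'\<close> is 0.\<close>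
  ultimately have le: "(p * r) * (p' * r') \<le> (x^2 + y^2) * (x'^2 + y'^2)" by linarith
  have n: "x^2 + y^2 \<ge> 0" "x'^2 + y'^2 \<ge> 0" by simp_all
  have "(x^2 + y^2) * (x'^2 + y'^2) \<le> (x^2 + y^2) * (p' * r')" using 2 n by (intro mult_left_mono)
  with le have "(p * r - (x^2 + y^2)) * (p' * r') \<le> 0" by (simp add: left_diff_distrib)
  then have pr': "p' * r' = 0" using 1 2 n by (smt (verit) mult_pos_pos)
  then have xy: "x' = 0" "y' = 0" using 2 n by (auto simp: sum_power2_le_zero_iff)
  have "(p * r' + r * p') = 0" using 3 xy by simp
  moreover have "p * r > 0" using 1 n by linarith
  ultimately have z: "p' = 0" "r' = 0" using pr' by (auto simp: zero_less_mult_iff)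
  have "form_coords std_frame F = form_coords std_frame 0"
    using z xy F(2)[unfolded i_invariant_iff[OF F(1)]] by (simp add: form_coords_def p'_r'_x'_y'_def)
  moreover have "det (coords_matrix std_frame) \<noteq> 0"
    unfolding det_4 by (simp add: real_coords_simps std_basis_def)
  moreover have "alternating 0" by (simp add: alternating_def)
  ultimately have "F = 0" using form_coords_inj F(1) by blast
  then show False using \<open>F \<noteq> 0\<close> by blast
qed

section \<open>Neron-Severi lattices and mirror partners\<close>

lemma NS_points_iff: "E \<in> points (NS \<Lambda>) \<longleftrightarrow> E \<in> H2_points \<Lambda> \<and> i_invariant E"
  by (simp add: NS_def i_invariant_def)

lemma NS_alternating: "E \<in> points (NS \<Lambda>) \<Longrightarrow> alternating E"
  by (simp add: NS_def H2_points_def alternating_def)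

lemma form_NS: "form (NS \<Lambda>) = form (H2 \<Lambda>)"
  by (simp add: NS_def)

lemma form_NS_std:
  assumes "oriented_period_basis \<omega> \<Lambda>" "E \<in> points (NS \<Lambda>)" "F \<in> points (NS \<Lambda>)"
  shows "form (NS \<Lambda>) E F = det (coords_matrix \<omega>) * wedge_eval std_frame E F" "form (NS \<Lambda>) E F = wedge_eval \<omega> E F"
proof -
  note alt = NS_alternating[OF assms(2)] NS_alternating[OF assms(3)]
  show "form (NS \<Lambda>) E F = wedge_eval \<omega> E F" unfolding form_NS by (rule form_H2[OF assms(1) alt])
  then show "form (NS \<Lambda>) E F = det (coords_matrix \<omega>) * wedge_eval std_frame E F"
    unfolding wedge_base_change[OF alt, of \<omega>] .
qed

lemma hyp3_even: "p \<in> points hyp3 \<Longrightarrow> \<exists>k::int. form hyp3 p p = 2 * of_int k"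
proof -
  assume "p \<in> points hyp3"
  then obtain x where "p = vec6 x" unfolding range_vec6[symmetric] by blast
  moreover obtain a b c d e f where "x = (a, b, c, d, e, f)" by (cases x)
  ultimately have "form hyp3 p p = 2 * of_int (a * b + c * d + e * f)" by (simp add: vec6_def algebra_simps)
  then show ?thesis by blast
qed

lemma abelian_surface_frame:
  assumes "abelian_surface \<Lambda>"
  obtains \<omega> E0 where "oriented_period_basis \<omega> \<Lambda>" "det (coords_matrix \<omega>) > 0" "E0 \<in> points (NS \<Lambda>)" "wedge_eval std_frame E0 E0 > 0"
proof -
  obtain \<omega> where \<omega>: "oriented_period_basis \<omega> \<Lambda>" using assms by (auto simp: abelian_surface_def complex_torus_def)
  obtain E0 where E0: "E0 \<in> points (NS \<Lambda>)" "\<forall>v. v \<noteq> 0 \<longrightarrow> form_apply E0 (\<i> *s v) v > 0"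
    using assms by (auto simp: abelian_surface_def)
  have "i_invariant E0" using E0(1) by (simp add: NS_points_iff)
  then have "wedge_eval std_frame E0 E0 > 0"
    using polarization_definite[OF NS_alternating[OF E0(1)]] E0(2) by blast
  then show ?thesis using that \<omega> E0(1) by (simp add: oriented_period_basis_def)
qed

text \<open>The basis is inherited from the second cohomology and evenness from U^3. Nondegeneracy
  is geometric: a vector in the radical is isotropic and orthogonal to a polarization, hence zero by
  the Hodge index inequality.\<close>

lemma even_lattice_NS:
  assumes "abelian_surface \<Lambda>" shows "even_lattice (NS \<Lambda>)"
proof -
  obtain \<omega> E0 where \<omega>: "oriented_period_basis \<omega> \<Lambda>" and d: "det (coords_matrix \<omega>) > 0"
    and E0: "E0 \<in> points (NS \<Lambda>)" "wedge_eval std_frame E0 E0 > 0"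
    using abelian_surface_frame[OF assms] .
  have H3: "is_lattice hyp3" by (intro is_lattice_sum is_lattice_hyp_plane)
  obtain B where B: "finite B" "independent B" "points hyp3 = int_span B" using H3 by (rule lattice_basis)
  have d0: "det (coords_matrix \<omega>) \<noteq> 0" using d by simp
  obtain G where G: "linear G" "\<And>p. alternating (G p)" "\<And>p. form_coords \<omega> (G p) = p" using linear_form_of_coords[OF d0] by blast
  have injG: "inj G" using G(3) by (metis injI)
  have H2G: "H2_points \<Lambda> = int_span (G ` B)"
  proof -
    have "H2_points \<Lambda> = G ` points hyp3"
    proof (intro equalityI subsetI)
      fix E assume "E \<in> H2_points \<Lambda>"
      then have E: "alternating E" "form_coords \<omega> E \<in> points hyp3" using H2_points_iff[OF \<omega>] by blast+
      have "E = G (form_coords \<omega> E)" by (rule form_coords_inj[OF d0 E(1) G(2)]) (simp add: G(3))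
      then show "E \<in> G ` points hyp3" using E(2) by (rule image_eqI)
    next
      fix E assume "E \<in> G ` points hyp3"
      then show "E \<in> H2_points \<Lambda>" using H2_points_iff[OF \<omega>] G(2,3) by (auto simp del: points_sum)
    qed
    then show ?thesis unfolding B(3) using int_span_linear_image[OF G(1) inj_on_subset[OF injG subset_UNIV], of B] by simp
  qed
  have "\<exists>C. finite C \<and> independent C \<and> points (NS \<Lambda>) = int_span C"
  proof (rule subgroup_int_span_basis)
    show "finite (G ` B)" using B by simp
    show "independent (G ` B)" by (rule linear_independent_injective_image[OF G(1) B(2) inj_on_subset[OF injG subset_UNIV]])
    show "points (NS \<Lambda>) \<subseteq> int_span (G ` B)" unfolding H2G[symmetric] by (auto simp: NS_points_iff)
  qed (rule subgroup_NS_points)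
  moreover have "bilinear (form (NS \<Lambda>))" unfolding form_NS H2_def by (simp add: bilinear_wedge)
  moreover have co: "form_coords \<omega> E \<in> points hyp3" if "E \<in> points (NS \<Lambda>)" for E
    using that H2_points_iff[OF \<omega>] NS_points_iff by blast
  moreover have fc: "form (NS \<Lambda>) E F = form hyp3 (form_coords \<omega> E) (form_coords \<omega> F)" if "E \<in> points (NS \<Lambda>)" "F \<in> points (NS \<Lambda>)" for E F
    unfolding form_NS_std(2)[OF \<omega> that] form_coords_wedge ..
  moreover have "E = 0" if E: "E \<in> points (NS \<Lambda>)" "\<And>F. F \<in> points (NS \<Lambda>) \<Longrightarrow> form (NS \<Lambda>) E F = 0" for E
  proof (rule ccontr)
    assume "E \<noteq> 0"
    have "wedge_eval std_frame E0 E = 0" "wedge_eval std_frame E E = 0"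
      using E(2)[OF E0(1)] E(2)[OF E(1)] d0 unfolding form_NS_std(1)[OF \<omega> E(1) E0(1)] form_NS_std(1)[OF \<omega> E(1) E(1)]
      by (simp_all add: wedge_commute[of std_frame E0 E])
    moreover have "i_invariant E0" "i_invariant E" using E(1) E0(1) by (auto simp: NS_points_iff)
    ultimately show False
      using hodge_index[of E0 E] NS_alternating[OF E0(1)] NS_alternating[OF E(1)] E0(2) \<open>E \<noteq> 0\<close> by simp
  qed
  ultimately show ?thesis
    unfolding even_lattice_def is_lattice_def
  proof (intro conjI ballI impI)
    show "form (NS \<Lambda>) E F \<in> \<int>" if "E \<in> points (NS \<Lambda>)" "F \<in> points (NS \<Lambda>)" for E F
      unfolding fc[OF that] by (rule is_latticeD(2)[OF H3 co[OF that(1)] co[OF that(2)]])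
    show "form (NS \<Lambda>) E F = form (NS \<Lambda>) F E" if "E \<in> points (NS \<Lambda>)" "F \<in> points (NS \<Lambda>)" for E F
      unfolding form_NS H2_def by (simp add: wedge_commute)
    show "\<exists>k::int. form (NS \<Lambda>) E E = 2 * of_int k" if "E \<in> points (NS \<Lambda>)" for E
      unfolding fc[OF that that] by (rule hyp3_even[OF co[OF that]])
  qed auto
qed

text \<open>\<open>A\<close> and \<open>B\<close> are the pairings of the polarization with the
  basis, so \<open>F\<close> is an integral vector orthogonal to it. The norm of \<open>F\<close> is
  the determinant times the norm of the polarization, and the Hodge index inequality gives the
  sign.\<close>

lemma NS_disc:
  assumes X: "abelian_surface \<Lambda>" and b: "binary (NS \<Lambda>) p1 p2 a b c"
  shows "4 * a * c - b * b < 0"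
proof -
  obtain \<omega> E0 where \<omega>: "oriented_period_basis \<omega> \<Lambda>" and d: "det (coords_matrix \<omega>) > 0"
    and E0: "E0 \<in> points (NS \<Lambda>)" "wedge_eval std_frame E0 E0 > 0"
    using abelian_surface_frame[OF X] .
  have p: "p1 \<noteq> p2" "independent {p1, p2}" "points (NS \<Lambda>) = int_span {p1, p2}" using b by (auto simp: binary_def)
  obtain s t where st: "E0 = of_int s *\<^sub>R p1 + of_int t *\<^sub>R p2" using E0(1) unfolding p(3) int_span_pair[OF p(1)] by blast
  define A B where "A = 2 * a * s + b * t" and "B = b * s + 2 * c * t"
  define F where "F = of_int B *\<^sub>R p1 + of_int (- A) *\<^sub>R p2"
  have F: "F \<in> points (NS \<Lambda>)" unfolding p(3) int_span_pair[OF p(1)] F_def by blast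
  note f = binary_form_expand[OF b]
  have E0E0: "form (NS \<Lambda>) E0 E0 = of_int (s * A + t * B)" unfolding st f A_def B_def by (simp add: algebra_simps)
  have pos: "form (NS \<Lambda>) E0 E0 > 0" unfolding form_NS_std(1)[OF \<omega> E0(1) E0(1)] using d E0(2) by simp
  have "form (NS \<Lambda>) E0 F = 0" unfolding st F_def f A_def B_def by (simp add: algebra_simps)
  then have orth: "wedge_eval std_frame E0 F = 0" using d unfolding form_NS_std(1)[OF \<omega> E0(1) F] by simp
  have "F \<noteq> 0"
  proof
    assume "F = 0"
    then have "real_of_int B = 0" "real_of_int (- A) = 0" unfolding F_def using independent_pair[OF p(2,1)] by blast+
    then show False using pos unfolding E0E0 by simp
  qed
  moreover have "i_invariant E0" "i_invariant F" using E0(1) F by (auto simp: NS_points_iff)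
  ultimately have "wedge_eval std_frame F F < 0"
    using hodge_index[OF NS_alternating[OF E0(1)] _ NS_alternating[OF F] _ E0(2) orth] by blast
  then have neg: "form (NS \<Lambda>) F F < 0" unfolding form_NS_std(1)[OF \<omega> F F] using d by (simp add: mult_pos_neg)
  have "form (NS \<Lambda>) F F = of_int (4 * a * c - b * b) * form (NS \<Lambda>) E0 E0"
    unfolding E0E0 F_def f A_def B_def by (simp add: algebra_simps)
  then have "real_of_int (4 * a * c - b * b) < 0" using neg pos by (simp only: mult_less_0_iff) linarith
  then show ?thesis by linarith
qed

text \<open>The Neron-Severi lattice is cut out of the second cohomology by linear equations, hence
  primitive, and the complement formula for U^3 applies.\<close>

lemma transcendental_lattice_isometric:
  assumes X: "abelian_surface \<Lambda>" and b: "binary (NS \<Lambda>) p1 p2 a b c"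
  shows "neg_lattice (NS \<Lambda>) \<oplus>\<^sub>L hyp_plane \<cong>\<^sub>L transcendental_lattice \<Lambda>"
proof -
  obtain \<omega> where \<omega>: "oriented_period_basis \<omega> \<Lambda>" using X by (auto simp: abelian_surface_def complex_torus_def)
  have pts: "points (H2 \<Lambda>) = H2_points \<Lambda>" by (simp add: H2_def)
  have iso: "H2 \<Lambda> \<cong>\<^sub>L hyp3" unfolding isometric_def using H2_isometric_hyp3[OF \<omega>] by blast
  have "primitive_embedding id (NS \<Lambda>) (H2 \<Lambda>)" unfolding primitive_embedding_def lattice_embedding_def
  proof (intro conjI ballI allI impI)
    fix E and n :: nat assume E: "E \<in> points (H2 \<Lambda>)" "0 < n \<and> of_nat n *\<^sub>R E \<in> id ` points (NS \<Lambda>)"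
    then have "i_invariant (of_nat n *\<^sub>R E)" "n \<noteq> 0" by (auto simp: NS_points_iff)
    then have "i_invariant E" by (simp add: i_invariant_def form_apply_simps)
    then show "E \<in> id ` points (NS \<Lambda>)" using E(1) by (simp add: NS_points_iff pts)
  qed (auto simp: pts NS_points_iff form_NS)
  from binary_ortho_compl[OF b this _ iso] show ?thesis
    unfolding transcendental_lattice_def using subgroup_H2_points by (simp add: pts)
qed

lemma mukai_isometric: "mukai_N \<Lambda> \<cong>\<^sub>L NS \<Lambda> \<oplus>\<^sub>L hyp_plane"
  unfolding isometric_def
proof (intro exI conjI)
  let ?f = "\<lambda>(r, D, s). (D, (r, - s)) :: real_form \<times> real \<times> real"
  have pts: "points (mukai_N \<Lambda>) = \<int> \<times> points (NS \<Lambda>) \<times> \<int>" by (simp add: mukai_N_def)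
  show im: "?f ` points (mukai_N \<Lambda>) = points (NS \<Lambda> \<oplus>\<^sub>L hyp_plane)"
  proof (intro equalityI subsetI)
    fix z assume "z \<in> points (NS \<Lambda> \<oplus>\<^sub>L hyp_plane)"
    then obtain D r s where z: "z = (D, r, s)" "D \<in> points (NS \<Lambda>)" "r \<in> \<int>" "s \<in> \<int>" by auto
    then have "(r, D, - s) \<in> points (mukai_N \<Lambda>)" "z = ?f (r, D, - s)" by (simp_all add: pts)
    then show "z \<in> ?f ` points (mukai_N \<Lambda>)" by blast
  qed (auto simp: pts)
  show "lattice_embedding ?f (mukai_N \<Lambda>) (NS \<Lambda> \<oplus>\<^sub>L hyp_plane)" unfolding lattice_embedding_def im
    by (auto simp: inj_on_def mukai_N_def)
qed

lemma binary_isometric: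
  assumes b: "binary M p1 p2 a b c" and N: "even_lattice N" and iso: "M \<cong>\<^sub>L N"
  shows "\<exists>q1 q2. binary N q1 q2 a b c"
proof -
  have M: "is_lattice M" and p: "p1 \<noteq> p2" "independent {p1, p2}" "points M = int_span {p1, p2}"
    and f: "form M p1 p1 = 2 * of_int a" "form M p1 p2 = of_int b" "form M p2 p2 = 2 * of_int c"
    using b by (auto simp: binary_def even_lattice_def)
  obtain F G where F: "linear F" "linear G" "F ` points M = points N" "G ` points N = points M"
    "\<And>x. x \<in> span (points M) \<Longrightarrow> G (F x) = x" "\<And>y. y \<in> span (points N) \<Longrightarrow> F (G y) = y"
    "\<And>x y. x \<in> span (points M) \<Longrightarrow> y \<in> span (points M) \<Longrightarrow> form N (F x) (F y) = form M x y"
    using isometric_linear[OF M even_latticeD(1)[OF N] iso] by metis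
  have ps: "p1 \<in> span (points M)" "p2 \<in> span (points M)" unfolding p(3) by (auto intro!: span_base int_span_base)
  have inj: "inj_on F (span {p1, p2})"
    using F(5) unfolding p(3) by (intro inj_on_inverseI[of _ G]) (simp add: span_int_span)
  have "F p1 \<noteq> F p2" using inj p(1) by (metis inj_onD insertI1 insertI2 span_base)
  moreover have "independent {F p1, F p2}" using linear_independent_injective_image[OF F(1) p(2) inj] by simp
  moreover have "points N = int_span {F p1, F p2}"
    using int_span_linear_image[OF F(1), of "{p1, p2}"] \<open>F p1 \<noteq> F p2\<close> unfolding F(3)[symmetric] p(3) by (simp add: inj_on_def)
  ultimately have "binary N (F p1) (F p2) a b c" unfolding binary_def using N F(7)[OF ps(1,1)] F(7)[OF ps] F(7)[OF ps(2,2)] f by simp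
  then show ?thesis by blast
qed

text \<open>Supplies the parameters of the period matrix. An irrational \<open>t\<close> with
  negative value exists because negativity is an open condition; scaling \<open>(t, 1)\<close> then
  tunes the value to an irrational number and keeps the ratio.\<close>

lemma irrational_direction:
  fixes a b c :: int
  assumes "4 * a * c - b * b < 0"
  shows "\<exists>S T :: real. of_int a * T^2 + of_int b * T * S + of_int c * S^2 < 0 \<and>
    of_int a * T^2 + of_int b * T * S + of_int c * S^2 \<notin> \<rat> \<and>
    (\<forall>i j :: int. of_int i * T = of_int j * S \<longrightarrow> i = 0 \<and> j = 0)"
proof -
  define f where "f t = of_int a * t^2 + of_int b * t + of_int c" for t :: real
  have "\<exists>t. f t < 0"
  proof -
    consider "a = 0" | "a > 0" | "a < 0" by linarith
    then show ?thesis
    proof cases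
      case 1
      then have "b \<noteq> 0" using assms by auto
      then have "f (- (of_int c + 1) / of_int b) = - 1" using 1 by (simp add: f_def)
      then show ?thesis by (intro exI[of _ "- (of_int c + 1) / of_int b"]) simp
    next
      case 2
      have "f (- of_int b / (2 * of_int a)) = of_int (4 * a * c - b * b) / (4 * of_int a)"
        using 2 by (simp add: f_def power2_eq_square field_simps)
      moreover have "real_of_int (4 * a * c - b * b) < 0" using assms by linarith
      ultimately have "f (- of_int b / (2 * of_int a)) < 0" using 2 by (simp only: divide_less_0_iff) simp
      then show ?thesis by blast
    next
      case 3
      \<comment> \<open>With this \<open>t\<close> the square is \<open>t + |b| t + |c| t\<close>,
        which outweighs the linear part when \<open>a\<close> is at most -1.\<close>
      define t where "t = 1 + \<bar>real_of_int b\<bar> + \<bar>real_of_int c\<bar>"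
      have t: "t \<ge> 1" by (simp add: t_def)
      have "of_int a * t^2 \<le> - 1 * t^2" using 3 by (intro mult_right_mono) auto
      moreover have "of_int b * t \<le> \<bar>real_of_int b\<bar> * t" using t by (intro mult_right_mono) auto
      moreover have "of_int c \<le> \<bar>real_of_int c\<bar> * t" using t mult_left_mono[of 1 t "\<bar>real_of_int c\<bar>"] by simp
      moreover have "t^2 = t + \<bar>real_of_int b\<bar> * t + \<bar>real_of_int c\<bar> * t" by (simp add: t_def power2_eq_square algebra_simps)
      ultimately have "f t < 0" unfolding f_def using t by linarith
      then show ?thesis by blast
    qed
  qed
  then obtain t0 where t0: "f t0 < 0" by blast
  have "open {t. f t < 0}" unfolding f_def by (intro open_Collect_less continuous_intros)
  then obtain \<epsilon> where \<epsilon>: "\<epsilon> > 0" "ball t0 \<epsilon> \<subseteq> {t. f t < 0}" using t0 open_contains_ball by (metis mem_Collect_eq)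
  obtain t where t: "t \<in> {t0<..<t0 + \<epsilon>}" "t \<notin> \<rat>"
    using real_interval_avoid_countable_set[OF _ countable_rat, of t0 "t0 + \<epsilon>"] \<epsilon>(1) by auto
  have ft: "f t < 0" using t(1) \<epsilon>(2) by (auto simp: dist_real_def subset_iff)
  obtain d :: real where d: "d \<in> {0<..<1}" "d \<notin> \<rat>"
    using real_interval_avoid_countable_set[OF _ countable_rat, of 0 1] by auto
  \<comment> \<open>Scaling multiplies the value by \<open>l^2\<close>, so this \<open>l\<close>
    makes it the irrational number \<open>- d\<close>.\<close>
  define l where "l = sqrt (d / - f t)"
  have "d / - f t > 0" using d(1) ft by (intro divide_pos_pos) auto
  then have l: "l > 0" "l^2 = d / - f t" by (simp_all add: l_def)
  have q: "of_int a * (l * t)^2 + of_int b * (l * t) * l + of_int c * l^2 = - d"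
  proof -
    have "of_int a * (l * t)^2 + of_int b * (l * t) * l + of_int c * l^2 = l^2 * f t"
      by (simp add: f_def power2_eq_square algebra_simps)
    then show ?thesis unfolding l(2) using ft by simp
  qed
  have ind: "i = 0 \<and> j = 0" if "of_int i * (l * t) = of_int j * l" for i j :: int
  proof -
    have "l * (of_int i * t) = l * of_int j" using that by (simp add: mult_ac)
    then have e: "of_int i * t = of_int j" using l(1) by simp
    have "i = 0"
    proof (rule ccontr)
      assume "i \<noteq> 0"
      then have "t = of_int j / of_int i" using e by (simp add: field_simps)
      then show False using t(2) by simp
    qed
    then show ?thesis using e by simp
  qed
  show ?thesis
    by (rule exI[of _ l], rule exI[of _ "l * t"]) (use q d ind in auto)
qed

text \<open>
  The period matrix \<open>(1, \<tau>)\<close> with \<open>\<tau> = i (aT, - bT - cS; S, T)\<close>. The integral forms of type (1,1)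
  are cut out by one equation with coefficients \<open>1, S, T, aT\<^sup>2 + bTS + cS\<^sup>2\<close>.
\<close>

theorem surface_with_NS:
  assumes b: "binary M p1 p2 a b c" and disc: "4 * a * c - b * b < 0"
  shows "\<exists>\<Lambda>. abelian_surface \<Lambda> \<and> NS \<Lambda> \<cong>\<^sub>L M"
proof -
  obtain S T :: real where neg: "of_int a * T^2 + of_int b * T * S + of_int c * S^2 < 0"
    and irr: "of_int a * T^2 + of_int b * T * S + of_int c * S^2 \<notin> \<rat>"
    and ind': "\<forall>i j :: int. of_int i * T = of_int j * S \<longrightarrow> i = 0 \<and> j = 0"
    using irrational_direction[OF disc] by (elim exE conjE)
  note ind = ind'[rule_format]
  define D where "D = of_int a * T^2 + of_int b * T * S + of_int c * S^2"
  \<comment> \<open>With this abbreviation \<open>D\<close> is the determinant of the imaginary part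
    of the period matrix.\<close>
  define U where "U = of_int b * T + of_int c * S"
  have D: "D = of_int a * T * T + S * U" by (simp add: D_def U_def power2_eq_square algebra_simps)
  have Dn: "D < 0" "D \<notin> \<rat>" using neg irr by (auto simp: D_def)
  have S0: "S \<noteq> 0" using ind[of 0 1] by auto
  define \<omega> :: "(complex^2)^4" where "\<omega> = (\<chi> i. quad (std_basis 1) (std_basis 3)
     ((of_int a * T) *\<^sub>R std_basis 2 + S *\<^sub>R std_basis 4) ((- U) *\<^sub>R std_basis 2 + T *\<^sub>R std_basis 4) i)"
  have \<omega>_simps: "\<omega> $ 1 = std_basis 1" "\<omega> $ 2 = std_basis 3" "\<omega> $ 3 = (of_int a * T) *\<^sub>R std_basis 2 + S *\<^sub>R std_basis 4"
    "\<omega> $ 4 = (- U) *\<^sub>R std_basis 2 + T *\<^sub>R std_basis 4"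
    by (simp_all add: \<omega>_def)
  define \<Lambda> where "\<Lambda> = range (\<lambda>c :: 4 \<Rightarrow> int. \<Sum>i\<in>UNIV. of_int (c i) *\<^sub>R (\<omega> $ i))"
  \<comment> \<open>The order e1, e2, i e1, i e2 is odd with respect to the complex orientation, so
    a negative \<open>D\<close> makes the basis positively oriented.\<close>
  have det: "det (coords_matrix \<omega>) = - D"
    unfolding det_4 vec_lambda_beta real_coords_simps \<omega>_simps by (simp add: std_basis_def D algebra_simps)
  have \<omega>: "oriented_period_basis \<omega> \<Lambda>" unfolding oriented_period_basis_def det using Dn by (simp add: \<Lambda>_def)
  have entries: "form_apply E (\<omega> $ 1) (\<omega> $ 2) = form_apply E (std_basis 1) (std_basis 3)"
    "form_apply E (\<omega> $ 1) (\<omega> $ 3) = of_int a * T * form_apply E (std_basis 1) (std_basis 2) + S * form_apply E (std_basis 1) (std_basis 4)"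
    "form_apply E (\<omega> $ 1) (\<omega> $ 4) = - U * form_apply E (std_basis 1) (std_basis 2) + T * form_apply E (std_basis 1) (std_basis 4)"
    "form_apply E (\<omega> $ 2) (\<omega> $ 3) = of_int a * T * form_apply E (std_basis 1) (std_basis 4) + S * form_apply E (std_basis 3) (std_basis 4)"
    "form_apply E (\<omega> $ 2) (\<omega> $ 4) = - U * form_apply E (std_basis 1) (std_basis 4) + T * form_apply E (std_basis 3) (std_basis 4)"
    "form_apply E (\<omega> $ 3) (\<omega> $ 4) = D * form_apply E (std_basis 1) (std_basis 3)"
    if E: "alternating E" "i_invariant E" for E
  proof -
    let ?e = "\<lambda>i j. form_apply E (std_basis i) (std_basis j)"
    have inv: "?e 2 4 = ?e 1 3" "?e 2 3 = - ?e 1 4" using E(2) unfolding i_invariant_iff[OF E(1)] by simp_all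
    have sk: "?e 4 2 = - ?e 1 3" "?e 3 2 = ?e 1 4"
      using inv alternating_skew[OF E(1), of "std_basis 4" "std_basis 2"] alternating_skew[OF E(1), of "std_basis 3" "std_basis 2"] by simp_all
    show "form_apply E (\<omega> $ 1) (\<omega> $ 2) = ?e 1 3" "form_apply E (\<omega> $ 1) (\<omega> $ 3) = of_int a * T * ?e 1 2 + S * ?e 1 4"
      "form_apply E (\<omega> $ 1) (\<omega> $ 4) = - U * ?e 1 2 + T * ?e 1 4"
      "form_apply E (\<omega> $ 2) (\<omega> $ 3) = of_int a * T * ?e 1 4 + S * ?e 3 4"
      "form_apply E (\<omega> $ 2) (\<omega> $ 4) = - U * ?e 1 4 + T * ?e 3 4"
      "form_apply E (\<omega> $ 3) (\<omega> $ 4) = D * ?e 1 3"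
      unfolding \<omega>_simps by (simp_all add: form_apply_simps inv sk alternating_self[OF E(1)] D algebra_simps)
  qed
  have relations: "form_apply E (\<omega> $ 1) (\<omega> $ 2) = 0" "form_apply E (\<omega> $ 3) (\<omega> $ 4) = 0"
    "form_apply E (\<omega> $ 2) (\<omega> $ 3) = of_int a * form_apply E (\<omega> $ 1) (\<omega> $ 4) + of_int b * form_apply E (\<omega> $ 1) (\<omega> $ 3)"
    "form_apply E (\<omega> $ 2) (\<omega> $ 4) = - of_int c * form_apply E (\<omega> $ 1) (\<omega> $ 3)"
    "form_apply E (\<omega> $ 1) (\<omega> $ 3) \<in> \<int>" "form_apply E (\<omega> $ 1) (\<omega> $ 4) \<in> \<int>"
    if E: "E \<in> points (NS \<Lambda>)" for E
  proof -
    have inv: "i_invariant E" and H: "E \<in> H2_points \<Lambda>" using E by (auto simp: NS_points_iff)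
    note v = entries[OF NS_alternating[OF E] inv]
    have mem: "form_apply E (\<omega> $ i) (\<omega> $ j) \<in> \<int>" for i j
      using H oriented_basis_mem[OF \<omega>] by (auto simp: H2_points_def)
    have "\<exists>n :: int. form_apply E (\<omega> $ i) (\<omega> $ j) = of_int n" for i j using mem[of i j] by (auto elim!: Ints_cases)
    then obtain n where n: "\<And>i j. form_apply E (\<omega> $ i) (\<omega> $ j) = of_int (n i j)" by metis
    \<comment> \<open>Two integers differ by the irrational factor \<open>D\<close>, so both
      vanish.\<close>
    have Dx: "D * of_int (n 1 2) = of_int (n 3 4)" using v(1,6) by (simp add: n)
    have "n 1 2 = 0"
    proof (rule ccontr)
      assume "n 1 2 \<noteq> 0"
      then have "D = of_int (n 3 4) / of_int (n 1 2)" using Dx by (simp add: field_simps)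
      then show False using Dn(2) by simp
    qed
    then show "form_apply E (\<omega> $ 1) (\<omega> $ 2) = 0" "form_apply E (\<omega> $ 3) (\<omega> $ 4) = 0" using Dx by (simp_all add: n)
    \<comment> \<open>This combination eliminates the remaining Hermitian parameters and leaves one
      relation between integers; the rational independence of \<open>S\<close> and \<open>T\<close>
      splits it into two. Only the entries \<open>14\<close> and \<open>13\<close> stay free, so the
      rank is 2.\<close>
    have "T * form_apply E (\<omega> $ 2) (\<omega> $ 3) - S * form_apply E (\<omega> $ 2) (\<omega> $ 4)
        = of_int a * T * form_apply E (\<omega> $ 1) (\<omega> $ 4) + U * form_apply E (\<omega> $ 1) (\<omega> $ 3)"
      unfolding v by (simp add: algebra_simps)
    then have "of_int (n 2 3 - a * n 1 4 - b * n 1 3) * T = of_int (n 2 4 + c * n 1 3) * S"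
      unfolding n U_def by (simp add: algebra_simps)
    from ind[OF this] have "n 2 3 = a * n 1 4 + b * n 1 3" "n 2 4 = - c * n 1 3" by simp_all
    then show "form_apply E (\<omega> $ 2) (\<omega> $ 3) = of_int a * form_apply E (\<omega> $ 1) (\<omega> $ 4) + of_int b * form_apply E (\<omega> $ 1) (\<omega> $ 3)"
      "form_apply E (\<omega> $ 2) (\<omega> $ 4) = - of_int c * form_apply E (\<omega> $ 1) (\<omega> $ 3)" by (simp_all add: n)
    show "form_apply E (\<omega> $ 1) (\<omega> $ 3) \<in> \<int>" "form_apply E (\<omega> $ 1) (\<omega> $ 4) \<in> \<int>" by (rule mem)+
  qed
  have exists_NS: "\<exists>E\<in>points (NS \<Lambda>). form_apply E (\<omega> $ 1) (\<omega> $ 4) = of_int x0 \<and> form_apply E (\<omega> $ 1) (\<omega> $ 3) = of_int y0" for x0 y0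
  proof -
    \<comment> \<open>Cramer's rule for the entries \<open>13\<close> and \<open>14\<close>, a
      linear system in \<open>p\<close>, \<open>y\<close> with determinant \<open>D\<close>;
      \<open>r\<close> is then read off from the entry \<open>23\<close>.\<close>
    define p where "p = (T * of_int y0 - S * of_int x0) / D"
    define y where "y = (of_int a * T * of_int x0 + U * of_int y0) / D"
    define r where "r = (of_int a * of_int x0 + of_int b * of_int y0 - of_int a * T * y) / S"
    have Dp: "D * p = T * of_int y0 - S * of_int x0" "D * y = of_int a * T * of_int x0 + U * of_int y0"
      "S * r = of_int a * of_int x0 + of_int b * of_int y0 - of_int a * T * y"
      using Dn S0 by (simp_all add: p_def y_def r_def)
    have std: "det (coords_matrix std_frame) \<noteq> 0"
      unfolding det_4 by (simp add: real_coords_simps std_basis_def)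
    obtain E where E: "alternating E" "form_apply E (std_basis 1) (std_basis 2) = p" "form_apply E (std_basis 1) (std_basis 3) = 0"
      "form_apply E (std_basis 1) (std_basis 4) = y" "form_apply E (std_basis 2) (std_basis 3) = - y"
      "form_apply E (std_basis 2) (std_basis 4) = 0" "form_apply E (std_basis 3) (std_basis 4) = r"
      using alternating_form_exists[OF std, of p 0 y "- y" 0 r] unfolding vec_lambda_beta .
    have inv: "i_invariant E" unfolding i_invariant_iff[OF E(1)] by (simp add: E)
    note v = entries[OF E(1) inv, unfolded E]
    have e13: "of_int a * T * p + S * y = of_int y0"
    proof -
      have "D * (of_int a * T * p + S * y) = of_int a * T * (D * p) + S * (D * y)" by (simp add: algebra_simps)
      also have "\<dots> = D * of_int y0" unfolding Dp(1,2) by (simp add: D algebra_simps)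
      finally show ?thesis using Dn(1) by (metis less_irrefl mult_left_cancel)
    qed
    have e14: "- U * p + T * y = of_int x0"
    proof -
      have "D * (- U * p + T * y) = - U * (D * p) + T * (D * y)" by (simp add: algebra_simps)
      also have "\<dots> = D * of_int x0" unfolding Dp(1,2) by (simp add: D algebra_simps)
      finally show ?thesis using Dn(1) by (metis less_irrefl mult_left_cancel)
    qed
    have e23: "of_int a * T * y + S * r = of_int (a * x0 + b * y0)" using Dp(3) by simp
    \<comment> \<open>The entry \<open>24\<close> is now determined, and its integrality is the
      point where the special shape of the period matrix is used.\<close>
    have e24: "- U * y + T * r = of_int (- c * y0)"
    proof -
      have "S * (- U * y + T * r) = T * (S * r) - (S * U) * y" by (simp add: algebra_simps)
      also have "\<dots> = T * (of_int a * of_int x0 + of_int b * of_int y0) - D * y" unfolding Dp(3) D by (simp add: algebra_simps)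
      also have "\<dots> = S * of_int (- c * y0)" unfolding Dp(2) U_def by (simp add: algebra_simps)
      finally show ?thesis by (rule mult_left_cancel[OF S0, THEN iffD1])
    qed
    have "E \<in> H2_points \<Lambda>" unfolding H2_points_iff[OF \<omega>]
      unfolding form_coords_def v e13 e14 e23 e24 using E(1) by simp
    then have "E \<in> points (NS \<Lambda>)" using inv by (simp add: NS_points_iff)
    then show ?thesis by (intro bexI[of _ E] conjI, unfold v e13 e14) simp_all
  qed
  have form_eq: "form (NS \<Lambda>) E F = 2 * of_int a * form_apply E (\<omega> $ 1) (\<omega> $ 4) * form_apply F (\<omega> $ 1) (\<omega> $ 4)
      + of_int b * (form_apply E (\<omega> $ 1) (\<omega> $ 4) * form_apply F (\<omega> $ 1) (\<omega> $ 3) + form_apply E (\<omega> $ 1) (\<omega> $ 3) * form_apply F (\<omega> $ 1) (\<omega> $ 4))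
      + 2 * of_int c * form_apply E (\<omega> $ 1) (\<omega> $ 3) * form_apply F (\<omega> $ 1) (\<omega> $ 3)"
    if "E \<in> points (NS \<Lambda>)" "F \<in> points (NS \<Lambda>)" for E F
    unfolding form_NS_std(2)[OF \<omega> that] wedge_eval_def Let_def relations(1-4)[OF that(1)] relations(1-4)[OF that(2)]
    by (simp add: algebra_simps)
  have "abelian_surface \<Lambda>"
  proof -
    obtain x0 y0 where xy: "a * x0 * x0 + b * x0 * y0 + c * y0 * y0 > 0" using indefinite_value[OF disc] by blast
    obtain E where E: "E \<in> points (NS \<Lambda>)" "form_apply E (\<omega> $ 1) (\<omega> $ 4) = of_int x0" "form_apply E (\<omega> $ 1) (\<omega> $ 3) = of_int y0"
      using exists_NS by blast
    have "form (NS \<Lambda>) E E = 2 * of_int (a * x0 * x0 + b * x0 * y0 + c * y0 * y0)"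
      unfolding form_eq[OF E(1,1)] E(2,3) by (simp add: algebra_simps)
    also have "\<dots> > 0" using xy by (simp only: of_int_0_less_iff zero_less_mult_iff) simp
    finally have pos: "wedge_eval std_frame E E > 0"
      unfolding form_NS_std(1)[OF \<omega> E(1,1)] det using Dn(1) by (simp add: mult_less_0_iff)
    have alt: "alternating E" and inv: "i_invariant E" using NS_alternating[OF E(1)] E(1) by (auto simp: NS_points_iff)
    define p where "p = form_apply E (std_basis 1) (std_basis 2)"
    have "p \<noteq> 0"
    proof
      assume "p = 0"
      then show False using pos unfolding wedge_std_invariant[OF alt alt inv inv] p_def by (simp add: sum_squares_gt_zero_iff) (smt (verit) zero_le_square)
    qed
    \<comment> \<open>A positive norm makes the Hermitian form definite up to sign, so
      \<open>E\<close> or \<open>- E\<close> is a polarization.\<close>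
    have "\<exists>E'\<in>points (NS \<Lambda>). wedge_eval std_frame E' E' > 0 \<and> form_apply E' (std_basis 1) (std_basis 2) < 0"
    proof (cases "p < 0")
      case True then show ?thesis using E(1) pos p_def by blast
    next
      case False
      have "- E \<in> points (NS \<Lambda>)" by (rule additive_subgroupD(3)[OF subgroup_NS_points E(1)])
      moreover have "wedge_eval std_frame (- E) (- E) > 0"
        using pos by (simp add: bilinear_lneg[OF bilinear_wedge] bilinear_rneg[OF bilinear_wedge])
      moreover have "form_apply (- E) (std_basis 1) (std_basis 2) < 0" using False \<open>p \<noteq> 0\<close> by (simp add: p_def form_apply_simps)
      ultimately show ?thesis by blast
    qed
    then obtain E' where E': "E' \<in> points (NS \<Lambda>)" "wedge_eval std_frame E' E' > 0" "form_apply E' (std_basis 1) (std_basis 2) < 0" by blast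
    have "i_invariant E'" using E'(1) by (simp add: NS_points_iff)
    then have "\<forall>v. v \<noteq> 0 \<longrightarrow> form_apply E' (\<i> *s v) v > 0" using definite_polarization[OF NS_alternating[OF E'(1)] _ E'(2,3)] by blast
    then show ?thesis unfolding abelian_surface_def complex_torus_def using \<omega> E'(1) by blast
  qed
  moreover have "NS \<Lambda> \<cong>\<^sub>L M"
  proof -
    have p: "p1 \<noteq> p2" "points M = int_span {p1, p2}" using b by (auto simp: binary_def)
    define g where "g E = form_apply E (\<omega> $ 1) (\<omega> $ 4) *\<^sub>R p1 + form_apply E (\<omega> $ 1) (\<omega> $ 3) *\<^sub>R p2" for E
    have im: "g ` points (NS \<Lambda>) = points M"
    proof (intro equalityI subsetI)
      fix x assume "x \<in> g ` points (NS \<Lambda>)"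
      then obtain E where E: "E \<in> points (NS \<Lambda>)" "x = g E" by blast
      obtain m n where "form_apply E (\<omega> $ 1) (\<omega> $ 4) = of_int m" "form_apply E (\<omega> $ 1) (\<omega> $ 3) = of_int n"
        using relations(5,6)[OF E(1)] by (auto elim!: Ints_cases)
      then show "x \<in> points M" unfolding p(2) int_span_pair[OF p(1)] E(2) g_def by auto
    next
      fix x assume "x \<in> points M"
      then obtain m n where mn: "x = of_int m *\<^sub>R p1 + of_int n *\<^sub>R p2" unfolding p(2) int_span_pair[OF p(1)] by blast
      obtain E where "E \<in> points (NS \<Lambda>)" "form_apply E (\<omega> $ 1) (\<omega> $ 4) = of_int m" "form_apply E (\<omega> $ 1) (\<omega> $ 3) = of_int n"
        using exists_NS by blast
      then show "x \<in> g ` points (NS \<Lambda>)" by (intro image_eqI[of _ _ E]) (simp_all add: g_def mn)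
    qed
    have gf: "form M (g E) (g F) = form (NS \<Lambda>) E F" if "E \<in> points (NS \<Lambda>)" "F \<in> points (NS \<Lambda>)" for E F
      unfolding g_def binary_form_expand[OF b] form_eq[OF that] by (simp add: algebra_simps)
    have g_lin: "g (E + F) = g E + g F" "g (E - F) = g E - g F" for E F by (simp_all add: g_def form_apply_simps algebra_simps)
    have "is_lattice M" using b by (auto simp: binary_def even_lattice_def)
    then have "inj_on g (points (NS \<Lambda>))"
      using is_lattice_embedding_inj[OF even_latticeD(1)[OF even_lattice_NS[OF \<open>abelian_surface \<Lambda>\<close>]] g_lin(2) is_latticeD(1) gf] by blast
    then show ?thesis unfolding isometric_def lattice_embedding_def using im gf g_lin(1) by (intro exI[of _ g]) simp
  qed
  ultimately show ?thesis by blast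
qed

section \<open>Common mirror partners\<close>

lemma share_mirror_partner_imp_stably_equivalent:
  assumes "share_mirror_partner X1 X2" shows "stably_equivalent (NS X1) (NS X2)"
proof -
  obtain Y where 1: "mukai_N X1 \<cong>\<^sub>L transcendental_lattice Y" and 2: "mukai_N X2 \<cong>\<^sub>L transcendental_lattice Y"
    using assms unfolding share_mirror_partner_def mirror_partners_def by blast
  have sub: "additive_subgroup (points (mukai_N X))" for X
    by (simp add: mukai_N_def additive_subgroup_Times additive_subgroup_Ints subgroup_NS_points)
  have "NS X1 \<oplus>\<^sub>L hyp_plane \<cong>\<^sub>L mukai_N X1" by (rule isometric_sym[OF sub mukai_isometric])
  then have "NS X1 \<oplus>\<^sub>L hyp_plane \<cong>\<^sub>L transcendental_lattice Y" using 1 by (rule isometric_trans)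
  then have "NS X1 \<oplus>\<^sub>L hyp_plane \<cong>\<^sub>L mukai_N X2" using isometric_sym[OF sub 2] by (rule isometric_trans)
  then have "NS X1 \<oplus>\<^sub>L hyp_plane \<cong>\<^sub>L NS X2 \<oplus>\<^sub>L hyp_plane" using mukai_isometric by (rule isometric_trans)
  then show ?thesis by (rule isometric_sum_hyp_imp_stably_equivalent)
qed

text \<open>One isometry gives both halves: read with the transcendental lattice of \<open>X\<close>
  on the left it matches the Mukai lattice of \<open>Y\<close>, and negated, since U(-1) is
  isometric to U, it matches the other pair.\<close>

lemma mirror_partnersI:
  assumes X: "abelian_surface X" "binary (NS X) p1 p2 a b c" and Y: "abelian_surface Y" "binary (NS Y) q1 q2 a' b' c'"
    and 1: "neg_lattice (NS X) \<oplus>\<^sub>L hyp_plane \<cong>\<^sub>L NS Y \<oplus>\<^sub>L hyp_plane"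
  shows "mirror_partners X Y"
proof -
  have sub: "additive_subgroup (points (neg_lattice (NS X) \<oplus>\<^sub>L hyp_plane))" "additive_subgroup (points (mukai_N X))"
    "additive_subgroup (points (neg_lattice (neg_lattice (NS X) \<oplus>\<^sub>L hyp_plane)))" for X
    by (simp_all add: mukai_N_def additive_subgroup_Times additive_subgroup_Ints subgroup_NS_points)
  have "transcendental_lattice X \<cong>\<^sub>L neg_lattice (NS X) \<oplus>\<^sub>L hyp_plane"
    by (rule isometric_sym[OF sub(1) transcendental_lattice_isometric[OF X]])
  then have "transcendental_lattice X \<cong>\<^sub>L NS Y \<oplus>\<^sub>L hyp_plane" using 1 by (rule isometric_trans)
  moreover have "NS Y \<oplus>\<^sub>L hyp_plane \<cong>\<^sub>L mukai_N Y" by (rule isometric_sym[OF sub(2) mukai_isometric])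
  ultimately have T: "transcendental_lattice X \<cong>\<^sub>L mukai_N Y" by (rule isometric_trans)
  have n: "neg_lattice (M \<oplus>\<^sub>L hyp_plane) \<cong>\<^sub>L neg_lattice M \<oplus>\<^sub>L hyp_plane" for M :: "real_form quad_lattice"
    unfolding neg_lattice_sum by (rule isometric_sum[OF isometric_refl neg_hyp_plane])
  have n': "NS X \<oplus>\<^sub>L hyp_plane \<cong>\<^sub>L neg_lattice (neg_lattice (NS X) \<oplus>\<^sub>L hyp_plane)"
    by (rule isometric_sym[OF sub(3) n[of "neg_lattice (NS X)", unfolded neg_neg_lattice]])
  have "neg_lattice (neg_lattice (NS X) \<oplus>\<^sub>L hyp_plane) \<cong>\<^sub>L neg_lattice (NS Y) \<oplus>\<^sub>L hyp_plane"
    by (rule isometric_trans[OF isometric_neg[OF 1] n])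
  then have "NS X \<oplus>\<^sub>L hyp_plane \<cong>\<^sub>L neg_lattice (NS Y) \<oplus>\<^sub>L hyp_plane" by (rule isometric_trans[OF n'])
  then have "NS X \<oplus>\<^sub>L hyp_plane \<cong>\<^sub>L transcendental_lattice Y" using transcendental_lattice_isometric[OF Y] by (rule isometric_trans)
  then have "mukai_N X \<cong>\<^sub>L transcendental_lattice Y" by (rule isometric_trans[OF mukai_isometric])
  then show ?thesis unfolding mirror_partners_def using X(1) Y(1) T by blast
qed

text \<open>\<open>Y\<close> is built from \<open>X1\<close> alone. Stable equivalence gives (3),
  and negating (3) provides the hypothesis of \<open>mirror_partnersI\<close> for \<open>X2\<close>
  with the same \<open>Y\<close>.\<close>

lemma stably_equivalent_imp_share_mirror_partner:
  assumes X: "abelian_surface X1" "abelian_surface X2" and \<rho>: "picard_number X1 = 2" "picard_number X2 = 2"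
    and st: "stably_equivalent (NS X1) (NS X2)"
  shows "share_mirror_partner X1 X2"
proof -
  note e = even_lattice_NS[OF X(1)] even_lattice_NS[OF X(2)]
  obtain p1 p2 a b c where 1: "binary (NS X1) p1 p2 a b c"
    using even_rank2_binary[OF e(1)] \<rho> by (auto simp: picard_number_def lattice_rank_def)
  obtain r1 r2 a' b' c' where 2: "binary (NS X2) r1 r2 a' b' c'"
    using even_rank2_binary[OF e(2)] \<rho> by (auto simp: picard_number_def lattice_rank_def)
  note d = NS_disc[OF X(1) 1] NS_disc[OF X(2) 2]
  have S: "NS X1 \<oplus>\<^sub>L hyp_plane \<cong>\<^sub>L NS X2 \<oplus>\<^sub>L hyp_plane" using binary_stable_equivalence(3)[OF 1 d(1) 2 d(2)] st by blast
  have L: "is_lattice (neg_lattice (NS X1))" by (intro is_lattice_neg even_latticeD e)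
  have "even_lattice (neg_lattice (NS X1))" unfolding even_lattice_def
  proof (intro conjI L ballI)
    fix E assume "E \<in> points (neg_lattice (NS X1))"
    then obtain k where "form (NS X1) E E = 2 * of_int k" using even_latticeD(2)[OF e(1)] by (auto simp: even_real_def)
    then show "\<exists>k::int. form (neg_lattice (NS X1)) E E = 2 * of_int k" by (intro exI[of _ "- k"]) simp
  qed
  then have n1: "binary (neg_lattice (NS X1)) p1 p2 (- a) (- b) (- c)" using 1 by (simp add: binary_def)
  obtain Y where Y: "abelian_surface Y" "NS Y \<cong>\<^sub>L neg_lattice (NS X1)" using surface_with_NS[OF n1] d(1) by auto
  have iso: "neg_lattice (NS X1) \<cong>\<^sub>L NS Y" by (rule isometric_sym[OF subgroup_NS_points Y(2)])
  obtain q1 q2 where q: "binary (NS Y) q1 q2 (- a) (- b) (- c)" using binary_isometric[OF n1 even_lattice_NS[OF Y(1)] iso] by blast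
  have i1: "neg_lattice (NS X1) \<oplus>\<^sub>L hyp_plane \<cong>\<^sub>L NS Y \<oplus>\<^sub>L hyp_plane" by (rule isometric_sum[OF iso isometric_refl])
  have sub: "additive_subgroup (points (neg_lattice (NS X) \<oplus>\<^sub>L neg_lattice hyp_plane))" "additive_subgroup (points (NS X \<oplus>\<^sub>L hyp_plane))" for X
    by (simp_all add: additive_subgroup_Times additive_subgroup_Ints subgroup_NS_points)
  have n: "neg_lattice (NS X) \<oplus>\<^sub>L neg_lattice hyp_plane \<cong>\<^sub>L neg_lattice (NS X) \<oplus>\<^sub>L hyp_plane" for X
    by (rule isometric_sum[OF isometric_refl neg_hyp_plane])
  have "NS X2 \<oplus>\<^sub>L hyp_plane \<cong>\<^sub>L NS X1 \<oplus>\<^sub>L hyp_plane" by (rule isometric_sym[OF sub(2) S])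
  then have "neg_lattice (NS X2) \<oplus>\<^sub>L neg_lattice hyp_plane \<cong>\<^sub>L neg_lattice (NS X1) \<oplus>\<^sub>L neg_lattice hyp_plane"
    unfolding neg_lattice_sum[symmetric] by (rule isometric_neg)
  then have "neg_lattice (NS X2) \<oplus>\<^sub>L hyp_plane \<cong>\<^sub>L NS Y \<oplus>\<^sub>L hyp_plane"
    by (rule isometric_trans[OF isometric_trans[OF isometric_sym[OF sub(1) n]] isometric_trans[OF n i1]])
  then have "mirror_partners X2 Y" by (rule mirror_partnersI[OF X(2) 2 Y(1) q])
  moreover have "mirror_partners X1 Y" by (rule mirror_partnersI[OF X(1) 1 Y(1) q i1])
  ultimately show ?thesis unfolding share_mirror_partner_def by blast
qed

theorem proposition3p8:
  fixes M1 :: "'a::real_vector quad_lattice" and M2 :: "'b::real_vector quad_lattice"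
  shows
    "(even_lattice M1 \<and> even_lattice M2 \<and> has_signature M1 1 1 \<and> has_signature M2 1 1 \<longrightarrow>
       ((\<exists>(N::std_lattice) \<iota>1 \<iota>2. even_lattice N \<and>
           primitive_embedding \<iota>1 N (hyp_plane \<oplus>\<^sub>L hyp_plane) \<and>
           primitive_embedding \<iota>2 N (hyp_plane \<oplus>\<^sub>L hyp_plane) \<and>
           M1 \<cong>\<^sub>L ortho_compl (\<iota>1 ` points N) (hyp_plane \<oplus>\<^sub>L hyp_plane) \<and>
           M2 \<cong>\<^sub>L ortho_compl (\<iota>2 ` points N) (hyp_plane \<oplus>\<^sub>L hyp_plane))
        \<longleftrightarrow> disc_forms_isomorphic M1 M2) \<and>
       (disc_forms_isomorphic M1 M2 \<longleftrightarrow> M1 \<oplus>\<^sub>L hyp_plane \<cong>\<^sub>L M2 \<oplus>\<^sub>L hyp_plane) \<and>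
       (M1 \<oplus>\<^sub>L hyp_plane \<cong>\<^sub>L M2 \<oplus>\<^sub>L hyp_plane \<longleftrightarrow> stably_equivalent M1 M2)) \<and>
     (\<forall>X1 X2. abelian_surface X1 \<and> abelian_surface X2 \<and>
         picard_number X1 = 2 \<and> picard_number X2 = 2 \<longrightarrow>
       (share_mirror_partner X1 X2 \<longleftrightarrow> stably_equivalent (NS X1) (NS X2)))"
proof (rule conjI)
  \<comment> \<open>The signature is used through its two consequences, rank two and negative
    determinant.\<close>
  have main: "(common_complement M1 M2 \<longleftrightarrow> disc_forms_isomorphic M1 M2) \<and>
       (disc_forms_isomorphic M1 M2 \<longleftrightarrow> M1 \<oplus>\<^sub>L hyp_plane \<cong>\<^sub>L M2 \<oplus>\<^sub>L hyp_plane) \<and>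
       (M1 \<oplus>\<^sub>L hyp_plane \<cong>\<^sub>L M2 \<oplus>\<^sub>L hyp_plane \<longleftrightarrow> stably_equivalent M1 M2)"
    if M: "even_lattice M1" "even_lattice M2" "has_signature M1 1 1" "has_signature M2 1 1"
  proof -
    obtain p1 p2 a b c where 1: "binary M1 p1 p2 a b c"
      using even_rank2_binary[OF M(1) signature_11_rank[OF M(3)]] by blast
    obtain r1 r2 a' b' c' where 2: "binary M2 r1 r2 a' b' c'"
      using even_rank2_binary[OF M(2) signature_11_rank[OF M(4)]] by blast
    show ?thesis
      using binary_stable_equivalence[OF 1 signature_11_disc[OF 1 M(3)] 2 signature_11_disc[OF 2 M(4)]] by blast
  qed
  show "even_lattice M1 \<and> even_lattice M2 \<and> has_signature M1 1 1 \<and> has_signature M2 1 1 \<longrightarrow>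
       ((\<exists>(N::std_lattice) \<iota>1 \<iota>2. even_lattice N \<and>
           primitive_embedding \<iota>1 N (hyp_plane \<oplus>\<^sub>L hyp_plane) \<and>
           primitive_embedding \<iota>2 N (hyp_plane \<oplus>\<^sub>L hyp_plane) \<and>
           M1 \<cong>\<^sub>L ortho_compl (\<iota>1 ` points N) (hyp_plane \<oplus>\<^sub>L hyp_plane) \<and>
           M2 \<cong>\<^sub>L ortho_compl (\<iota>2 ` points N) (hyp_plane \<oplus>\<^sub>L hyp_plane))
        \<longleftrightarrow> disc_forms_isomorphic M1 M2) \<and>
       (disc_forms_isomorphic M1 M2 \<longleftrightarrow> M1 \<oplus>\<^sub>L hyp_plane \<cong>\<^sub>L M2 \<oplus>\<^sub>L hyp_plane) \<and>
       (M1 \<oplus>\<^sub>L hyp_plane \<cong>\<^sub>L M2 \<oplus>\<^sub>L hyp_plane \<longleftrightarrow> stably_equivalent M1 M2)"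
    by (intro impI, elim conjE, rule main[unfolded common_complement_def])
next
  show "\<forall>X1 X2. abelian_surface X1 \<and> abelian_surface X2 \<and>
         picard_number X1 = 2 \<and> picard_number X2 = 2 \<longrightarrow>
       (share_mirror_partner X1 X2 \<longleftrightarrow> stably_equivalent (NS X1) (NS X2))"
    using share_mirror_partner_imp_stably_equivalent stably_equivalent_imp_share_mirror_partner by blast
qed

end
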